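(* Fix one of the matrix models (i)–(v) described in the context, with type 1 matrix $L$, a polynomial $P$ and a function $F$ satisfying the hypotheses on the potential and HP1–HP4 of the context, and consider $\mu_N^{(1)}$. Let $m,n\ge1$ be integers, and assume that for each $s\in\{m,n\}$ there are compatible seeds $W,h$ of $\mathrm{Tr}(\Re P(L))$ and $\mathrm{Tr}(\Re L^s)$ such that $|h|^ae^{-W}$ is bounded for $1\le a\le3$. Define $$\mathcal C_{m,n}=\lim_{N\to\infty}\frac1N\Big(\mathbb E_1\big[\mathrm{Tr}(\Re L^m)\,\mathrm{Tr}(\Re L^n)\big]-\mathbb E_1\big[\mathrm{Tr}(\Re L^m)\big]\mathbb E_1\big[\mathrm{Tr}(\Re L^n)\big]\Big),$$ where $\mathbb E_1$ is the expectation under $\mu_N^{(1)}$, and the free energy $\mathcal F^{(1)}(\alpha,\cdot)=-\lim_{N\to\infty}\frac1N\ln Z_N^{(1)}(\alpha,\cdot)$. Then $$\mathcal C_{m,n}=\partial_{t_1}\partial_{t_2}\,\mathcal F^{(1)}(\alpha,\Re P+it_1\Re z^m+it_2\Re z^n)\big|_{t_1=t_2=0}.$$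
   Context: Notation: $\mathbb R_+=[0,\infty)$, $\mathbb D=\{z\in\mathbb C:|z|<1\}$, $\mathbb C\cong\mathbb R^2$; $E_{i,j}$ are the $N\times N$ matrix units. **Matrix models (type 1).** Variables are $\mathbf x=(x_1,\dots,x_N)\in X^N$; indices are taken modulo $N$. (i) $X=\mathbb R\times\mathbb R_+$, $x_j=(a_j,b_j)$, $L=\sum_{j=1}^N a_jE_{j,j}+\sum_{j=1}^N b_j(E_{j,j+1}+E_{j+1,j})$ (periodic Jacobi). (ii) $X=\mathbb R_+\times\mathbb R_+$, $x_j=(a_j,b_j)$, $L=BB^{\intercal}$, $B=\sum_{j=1}^N(a_jE_{j,j}+b_jE_{j,j+1})$. (iii) $X=\mathbb R_+$, $x_j=a_j$, $L=\sum_{j=1}^N a_j(E_{j,j+1}-E_{j+1,j})$. (iv) $X=\mathbb D$, $x_j=a_j$, $N$ even. Let $\rho_j=\sqrt{1-|a_j|^2}$, $\Xi_j=\begin{pmatrix}\overline{a_j}&\rho_j\\ \rho_j&-a_j\end{pmatrix}$; $L=\mathcal L\mathcal M$, $\mathcal L=\mathrm{diag}(\Xi_1,\Xi_3,\dots,\Xi_{N-1})$, and $\mathcal M$ has the block $\mathrm{diag}(\Xi_2,\dots,\Xi_{N-2})$ in rows and columns $2,\dots,N-1$, with $\mathcal M_{1,1}=-a_N$, $\mathcal M_{1,N}=\mathcal M_{N,1}=\rho_N$, $\mathcal M_{N,N}=\overline{a_N}$ (periodic CMV). (v) $r\ge1$ fixed, $X=\mathbb R_+$: $L=\sum_{j=1}^N(a_jE_{j,j+1}+b_jE_{j+r,j})$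 where either all $b_j=1$ and $x_j=a_j$, or all $a_j=1$ and $x_j=b_j$. For a polynomial $P$ and a matrix $M$, $\mathrm{Tr}(\Re P(M)):=\Re\,\mathrm{Tr}\,P(M)$. **Circular functions.** Let $s\ge1$, $N=sM+\ell$, $0\le\ell<s$. $Y:X^N\to\mathbb C$ is $s$-circular if there are $y:X^{2s}\to\mathbb C$ (a *seed* ) and $\tilde y:X^{2s+\ell}\to\mathbb C$ (a *weed* ) with $$Y(\mathbf x)=\sum_{j=1}^{M-1}y(\mathbf x_j,\mathbf x_{j+1})+\tilde y(\mathbf x_1,\mathbf x_M,x_{sM+1},\dots,x_N),\quad \mathbf x_j=(x_{(j-1)s+1},\dots,x_{js}),$$ where $s$ (the circular index) is independent of $N$ for $N$ large; seeds used in the hypotheses are independent of $N$. Seeds $y_1,y_2$ of circular functions $Y_1,Y_2$ of indices $s_1,s_2$ are *compatible* if both have circular index $s_3=\mathrm{lcm}(s_1,s_2)$, $y_i$ is a seed of $Y_i$, and $y_1+y_2$ is a seed of $Y_1+Y_2$. For any of these matrices and any polynomial $P$, $\mathrm{Tr}\,P(L)$ is circular. **Hypotheses on the potential.** Model (i): $P\in\mathbb R[X]$ of (even) degree $\geq2$ with positive leading coefficient. Model (ii): $P\in\mathbb R[X]$ of degree $\ge1$ with positive leading coefficient. Model (iii): $P\in\mathbb R[X]$, $P(x)=(-1)^D c_D x^{2D}+Q(x)$ with $c_D>0$, $Q\in\mathbb R[X]$ of degree smaller than $2D-1$. Model (iv): $P\in\mathbb C[X]$. Model (v): $P\in\mathbb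 R[X]$ of degree $j(r+1)$ for some $j\ge1$ with positive leading coefficient. **HP1–HP4.** (HP1) $X$ is a convex subset of $\mathbb R^d$, $d=1$ or $2$. (HP2) $F:X\times(0,\infty)\to\mathbb R_+$, $F(\cdot,\alpha)\in C^1(X)$ for each $\alpha>0$, $F(x,\cdot)\in C^\infty((0,\infty))$ for each $x\in X$. (HP3) The seed $W$ and the weed $\widetilde W$ of $\mathrm{Tr}(\Re P(L))$ are bounded away from $-\infty$. (HP4) $F(\cdot,\alpha)\in L^1(X)$ for all $\alpha>0$; for each $[c,d]\subset(0,\infty)$ there is $g_{c,d}\in L^2(X)$ with $|\sqrt{F(\cdot,\alpha)}|,|\partial_\alpha\sqrt{F(\cdot,\alpha)}|\le g_{c,d}$ for all $\alpha\in[c,d]$; moreover there exist $\mathtt c\in\mathbb N$ and $\varepsilon_0>0$ such that for all $0<\varepsilon<\varepsilon_0$ there exist a compact $\mathcal O_\varepsilon\subseteq X$ and $d_1,d_2,d_3>0$ (depending on $\varepsilon$) with: $\|F(\cdot,\alpha)\|_{L^1(X)}=d_1\alpha^{-\mathtt c}(1+o(1))$ and $\int_{\mathcal O_\varepsilon}F(x,\alpha)dx=d_2\alpha^{-\mathtt c}(1+o(1))$ as $\alpha\to0$; $\int_{X\setminus\mathcal O_\varepsilon}F(x,\alpha)dx\le d_3$; there is a continuous $w:X^k\to\mathbb R$ ($k$ the circular index of $W$) with $W(\mathbf x,\mathbf y)=w(\mathbf x)+w(\mathbf y)+o(\varepsilon)$ for $\mathbf x,\mathbf y$ with all components in $\mathcal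 O_\varepsilon$; and $\mathcal O_{\varepsilon_1}\subseteq\mathcal O_{\varepsilon_2}$ if $\varepsilon_1<\varepsilon_2$. **Measure.** For $\alpha>0$, on $X^N$, $$\mu^{(1)}_N=\frac1{Z^{(1)}_N(\alpha,\Re P)}\prod_{j=1}^NF(x_j,\alpha)\,e^{-\mathrm{Tr}(\Re P(L))}d\mathbf x,$$ with $Z^{(1)}_N(\alpha,\Re P)$ the normalizing constant. $Z_N^{(1)}(\alpha,\Re P+it_1\Re z^m+it_2\Re z^n)$ denotes the same integral with $\mathrm{Tr}(\Re P(L))$ replaced by $\mathrm{Tr}(\Re P(L))+it_1\mathrm{Tr}(\Re L^m)+it_2\mathrm{Tr}(\Re L^n)$; for small $t_1,t_2$, $\ln$ is the continuous determination that is real at $t_1=t_2=0$. *)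

theory Defs
  imports
    "HOL-Analysis.Analysis"
    "HOL-Library.Landau_Symbols"
    "HOL-Computational_Algebra.Polynomial"
    "Jordan_Normal_Form.Matrix"
begin

section \<open>Traces of polynomials of matrices\<close>

definition mat_trace :: "complex mat \<Rightarrow> complex" where
  "mat_trace A = (\<Sum>i<dim_row A. A $$ (i, i))"

definition poly_of_mat :: "complex poly \<Rightarrow> complex mat \<Rightarrow> complex mat" where
  "poly_of_mat P A =
     mat (dim_row A) (dim_row A) (\<lambda>(i, j). \<Sum>d\<le>degree P. coeff P d * (A ^\<^sub>m d) $$ (i, j))"

text \<open>The real number Tr (Re P(A)), which by convention is the real part of Tr P(A).\<close>

definition re_trace :: "complex poly \<Rightarrow> complex mat \<Rightarrow> real" where
  "re_trace P A = Re (mat_trace (poly_of_mat P A))"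


section \<open>The matrix models\<close>

text \<open>
  Variables are functions \<open>x\<close> with \<open>x j\<close> meaningful for \<open>j\<close> in \<open>{1..N}\<close>; \<open>X\<^sup>N\<close> is the extensional
  product \<open>{1..N} \<rightarrow>\<^sub>E X\<close>. The set \<open>sizes\<close> holds the \<open>N\<close> for which the model is considered (the even
  numbers for the CMV model, all numbers otherwise).
\<close>

record 'a matrix_model =
  var_space :: "'a set"
  sizes :: "nat set"
  lax :: "nat \<Rightarrow> (nat \<Rightarrow> 'a) \<Rightarrow> complex mat"

text \<open>
  Entries of the \<open>N \<times> N\<close> matrix unit \<open>E\<^sub>i\<^sub>,\<^sub>j\<close> with \<open>i\<close>, \<open>j\<close> counted from 1 and taken modulo \<open>N\<close>, at
  the position \<open>(p, q)\<close> counted from 0 as in the type of matrices.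
\<close>

definition unit_entry :: "nat \<Rightarrow> nat \<Rightarrow> nat \<Rightarrow> nat \<Rightarrow> nat \<Rightarrow> complex" where
  "unit_entry N i j p q =
     (if (p + 1) mod N = i mod N \<and> (q + 1) mod N = j mod N then 1 else 0)"

definition jacobi_lax :: "nat \<Rightarrow> (nat \<Rightarrow> real \<times> real) \<Rightarrow> complex mat" where
  "jacobi_lax N x = mat N N (\<lambda>(p, q).
     (\<Sum>j=1..N. of_real (fst (x j)) * unit_entry N j j p q)
     + (\<Sum>j=1..N. of_real (snd (x j)) * (unit_entry N j (j + 1) p q + unit_entry N (j + 1) j p q)))"

definition jacobi_model :: "(real \<times> real) matrix_model" where
  "jacobi_model = \<lparr>var_space = UNIV \<times> {0..}, sizes = UNIV, lax = jacobi_lax\<rparr>"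

definition laguerre_factor :: "nat \<Rightarrow> (nat \<Rightarrow> real \<times> real) \<Rightarrow> complex mat" where
  "laguerre_factor N x = mat N N (\<lambda>(p, q).
     \<Sum>j=1..N. of_real (fst (x j)) * unit_entry N j j p q
              + of_real (snd (x j)) * unit_entry N j (j + 1) p q)"

definition laguerre_model :: "(real \<times> real) matrix_model" where
  "laguerre_model = \<lparr>var_space = {0..} \<times> {0..}, sizes = UNIV,
     lax = (\<lambda>N x. laguerre_factor N x * transpose_mat (laguerre_factor N x))\<rparr>"

definition antisymmetric_lax :: "nat \<Rightarrow> (nat \<Rightarrow> real) \<Rightarrow> complex mat" where
  "antisymmetric_lax N x = mat N N (\<lambda>(p, q).
     \<Sum>j=1..N. of_real (x j) * (unit_entry N j (j + 1) p q - unit_entry N (j + 1) j p q))"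

definition antisymmetric_model :: "real matrix_model" where
  "antisymmetric_model = \<lparr>var_space = {0..}, sizes = UNIV, lax = antisymmetric_lax\<rparr>"

text \<open>
  The block \<open>\<Xi>\<^sub>j\<close> placed in rows and columns \<open>j\<close>, \<open>j + 1\<close>. For \<open>j = N\<close> these are the rows and columns
  \<open>N\<close>, \<open>1\<close>, which yields exactly the four corner entries of the second CMV factor.
\<close>

definition cmv_block_entry :: "nat \<Rightarrow> (nat \<Rightarrow> complex) \<Rightarrow> nat \<Rightarrow> nat \<Rightarrow> nat \<Rightarrow> complex" where
  "cmv_block_entry N x j p q =
     (let \<rho> = complex_of_real (sqrt (1 - (cmod (x j))\<^sup>2)) in
        cnj (x j) * unit_entry N j j p q
        + \<rho> * unit_entry N j (j + 1) p q
        + \<rho> * unit_entry N (j + 1) j p q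
        - x j * unit_entry N (j + 1) (j + 1) p q)"

definition cmv_lax :: "nat \<Rightarrow> (nat \<Rightarrow> complex) \<Rightarrow> complex mat" where
  "cmv_lax N x =
     mat N N (\<lambda>(p, q). \<Sum>j\<in>{j\<in>{1..N}. odd j}. cmv_block_entry N x j p q)
     * mat N N (\<lambda>(p, q). \<Sum>j\<in>{j\<in>{1..N}. even j}. cmv_block_entry N x j p q)"

definition cmv_model :: "complex matrix_model" where
  "cmv_model = \<lparr>var_space = ball 0 1, sizes = {N. even N}, lax = cmv_lax\<rparr>"

definition inb_lax :: "nat \<Rightarrow> nat \<Rightarrow> (nat \<Rightarrow> real) \<Rightarrow> (nat \<Rightarrow> real) \<Rightarrow> complex mat" where
  "inb_lax r N a b = mat N N (\<lambda>(p, q).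
     \<Sum>j=1..N. of_real (a j) * unit_entry N j (j + 1) p q
              + of_real (b j) * unit_entry N (j + r) j p q)"

definition inb_model_a :: "nat \<Rightarrow> real matrix_model" where
  "inb_model_a r = \<lparr>var_space = {0..}, sizes = UNIV, lax = (\<lambda>N x. inb_lax r N x (\<lambda>_. 1))\<rparr>"

definition inb_model_b :: "nat \<Rightarrow> real matrix_model" where
  "inb_model_b r = \<lparr>var_space = {0..}, sizes = UNIV, lax = (\<lambda>N x. inb_lax r N (\<lambda>_. 1) x)\<rparr>"


section \<open>Hypotheses on the potential\<close>

definition jacobi_potential :: "real poly \<Rightarrow> bool" where
  "jacobi_potential P \<longleftrightarrow> even (degree P) \<and> 2 \<le> degree P \<and> 0 < lead_coeff P"

definition laguerre_potential :: "real poly \<Rightarrow> bool" where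
  "laguerre_potential P \<longleftrightarrow> 1 \<le> degree P \<and> 0 < lead_coeff P"

text \<open>The truncated subtraction below is harmless: it merely excludes \<open>D = 0\<close>.\<close>

definition antisymmetric_potential :: "real poly \<Rightarrow> bool" where
  "antisymmetric_potential P \<longleftrightarrow>
     (\<exists>D c Q. 0 < c \<and> degree Q < 2 * D - 1 \<and> P = monom ((- 1) ^ D * c) (2 * D) + Q)"

definition inb_potential :: "nat \<Rightarrow> real poly \<Rightarrow> bool" where
  "inb_potential r P \<longleftrightarrow> (\<exists>j\<ge>1. degree P = j * (r + 1)) \<and> 0 < lead_coeff P"

abbreviation complex_poly :: "real poly \<Rightarrow> complex poly" where
  "complex_poly P \<equiv> map_poly complex_of_real P"


section \<open>Circular functions\<close>

abbreviation vectors :: "'a set \<Rightarrow> nat \<Rightarrow> (nat \<Rightarrow> 'a) set" where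
  "vectors X k \<equiv> {1..k} \<rightarrow>\<^sub>E X"

text \<open>The limit \<open>N \<rightarrow> \<infinity>\<close> along the sizes considered.\<close>

abbreviation large :: "nat set \<Rightarrow> nat filter" where
  "large S \<equiv> inf sequentially (principal S)"

definition block :: "nat \<Rightarrow> (nat \<Rightarrow> 'a) \<Rightarrow> nat \<Rightarrow> (nat \<Rightarrow> 'a)" where
  "block s x j = (\<lambda>i\<in>{1..s}. x ((j - 1) * s + i))"

text \<open>The components of index \<open>s * M + 1, \<dots>, N\<close>, where \<open>M = N div s\<close>.\<close>

definition tail_block :: "nat \<Rightarrow> nat \<Rightarrow> (nat \<Rightarrow> 'a) \<Rightarrow> (nat \<Rightarrow> 'a)" where
  "tail_block s N x = (\<lambda>i\<in>{1..N mod s}. x (s * (N div s) + i))"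

text \<open>
  A seed is a function on \<open>X\<^sup>2\<^sup>s = X\<^sup>s \<times> X\<^sup>s\<close>, a weed one on \<open>X\<^sup>2\<^sup>s\<^sup>+\<^sup>l = X\<^sup>s \<times> X\<^sup>s \<times> X\<^sup>l\<close> with \<open>l = N mod s\<close>.
  The circular functions used below are real-valued, so real seeds are no restriction: the real
  part of a complex seed is a seed.
\<close>

definition seed_weed ::
  "'a set \<Rightarrow> nat \<Rightarrow> nat \<Rightarrow> ((nat \<Rightarrow> 'a) \<Rightarrow> 'b::comm_monoid_add) \<Rightarrow> ((nat \<Rightarrow> 'a) \<Rightarrow> (nat \<Rightarrow> 'a) \<Rightarrow> 'b)
    \<Rightarrow> ((nat \<Rightarrow> 'a) \<Rightarrow> (nat \<Rightarrow> 'a) \<Rightarrow> (nat \<Rightarrow> 'a) \<Rightarrow> 'b) \<Rightarrow> bool" where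
  "seed_weed X s N Y y yt \<longleftrightarrow>
     (\<forall>x\<in>vectors X N.
        Y x = (\<Sum>j\<in>{1..<N div s}. y (block s x j) (block s x (j + 1)))
              + yt (block s x 1) (block s x (N div s)) (tail_block s N x))"

text \<open>
  For a family \<open>Y N\<close> of functions on \<open>X\<^sup>N\<close>: the index and the seed do not depend on \<open>N\<close>, the weed may.
\<close>

definition is_seed ::
  "'a set \<Rightarrow> nat set \<Rightarrow> nat \<Rightarrow> (nat \<Rightarrow> (nat \<Rightarrow> 'a) \<Rightarrow> 'b::comm_monoid_add)
    \<Rightarrow> ((nat \<Rightarrow> 'a) \<Rightarrow> (nat \<Rightarrow> 'a) \<Rightarrow> 'b) \<Rightarrow> bool" where
  "is_seed X S s Y y \<longleftrightarrow> 1 \<le> s \<and> (\<forall>\<^sub>F N in large S. \<exists>yt. seed_weed X s N (Y N) y yt)"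

definition circular ::
  "'a set \<Rightarrow> nat set \<Rightarrow> nat \<Rightarrow> (nat \<Rightarrow> (nat \<Rightarrow> 'a) \<Rightarrow> 'b::comm_monoid_add) \<Rightarrow> bool" where
  "circular X S s Y \<longleftrightarrow> (\<exists>y. is_seed X S s Y y)"

definition compatible_seeds ::
  "'a set \<Rightarrow> nat set
    \<Rightarrow> nat \<Rightarrow> (nat \<Rightarrow> (nat \<Rightarrow> 'a) \<Rightarrow> 'b::comm_monoid_add)
    \<Rightarrow> nat \<Rightarrow> (nat \<Rightarrow> (nat \<Rightarrow> 'a) \<Rightarrow> 'b)
    \<Rightarrow> ((nat \<Rightarrow> 'a) \<Rightarrow> (nat \<Rightarrow> 'a) \<Rightarrow> 'b) \<Rightarrow> ((nat \<Rightarrow> 'a) \<Rightarrow> (nat \<Rightarrow> 'a) \<Rightarrow> 'b) \<Rightarrow> bool" where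
  "compatible_seeds X S s1 Y1 s2 Y2 y1 y2 \<longleftrightarrow>
     circular X S s1 Y1 \<and> circular X S s2 Y2 \<and>
     is_seed X S (lcm s1 s2) Y1 y1 \<and> is_seed X S (lcm s1 s2) Y2 y2 \<and>
     is_seed X S (lcm s1 s2) (\<lambda>N x. Y1 N x + Y2 N x) (\<lambda>u v. y1 u v + y2 u v)"

abbreviation trace_fun :: "'a matrix_model \<Rightarrow> complex poly \<Rightarrow> nat \<Rightarrow> (nat \<Rightarrow> 'a) \<Rightarrow> real" where
  "trace_fun \<M> P N x \<equiv> re_trace P (lax \<M> N x)"

text \<open>\<open>monom 1 p\<close> is the polynomial \<open>z\<^sup>p\<close>, so its trace function is Tr (Re \<open>L\<^sup>p\<close>).\<close>

definition seed_moment_bound :: "'a matrix_model \<Rightarrow> complex poly \<Rightarrow> nat \<Rightarrow> bool" where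
  "seed_moment_bound \<M> P p \<longleftrightarrow>
     (\<exists>s1 s2 W h.
        compatible_seeds (var_space \<M>) (sizes \<M>)
          s1 (trace_fun \<M> P) s2 (trace_fun \<M> (monom 1 p)) W h \<and>
        (\<forall>a::real. 1 \<le> a \<and> a \<le> 3 \<longrightarrow>
           bounded ((\<lambda>(u, v). \<bar>h u v\<bar> powr a * exp (- W u v)) `
             (vectors (var_space \<M>) (lcm s1 s2) \<times> vectors (var_space \<M>) (lcm s1 s2)))))"


section \<open>The hypotheses HP1--HP4\<close>

definition HP1 :: "'a::euclidean_space set \<Rightarrow> bool" where
  "HP1 X \<longleftrightarrow> convex X \<and> DIM('a) \<in> {1, 2}"

text \<open>\<open>X\<close> need not be open; derivatives are taken within \<open>X\<close>.\<close>

definition C1_on :: "'a::euclidean_space set \<Rightarrow> ('a \<Rightarrow> real) \<Rightarrow> bool" where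
  "C1_on X f \<longleftrightarrow>
     (\<exists>f' :: 'a \<Rightarrow> 'a \<Rightarrow>\<^sub>L real.
        (\<forall>x\<in>X. (f has_derivative blinfun_apply (f' x)) (at x within X)) \<and> continuous_on X f')"

definition smooth_on_positive :: "(real \<Rightarrow> real) \<Rightarrow> bool" where
  "smooth_on_positive f \<longleftrightarrow> (\<forall>i. \<forall>\<alpha>>0. ((deriv ^^ i) f) differentiable (at \<alpha>))"

definition HP2 :: "'a::euclidean_space set \<Rightarrow> ('a \<Rightarrow> real \<Rightarrow> real) \<Rightarrow> bool" where
  "HP2 X F \<longleftrightarrow>
     (\<forall>x\<in>X. \<forall>\<alpha>>0. 0 \<le> F x \<alpha>) \<and>
     (\<forall>\<alpha>>0. C1_on X (\<lambda>x. F x \<alpha>)) \<and>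
     (\<forall>x\<in>X. smooth_on_positive (F x))"

definition HP3 ::
  "'a matrix_model \<Rightarrow> complex poly \<Rightarrow> nat \<Rightarrow> ((nat \<Rightarrow> 'a) \<Rightarrow> (nat \<Rightarrow> 'a) \<Rightarrow> real) \<Rightarrow> bool" where
  "HP3 \<M> P k W \<longleftrightarrow>
     (let X = var_space \<M> in
        1 \<le> k \<and>
        (\<exists>c. \<forall>u\<in>vectors X k. \<forall>v\<in>vectors X k. c \<le> W u v) \<and>
        (\<forall>\<^sub>F N in large (sizes \<M>). \<exists>Wt. seed_weed X k N (trace_fun \<M> P N) W Wt \<and>
           (\<exists>c. \<forall>u\<in>vectors X k. \<forall>v\<in>vectors X k. \<forall>z\<in>vectors X (N mod k). c \<le> Wt u v z)))"

text \<open>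
  \<open>K \<epsilon>\<close> is the compact set \<open>\<O>\<^sub>\<epsilon>\<close>, and \<open>\<eta>\<close> is the \<open>o(\<epsilon>)\<close> error, uniform over the vectors with all
  components in \<open>K \<epsilon>\<close>. Continuity of \<open>w\<close> refers to the product topology.
\<close>

definition HP4 ::
  "'a::euclidean_space set \<Rightarrow> nat \<Rightarrow> ((nat \<Rightarrow> 'a) \<Rightarrow> (nat \<Rightarrow> 'a) \<Rightarrow> real)
    \<Rightarrow> ('a \<Rightarrow> real \<Rightarrow> real) \<Rightarrow> bool" where
  "HP4 X k W F \<longleftrightarrow>
     (\<forall>\<alpha>>0. set_integrable lborel X (\<lambda>x. F x \<alpha>)) \<and>
     (\<forall>c d. 0 < c \<and> c \<le> d \<longrightarrow>
        (\<exists>g. set_borel_measurable lborel X g \<and> set_integrable lborel X (\<lambda>x. (g x)\<^sup>2) \<and>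
           (\<forall>x\<in>X. \<forall>\<alpha>\<in>{c..d}.
              \<bar>sqrt (F x \<alpha>)\<bar> \<le> g x \<and>
              (\<exists>D. ((\<lambda>\<beta>. sqrt (F x \<beta>)) has_real_derivative D) (at \<alpha>) \<and> \<bar>D\<bar> \<le> g x)))) \<and>
     (\<exists>c::nat. \<exists>\<epsilon>0>0. \<exists>K d1 d2 d3 w \<eta>.
        (\<forall>\<epsilon>. 0 < \<epsilon> \<and> \<epsilon> < \<epsilon>0 \<longrightarrow>
           compact (K \<epsilon>) \<and> K \<epsilon> \<subseteq> X \<and> 0 < d1 \<epsilon> \<and> 0 < d2 \<epsilon> \<and> 0 < d3 \<epsilon> \<and>
           (\<lambda>\<alpha>. LINT x:X|lborel. \<bar>F x \<alpha>\<bar>) \<sim>[at_right 0] (\<lambda>\<alpha>. d1 \<epsilon> / \<alpha> ^ c) \<and>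
           (\<lambda>\<alpha>. LINT x:K \<epsilon>|lborel. F x \<alpha>) \<sim>[at_right 0] (\<lambda>\<alpha>. d2 \<epsilon> / \<alpha> ^ c) \<and>
           (\<forall>\<^sub>F \<alpha> in at_right 0. (LINT x:X - K \<epsilon>|lborel. F x \<alpha>) \<le> d3 \<epsilon>) \<and>
           continuous_on (vectors X k) (w \<epsilon>) \<and>
           (\<forall>u\<in>vectors (K \<epsilon>) k. \<forall>v\<in>vectors (K \<epsilon>) k. \<bar>W u v - (w \<epsilon> u + w \<epsilon> v)\<bar> \<le> \<eta> \<epsilon>)) \<and>
        \<eta> \<in> o[at_right 0](\<lambda>\<epsilon>::real. \<epsilon>) \<and>
        (\<forall>\<epsilon>1 \<epsilon>2. 0 < \<epsilon>1 \<and> \<epsilon>1 < \<epsilon>2 \<and> \<epsilon>2 < \<epsilon>0 \<longrightarrow> K \<epsilon>1 \<subseteq> K \<epsilon>2))"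


section \<open>Partition function, measure and free energy\<close>

abbreviation ref_measure :: "nat \<Rightarrow> (nat \<Rightarrow> 'a::euclidean_space) measure" where
  "ref_measure N \<equiv> \<Pi>\<^sub>M j\<in>{1..N}. lborel"

text \<open>Used with real and with complex exponents \<open>V\<close>.\<close>

definition partition_function ::
  "'a::euclidean_space matrix_model \<Rightarrow> ('a \<Rightarrow> real \<Rightarrow> real) \<Rightarrow> real \<Rightarrow> nat
    \<Rightarrow> ((nat \<Rightarrow> 'a) \<Rightarrow> 'b::{real_normed_field, banach, second_countable_topology}) \<Rightarrow> 'b" where
  "partition_function \<M> F \<alpha> N V =
     (LINT x:vectors (var_space \<M>) N|ref_measure N.
        of_real (\<Prod>j=1..N. F (x j) \<alpha>) * exp (- V x))"

definition gibbs ::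
  "'a::euclidean_space matrix_model \<Rightarrow> ('a \<Rightarrow> real \<Rightarrow> real) \<Rightarrow> real \<Rightarrow> complex poly \<Rightarrow> nat
    \<Rightarrow> (nat \<Rightarrow> 'a) measure" where
  "gibbs \<M> F \<alpha> P N =
     density (restrict_space (ref_measure N) (vectors (var_space \<M>) N))
       (\<lambda>x. ennreal ((\<Prod>j=1..N. F (x j) \<alpha>) * exp (- trace_fun \<M> P N x)
                      / partition_function \<M> F \<alpha> N (trace_fun \<M> P N)))"

definition perturbed_partition_function ::
  "'a::euclidean_space matrix_model \<Rightarrow> ('a \<Rightarrow> real \<Rightarrow> real) \<Rightarrow> real \<Rightarrow> complex poly
    \<Rightarrow> nat \<Rightarrow> nat \<Rightarrow> nat \<Rightarrow> real \<times> real \<Rightarrow> complex" where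
  "perturbed_partition_function \<M> F \<alpha> P m n N = (\<lambda>(t1, t2).
     partition_function \<M> F \<alpha> N (\<lambda>x.
       of_real (trace_fun \<M> P N x)
       + \<i> * of_real t1 * of_real (trace_fun \<M> (monom 1 m) N x)
       + \<i> * of_real t2 * of_real (trace_fun \<M> (monom 1 n) N x)))"

text \<open>The continuous determination of \<open>ln f\<close> on the disc of radius \<open>\<delta>\<close> that is real at the origin.\<close>

definition continuous_log :: "real \<Rightarrow> (real \<times> real \<Rightarrow> complex) \<Rightarrow> (real \<times> real \<Rightarrow> complex) \<Rightarrow> bool" where
  "continuous_log \<delta> f l \<longleftrightarrow>
     continuous_on (ball (0, 0) \<delta>) l \<and> (\<forall>t\<in>ball (0, 0) \<delta>. exp (l t) = f t) \<and> l (0, 0) \<in> \<real>"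

text \<open>
  \<open>\<Phi> (t1, t2)\<close> is the free energy of the potential \<open>Re P + i t1 Re z\<^sup>m + i t2 Re z\<^sup>n\<close>, for
  \<open>(t1, t2)\<close> in a disc that does not depend on \<open>N\<close>.
\<close>

definition is_free_energy ::
  "'a::euclidean_space matrix_model \<Rightarrow> ('a \<Rightarrow> real \<Rightarrow> real) \<Rightarrow> real \<Rightarrow> complex poly
    \<Rightarrow> nat \<Rightarrow> nat \<Rightarrow> real \<Rightarrow> (real \<times> real \<Rightarrow> complex) \<Rightarrow> bool" where
  "is_free_energy \<M> F \<alpha> P m n \<delta> \<Phi> \<longleftrightarrow>
     (\<exists>l :: nat \<Rightarrow> real \<times> real \<Rightarrow> complex.
        (\<forall>\<^sub>F N in large (sizes \<M>).
           continuous_log \<delta> (perturbed_partition_function \<M> F \<alpha> P m n N) (l N)) \<and>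
        (\<forall>t\<in>ball (0, 0) \<delta>. ((\<lambda>N. - (l N t / of_nat N)) \<longlongrightarrow> \<Phi> t) (large (sizes \<M>))))"

definition has_mixed_derivative_at_0 :: "(real \<times> real \<Rightarrow> complex) \<Rightarrow> complex \<Rightarrow> bool" where
  "has_mixed_derivative_at_0 \<Phi> c \<longleftrightarrow>
     (\<exists>g. (\<forall>\<^sub>F t1 in nhds 0. ((\<lambda>t2. \<Phi> (t1, t2)) has_vector_derivative g t1) (at 0)) \<and>
          (g has_vector_derivative c) (at 0))"

definition trace_covariance ::
  "'a::euclidean_space matrix_model \<Rightarrow> ('a \<Rightarrow> real \<Rightarrow> real) \<Rightarrow> real \<Rightarrow> complex poly
    \<Rightarrow> nat \<Rightarrow> nat \<Rightarrow> nat \<Rightarrow> real" where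
  "trace_covariance \<M> F \<alpha> P m n N =
     (let \<mu> = gibbs \<M> F \<alpha> P N;
          f = trace_fun \<M> (monom 1 m) N;
          g = trace_fun \<M> (monom 1 n) N
      in (\<integral>x. f x * g x \<partial>\<mu>) - (\<integral>x. f x \<partial>\<mu>) * (\<integral>x. g x \<partial>\<mu>))"


section \<open>Hypotheses and conclusion for a given model\<close>

text \<open>
  The last conjunct says that the normalizing constant is finite and nonzero, so that the measure
  exists; HP2 and HP4 alone allow \<open>F x \<alpha>\<close> to vanish identically in \<open>x\<close> for some \<open>\<alpha>\<close>. (A Bochner
  integral that is not zero is the integral of an integrable function.)
\<close>

definition standing_hypotheses ::
  "'a::euclidean_space matrix_model \<Rightarrow> complex poly \<Rightarrow> ('a \<Rightarrow> real \<Rightarrow> real) \<Rightarrow> real \<Rightarrow> bool" where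
  "standing_hypotheses \<M> P F \<alpha> \<longleftrightarrow>
     HP1 (var_space \<M>) \<and> HP2 (var_space \<M>) F \<and>
     (\<exists>k W. HP3 \<M> P k W \<and> HP4 (var_space \<M>) k W F) \<and>
     (\<forall>\<^sub>F N in large (sizes \<M>). 0 < partition_function \<M> F \<alpha> N (trace_fun \<M> P N))"

text \<open>
  The integrability clause excludes that expectations of non-integrable functions are silently 0.
\<close>

definition covariance_is_free_energy_derivative ::
  "'a::euclidean_space matrix_model \<Rightarrow> complex poly \<Rightarrow> ('a \<Rightarrow> real \<Rightarrow> real) \<Rightarrow> real
    \<Rightarrow> nat \<Rightarrow> nat \<Rightarrow> bool" where
  "covariance_is_free_energy_derivative \<M> P F \<alpha> m n \<longleftrightarrow>
     (\<forall>\<^sub>F N in large (sizes \<M>).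
        integrable (gibbs \<M> F \<alpha> P N) (trace_fun \<M> (monom 1 m) N) \<and>
        integrable (gibbs \<M> F \<alpha> P N) (trace_fun \<M> (monom 1 n) N) \<and>
        integrable (gibbs \<M> F \<alpha> P N)
          (\<lambda>x. trace_fun \<M> (monom 1 m) N x * trace_fun \<M> (monom 1 n) N x)) \<and>
     (\<exists>C \<delta> \<Phi>.
        ((\<lambda>N. trace_covariance \<M> F \<alpha> P m n N / real N) \<longlongrightarrow> C) (large (sizes \<M>)) \<and>
        0 < \<delta> \<and> is_free_energy \<M> F \<alpha> P m n \<delta> \<Phi> \<and>
        has_mixed_derivative_at_0 \<Phi> (complex_of_real C))"

end

theory Submission imports Defs "HOL-Probability.Infinite_Product_Measure" "HOL-Probability.Characteristic_Functions" begin


text \<open>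
Each Lax matrix is the periodization of a band operator with shift invariant coefficients, so the
traces are cyclic sums of one local function of \<open>Q\<close> consecutive variables. The partition
function is then the trace of a power of a transfer operator on bounded functions, perturbed by
\<open>i t\<^sub>1 h\<^sub>1 + i t\<^sub>2 h\<^sub>2\<close>. At \<open>t = 0\<close> the operator is positive and contracts as in Harris' theorem, with
minorization on an increasing family of sets in place of one small set; hence a spectral gap.
A fixed point argument continues eigenvector, eigenfunctional and eigenvalue to small \<open>t\<close>. The
free energy is minus the logarithm of the eigenvalue, and its mixed derivative as well as the limiting
covariance is the sum of the correlations of \<open>h\<^sub>1\<close> and \<open>h\<^sub>2\<close> along the chain.
\<close>

text \<open>The first obstacle is that the variables may be unbounded: the transfer kernel is
  bounded above, but bounded below only on sets \<open>A j\<close> whose mass tends to 1 while the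
  bound \<open>d j\<close> may tend to 0. Nor is an eigenfunction known at the start, so
  oscillations are measured relative to the iterates \<open>g n\<close> of the constant 1. Division
  by \<open>g n\<close> would give a Markov kernel with Lyapunov function \<open>s n / g n\<close>;
  the estimates avoid this division because \<open>g n\<close> may vanish. The partition function is
  not treated as the trace of a trace class operator. It is an integral over a state
  \<open>v\<close> of an operator power applied to the function \<open>kern v\<close> that closes
  the cycle at \<open>v\<close>, so that a gap in the supremum norm is enough. The second obstacle
  is a local energy bounded below: the leading term of the polynomial controls one site, the lower
  ones involve neighbours. Adding differences of translates does not change a sum over the cycle,
  and this freedom makes the local energy dominate all local trace densities. The observables then
  have bounded third moments against the weight, as the Taylor remainders of the perturbed operator
  require.\<close>

abbreviation "bap == blinfun_apply"
abbreviation "bmeas == borel_measurable"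
abbreviation "cor == complex_of_real"
abbreviation tends (infix "---->" 60) where "X ----> L == X \<longlonglongrightarrow> L"
type_synonym 'b op = "'b \<Rightarrow>\<^sub>L 'b"
type_synonym 'b fn = "'b \<Rightarrow>\<^sub>L complex"
lemmas mlm = mult_left_mono
 and mrm = mult_right_mono
 and alg = algebra_simps
 and Lintegral_nonneg = Bochner_Integration.integral_nonneg
 and Lintegral_diff = Bochner_Integration.integral_diff
 and Lintegrable_diff = Bochner_Integration.integrable_diff
 and Lintegral_add = Bochner_Integration.integral_add
 and Lintegral_mult_right = Bochner_Integration.integral_mult_right
 and Lintegral_cong = Bochner_Integration.integral_cong
 and Lintegrable_sum = Bochner_Integration.integrable_sum
 and Lintegral_sum = Bochner_Integration.integral_sum
 and Lintegrable_cong = Bochner_Integration.integrable_cong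

section \<open>Positive kernels: growth of the iterates, contraction, spectral gap\<close>

text \<open>No uniform lower bound is assumed: \<open>d j\<close> may tend to 0. This is compensated
  by the upper bound \<open>C\<close>, which keeps the mass that one application sends outside
  \<open>A j\<close> below \<open>C * (1 - prob (A j))\<close> times the total.\<close>

locale positive_kernel = prob_space M for M :: "'x measure" + fixes k :: "'x => 'x => real" and C :: real and A :: "nat => 'x set" and d :: "nat => real"
assumes k_meas: "(%(u, v). k u v) : bmeas (M \<Otimes>\<^sub>M M)"
 and k_nonneg: "!!u v. u : space M ==> v : space M ==> 0 <= k u v"
 and k_le: "!!u v. u : space M ==> v : space M ==> k u v <= C"
 and C_pos: "0 < C"
 and A_sets [measurable]: "!!j. A j : sets M"
 and A_mono: "incseq A"
 and A_lim: "(%j. prob (A j)) ----> 1"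
 and d_pos: "!!j. 0 < d j"
 and k_ge: "!!j u v. u : A j ==> v : A j ==> d j <= k u v"
begin

text \<open>The bound is asked on \<open>space M\<close> only, which is where the kernel bounds of
  the locale hold.\<close>

definition bdm :: "('x => 'b::real_normed_vector) set" where
"bdm = {f : bmeas M. EX B. ALL x:space M. norm (f x) <= B}"

definition Kop :: "('x => 'b::{banach, second_countable_topology}) => 'x => 'b" where
"Kop f u = (LINT v|M. k u v *\<^sub>R f v)"

lemma bdm_int: "f : bdm ==> integrable M (f :: 'x => 'b::{banach, second_countable_topology})" unfolding bdm_def by (auto intro!: integrable_const_bound AE_I2)

lemma bdmI: "f : bmeas M ==> (!!x. x : space M ==> norm (f x) <= B) ==> f : bdm" unfolding bdm_def by auto

lemma bdm_const [intro, simp]: "(%_. c) : bdm" by (rule bdmI) auto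

lemma bdm_add [intro]: fixes f g :: "'x => 'b::{banach, second_countable_topology}" assumes "f : bdm" "g : bdm" shows "(%x. f x + g x) : bdm"
proof -
obtain B where B: "!!x. x : space M ==> norm (f x) <= B" using assms by (auto simp: bdm_def)
obtain B' where B': "!!x. x : space M ==> norm (g x) <= B'" using assms by (auto simp: bdm_def)
have [measurable]: "f : bmeas M" "g : bmeas M" using assms by (auto simp: bdm_def)
show ?thesis by (rule bdmI[of _ "B + B'"]) (auto intro!: norm_triangle_le add_mono B B')
qed

lemma bdm_scaleR [intro]: fixes f :: "'x => real" and g :: "'x => 'b::{banach, second_countable_topology}"
assumes "f : bdm" "g : bdm" shows "(%x. f x *\<^sub>R g x) : bdm"
proof -
obtain B where B: "!!x. x : space M ==> norm (f x) <= B" using assms by (auto simp: bdm_def)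
obtain B' where B': "!!x. x : space M ==> norm (g x) <= B'" using assms by (auto simp: bdm_def)
have [measurable]: "f : bmeas M" "g : bmeas M" using assms by (auto simp: bdm_def)
have "norm (f x *\<^sub>R g x) <= B * B'" if "x : space M" for x using mult_mono[OF B[OF that] B'[OF that]] norm_ge_zero[of "f x"] B[OF that] by simp
thus ?thesis by (intro bdmI[of _ "B * B'"]) auto
qed

lemma bdm_mult [intro]: fixes f g :: "'x => real" assumes "f : bdm" "g : bdm" shows "(%x. f x * g x) : bdm" using bdm_scaleR[OF assms] by simp

lemma bdm_minus [intro]: fixes f g :: "'x => 'b::{banach, second_countable_topology}" assumes "f : bdm" "g : bdm" shows "(%x. f x - g x) : bdm"
using bdm_add[OF assms(1) bdm_scaleR[OF bdm_const assms(2), of "-1"]] by simp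

lemma bdm_indicator [intro, simp]: "X : sets M ==> (indicator X :: 'x => real) : bdm" by (rule bdmI[of _ 1]) (auto simp: indicator_def)

lemma bdm_k [intro]: "u : space M ==> k u : bdm" using measurable_compose_Pair1[OF _ k_meas, of u] k_nonneg k_le by (intro bdmI[of _ C]) auto

text \<open>The kernel smooths: the right-hand side has the L1 norm of \<open>f\<close>, not its
  supremum, so a function carried by a set of small probability becomes uniformly small after one
  step. The tail estimates below rest on this gain.\<close>

lemma Kop_norm: fixes f :: "'x => 'b::{banach, second_countable_topology}" assumes "f : bdm" "u : space M" shows "norm (Kop f u) <= C * (LINT v|M. norm (f v))"
proof -
have i: "integrable M (%v. norm (f v))" using bdm_int[OF assms(1)] by auto
have "norm (Kop f u) <= (LINT v|M. norm (k u v *\<^sub>R f v))" unfolding Kop_def by (rule integral_norm_bound)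
also have "... <= (LINT v|M. C * norm (f v))" using assms i by (intro integral_mono integrable_norm bdm_int bdm_scaleR bdm_k integrable_mult_right)
  (auto intro!: mrm simp: k_nonneg k_le)
finally show ?thesis using i by simp
qed

lemma bdm_Kop [intro]: fixes f :: "'x => 'b::{banach, second_countable_topology}" assumes "f : bdm" shows "Kop f : bdm"
proof (rule bdmI)
have [measurable]: "f : bmeas M" using assms by (auto simp: bdm_def)
note k_meas [measurable]
have "(%(u, v). k u v *\<^sub>R f v) : bmeas (M \<Otimes>\<^sub>M M)" by measurable
thus "Kop f : bmeas M" unfolding Kop_def by (rule borel_measurable_lebesgue_integral)
qed (rule Kop_norm[OF assms])

lemma Kop_mono: fixes f g :: "'x => real" assumes "f : bdm" "g : bdm" "u : space M" "!!v. v : space M ==> f v <= g v" shows "Kop f u <= Kop g u"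
unfolding Kop_def using assms by (intro integral_mono bdm_int bdm_scaleR bdm_k) (auto intro!: mlm k_nonneg)

lemma Kop_nonneg: fixes f :: "'x => real" assumes "u : space M" "!!v. v : space M ==> 0 <= f v" shows "0 <= Kop f u"
unfolding Kop_def using assms by (intro Lintegral_nonneg) (auto intro!: mult_nonneg_nonneg k_nonneg)

lemma Kop_diff: fixes f g :: "'x => 'b::{banach, second_countable_topology}" assumes "f : bdm" "g : bdm" "u : space M"
shows "Kop (%x. f x - g x) u = Kop f u - Kop g u" unfolding Kop_def using assms by (simp add: scaleR_diff_right Lintegral_diff bdm_int bdm_scaleR bdm_k)

lemma Kop_scaleR: fixes f :: "'x => 'b::{banach, second_countable_topology}" shows "Kop (%x. c *\<^sub>R f x) u = c *\<^sub>R Kop f u"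
proof -
have "(%v. k u v *\<^sub>R c *\<^sub>R f v) = (%v. c *\<^sub>R k u v *\<^sub>R f v)" by (simp add: mult.commute)
thus ?thesis unfolding Kop_def by (simp only: integral_scaleR_right)
qed

text \<open>The weight \<open>p v q v' - e 1\<^sub>X v 1\<^sub>X v'\<close> removes a symmetric part, against which the antisymmetric
integrand has integral 0; this is where the contraction comes from.\<close>

lemma antisymmetric_integral_bound: fixes f :: "'x => complex" and g p q :: "'x => real" assumes [intro]: "f : bdm" "g : bdm" "p : bdm" "q : bdm"
 and [simp, measurable, intro]: "X : sets M" "Y : sets M"
 and w: "!!v v'. v : space M ==> v' : space M ==> e * indicator X v * indicator X v' <= p v * q v'"
 and bd: "!!v v'. v : space M ==> v' : space M ==>
  norm (g v' *\<^sub>R f v - g v *\<^sub>R f v') <= al * g v * g v' + et * (g v + g v')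
    - ze * (indicator Y v * g v) * (indicator Y v' * g v')"
shows "norm ((LINT v|M. q v * g v) *\<^sub>R (LINT v|M. p v *\<^sub>R f v) - (LINT v|M. p v * g v) *\<^sub>R (LINT v|M. q v *\<^sub>R f v))
 <= al * (LINT v|M. p v * g v) * (LINT v|M. q v * g v)
  + et * ((LINT v|M. p v * g v) * (LINT v|M. q v) + (LINT v|M. p v) * (LINT v|M. q v * g v))
  - ze * (LINT v|M. p v * (indicator Y v * g v)) * (LINT v|M. q v * (indicator Y v * g v))
  - e * (al * (LINT v|M. indicator X v * g v)^2 + 2 * et * (LINT v|M. indicator X v * g v) * prob X
   - ze * (LINT v|M. indicator X v * (indicator Y v * g v))^2)"
proof -
note [simp] = bdm_int
let ?X = "indicator X :: 'x => real" and ?Y = "indicator Y :: 'x => real"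
define Qg Pg Qf Pf where "Qg = (LINT v|M. q v * g v)" "Pg = (LINT v|M. p v * g v)"
 "Qf = (LINT v|M. q v *\<^sub>R f v)" "Pf = (LINT v|M. p v *\<^sub>R f v)"
define Q1 P1 QY PY where "Q1 = (LINT v|M. q v)" "P1 = (LINT v|M. p v)"
 "QY = (LINT v|M. q v * (?Y v * g v))" "PY = (LINT v|M. p v * (?Y v * g v))"
define a b xy where "a = (LINT v|M. ?X v * g v)" "b = (LINT v|M. ?X v *\<^sub>R f v)" "xy = (LINT v|M. ?X v * (?Y v * g v))"
note defs = Qg_Pg_Qf_Pf_def Q1_P1_QY_PY_def a_b_xy_def
\<comment> \<open>\<open>H\<close> and \<open>E\<close> are what remains when the second variable is
  integrated out, \<open>H\<close> of the weighted integrand and \<open>E\<close> of its weighted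
  bound. The part of \<open>H\<close> that is subtracted has integral
  \<open>e * (a * b - a * b) = 0\<close>.\<close>
define H where "H v = p v *\<^sub>R (Qg *\<^sub>R f v - g v *\<^sub>R Qf) - (e * ?X v) *\<^sub>R (a *\<^sub>R f v - g v *\<^sub>R b)" for v
define E where "E v = p v * (al * g v * Qg + et * (g v * Q1 + Qg) - ze * (?Y v * g v) * QY)
  - e * ?X v * (al * g v * a + et * (g v * prob X + a) - ze * (?Y v * g v) * xy)" for v
have pX: "(LINT v|M. ?X v) = prob X" by simp
have H: "norm (H v) <= E v" if v: "v : space M" for v
proof -
 let ?w = "%v'. p v * q v' - e * ?X v * ?X v'"
 have "H v = (LINT v'|M. ((q v' * g v') *\<^sub>R (p v *\<^sub>R f v) - (p v * g v) *\<^sub>R (q v' *\<^sub>R f v'))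
       - ((?X v' * g v') *\<^sub>R ((e * ?X v) *\<^sub>R f v) - (e * ?X v * g v) *\<^sub>R (?X v' *\<^sub>R f v')))"
 proof -
  have i: "integrable M (%v'. (q v' * g v') *\<^sub>R (p v *\<^sub>R f v))" "integrable M (%v'. (p v * g v) *\<^sub>R (q v' *\<^sub>R f v'))"
   "integrable M (%v'. (?X v' * g v') *\<^sub>R ((e * ?X v) *\<^sub>R f v))" "integrable M (%v'. (e * ?X v * g v) *\<^sub>R (?X v' *\<^sub>R f v'))"
   by (intro bdm_int bdm_scaleR bdm_mult bdm_minus bdm_const assms bdm_indicator)+
  have j: "integrable M (%v'. q v' * g v')" "integrable M (%v'. ?X v' * g v')" by (intro bdm_int bdm_mult bdm_indicator assms)+
  show ?thesis unfolding Lintegral_diff[OF Lintegrable_diff[OF i(1,2)] Lintegrable_diff[OF i(3,4)]]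
    Lintegral_diff[OF i(1,2)] Lintegral_diff[OF i(3,4)]
    integral_scaleR_right integral_scaleR_left[OF j(1)] integral_scaleR_left[OF j(2)] H_def defs by (simp add: alg)
 qed
 also have "... = (LINT v'|M. ?w v' *\<^sub>R (g v' *\<^sub>R f v - g v *\<^sub>R f v'))"
  by (rule arg_cong[where f="integral\<^sup>L M"]) (auto simp: alg fun_eq_iff)
 also have "norm ... <= (LINT v'|M. norm (?w v' *\<^sub>R (g v' *\<^sub>R f v - g v *\<^sub>R f v')))" by (rule integral_norm_bound)
 also have "... <= (LINT v'|M. ?w v' * (al * g v * g v' + et * (g v + g v') - ze * (?Y v * g v) * (?Y v' * g v')))"
 proof (rule integral_mono)
  show "integrable M (%v'. norm (?w v' *\<^sub>R (g v' *\<^sub>R f v - g v *\<^sub>R f v')))"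
   by (intro integrable_norm bdm_int bdm_scaleR bdm_minus bdm_mult bdm_const bdm_indicator assms)
  show "integrable M (%v'. ?w v' * (al * g v * g v' + et * (g v + g v') - ze * (?Y v * g v) * (?Y v' * g v')))"
   by (intro integrable_norm bdm_int bdm_add bdm_minus bdm_mult bdm_const bdm_indicator assms)
  fix v' assume v': "v' : space M"
  show "norm (?w v' *\<^sub>R (g v' *\<^sub>R f v - g v *\<^sub>R f v')) <=
    ?w v' * (al * g v * g v' + et * (g v + g v') - ze * (?Y v * g v) * (?Y v' * g v'))" using mlm[OF bd[OF v v'], of "?w v'"] w[OF v v'] by simp
 qed
 also have "... = (LINT v'|M. (p v * al * g v + p v * et) * (q v' * g v') + (p v * et * g v) * q v'
   - (p v * ze * (?Y v * g v)) * (q v' * (?Y v' * g v'))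
   - (e * ?X v * al * g v + e * ?X v * et) * (?X v' * g v') - (e * ?X v * et * g v) * ?X v'
   + (e * ?X v * ze * (?Y v * g v)) * (?X v' * (?Y v' * g v')))" by (rule arg_cong[where f="integral\<^sup>L M"]) (auto simp: alg fun_eq_iff)
 also have "... = (p v * al * g v + p v * et) * Qg + (p v * et * g v) * Q1
   - (p v * ze * (?Y v * g v)) * QY
   - (e * ?X v * al * g v + e * ?X v * et) * a - (e * ?X v * et * g v) * prob X
   + (e * ?X v * ze * (?Y v * g v)) * xy" unfolding defs pX[symmetric] by (subst Lintegral_diff Lintegral_add Lintegral_mult_right
    | intro bdm_int bdm_add bdm_minus bdm_mult bdm_const bdm_indicator assms | simp only: )+
 also have "... = E v" unfolding E_def by (simp add: alg)
 finally show ?thesis .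
qed
have iE: "integrable M E" unfolding E_def by (intro bdm_int bdm_add bdm_minus bdm_mult bdm_const bdm_indicator assms)
have "Qg *\<^sub>R Pf - Pg *\<^sub>R Qf = (LINT v|M. H v)"
proof -
 have "(LINT v|M. H v) = (LINT v|M. (Qg *\<^sub>R p v *\<^sub>R f v - (p v * g v) *\<^sub>R Qf) - (e *\<^sub>R a *\<^sub>R ?X v *\<^sub>R f v - e *\<^sub>R (?X v * g v) *\<^sub>R b))"
  unfolding H_def by (rule arg_cong[where f="integral\<^sup>L M"]) (auto simp: alg fun_eq_iff)
 also have "... = (Qg *\<^sub>R Pf - Pg *\<^sub>R Qf) - (e *\<^sub>R a *\<^sub>R b - e *\<^sub>R a *\<^sub>R b)"
 proof -
  have i: "integrable M (%v. Qg *\<^sub>R p v *\<^sub>R f v)" "integrable M (%v. (p v * g v) *\<^sub>R Qf)"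
   "integrable M (%v. e *\<^sub>R a *\<^sub>R ?X v *\<^sub>R f v)" "integrable M (%v. e *\<^sub>R (?X v * g v) *\<^sub>R b)"
   by (intro bdm_int bdm_scaleR bdm_mult bdm_minus bdm_const assms bdm_indicator)+
  have j: "integrable M (%v. p v * g v)" "integrable M (%v'. ?X v' * g v')" by (intro bdm_int bdm_mult bdm_indicator assms)+
  show ?thesis unfolding Lintegral_diff[OF Lintegrable_diff[OF i(1,2)] Lintegrable_diff[OF i(3,4)]]
    Lintegral_diff[OF i(1,2)] Lintegral_diff[OF i(3,4)]
    integral_scaleR_right integral_scaleR_left[OF j(1)] integral_scaleR_left[OF j(2)] unfolding defs by (simp add: alg)
 qed
 finally show ?thesis by simp
qed
also have "norm ... <= (LINT v|M. norm (H v))" by (rule integral_norm_bound)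
also have "... <= (LINT v|M. E v)" by (rule integral_mono[OF _ iE H], unfold H_def)
  (intro integrable_norm bdm_int bdm_scaleR bdm_mult bdm_minus bdm_const assms bdm_indicator, simp_all)
also have "... = (LINT v|M. (al * Qg + et * Q1) * (p v * g v) + et * Qg * p v - ze * QY * (p v * (?Y v * g v))
   - e * (al * a + et * prob X) * (?X v * g v) - e * et * a * ?X v + e * ze * xy * (?X v * (?Y v * g v)))"
 unfolding E_def by (rule arg_cong[where f="integral\<^sup>L M"]) (auto simp: alg fun_eq_iff)
also have "... = (al * Qg + et * Q1) * Pg + et * Qg * P1 - ze * QY * PY
   - e * (al * a + et * prob X) * a - e * et * a * prob X + e * ze * xy * xy" unfolding defs pX[symmetric]
  by (subst Lintegral_diff Lintegral_add Lintegral_mult_right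
    | intro bdm_int bdm_add bdm_minus bdm_mult bdm_const bdm_indicator assms | simp only: )+
also have "... = al * Pg * Qg + et * (Pg * Q1 + P1 * Qg) - ze * PY * QY - e * (al * a^2 + 2 * et * a * prob X - ze * xy^2)" by (simp add: alg power2_eq_square)
finally show ?thesis unfolding defs .
qed

text \<open>The iterates of the constant 1 stand in for the eigenfunction, whose existence is still
  open here: masses and oscillations are measured relative to them.\<close>

definition g :: "nat => 'x => real" where "g n = (Kop ^^ n) (%_. 1)"
definition s :: "nat => real" where "s n = (LINT u|M. g n u)"
definition sA :: "nat => nat => real" where "sA j n = (LINT u|M. indicator (A j) u * g n u)"

lemma g_0 [simp]: "g 0 u = 1" and g_Suc: "g (Suc n) = Kop (g n)" by (simp_all add: g_def)

lemma g_bdm [intro, simp]: "g n : bdm" by (induction n) (auto simp: g_Suc g_def intro!: bdm_Kop)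

lemma g_nonneg: "u : space M ==> 0 <= g n u" by (induction n arbitrary: u) (auto simp: g_Suc intro!: Kop_nonneg)

lemma s_0 [simp]: "s 0 = 1" by (simp add: s_def prob_space)

lemma s_nonneg: "0 <= s n" unfolding s_def by (intro Lintegral_nonneg) (rule g_nonneg)

lemma g_le: assumes "u : space M" shows "g (Suc n) u <= C * s n"
proof -
have "norm (g (Suc n) u) <= C * (LINT v|M. norm (g n v))" unfolding g_Suc by (rule Kop_norm) (auto simp: assms)
also have "(LINT v|M. norm (g n v)) = s n" unfolding s_def by (intro Lintegral_cong) (auto simp: g_nonneg)
finally show ?thesis by simp
qed

lemma integral_restrict_le: assumes f: "f : bdm" "!!u. u : space M ==> f u <= b" and X: "X : sets M" shows "(LINT u|M. indicator X u * f u) <= b * prob X"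
proof -
have "(LINT u|M. indicator X u * f u) <= (LINT u|M. b * indicator X u)"
 using f X by (intro integral_mono bdm_int bdm_mult bdm_indicator bdm_const) (auto simp: indicator_def)
thus ?thesis using X by simp
qed

lemma integral_restrict_ge: assumes f: "f : bdm" "!!u. u : X ==> b <= f u" and X: "X : sets M" shows "b * prob X <= (LINT u|M. indicator X u * f u)"
proof -
have "(LINT u|M. b * indicator X u) <= (LINT u|M. indicator X u * f u)"
 using f X by (intro integral_mono bdm_int bdm_mult bdm_indicator bdm_const) (auto simp: indicator_def)
thus ?thesis using X by simp
qed

lemma integral_split_set: fixes f :: "'x => real" assumes f: "f : bdm" and X: "X : sets M"
shows "(LINT u|M. f u) = (LINT u|M. indicator X u * f u) + (LINT u|M. indicator (space M - X) u * f u)"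
proof -
have "(LINT u|M. f u) = (LINT u|M. indicator X u * f u + indicator (space M - X) u * f u)" by (intro Lintegral_cong) (auto simp: indicator_def)
thus ?thesis using f X by (subst (asm) Lintegral_add) (auto intro!: bdm_int)
qed

lemma s_le: "s (Suc n) <= C * s n" using integral_restrict_le[OF g_bdm g_le, of "space M" n] by (simp add: s_def prob_space cong: Lintegral_cong)

lemma A_space: "A j <= space M" by (rule sets.sets_into_space[OF A_sets])

lemma sA_mono: assumes "i <= j" shows "sA i n <= sA j n" using incseqD[OF A_mono assms] A_space g_nonneg unfolding sA_def
by (intro integral_mono bdm_int bdm_mult bdm_indicator) (auto simp: indicator_def)

lemma sA_le: "sA j n <= s n" unfolding sA_def s_def using g_nonneg by (intro integral_mono bdm_int bdm_mult bdm_indicator) (auto simp: indicator_def)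

lemma sA_nonneg: "0 <= sA j n" unfolding sA_def using g_nonneg by (intro Lintegral_nonneg) (auto simp: indicator_def)

lemma prob_compl_A: "prob (space M - A j) = 1 - prob (A j)" by (rule prob_compl) simp

lemma large_A: assumes "0 < e" obtains j where "j0 <= j" "1 - prob (A j) <= e"
proof -
have "\<forall>\<^sub>F j in sequentially. 1 - e < prob (A j)" using order_tendstoD(1)[OF A_lim, of "1 - e"] assms by simp
hence "\<forall>\<^sub>F j in sequentially. j0 <= j & 1 - prob (A j) <= e" using eventually_ge_at_top[of j0] by eventually_elim auto
thus ?thesis using that by (auto dest!: eventually_happens)
qed

lemma g_ge: assumes "u : A j" shows "d j * sA j n <= g (Suc n) u"
proof -
have u: "u : space M" using assms A_space by auto
have "(LINT v|M. d j * (indicator (A j) v * g n v)) <= (LINT v|M. k u v *\<^sub>R g n v)"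
proof (intro integral_mono bdm_int bdm_mult bdm_indicator bdm_scaleR bdm_k)
 fix v assume "v : space M"
 thus "d j * (indicator (A j) v * g n v) <= k u v *\<^sub>R g n v" using k_ge[OF assms] u by (auto simp: indicator_def g_nonneg k_nonneg intro!: mrm)
qed (auto simp: u)
thus ?thesis unfolding g_Suc Kop_def sA_def by simp
qed

text \<open>In the application \<open>a\<close>, \<open>D\<close>, \<open>e\<close> are the masses
  of an iterate on an inner set, on the shell up to a larger set, and outside; primes mean one step
  later. The cone \<open>e <= ka * (a + ta * D)\<close> is kept: the shell has a small weight
  \<open>ta\<close>, since only the weak bound \<open>de\<close> feeds it back to the inner set, and
  \<open>ka\<close> is large enough to absorb what leaks out at the rate \<open>x\<close>.\<close>

lemma growth_step: fixes a D e a' D' e' rh de x ka ta :: real assumes "e' <= x * (a + D + e)" "rh * a + de * D <= a'" "0 <= D'" "e <= ka * (a + ta * D)"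
 and "2 * x <= rh" "1 <= ka" "2 * x <= ka * de" "0 <= ta" "x * ta <= de / 2" "0 <= a" "0 <= D" "0 < x" shows "e' <= ka * (a' + ta * D')"
proof -
have "x * e <= x * (ka * (a + ta * D))" using assms by (intro mlm) auto
hence "e' <= x * a + x * D + ka * x * a + ka * (x * ta) * D" using assms(1) by (simp add: alg)
also have "ka * (x * ta) * D <= ka * (de / 2) * D" using assms by (intro mrm mlm) auto
also have "x * D <= ka * (de / 2) * D" using assms by (intro mrm) auto
also have "x * a <= ka * x * a" using assms by (intro mrm) (auto simp: mult_le_cancel_right1)
also have "ka * x * a + ka * (de / 2) * D + ka * x * a + ka * (de / 2) * D = ka * ((2 * x) * a + de * D)" by (simp add: alg)
also have "... <= ka * (rh * a + de * D)" using assms by (intro mlm add_right_mono mrm) auto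
also have "... <= ka * (a' + ta * D')" using assms by (intro mlm) (auto intro!: add_increasing2)
finally show ?thesis by simp
qed

text \<open>The mass cannot escape from the sets \<open>A j\<close>. The order of choices matters:
  \<open>A j0\<close> fixes the rate \<open>rh\<close>, and only then \<open>A j\<close> is taken
  with a complement small against \<open>rh\<close>. The constant \<open>d j\<close> of the larger
  set may be tiny; this is harmless because it only influences the shape \<open>ka\<close>,
  \<open>ta\<close> of the invariant cone.\<close>

lemma growth:
obtains j0 c where "0 < c" "!!n. c * s n <= sA j0 n" "!!n. c * s n <= s (Suc n)"
proof -
obtain j0 where j0: "1 - prob (A j0) <= 1/2" using large_A[of "1/2" 0] by auto
define rh where "rh = d j0 / 2"
have rh: "0 < rh" using d_pos by (simp add: rh_def)
define ep where "ep = min (1/2) (rh / (4 * C))"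
have ep: "0 < ep" using rh C_pos by (simp add: ep_def)
obtain j where j: "j0 <= j" "1 - prob (A j) <= ep" using large_A[OF ep, of j0] by auto
define de where "de = d j / 2"
have de: "0 < de" using d_pos by (simp add: de_def)
define x where "x = ep * C"
have x: "0 < x" "2 * x <= rh" using ep C_pos rh by (auto simp: x_def ep_def min_def field_simps)
define ka ta where "ka = max 1 (2 * x / de)" and "ta = min 1 (de / (2 * x))"
have ka: "1 <= ka" "2 * x <= ka * de" using de x by (auto simp: ka_def max_def field_simps)
have ta: "0 <= ta" "ta <= 1" "x * ta <= de / 2" using de x by (auto simp: ta_def min_def field_simps)
define e where "e n = (LINT u|M. indicator (space M - A j) u * g n u)" for n
have s_eq: "s n = sA j0 n + (sA j n - sA j0 n) + e n" for n using integral_split_set[OF g_bdm A_sets, of n j] unfolding s_def sA_def e_def by simp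
have D0: "0 <= sA j n - sA j0 n" for n using sA_mono[OF j(1)] by simp
have e': "e (Suc n) <= x * (sA j0 n + (sA j n - sA j0 n) + e n)" for n
proof -
 have "e (Suc n) <= (C * s n) * prob (space M - A j)" unfolding e_def by (rule integral_restrict_le) (auto simp: g_le)
 also have "... <= (C * s n) * ep" using j(2) C_pos s_nonneg by (intro mlm) (auto simp: prob_compl_A)
 finally show ?thesis unfolding s_eq[symmetric] by (simp add: x_def mult_ac)
qed
have a': "rh * sA j0 n + de * (sA j n - sA j0 n) <= sA j0 (Suc n)" for n
proof -
 let ?b = "d j0 * sA j0 n + d j * (sA j n - sA j0 n)"
 have b: "?b <= g (Suc n) u" if u: "u : A j0" for u
 proof -
  have us: "u : space M" and uj: "u : A j" using u A_space incseqD[OF A_mono j(1)] by auto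
  \<comment> \<open>Together the two terms put the weight \<open>d j0\<close> on \<open>A j0\<close>
    and \<open>d j\<close> on the shell; \<open>d j0 - d j\<close> may have either sign.\<close>
  have "(LINT v|M. (d j0 - d j) * (indicator (A j0) v * g n v) + d j * (indicator (A j) v * g n v)) <= (LINT v|M. k u v *\<^sub>R g n v)"
  proof (intro integral_mono bdm_int bdm_add bdm_mult bdm_indicator bdm_scaleR bdm_k)
   fix v assume v: "v : space M"
   show "(d j0 - d j) * (indicator (A j0) v * g n v) + d j * (indicator (A j) v * g n v) <= k u v *\<^sub>R g n v"
    using incseqD[OF A_mono j(1)] k_ge[OF u, of v] k_ge[OF uj, of v] k_nonneg[OF us v] g_nonneg[OF v, of n]
    by (cases "v : A j0"; cases "v : A j") (auto simp: indicator_def alg[symmetric] intro!: mrm)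
  qed (auto simp: us)
  also have "(LINT v|M. (d j0 - d j) * (indicator (A j0) v * g n v) + d j * (indicator (A j) v * g n v))
    = (d j0 - d j) * sA j0 n + d j * sA j n" unfolding sA_def by (subst Lintegral_add) (auto intro!: bdm_int bdm_mult simp del: left_diff_distrib)
  also have "... = ?b" by (simp add: alg)
  finally show ?thesis unfolding g_Suc Kop_def .
 qed
 have b0: "0 <= ?b" using D0 sA_nonneg d_pos[of j] d_pos[of j0] by (intro add_nonneg_nonneg mult_nonneg_nonneg) auto
 have "?b * (1/2) <= ?b * prob (A j0)" using j0 b0 by (intro mlm) auto
 also have "... <= sA j0 (Suc n)" unfolding sA_def[of _ "Suc n"] by (rule integral_restrict_ge) (auto simp: b)
 finally show ?thesis by (simp add: rh_def de_def)
qed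
have sA0: "1/2 <= sA i 0" if "j0 <= i" for i using j0 sA_mono[OF that, of 0] by (simp add: sA_def)
have inv: "e n <= ka * (sA j0 n + ta * (sA j n - sA j0 n))" for n
proof (induction n)
 case 0
 have "e 0 <= ep" using j(2) by (simp add: e_def prob_compl_A)
 also have "... <= 1 * (1/2 + ta * 0)" by (simp add: ep_def)
 also have "... <= ka * (sA j0 0 + ta * (sA j 0 - sA j0 0))" using ka ta sA0[of j0] D0 by (intro mult_mono add_mono mult_nonneg_nonneg) auto
 finally show ?case .
next
 case (Suc n)
 show ?case by (rule growth_step[OF e' a' D0 Suc.IH x(2) ka ta(1,3) sA_nonneg D0 x(1)])
qed
define c1 where "c1 = min rh de / (1 + ka)"
have c1: "0 < c1" using rh de ka by (simp add: c1_def)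
have key: "c1 * s n <= sA j0 (Suc n)" for n
proof -
 have "ta * (sA j n - sA j0 n) <= sA j n - sA j0 n" using ta D0 by (simp add: mult_left_le_one_le)
 hence "ka * (sA j0 n + ta * (sA j n - sA j0 n)) <= ka * sA j n" using ka by (intro mlm) auto
 hence "s n <= (1 + ka) * sA j n" using inv[of n] unfolding s_eq[of n] by (simp add: alg)
 hence "c1 * s n <= min rh de * sA j n" using ka c1 mlm[of "s n" "(1 + ka) * sA j n" c1] by (simp add: c1_def)
 also have "... = min rh de * sA j0 n + min rh de * (sA j n - sA j0 n)" by (simp add: alg)
 also have "... <= rh * sA j0 n + de * (sA j n - sA j0 n)" using D0 sA_nonneg by (intro add_mono mrm) auto
 finally show ?thesis using a' by (meson order_trans)
qed
\<comment> \<open>\<open>key\<close> compares step \<open>n\<close> with step \<open>Suc n\<close>.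
  The quotient by \<open>C\<close> brings the comparison back to a single index, and 1/2 covers
  \<open>n = 0\<close>.\<close>
define c where "c = min (min c1 (c1 / C)) (1/2)"
have c: "0 < c" "c <= c1" "c <= 1/2" "c * C <= c1" using c1 C_pos by (auto simp: c_def min_def field_simps)
show ?thesis
proof (rule that[of c j0])
 fix n
 show "c * s n <= s (Suc n)" using mrm[OF c(2) s_nonneg[of n]] key[of n] sA_le[of j0 "Suc n"] by linarith
 show "c * s n <= sA j0 n"
 proof (cases n)
  case 0
  thus ?thesis using c sA0[of j0] by simp
 next
  case (Suc m)
  have "c * s n <= c * (C * s m)" using s_le[of m] c Suc by (intro mlm) auto
  also have "... <= c1 * s m" using mrm[OF c(4) s_nonneg[of m]] by (simp add: mult_ac)
  finally show ?thesis using key[of m] Suc by simp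
 qed
qed (use c in auto)
qed

end

context positive_kernel
begin
text \<open>Harris' drift condition. Weighting \<open>k\<close> by \<open>g n\<close> and dividing
  by \<open>g (Suc n)\<close> gives a Markov kernel, and for it the inequality says that the mean of
  the Lyapunov function \<open>s n / g n\<close> is at most
  \<open>ga * s (Suc n) / g (Suc n) + C3\<close>. It holds because \<open>g n\<close> is at least a
  multiple of \<open>s n\<close> on \<open>A j\<close>, while the complement of \<open>A j\<close>
  has little mass.\<close>

lemma drift: assumes ga: "0 < ga"
obtains C3 where "1 <= C3" "!!n u. u : space M ==> s n * g 1 u <= ga * s (Suc n) + C3 * g (Suc n) u"
proof -
obtain c j0 where c: "0 < c" "!!n. c * s n <= sA j0 n" "!!n. c * s n <= s (Suc n)" by (rule growth) blast
have e: "0 < ga * c / C" using ga c C_pos by simp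
obtain j where j: "j0 <= j" "1 - prob (A j) <= ga * c / C" using large_A[OF e, of j0] by auto
define c3 where "c3 = min 1 (d j * c / C)"
have c3: "0 < c3" "c3 <= 1" "c3 * C <= d j * c" using d_pos[of j] c C_pos by (auto simp: c3_def min_def field_simps)
have gA: "c3 * s n <= g n v" if "v : A j" for v n
proof (cases n)
 case 0 thus ?thesis using c3 by simp
next
 case (Suc m)
 have "c3 * s n <= c3 * (C * s m)" using s_le[of m] c3 Suc by (intro mlm) auto
 also have "... <= d j * (c * s m)" using mrm[OF c3(3) s_nonneg[of m]] by (simp add: mult_ac)
 also have "... <= d j * sA j m" using c(2)[of m] sA_mono[OF j(1), of m] d_pos[of j] by (intro mlm) auto
 also have "... <= g n v" using g_ge[OF that] Suc by simp
 finally show ?thesis .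
qed
have main: "s n * g 1 u <= ga * s (Suc n) + (1 / c3) * g (Suc n) u" if u: "u : space M" for n u
proof -
 have "s n * g 1 u = (LINT v|M. k u v * s n)" by (simp add: g_def Kop_def)
 also have "... <= (LINT v|M. (C * s n) * indicator (space M - A j) v + (1 / c3) * (k u v * g n v))"
 proof (intro integral_mono bdm_int bdm_add bdm_mult bdm_indicator bdm_k bdm_const)
  fix v assume v: "v : space M"
  show "k u v * s n <= (C * s n) * indicator (space M - A j) v + (1 / c3) * (k u v * g n v)"
  proof (cases "v : A j")
   case True
   have "k u v * (c3 * s n) <= k u v * g n v" using gA[OF True] k_nonneg[OF u v] by (rule mlm)
   thus ?thesis using True c3 by (simp add: field_simps)
  next
   case False
   have "k u v * s n <= C * s n" using k_le[OF u v] s_nonneg by (rule mrm)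
   moreover have "0 <= (1 / c3) * (k u v * g n v)" using c3 k_nonneg[OF u v] g_nonneg[OF v] by simp
   ultimately show ?thesis using False v by simp
  qed
 qed (auto simp: u)
 also have "... = C * s n * (1 - prob (A j)) + (1 / c3) * g (Suc n) u"
 proof -
  have "integrable M (%v. (C * s n) * indicator (space M - A j) v)" "integrable M (%v. (1 / c3) * (k u v * g n v))"
   by (intro bdm_int bdm_mult bdm_indicator bdm_const bdm_k g_bdm u sets.compl_sets A_sets)+
  thus ?thesis by (subst Lintegral_add) (auto simp: g_Suc Kop_def prob_compl_A)
 qed
 also have "C * s n * (1 - prob (A j)) <= C * s n * (ga * c / C)" using j(2) C_pos s_nonneg by (intro mlm) auto
 also have "... = ga * (c * s n)" using C_pos by simp
 also have "... <= ga * s (Suc n)" using c(3)[of n] ga by (intro mlm) auto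
 finally show ?thesis by simp
qed
show ?thesis by (rule that[of "1 / c3"]) (use c3 main in auto)
qed

text \<open>Divided by \<open>g n u * g n u'\<close>, this bounds the difference of
  \<open>f / g n\<close> at two points by \<open>b * (2 + bt * (V u + V u'))\<close> with
  \<open>V = s n / g n\<close>: the weighted seminorm in which Harris' theorem becomes a strict
  contraction. The product form still makes sense where \<open>g n\<close> vanishes.\<close>

definition osc :: "real => nat => real => ('x => complex) => bool" where
"osc bt n b f \<longleftrightarrow> (ALL u:space M. ALL u':space M. norm (g n u' *\<^sub>R f u - g n u *\<^sub>R f u')
  <= b * (2 * g n u * g n u' + bt * s n * (g n u + g n u')))"

text \<open>Two steps are taken because one step gains from the minorization only where both points
  lie in \<open>A j\<close>; the second step spreads this gain. Where the Lyapunov part dominates,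
  the drift shrinks it. Where it is small, at least half of the mass that makes up
  \<open>g (Suc (Suc n))\<close> has passed through \<open>A j\<close>, for both points.\<close>

lemma contraction:
obtains bt th where "0 < bt" "0 <= th" "th < 1"
 "!!f n b. f : bdm ==> 0 <= b ==> osc bt n b f ==> osc bt (Suc (Suc n)) (th * b) (Kop (Kop f))"
proof -
obtain c j0 where c: "0 < c" "!!n. c * s n <= sA j0 n" "!!n. c * s n <= s (Suc n)" by (rule growth) blast
obtain C3 where C3: "1 <= C3" "!!n u. u : space M ==> s n * g 1 u <= (1/4) * s (Suc n) + C3 * g (Suc n) u" using drift[of "1/4"] by auto
\<comment> \<open>Two drift steps at rate 1/4 leave 1/16 of the Lyapunov part. For
  \<open>y >= R * x\<close> the freed share of at least 7/16 is worth
  \<open>7 * (bt * C3) * x\<close>, more than the at most \<open>9/2 * (bt * C3) * x\<close> that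
  has to be paid for.\<close>
define R where "R = 16 * C3"
have R: "0 < R" using C3 by (simp add: R_def)
have e: "0 < c^2 / (2 * R * C^2)" using c R C_pos by simp
obtain j where j: "j0 <= j" "1 - prob (A j) <= c^2 / (2 * R * C^2)" using large_A[OF e, of j0] by auto
define ka where "ka = (d j * c / C)^2"
have ka: "0 < ka" using d_pos[of j] c C_pos by (simp add: ka_def)
define bt where "bt = ka / (10 * C3)"
have bt: "0 < bt" "bt * C3 = ka / 10" using ka C3 by (auto simp: bt_def)
define th where "th = max (1/2) (1 - ka / 10)"
have th: "1/2 <= th" "1 - ka / 10 <= th" "th < 1" using ka by (auto simp: th_def)
let ?Y = "indicator (A j) :: 'x => real"
have drift': "bt * s n * (g (Suc n) u * g 1 u' + g 1 u * g (Suc n) u')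
  <= 2 * (bt * C3) * (g (Suc n) u * g (Suc n) u') + bt / 4 * s (Suc n) * (g (Suc n) u + g (Suc n) u')"
 if u: "u : space M" "u' : space M" for n u u'
proof -
 have "g (Suc n) u * (s n * g 1 u') <= g (Suc n) u * ((1/4) * s (Suc n) + C3 * g (Suc n) u')" using C3(2)[OF u(2), of n] g_nonneg[OF u(1)] by (rule mlm)
 moreover have "g (Suc n) u' * (s n * g 1 u) <= g (Suc n) u' * ((1/4) * s (Suc n) + C3 * g (Suc n) u)" using C3(2)[OF u(1), of n] g_nonneg[OF u(2)] by (rule mlm)
 ultimately have "s n * (g (Suc n) u * g 1 u' + g 1 u * g (Suc n) u')
   <= (1/4) * s (Suc n) * (g (Suc n) u + g (Suc n) u') + 2 * C3 * (g (Suc n) u * g (Suc n) u')" by (simp add: alg)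
 from mlm[OF this, of bt] bt(1) show ?thesis by (simp add: alg)
qed
have main: "osc bt (Suc (Suc n)) (th * b) (Kop (Kop f))" if f: "f : bdm" "0 <= b" "osc bt n b f" for f n b
proof -
 let ?g1 = "g (Suc n)" and ?g2 = "g (Suc (Suc n))"
 let ?f1 = "Kop f"
 have f1: "?f1 : bdm" using f by auto
 have gK: "(LINT v|M. k u v * g m v) = g (Suc m) u" for u m by (simp add: g_Suc Kop_def)
 have g1: "(LINT v|M. k u v) = g 1 u" for u by (simp add: g_def Kop_def)
 have step1: "norm (?g1 u' *\<^sub>R ?f1 u - ?g1 u *\<^sub>R ?f1 u') <= b * (2 + 2 * (bt * C3)) * ?g1 u * ?g1 u'
    + b * (bt / 4 * s (Suc n)) * (?g1 u + ?g1 u') - (2 * ka * b) * (?Y u * ?g1 u) * (?Y u' * ?g1 u')"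
  if u: "u : space M" "u' : space M" for u u'
 proof -
  define e where "e = (if u : A j & u' : A j then (d j)^2 else 0)"
  have "norm (?g1 u' *\<^sub>R ?f1 u - ?g1 u *\<^sub>R ?f1 u') <= (2 * b) * ?g1 u * ?g1 u' + (b * (bt * s n)) * (?g1 u * g 1 u' + g 1 u * ?g1 u')
    - 0 * (LINT v|M. k u v * (?Y v * g n v)) * (LINT v|M. k u' v * (?Y v * g n v))
    - e * ((2 * b) * (sA j n)^2 + 2 * (b * (bt * s n)) * sA j n * prob (A j) - 0 * (LINT v|M. ?Y v * (?Y v * g n v))^2)"
   unfolding Kop_def[of f] sA_def gK[symmetric] g1[symmetric]
  proof (rule antisymmetric_integral_bound)
   fix v v' assume v: "v : space M" "v' : space M"
   show "e * ?Y v * ?Y v' <= k u v * k u' v'"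
   proof (cases "v : A j & v' : A j & u : A j & u' : A j")
    case True
    hence "d j * d j <= k u v * k u' v'" using d_pos[of j] by (intro mult_mono k_ge k_nonneg u v) (auto intro: less_imp_le)
    thus ?thesis using True by (simp add: e_def power2_eq_square)
   next
    case False
    hence "e * ?Y v * ?Y v' = 0" by (auto simp: e_def)
    moreover have "0 <= k u v * k u' v'" using u v by (intro mult_nonneg_nonneg k_nonneg)
    ultimately show ?thesis by linarith
   qed
   show "norm (g n v' *\<^sub>R f v - g n v *\<^sub>R f v') <= 2 * b * g n v * g n v' + b * (bt * s n) * (g n v + g n v')
     - 0 * (?Y v * g n v) * (?Y v' * g n v')" using f(3) v unfolding osc_def by (auto simp: alg)
  qed (use f u in auto)
  also have "(b * (bt * s n)) * (?g1 u * g 1 u' + g 1 u * ?g1 u') <=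
    b * (2 * (bt * C3) * (?g1 u * ?g1 u') + bt / 4 * s (Suc n) * (?g1 u + ?g1 u'))" using mlm[OF drift'[OF u] f(2)] by (simp add: mult.assoc)
  finally have 1: "norm (?g1 u' *\<^sub>R ?f1 u - ?g1 u *\<^sub>R ?f1 u') <= b * (2 + 2 * (bt * C3)) * ?g1 u * ?g1 u'
    + b * (bt / 4 * s (Suc n)) * (?g1 u + ?g1 u') - e * ((2 * b) * (sA j n)^2 + 2 * (b * (bt * s n)) * sA j n * prob (A j))" by (simp add: alg add_divide_distrib)
  have "(2 * ka * b) * (?Y u * ?g1 u) * (?Y u' * ?g1 u') <= e * ((2 * b) * (sA j n)^2 + 2 * (b * (bt * s n)) * sA j n * prob (A j))"
  proof (cases "u : A j & u' : A j")
   case True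
   have "?g1 u * ?g1 u' <= (C * s n) * (C * s n)" using u g_nonneg g_le C_pos s_nonneg by (intro mult_mono) auto
   hence "ka * (?g1 u * ?g1 u') <= ka * ((C * s n) * (C * s n))" using ka by (intro mlm) auto
   also have "... = (d j)^2 * (c * s n)^2" using C_pos by (simp add: ka_def power2_eq_square)
   also have "... <= (d j)^2 * (sA j n)^2" using c(2)[of n] sA_mono[OF j(1), of n] c(1) s_nonneg[of n] by (intro mlm power_mono) auto
   finally have "2 * b * (ka * (?g1 u * ?g1 u')) <= 2 * b * ((d j)^2 * (sA j n)^2)" using f(2) by (intro mlm) auto
   moreover have "0 <= (d j)^2 * (2 * (b * (bt * s n)) * sA j n * prob (A j))" using f(2) bt s_nonneg sA_nonneg by (intro mult_nonneg_nonneg) auto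
   ultimately show ?thesis using True by (simp add: e_def alg)
  next
   case False
   hence L: "(2 * ka * b) * (?Y u * ?g1 u) * (?Y u' * ?g1 u') = 0" and e0: "e = 0" by (auto simp: e_def indicator_def)
   show ?thesis unfolding L unfolding e0 by simp
  qed
  with 1 show ?thesis by linarith
 qed
 have step2: "norm (?g2 u' *\<^sub>R Kop ?f1 u - ?g2 u *\<^sub>R Kop ?f1 u') <= th * b * (2 * ?g2 u * ?g2 u' + bt * s (Suc (Suc n)) * (?g2 u + ?g2 u'))"
  if u: "u : space M" "u' : space M" for u u'
 proof -
  define P where "P u = (LINT v|M. k u v * (?Y v * ?g1 v))" for u
  define x y where "x = ?g2 u * ?g2 u'" and "y = s (Suc (Suc n)) * (?g2 u + ?g2 u')"
  have xy: "0 <= x" "0 <= y" using u g_nonneg s_nonneg by (auto simp: x_def y_def)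
  \<comment> \<open>This time with \<open>e = 0\<close>: the starting points are arbitrary, and the
    negative term is the gain of the first step carried through the kernel.\<close>
  have "norm (?g2 u' *\<^sub>R Kop ?f1 u - ?g2 u *\<^sub>R Kop ?f1 u') <= (b * (2 + 2 * (bt * C3))) * ?g2 u * ?g2 u'
    + (b * (bt / 4 * s (Suc n))) * (?g2 u * g 1 u' + g 1 u * ?g2 u')
    - (2 * ka * b) * P u * P u' - 0 * ((b * (2 + 2 * (bt * C3))) * (sA j (Suc n))^2
      + 2 * (b * (bt / 4 * s (Suc n))) * sA j (Suc n) * prob (A j) - (2 * ka * b) * (LINT v|M. ?Y v * (?Y v * ?g1 v))^2)"
   unfolding Kop_def[of ?f1] P_def sA_def gK[of u "Suc n", symmetric] gK[of u' "Suc n", symmetric]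
    g1[of u, symmetric] g1[of u', symmetric]
  proof (rule antisymmetric_integral_bound)
   fix v v' assume v: "v : space M" "v' : space M"
   show "0 * ?Y v * ?Y v' <= k u v * k u' v'" using u v k_nonneg by simp
   show "norm (?g1 v' *\<^sub>R ?f1 v - ?g1 v *\<^sub>R ?f1 v') <= b * (2 + 2 * (bt * C3)) * ?g1 v * ?g1 v'
    + b * (bt / 4 * s (Suc n)) * (?g1 v + ?g1 v') - (2 * ka * b) * (?Y v * ?g1 v) * (?Y v' * ?g1 v')" using step1[OF v] .
  qed (use f1 u in auto)
  also have "(b * (bt / 4 * s (Suc n))) * (?g2 u * g 1 u' + g 1 u * ?g2 u') <= b * ((bt * C3) / 2 * x + bt / 16 * y)"
   using mlm[OF drift'[OF u, of "Suc n"], of "b/4"] f(2) by (simp add: x_def y_def mult_ac distrib_left)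
  finally have 2: "norm (?g2 u' *\<^sub>R Kop ?f1 u - ?g2 u *\<^sub>R Kop ?f1 u')
    <= b * ((2 + 5/2 * (bt * C3)) * x + bt / 16 * y - 2 * ka * (P u * P u'))" by (simp add: x_def alg)
  have P0: "0 <= P u" if "u : space M" for u unfolding P_def using that g_nonneg
   by (intro Lintegral_nonneg) (auto intro!: mult_nonneg_nonneg k_nonneg simp: indicator_def)
  have "(2 + 5/2 * (bt * C3)) * x + bt / 16 * y - 2 * ka * (P u * P u') <= th * (2 * x + bt * y)"
  proof (cases "y >= R * x")
   case True
   have "(th - 1/16) * (bt * y) >= (7/16) * (bt * (R * x))" using th bt xy True R by (intro mult_mono) auto
   also have "(7/16) * (bt * (R * x)) = 7 * (bt * C3) * x" by (simp add: R_def)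
   finally have "7 * (bt * C3) * x <= (th - 1/16) * (bt * y)" .
   moreover have "(2 + 5/2 * (bt * C3) - 2 * th) * x <= (7 * (bt * C3)) * x" using th bt(2) ka xy by (intro mrm) auto
   moreover have "0 <= 2 * ka * (P u * P u')" using ka P0 u by simp
   ultimately show ?thesis by (simp add: alg)
  next
   case False
   have tail: "P w >= ?g2 w - s (Suc (Suc n)) / (2 * R)" if w: "w : space M" for w
   proof -
    have "?g2 w = P w + (LINT v|M. indicator (space M - A j) v * (k w v * ?g1 v))" unfolding gK[symmetric, of "Suc n"] P_def
     by (subst integral_split_set[OF bdm_mult[OF bdm_k g_bdm] A_sets[of j]]) (auto simp: w mult_ac)
    also have "(LINT v|M. indicator (space M - A j) v * (k w v * ?g1 v)) <= (C * (C * s n)) * prob (space M - A j)"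
     using w by (intro integral_restrict_le) (auto intro!: mult_mono k_le g_le k_nonneg g_nonneg less_imp_le[OF C_pos])
    also have "... <= (C * (C * s n)) * (c^2 / (2 * R * C^2))" using j(2) C_pos s_nonneg by (intro mlm) (auto simp: prob_compl_A)
    also have "... = c * (c * s n) / (2 * R)" using C_pos by (simp add: power2_eq_square)
    also have "... <= c * s (Suc n) / (2 * R)" using c R by (intro divide_right_mono mlm) auto
    also have "... <= s (Suc (Suc n)) / (2 * R)" using c R by (intro divide_right_mono) auto
    finally show ?thesis by simp
   qed
   have x0: "0 < x" using False xy R by (cases "x = 0") auto
   hence G: "0 < ?g2 u" "0 < ?g2 u'" using g_nonneg[OF u(1), of "Suc (Suc n)"] g_nonneg[OF u(2), of "Suc (Suc n)"] by (auto simp: x_def zero_less_mult_iff)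
   have F: "s (Suc (Suc n)) * ?g2 u + s (Suc (Suc n)) * ?g2 u' < R * ?g2 u * ?g2 u'" using False by (simp add: x_def y_def alg)
   have F0: "0 <= s (Suc (Suc n)) * ?g2 u" "0 <= s (Suc (Suc n)) * ?g2 u'" using G s_nonneg by simp_all
   have FF: "R * ?g2 u * ?g2 u' = R * ?g2 u' * ?g2 u" by simp
   have sG: "s (Suc (Suc n)) * ?g2 u <= R * ?g2 u' * ?g2 u" "s (Suc (Suc n)) * ?g2 u' <= R * ?g2 u * ?g2 u'" using F F0 FF by linarith+
   have "s (Suc (Suc n)) <= R * ?g2 u'" "s (Suc (Suc n)) <= R * ?g2 u"
    using sG unfolding mult_le_cancel_right_pos[OF G(1)] mult_le_cancel_right_pos[OF G(2)] by auto
   hence "s (Suc (Suc n)) / (2 * R) <= ?g2 u' / 2" "s (Suc (Suc n)) / (2 * R) <= ?g2 u / 2" using R by (auto simp: field_simps)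
   hence "?g2 u / 2 <= P u" "?g2 u' / 2 <= P u'" using tail[OF u(1)] tail[OF u(2)] by linarith+
   hence "(?g2 u / 2) * (?g2 u' / 2) <= P u * P u'" using G P0 u by (intro mult_mono) auto
   hence "2 * ka * ((?g2 u / 2) * (?g2 u' / 2)) <= 2 * ka * (P u * P u')" using ka by (intro mlm) auto
   hence "2 * ka * (P u * P u') >= ka / 2 * x" by (simp add: x_def mult_ac)
   moreover have "(2 + 5/2 * (bt * C3) - ka / 2) * x <= (th * 2) * x" using th bt(2) ka xy by (intro mrm) auto
   moreover have "bt / 16 * y <= th * (bt * y)" using mrm[of "1/16" th "bt * y"] th bt xy by simp
   ultimately show ?thesis by (simp add: alg)
  qed
  from mlm[OF this f(2)] 2 show ?thesis by (simp add: x_def y_def alg)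
 qed
 show ?thesis unfolding osc_def using step2 by blast
qed
show ?thesis by (rule that[of bt th]) (use bt th main in auto)
qed

end

lemma geometric_Cauchy: fixes x :: "nat => 'a::banach" assumes "0 <= q" "q < 1" "0 <= D" and x: "!!n. norm (x (Suc n) - x n) <= D * q ^ n"
obtains l where "x ----> l" "!!n. norm (x n - l) <= D / (1 - q) * q ^ n"
proof -
have tail: "norm (x (n + m) - x n) <= D / (1 - q) * q ^ n" for n m
proof -
 have "norm (x (n + m) - x n) = norm (SUM i<m. x (n + Suc i) - x (n + i))" using sum_lessThan_telescope[of "%i. x (n + i)" m] by simp
 also have "... <= (SUM i<m. D * q ^ (n + i))" using x by (intro sum_norm_le) simp
 also have "... = D * q ^ n * (SUM i<m. q ^ i)" by (simp add: sum_distrib_left power_add mult_ac)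
 also have "... <= D * q ^ n * (1 / (1 - q))"
  using assms by (intro mlm sum_le_suminf[OF summable_geometric, of q "{..<m}", simplified suminf_geometric] mult_nonneg_nonneg)
    (auto simp: suminf_geometric[symmetric] intro!: sum_le_suminf summable_geometric)
 finally show ?thesis by simp
qed
have "(%n. D / (1 - q) * q ^ n) ----> D / (1 - q) * 0" using assms by (intro tendsto_intros LIMSEQ_realpow_zero)
hence z: "(%n. D / (1 - q) * q ^ n) ----> 0" by simp
have "Cauchy x"
proof (rule metric_CauchyI)
 fix e :: real assume "0 < e"
 hence "\<forall>\<^sub>F n in sequentially. D / (1 - q) * q ^ n < e / 2" using order_tendstoD(2)[OF z, of "e/2"] by simp
 then obtain N where N: "D / (1 - q) * q ^ N < e / 2" by (auto dest: eventually_happens)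
 have N': "dist (x m) (x N) < e / 2" if "N <= m" for m using le_less_trans[OF tail[of N "m - N"] N] that by (simp add: dist_norm)
 show "EX M. ALL m>=M. ALL n>=M. dist (x m) (x n) < e" using N' dist_triangle_half_r[of "x N"] by (metis dist_commute)
qed
then obtain l where l: "x ----> l" by (auto simp: Cauchy_convergent_iff convergent_def)
have "norm (x n - l) <= D / (1 - q) * q ^ n" for n
proof -
 have "(%m. norm (x (m + n) - x n)) ----> norm (l - x n)" by (intro tendsto_intros LIMSEQ_ignore_initial_segment l)
 hence "norm (l - x n) <= D / (1 - q) * q ^ n" by (rule LIMSEQ_le_const2) (use tail[of n] in \<open>auto simp: add.commute\<close>)
 thus ?thesis by (simp add: norm_minus_commute)
qed
with l show ?thesis by (rule that)
qed

context positive_kernel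
begin

abbreviation K2 :: "('x => 'b::{banach, second_countable_topology}) => 'x => 'b" where
"K2 f == Kop (Kop f)"

lemma K2_pow_bdm: "f : bdm ==> (K2 ^^ n) f : bdm" by (induction n) auto

lemma K2_norm: fixes f :: "'x => 'b::{banach, second_countable_topology}" assumes "f : bdm" "u : space M" "!!v. v : space M ==> norm (f v) <= B"
shows "norm (K2 f u) <= C^2 * B"
proof -
have 1: "norm (Kop f v) <= C * B" if "f : bdm" "!!v. v : space M ==> norm (f v) <= B" "v : space M" for f :: "'x => 'b" and v B
proof -
 have "norm (Kop f v) <= C * (LINT v|M. norm (f v))" by (rule Kop_norm) (use that in auto)
 also have "(LINT v|M. norm (f v)) <= (LINT v|M. B)" using that by (intro integral_mono integrable_norm bdm_int) auto
 finally show ?thesis using C_pos by (simp add: prob_space)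
qed
show ?thesis using 1[OF bdm_Kop[OF assms(1)] 1[OF assms(1,3)] assms(2)] by (simp add: power2_eq_square mult.assoc)
qed

lemma K2_diff: fixes f h :: "'x => 'b::{banach, second_countable_topology}" assumes "f : bdm" "h : bdm" "u : space M" shows "K2 (%x. f x - h x) u = K2 f u - K2 h u"
proof -
have "K2 (%x. f x - h x) u = Kop (%x. Kop f x - Kop h x) u" unfolding Kop_def[of "Kop (%x. f x - h x)"] Kop_def[of "%x. Kop f x - Kop h x"]
 by (intro Lintegral_cong) (auto simp: Kop_diff assms)
thus ?thesis using assms by (simp add: Kop_diff bdm_Kop)
qed

lemma K2_scaleR: fixes f :: "'x => 'b::{banach, second_countable_topology}" shows "K2 (%x. c *\<^sub>R f x) u = c *\<^sub>R K2 f u"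
proof -
have "Kop (%x. c *\<^sub>R f x) = (%u. c *\<^sub>R Kop f u)" by (rule ext) (rule Kop_scaleR)
thus ?thesis by (simp add: Kop_scaleR)
qed

lemma Kop_of_real: "Kop (%x. cor (f x)) u = cor (Kop f u)" unfolding Kop_def by (simp add: scaleR_conv_of_real flip: of_real_mult)

lemma K2_pow_of_real: "(K2 ^^ n) (%x. cor (f x)) = (%u. cor ((K2 ^^ n) f u))"
by (induction n arbitrary: f) (simp_all add: Kop_of_real[abs_def] funpow_Suc_right del: funpow.simps(2))

lemma K2_pow_1: "(K2 ^^ n) (%_. 1) = g (2 * n)"
proof (induction n)
case 0
show ?case by (simp add: g_def)
next
case (Suc n)
thus ?case by (simp add: g_Suc)
qed

lemma Kop_cong: "(!!v. v : space M ==> f v = h v) ==> Kop f u = Kop h u" unfolding Kop_def by (intro Lintegral_cong) auto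

lemma K2_cong: "(!!v. v : space M ==> f v = h v) ==> K2 f u = K2 h u" using Kop_cong by (metis (no_types, lifting))

lemma K2_mono: fixes f h :: "'x => real" assumes "f : bdm" "h : bdm" "u : space M" "!!v. v : space M ==> f v <= h v" shows "K2 f u <= K2 h u"
using assms by (intro Kop_mono bdm_Kop) auto

lemma K2_pow_mono: fixes f h :: "'x => real" assumes "f : bdm" "h : bdm" "u : space M" "!!v. v : space M ==> f v <= h v" shows "(K2 ^^ n) f u <= (K2 ^^ n) h u"
using assms by (induction n arbitrary: u) (auto intro!: K2_mono K2_pow_bdm)

lemma K2_pow_scaleR: "(K2 ^^ n) (%x. c *\<^sub>R f x) u = c *\<^sub>R (K2 ^^ n) (f :: 'x => 'b::{banach, second_countable_topology}) u"
proof -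
have "(K2 ^^ n) (%x. c *\<^sub>R f x) = (%u. c *\<^sub>R (K2 ^^ n) f u)" by (induction n) (simp_all add: K2_scaleR)
thus ?thesis by simp
qed

lemma K2_eigen_pow: assumes "!!u. u : space M ==> K2 r u = La *\<^sub>R r u" "u : space M"
shows "(K2 ^^ n) r u = La ^ n *\<^sub>R (r u :: 'b::{banach, second_countable_topology})" using assms(2)
proof (induction n arbitrary: u)
case (Suc n)
have "K2 ((K2 ^^ n) r) u = K2 (%x. La ^ n *\<^sub>R r x) u" by (rule K2_cong) (rule Suc.IH)
also have "... = La ^ n *\<^sub>R La *\<^sub>R r u" by (simp add: K2_scaleR assms(1) Suc.prems)
finally show ?case by (simp add: mult.commute)
qed simp

lemma integral_bound: fixes f :: "'x => 'b::{banach, second_countable_topology}" assumes "!!x. x : space M ==> norm (f x) <= B" "0 <= B"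
shows "norm (LINT x|M. f x) <= B"
proof (cases "integrable M f")
case True
have "norm (LINT x|M. f x) <= (LINT x|M. norm (f x))" by (rule integral_norm_bound)
also have "... <= (LINT x|M. B)" using True assms by (intro integral_mono) auto
finally show ?thesis by (simp add: prob_space)
qed (simp add: not_integrable_integral_eq assms)

lemma s_pos: "0 < s n"
proof -
obtain c j0 where c: "0 < c" "!!n. c * s n <= sA j0 n" "!!n. c * s n <= s (Suc n)" by (rule growth) blast
have "0 < s n"
proof (induction n)
 case (Suc n)
 hence "0 < c * s n" using c by simp
 thus ?case using c(3)[of n] by linarith
qed simp
thus ?thesis .
qed

text \<open>The oscillation bound is integrated over its second argument, which turns the values of
  \<open>g\<close> and of the iterate there into \<open>s\<close> and a mean. Relative to the growth
  of \<open>s\<close>, every iterate is thus a multiple of \<open>g\<close> up to a geometrically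
  small error.\<close>

lemma approx_by_g:
obtains D th where "0 <= D" "1/2 <= th" "th < 1"
 "!!(f :: 'x => complex) B n u. f : bdm ==> (!!x. x : space M ==> norm (f x) <= B) ==> 0 <= B ==> u : space M ==>
   norm (s (2 * n) *\<^sub>R (K2 ^^ n) f u - g (2 * n) u *\<^sub>R (LINT x|M. (K2 ^^ n) f x)) <= D * th ^ n * B * (s (2 * n))^2"
proof -
obtain bt th0 where bt: "0 < bt" "0 <= th0" "th0 < 1"
 "!!f n b. f : bdm ==> 0 <= b ==> osc bt n b f ==> osc bt (Suc (Suc n)) (th0 * b) (Kop (Kop f))" by (rule contraction) blast
obtain c j0 where c: "0 < c" "!!n. c * s n <= sA j0 n" "!!n. c * s n <= s (Suc n)" by (rule growth) blast
define E where "E = max 1 (C / c)"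
have gE: "g n u <= E * s n" if u: "u : space M" for n u
proof (cases n)
 case (Suc m)
 have "g n u <= C * s m" using g_le[OF u] Suc by simp
 also have "... = (C / c) * (c * s m)" using c by simp
 also have "... <= (C / c) * s n" using c(1) c(3)[of m] C_pos Suc by (intro mlm) auto
 also have "... <= E * s n" using s_nonneg by (intro mrm) (auto simp: E_def)
 finally show ?thesis .
qed (auto simp: E_def)
define th where "th = max (1/2) th0"
have E: "1 <= E" by (simp add: E_def)
have main: "norm (s (2 * n) *\<^sub>R (K2 ^^ n) f u - g (2 * n) u *\<^sub>R (LINT x|M. (K2 ^^ n) f x))
   <= (2 * E^2 + bt * (2 * E)) * th ^ n * B * (s (2 * n))^2"
 if f: "f : bdm" "!!x. x : space M ==> norm (f x) <= B" "0 <= B" and u: "u : space M" for f :: "'x => complex" and B n u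
proof -
 have o: "osc bt (2 * n) (th0 ^ n * B) ((K2 ^^ n) f)" for n
 proof (induction n)
  case 0
  have "norm (f x - f y) <= B * (2 + bt * 2)" if "x : space M" "y : space M" for x y
  proof -
   have "norm (f x - f y) <= B * 2" using norm_triangle_ineq4[of "f x" "f y"] f(2)[OF that(1)] f(2)[OF that(2)] by simp
   also have "... <= B * (2 + bt * 2)" using bt f by (intro mlm) auto
   finally show ?thesis .
  qed
  thus ?case by (simp add: osc_def)
 next
  case (Suc n)
  show ?case using bt(4)[OF K2_pow_bdm[OF f(1)] _ Suc.IH] f bt by (simp add: mult.assoc)
 qed
 let ?x = "(K2 ^^ n) f" and ?g = "g (2 * n)" and ?s = "s (2 * n)"
 have x: "?x : bdm" by (rule K2_pow_bdm[OF f(1)])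
 have "?s *\<^sub>R ?x u - ?g u *\<^sub>R (LINT x|M. ?x x) = (LINT v|M. ?g v *\<^sub>R ?x u - ?g u *\<^sub>R ?x v)"
  using x by (subst Lintegral_diff) (auto intro!: bdm_int simp: s_def integral_scaleR_left bdm_int)
 also have "norm ... <= (2 * E^2 + bt * (2 * E)) * th ^ n * B * ?s^2"
 proof (rule integral_bound)
  fix v assume v: "v : space M"
  have "norm (?g v *\<^sub>R ?x u - ?g u *\<^sub>R ?x v) <= th0 ^ n * B * (2 * ?g u * ?g v + bt * ?s * (?g u + ?g v))" using o[of n] u v unfolding osc_def by blast
  also have "... <= th0 ^ n * B * (2 * (E * ?s) * (E * ?s) + bt * ?s * (E * ?s + E * ?s))"
   using gE[OF u, of "2*n"] gE[OF v, of "2*n"] g_nonneg[OF u, of "2*n"] g_nonneg[OF v, of "2*n"] bt f s_nonneg[of "2*n"] E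
   by (intro mlm add_mono mult_mono mult_nonneg_nonneg zero_le_power) auto
  also have "... = (2 * E^2 + bt * (2 * E)) * (B * ?s^2) * th0 ^ n" by (simp add: power2_eq_square alg)
  also have "... <= (2 * E^2 + bt * (2 * E)) * (B * ?s^2) * th ^ n" using bt f E by (intro mlm power_mono mult_nonneg_nonneg add_nonneg_nonneg) (auto simp: th_def)
  finally show "norm (?g v *\<^sub>R ?x u - ?g u *\<^sub>R ?x v) <= (2 * E^2 + bt * (2 * E)) * th ^ n * B * ?s^2" by (simp add: mult_ac)
 qed (use bt f E in \<open>auto simp: th_def intro!: mult_nonneg_nonneg add_nonneg_nonneg zero_le_power\<close>)
 finally show ?thesis .
qed
show ?thesis by (rule that[of "2 * E^2 + bt * (2 * E)" th]) (use bt E main in \<open>auto simp: th_def\<close>)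
qed

end

context positive_kernel
begin

lemma K2_pow_norm_le: fixes f :: "'x => complex" assumes f: "f : bdm" "!!x. x : space M ==> norm (f x) <= B" and u: "u : space M"
shows "norm ((K2 ^^ n) f u) <= B * g (2 * n) u"
proof -
have 1: "norm (Kop f u) <= Kop h u" if "f : bdm" "h : bdm" "!!x. x : space M ==> norm (f x) <= h x" "u : space M"
 for f :: "'x => complex" and h u
proof -
 have "norm (Kop f u) <= (LINT v|M. norm (k u v *\<^sub>R f v))" unfolding Kop_def by (rule integral_norm_bound)
 also have "... <= Kop h u" unfolding Kop_def using that by (intro integral_mono integrable_norm bdm_int bdm_scaleR bdm_k) (auto intro!: mult_mono simp: k_nonneg)
 finally show ?thesis .
qed
have "norm ((K2 ^^ n) f u) <= (K2 ^^ n) (%x. B *\<^sub>R 1) u" using u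
proof (induction n arbitrary: u)
 case (Suc n)
 thus ?case using f by (auto intro!: 1 bdm_Kop K2_pow_bdm)
qed (use f in auto)
also have "(K2 ^^ n) (%x. B *\<^sub>R 1) u = B *\<^sub>R g (2 * n) u" by (simp only: K2_pow_scaleR K2_pow_1)
finally show ?thesis by simp
qed

lemma K2_pow_diff: fixes f h :: "'x => 'b::{banach, second_countable_topology}" assumes "f : bdm" "h : bdm" "u : space M"
shows "(K2 ^^ n) (%x. f x - h x) u = (K2 ^^ n) f u - (K2 ^^ n) h u" using assms(3)
proof (induction n arbitrary: u)
case (Suc n)
have "(K2 ^^ Suc n) (%x. f x - h x) u = K2 (%v. (K2 ^^ n) f v - (K2 ^^ n) h v) u" using Suc.IH by (auto intro: K2_cong)
thus ?case using assms(1,2) Suc.prems by (simp add: K2_diff K2_pow_bdm)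
qed simp

text \<open>Convergent ratios alone do not give growth at most like \<open>La ^ n\<close>, but they
  give every larger rate.\<close>

lemma ratio_bound: fixes S :: "nat => real" assumes S: "!!n. 0 < S n" and lim: "(%n. S (Suc n) / S n) ----> La" and "La < rh" "0 < rh"
obtains E where "0 < E" "!!n. S n <= E * rh ^ n"
proof -
obtain J where J: "!!n. J <= n ==> S (Suc n) / S n < rh" using order_tendstoD(2)[OF lim assms(3)] by (auto simp: eventually_sequentially)
define E where "E = (SUM i<=J. S i / rh ^ i)"
have small: "S n <= E * rh ^ n" if "n <= J" for n
proof -
 have "S n / rh ^ n <= E" unfolding E_def using that S assms(4) by (intro member_le_sum) (auto intro!: divide_nonneg_nonneg less_imp_le[OF S])
 thus ?thesis using assms(4) by (simp add: divide_le_eq)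
qed
have big: "S (J + n) <= E * rh ^ (J + n)" for n
proof (induction n)
 case (Suc n)
 have "S (J + Suc n) <= rh * S (J + n)" using J[of "J + n"] S[of "J + n"] by (simp add: divide_less_eq)
 also have "... <= rh * (E * rh ^ (J + n))" using Suc assms(4) by (intro mlm) auto
 finally show ?case by (simp add: mult_ac)
qed (use small in auto)
have "S n <= E * rh ^ n" for n using small[of n] big[of "n - J"] by (cases "n <= J") auto
moreover have "0 < E" unfolding E_def using S assms(4) by (intro sum_pos) auto
ultimately show ?thesis using that by blast
qed

text \<open>The normalized iterates of 1 converge to the eigenfunction, and the integrals of an
  arbitrary iterate, divided by \<open>La ^ n\<close>, to its coefficient. The last clause prepares
  the lower bound on the partition function: the mass that starts on a suitable \<open>A j\<close>
  is of the full order \<open>La ^ n\<close>.\<close>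

theorem spectral_gap:
obtains La r D th where "0 < La" "0 <= D" "0 <= th" "th < 1" "r : bdm" "!!u. u : space M ==> 0 <= r u"
 "(LINT u|M. r u) = (1 :: real)" "!!u. u : space M ==> K2 r u = La * r u"
 "!!(f :: 'x => complex) B. f : bdm ==> (!!x. x : space M ==> norm (f x) <= B) ==> 0 <= B ==>
   EX c. ALL n. ALL u:space M. norm ((K2 ^^ n) f u - of_real (La ^ n) * c * of_real (r u)) <= D * th ^ n * La ^ n * B"
 "EX j p. 0 < p & 0 < (LINT u|M. indicator (A j) u * r u) & (ALL n. p * La ^ n <= (LINT u|M. (K2 ^^ n) (indicator (A j)) u))"
proof -
obtain D0 th where D0: "0 <= D0" and th: "1/2 <= th" "th < 1" and approx:
 "!!(f :: 'x => complex) B n u. f : bdm ==> (!!x. x : space M ==> norm (f x) <= B) ==> 0 <= B ==> u : space M ==>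
   norm (s (2 * n) *\<^sub>R (K2 ^^ n) f u - g (2 * n) u *\<^sub>R (LINT x|M. (K2 ^^ n) f x)) <= D0 * th ^ n * B * (s (2 * n))^2" by (rule approx_by_g) blast
obtain c j0 where c: "0 < c" "!!n. c * s n <= sA j0 n" "!!n. c * s n <= s (Suc n)" by (rule growth) blast
define S where "S n = s (2 * n)" for n
have S: "0 < S n" for n unfolding S_def by (rule s_pos)
have Sc: "c^2 * S n <= S (Suc n)" for n using c(3)[of "2 * n"] c(3)[of "Suc (2 * n)"] mlm[OF c(3)[of "2*n"] less_imp_le[OF c(1)]]
 by (simp add: S_def power2_eq_square)
define h where "h n u = g (2 * n) u / S n" for n u
have hb: "h n : bdm" for n unfolding h_def using bdm_scaleR[OF bdm_const[of "1 / S n"] g_bdm[of "2 * n"]] by simp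
have h_int: "(LINT u|M. h n u) = 1" for n using S[of n] unfolding h_def by (simp add: s_def S_def)
have g2: "g (2 * Suc n) u = K2 (g (2 * n)) u" for n u by (simp add: g_Suc)
define D1 where "D1 = D0 * C^2 / c^2"
have D1: "0 <= D1" using D0 by (simp add: D1_def)
\<comment> \<open>With \<open>f = g 2\<close> the approximation compares the consecutive iterates
  \<open>g (2 * Suc n)\<close> and \<open>g (2 * n)\<close>.\<close>
have hdiff: "norm (h (Suc n) u - h n u) <= D1 * th ^ n" if u: "u : space M" for n u
proof -
 let ?f = "%u. cor (g 2 u)"
 have fb: "?f : bdm"
 proof -
  have [measurable]: "g 2 : bmeas M" using g_bdm[of 2] unfolding bdm_def by auto
  show ?thesis using g_bdm[of 2] unfolding bdm_def by auto
 qed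
 have fe: "(K2 ^^ n) ?f = (%u. cor (g (2 * Suc n) u))"
 proof -
  have "(K2 ^^ n) (g 2) = (K2 ^^ Suc n) (%_. 1)" using K2_pow_1[of 1] by (simp add: funpow_Suc_right del: funpow.simps(2))
  thus ?thesis unfolding K2_pow_of_real by (simp only: K2_pow_1)
 qed
 have g1: "norm (?f x) <= C^2" if "x : space M" for x
 proof -
  have "g 2 x <= C * s 1" using g_le[OF that, of 1] by (simp add: numeral_2_eq_2)
  also have "... <= C * (C * 1)" using s_le[of 0] C_pos by (intro mlm) auto
  finally show ?thesis using g_nonneg[OF that, of 2] by (simp add: power2_eq_square)
 qed
 have "norm (S n *\<^sub>R cor (g (2 * Suc n) u) - g (2 * n) u *\<^sub>R (LINT x|M. cor (g (2 * Suc n) x)))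
   <= D0 * th ^ n * C^2 * (S n)^2" using approx[OF fb g1 _ u, of n] unfolding fe S_def by simp
 also have "(LINT x|M. cor (g (2 * Suc n) x)) = of_real (S (Suc n))" by (simp add: S_def s_def)
 also have "S n *\<^sub>R cor (g (2 * Suc n) u) - g (2 * n) u *\<^sub>R of_real (S (Suc n))
   = of_real (S n * S (Suc n) * (h (Suc n) u - h n u))" using S[of n] S[of "Suc n"] by (simp add: h_def scaleR_conv_of_real right_diff_distrib)
 finally have "S n * S (Suc n) * abs (h (Suc n) u - h n u) <= D0 * th ^ n * C^2 * (S n)^2"
  using S[of n] S[of "Suc n"] by (simp add: norm_mult abs_mult del: of_real_mult of_real_diff)
 hence "S (Suc n) * abs (h (Suc n) u - h n u) <= D0 * th ^ n * C^2 * S n" using S[of n] by (simp add: power2_eq_square mult.assoc mult.left_commute[of _ "S n"])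
 moreover have "c^2 * S n * abs (h (Suc n) u - h n u) <= S (Suc n) * abs (h (Suc n) u - h n u)" using Sc[of n] by (intro mrm) auto
 ultimately have "S n * (c^2 * abs (h (Suc n) u - h n u)) <= S n * (D0 * th ^ n * C^2)" by (simp add: mult_ac)
 hence "c^2 * abs (h (Suc n) u - h n u) <= D0 * th ^ n * C^2" using S[of n] by simp
 thus ?thesis using c(1) by (simp add: D1_def field_simps)
qed
define r where "r u = lim (%n. h n u)" for u
define D2 where "D2 = D1 / (1 - th)"
have D2: "0 <= D2" using D1 th by (simp add: D2_def)
have r: "(%n. h n u) ----> r u" "norm (h n u - r u) <= D2 * th ^ n" if u: "u : space M" for u n
proof -
 obtain l where l: "(%n. h n u) ----> l" "!!n. norm (h n u - l) <= D1 / (1 - th) * th ^ n"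
  by (rule geometric_Cauchy[of th D1 "%n. h n u"]) (use th D1 hdiff[OF u] in auto)
 have "r u = l" unfolding r_def using l(1) by (rule limI)
 thus "(%n. h n u) ----> r u" "norm (h n u - r u) <= D2 * th ^ n" using l by (auto simp: D2_def)
qed
have r0: "0 <= r u" if "u : space M" for u by (rule LIMSEQ_le_const[OF r(1)[OF that]]) (use g_nonneg[OF that] less_imp_le[OF S] in \<open>auto simp: h_def\<close>)
have r1: "r u <= 1 + D2" if "u : space M" for u using r(2)[OF that, of 0] by (simp add: h_def S_def)
have rb: "r : bdm"
proof (rule bdmI)
 have "!!n. h n : bmeas M" using hb by (auto simp: bdm_def)
 thus "r : bmeas M" unfolding r_def by (rule borel_measurable_lim_metric)
qed (use r0 r1 in auto)
have geo: "(%n. a * th ^ n) ----> 0" for a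
proof -
 have "(%n. a * th ^ n) ----> a * 0" using th by (intro tendsto_intros LIMSEQ_realpow_zero) auto
 thus ?thesis by simp
qed
have r_int: "(LINT u|M. r u) = 1"
proof -
 have "norm (1 - (LINT u|M. r u)) <= D2 * th ^ n" for n
 proof -
  have "1 - (LINT u|M. r u) = (LINT u|M. h n u - r u)" using hb rb by (subst Lintegral_diff) (auto intro!: bdm_int simp: h_int)
  also have "norm ... <= D2 * th ^ n" by (rule integral_bound) (use r(2) D2 th in auto)
  finally show ?thesis .
 qed
 hence "norm (1 - (LINT u|M. r u)) <= 0" by (intro LIMSEQ_le_const[OF geo[of D2]]) auto
 thus ?thesis by simp
qed
define rh where "rh n = S (Suc n) / S n" for n
define La where "La = (LINT u|M. K2 r u)"
have K2h: "K2 (h n) u = rh n * h (Suc n) u" for n u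
proof -
 have "K2 (h n) u = (1 / S n) * K2 (g (2 * n)) u" using K2_scaleR[of "1 / S n" "g (2 * n)" u] by (simp add: h_def[abs_def])
 thus ?thesis using S[of "Suc n"] S[of n] by (simp add: g_Suc rh_def h_def)
qed
have K2hr: "norm (K2 (h n) u - K2 r u) <= C^2 * (D2 * th ^ n)" if u: "u : space M" for n u
 unfolding K2_diff[OF hb rb u, symmetric] by (rule K2_norm[OF bdm_minus[OF hb rb] u]) (rule r(2))
have rhLa: "norm (rh n - La) <= C^2 * D2 * th ^ n" for n
proof -
 have "rh n = (LINT u|M. K2 (h n) u)" by (simp add: K2h h_int)
 hence "rh n - La = (LINT u|M. K2 (h n) u - K2 r u)" unfolding La_def using hb rb by (simp add: Lintegral_diff bdm_int bdm_Kop)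
 also have "norm ... <= C^2 * (D2 * th ^ n)" by (rule integral_bound) (use K2hr D2 th in auto)
 finally show ?thesis by simp
qed
have rhlim: "rh ----> La" by (rule LIM_zero_cancel, rule Lim_null_comparison[OF _ geo[of "C^2 * D2"]]) (use rhLa in auto)
have rhc: "c^2 <= rh n" for n using Sc[of n] S[of n] by (simp add: rh_def le_divide_eq)
have Lac: "c^2 <= La" by (rule LIMSEQ_le_const[OF rhlim]) (use rhc in auto)
have La: "0 < La" using Lac c(1) zero_less_power[OF c(1), of 2] by linarith
have K2r: "K2 r u = La * r u" if u: "u : space M" for u
proof (rule LIMSEQ_unique)
 show "(%n. K2 (h n) u) ----> K2 r u"
  by (rule LIM_zero_cancel, rule Lim_null_comparison[OF _ geo[of "C^2 * D2"]]) (use K2hr[OF u] in \<open>auto simp: mult.assoc\<close>)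
 show "(%n. K2 (h n) u) ----> La * r u" unfolding K2h by (intro tendsto_intros rhlim LIMSEQ_Suc r(1) u)
qed
\<comment> \<open>Half of the decay pays for \<open>S n\<close> being controlled only by
  \<open>(La / th') ^ n\<close> instead of \<open>La ^ n\<close>: with \<open>th' ^ 2 = th\<close>
  the other half remains.\<close>
define th' where "th' = sqrt th"
have th': "0 < th'" "th' < 1" "th'^2 = th" using th by (auto simp: th'_def)
have "La < La / th'" using La th' by (simp add: less_divide_eq)
then obtain E where E: "0 < E" "!!n. S n <= E * (La / th') ^ n" using ratio_bound[OF S rhlim[unfolded rh_def]] La th' by (metis zero_less_divide_iff)
have SE: "th ^ n * S n <= E * (th' ^ n * La ^ n)" for n
proof -
 have "th ^ n * S n <= th ^ n * (E * (La / th') ^ n)" using E th by (intro mlm) auto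
 also have "... = E * ((th * (La / th')) ^ n)" by (simp only: power_mult_distrib mult_ac)
 also have "th * (La / th') = th' * La" using th'(1) unfolding th'(3)[symmetric] by (simp add: power2_eq_square)
 finally show ?thesis by (simp add: power_mult_distrib)
qed
define D3 where "D3 = C^2 * D2 * (1 + 2 * D2) + La * D1 + (C^2 + La) * D0"
have D3: "0 <= D3" using D0 D1 D2 La by (simp add: D3_def)
define D5 where "D5 = D3 * E / La / (1 - th')"
have D5: "0 <= D5" using D3 E La th' by (simp add: D5_def)
define DD where "DD = D0 * E + D2 * E + D5 * (1 + D2)"
have DD: "0 <= DD" using D0 D2 D5 E by (simp add: DD_def)
have main: "EX a. ALL n. ALL u:space M. norm ((K2 ^^ n) f u - of_real (La ^ n) * a * of_real (r u)) <= DD * th' ^ n * La ^ n * B"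
 if f: "f : bdm" "!!x. x : space M ==> norm (f x) <= B" "0 <= B" for f :: "'x => complex" and B
proof -
 define x where "x n = (K2 ^^ n) f" for n
 define I where "I n = (LINT u|M. x n u)" for n
 define e where "e n u = x n u - h n u *\<^sub>R I n" for n u
 have xb: "x n : bdm" for n unfolding x_def by (rule K2_pow_bdm[OF f(1)])
 have hIb: "(%u. h n u *\<^sub>R I n) : bdm" for n by (intro bdm_scaleR hb bdm_const)
 have eb: "e n : bdm" for n unfolding e_def by (intro bdm_minus xb hIb)
 have en: "norm (e n u) <= D0 * th ^ n * B * S n" if u: "u : space M" for n u
 proof -
  have "S n *\<^sub>R e n u = S n *\<^sub>R x n u - g (2 * n) u *\<^sub>R I n" using S[of n] by (simp add: e_def h_def scaleR_diff_right)
  hence "norm (S n *\<^sub>R e n u) <= D0 * th ^ n * B * (S n)^2" using approx[OF f u, of n] by (simp add: x_def I_def S_def)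
  hence "S n * norm (e n u) <= S n * (D0 * th ^ n * B * S n)" using S[of n] by (simp add: power2_eq_square mult_ac)
  thus ?thesis using S[of n] by simp
 qed
 have In: "norm (I n) <= B * S n" for n
 proof -
  have "norm (I n) <= (LINT u|M. norm (x n u))" unfolding I_def by (rule integral_norm_bound)
  also have "... <= (LINT u|M. B * g (2 * n) u)" using xb by (intro integral_mono integrable_norm bdm_int bdm_mult bdm_const g_bdm)
    (auto simp: x_def intro!: K2_pow_norm_le f)
  finally show ?thesis by (simp add: S_def s_def)
 qed
 \<comment> \<open>The part along \<open>h n\<close> satisfies the eigenvalue equation up to an
   error of order \<open>th ^ n\<close>; the part \<open>e n\<close> is small by itself.\<close>
 have step: "norm (x (Suc n) u - La *\<^sub>R x n u) <= D3 * E * B * (th' ^ n * La ^ n)" if u: "u : space M" for n u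
 proof -
  have xe: "x n v = h n v *\<^sub>R I n + e n v" for v by (simp add: e_def)
  have "x (Suc n) u = K2 (x n) u" by (simp add: x_def)
  also have "... = K2 (%v. h n v *\<^sub>R I n) u + K2 (e n) u"
   using K2_diff[OF xb[of n] hIb[of n] u] unfolding e_def[symmetric, abs_def] by (simp add: e_def[abs_def] alg)
  also have "K2 (%v. h n v *\<^sub>R I n) u = K2 (h n) u *\<^sub>R I n"
  proof -
   have *: "Kop (%v. p v *\<^sub>R z) w = Kop p w *\<^sub>R z" if "p : bdm" "w : space M" for p w and z :: complex
   proof -
    have "Kop (%v. p v *\<^sub>R z) w = (LINT v|M. (k w v * p v) *\<^sub>R z)" by (simp add: Kop_def)
    also have "... = (LINT v|M. k w v * p v) *\<^sub>R z" using that by (intro integral_scaleR_left) (auto intro!: bdm_int bdm_mult)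
    finally show ?thesis by (simp add: Kop_def)
   qed
   have "K2 (%v. h n v *\<^sub>R I n) u = Kop (%v. Kop (h n) v *\<^sub>R I n) u" by (rule Kop_cong) (rule *[OF hb])
   thus ?thesis using u hb by (simp add: * bdm_Kop)
  qed
  finally have "x (Suc n) u - La *\<^sub>R x n u = ((rh n - La) * h (Suc n) u + La * (h (Suc n) u - h n u)) *\<^sub>R I n + (K2 (e n) u - La *\<^sub>R e n u)"
   unfolding xe K2h by (simp add: alg)
  also have "norm ... <= (C^2 * D2 * th ^ n * (1 + 2 * D2) + La * (D1 * th ^ n)) * (B * S n)
     + (C^2 * (D0 * th ^ n * B * S n) + La * (D0 * th ^ n * B * S n))"
  proof (intro norm_triangle_le add_mono)
   have "norm (r u) <= 1 + D2" using r0[OF u] r1[OF u] by simp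
   moreover have "norm (h (Suc n) u - r u) <= D2" using r(2)[OF u, of "Suc n"] mlm[OF power_le_one[of th "Suc n"] D2] th by simp
   ultimately have hh: "norm (h (Suc n) u) <= 1 + 2 * D2" by simp
   have "norm ((rh n - La) * h (Suc n) u + La * (h (Suc n) u - h n u)) <=
     C^2 * D2 * th ^ n * (1 + 2 * D2) + La * (D1 * th ^ n)" using rhLa[of n] hh hdiff[OF u, of n] La D2 th unfolding norm_mult
    by (intro norm_triangle_le add_mono) (auto simp: norm_mult abs_mult intro!: mult_mono)
   thus "norm (((rh n - La) * h (Suc n) u + La * (h (Suc n) u - h n u)) *\<^sub>R I n) <=
     (C^2 * D2 * th ^ n * (1 + 2 * D2) + La * (D1 * th ^ n)) * (B * S n)"
    using In[of n] f D1 D2 th La unfolding norm_scaleR by (intro mult_mono) (auto intro!: add_nonneg_nonneg)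
   have "norm (K2 (e n) u) <= C^2 * (D0 * th ^ n * B * S n)" by (rule K2_norm[OF eb u en])
   moreover have "norm (La *\<^sub>R e n u) <= La * (D0 * th ^ n * B * S n)" using en[OF u, of n] La by simp
   ultimately show "norm (K2 (e n) u - La *\<^sub>R e n u) <= C^2 * (D0 * th ^ n * B * S n) + La * (D0 * th ^ n * B * S n)"
    using norm_triangle_ineq4[of "K2 (e n) u" "La *\<^sub>R e n u"] by linarith
  qed
  also have "... = D3 * B * (th ^ n * S n)" by (simp add: D3_def alg)
  also have "... <= D3 * B * (E * (th' ^ n * La ^ n))" using SE[of n] D3 f by (intro mlm) auto
  finally show ?thesis by (simp add: mult_ac)
 qed
 have Jdiff: "norm (I (Suc n) /\<^sub>R La ^ Suc n - I n /\<^sub>R La ^ n) <= (D3 * E * B / La) * th' ^ n" for n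
 proof -
  have "I (Suc n) - La *\<^sub>R I n = (LINT u|M. x (Suc n) u - La *\<^sub>R x n u)"
   unfolding I_def using xb by (subst Lintegral_diff) (auto intro!: bdm_int bdm_scaleR)
  also have "norm ... <= D3 * E * B * (th' ^ n * La ^ n)" by (rule integral_bound[OF step]) (use D3 E f th' La in auto)
  finally have 1: "norm (I (Suc n) - La *\<^sub>R I n) <= D3 * E * B * (th' ^ n * La ^ n)" .
  have "I (Suc n) /\<^sub>R La ^ Suc n - I n /\<^sub>R La ^ n = (I (Suc n) - La *\<^sub>R I n) /\<^sub>R La ^ Suc n" using La by (simp add: scaleR_diff_right)
  hence "norm (I (Suc n) /\<^sub>R La ^ Suc n - I n /\<^sub>R La ^ n) = norm (I (Suc n) - La *\<^sub>R I n) / La ^ Suc n" using La by (simp add: divide_inverse)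
  also have "... <= D3 * E * B * (th' ^ n * La ^ n) / La ^ Suc n" using 1 La by (intro divide_right_mono) auto
  finally show ?thesis using La by simp
 qed
 have "0 <= D3 * E * B / La" using D3 E f La by simp
 then obtain a where a: "!!n. norm (I n /\<^sub>R La ^ n - a) <= D3 * E * B / La / (1 - th') * th' ^ n"
  using geometric_Cauchy[OF less_imp_le[OF th'(1)] th'(2) _ Jdiff] by metis
 have "norm (x n u - of_real (La ^ n) * a * of_real (r u)) <= DD * th' ^ n * La ^ n * B" if u: "u : space M" for n u
 proof -
  \<comment> \<open>Three errors: from the iterate to a multiple of \<open>h n\<close>, from
    \<open>h n\<close> to \<open>r\<close>, and from the normalized integral to its limit.\<close>
  have "x n u - of_real (La ^ n) * a * of_real (r u) = e n u + (h n u - r u) *\<^sub>R I n + (La ^ n * r u) *\<^sub>R (I n /\<^sub>R La ^ n - a)"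
  proof -
   have z: "La ^ n *\<^sub>R (I n /\<^sub>R La ^ n) = I n" using La by simp
   have "(La ^ n * r u) *\<^sub>R (I n /\<^sub>R La ^ n - a) = r u *\<^sub>R (La ^ n *\<^sub>R (I n /\<^sub>R La ^ n)) - of_real (La ^ n) * a * of_real (r u)"
    by (simp add: scaleR_conv_of_real alg)
   thus ?thesis unfolding z by (simp add: e_def scaleR_diff_left)
  qed
  also have "norm ... <= D0 * th ^ n * B * S n + (D2 * th ^ n) * (B * S n) + (La ^ n * (1 + D2)) * (D5 * B * th' ^ n)"
  proof (intro norm_triangle_le add_mono)
   show "norm (e n u) <= D0 * th ^ n * B * S n" by (rule en[OF u])
   show "norm ((h n u - r u) *\<^sub>R I n) <= (D2 * th ^ n) * (B * S n)"
    using r(2)[OF u, of n] In[of n] f S[of n] D2 th unfolding norm_scaleR by (intro mult_mono) auto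
   show "norm ((La ^ n * r u) *\<^sub>R (I n /\<^sub>R La ^ n - a)) <= (La ^ n * (1 + D2)) * (D5 * B * th' ^ n)"
    using a[of n] r0[OF u] r1[OF u] La D2 unfolding norm_scaleR by (intro mult_mono) (auto simp: D5_def mult_ac abs_mult)
  qed
  also have "... = (D0 + D2) * B * (th ^ n * S n) + (1 + D2) * D5 * B * (th' ^ n * La ^ n)" by (simp add: alg)
  also have "... <= (D0 + D2) * B * (E * (th' ^ n * La ^ n)) + (1 + D2) * D5 * B * (th' ^ n * La ^ n)" using SE[of n] D0 D2 f by (intro add_right_mono mlm) auto
  finally show ?thesis by (simp add: DD_def alg)
 qed
 thus ?thesis by (auto simp: x_def intro!: exI[of _ a])
qed
have trace: "EX j p. 0 < p & 0 < (LINT u|M. indicator (A j) u * r u) & (ALL n. p * La ^ n <= (LINT u|M. (K2 ^^ n) (indicator (A j)) u))"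
proof -
 \<comment> \<open>The complement of \<open>A j\<close> is so small that \<open>K2\<close> maps its
   indicator below \<open>c^2 / 2\<close>; at least half of \<open>S n\<close> then comes from
   \<open>A j\<close>.\<close>
 define q where "q = min (1/2) (c^2 / (2 * C^2))"
 have q: "0 < q" "q <= 1/2" "C^2 * q <= c^2 / 2" using c(1) C_pos by (auto simp: q_def min_def field_simps)
 obtain j where j: "j0 <= j" "1 - prob (A j) <= q" using large_A[OF q(1), of j0] by auto
 let ?a = "indicator (A j) :: 'x => real" and ?b = "indicator (space M - A j) :: 'x => real"
 have ab: "?a : bdm" "?b : bdm" by auto
 have half: "S n / 2 <= (LINT u|M. (K2 ^^ n) ?a u)" for n
 proof -
  have "(K2 ^^ n) ?a u = g (2 * n) u - (K2 ^^ n) ?b u" if u: "u : space M" for u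
  proof -
   have "(K2 ^^ n) ?a u = (K2 ^^ n) (%x. 1 - ?b x) u"
   proof (rule antisym)
    show "(K2 ^^ n) ?a u <= (K2 ^^ n) (%x. 1 - ?b x) u" by (intro K2_pow_mono bdm_minus bdm_const ab u) (auto simp: indicator_def)
    show "(K2 ^^ n) (%x. 1 - ?b x) u <= (K2 ^^ n) ?a u" by (intro K2_pow_mono bdm_minus bdm_const ab u) (auto simp: indicator_def)
   qed
   thus ?thesis by (simp only: K2_pow_diff[OF bdm_const ab(2) u] K2_pow_1)
  qed
  hence "(LINT u|M. (K2 ^^ n) ?a u) = (LINT u|M. g (2 * n) u - (K2 ^^ n) ?b u)" by (intro Lintegral_cong) auto
  also have "... = S n - (LINT u|M. (K2 ^^ n) ?b u)" using ab by (subst Lintegral_diff) (auto simp: S_def s_def intro!: bdm_int K2_pow_bdm)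
  finally have 1: "(LINT u|M. (K2 ^^ n) ?a u) = S n - (LINT u|M. (K2 ^^ n) ?b u)" .
  have "(LINT u|M. (K2 ^^ n) ?b u) <= S n / 2"
  proof (cases n)
   case 0
   thus ?thesis using j(2) q(2) by (simp add: S_def prob_compl_A)
  next
   case (Suc m)
   have K2b: "K2 ?b u <= (C^2 * q) *\<^sub>R 1" if u: "u : space M" for u
   proof -
    have 1: "Kop ?b v <= C * q" if "v : space M" for v
    proof -
     have "norm (Kop ?b v) <= C * (LINT v|M. norm (?b v))" by (rule Kop_norm[OF ab(2) that])
     also have "... <= C * q" using j(2) C_pos by (intro mlm) (auto simp: prob_compl_A)
     finally show ?thesis by simp
    qed
    have "norm (K2 ?b u) <= C * (LINT v|M. norm (Kop ?b v))" by (rule Kop_norm[OF bdm_Kop[OF ab(2)] u])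
    also have "... <= C * (LINT v|M. C * q)" using 1 C_pos ab by (intro mlm integral_mono integrable_norm bdm_int bdm_Kop) (auto simp: Kop_nonneg)
    finally show ?thesis by (simp add: power2_eq_square prob_space)
   qed
   have "(LINT u|M. (K2 ^^ n) ?b u) = (LINT u|M. (K2 ^^ m) (K2 ?b) u)" by (simp add: Suc funpow_Suc_right del: funpow.simps(2))
   also have "... <= (LINT u|M. (K2 ^^ m) (%_. (C^2 * q) *\<^sub>R 1) u)"
    using ab K2b by (intro integral_mono bdm_int K2_pow_bdm K2_pow_mono bdm_Kop bdm_const) auto
   also have "... = C^2 * q * S m" by (simp only: K2_pow_scaleR K2_pow_1) (simp add: S_def s_def)
   also have "... <= c^2 / 2 * S m" using q S[of m] by (intro mrm) auto
   also have "... <= S n / 2" using Sc[of m] Suc by simp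
   finally show ?thesis .
  qed
  with 1 show ?thesis by linarith
 qed
 have low: "La ^ n <= (1 + D2) * S n" for n
 proof -
  have "La ^ n = (LINT u|M. La ^ n * r u)" by (simp add: r_int)
  also have "... = (LINT u|M. (K2 ^^ n) r u)" using K2_eigen_pow[of r La] K2r by (intro Lintegral_cong) auto
  also have "... <= (LINT u|M. (K2 ^^ n) (%_. (1 + D2) *\<^sub>R 1) u)" using r1 rb by (intro integral_mono bdm_int K2_pow_bdm K2_pow_mono bdm_const) auto
  also have "... = (1 + D2) * S n" by (simp only: K2_pow_scaleR K2_pow_1) (simp add: S_def s_def)
  finally show ?thesis .
 qed
 define p where "p = (1 / 2) / (1 + D2)"
 have p: "0 < p" "p * (1 + D2) = 1 / 2" using D2 by (auto simp: p_def)
 have "p * La ^ n <= (LINT u|M. (K2 ^^ n) ?a u)" for n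
 proof -
  have "p * La ^ n <= p * ((1 + D2) * S n)" using low[of n] p(1) by (intro mlm) auto
  also have "... = S n / 2" by (simp only: mult.assoc[symmetric] p(2))
  finally show ?thesis using half[of n] by linarith
 qed
 moreover have "c <= (LINT u|M. ?a u * r u)"
 proof -
  have "c <= (LINT u|M. ?a u * r u) + D2 * th ^ n" for n
  proof -
   have "c <= sA j (2 * n) / S n" using c(2)[of "2*n"] sA_mono[OF j(1), of "2*n"] S[of n] by (simp add: le_divide_eq S_def)
   also have "... = (LINT u|M. ?a u * h n u)" by (simp add: sA_def h_def)
   also have "... <= (LINT u|M. ?a u * r u + D2 * th ^ n)"
   proof (intro integral_mono bdm_int bdm_add bdm_mult ab hb rb bdm_const)
    fix u assume u: "u : space M"
    show "?a u * h n u <= ?a u * r u + D2 * th ^ n" using r(2)[OF u, of n] D2 th by (auto simp: indicator_def)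
   qed
   also have "... = (LINT u|M. ?a u * r u) + D2 * th ^ n" using ab rb by (subst Lintegral_add) (auto intro!: bdm_int bdm_mult simp: prob_space)
   finally show ?thesis .
  qed
  hence "c - (LINT u|M. ?a u * r u) <= 0" by (intro LIMSEQ_le_const[OF geo[of D2]]) (auto simp: alg)
  thus ?thesis by simp
 qed
 ultimately show ?thesis using p(1) c(1) by (intro exI[of _ j] exI[of _ p]) auto
qed
show ?thesis by (rule that[of La DD th' r]) (use La DD th' rb r0 r_int K2r main trace in auto)
qed

end

section \<open>Perturbation of a simple eigenvalue in a complex Banach space\<close>

text \<open>Complex scalars act through a bilinear map on a real Banach space; complex linearity of
  an operator means that it commutes with \<open>sc\<close>. In this form the same results apply to
  a space and to its functionals.\<close>

locale complex_banach = fixes sc :: "complex => 'b::banach => 'b" assumes bb: "bounded_bilinear sc"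
 and sc_sc: "sc a (sc b x) = sc (a * b) x"
 and sc_1: "sc 1 x = x"
begin

sublocale sc: bounded_bilinear sc by (rule bb)

lemma sc_bound: obtains K where "0 <= K" "!!a x. norm (sc a x) <= K * norm a * norm x" using sc.nonneg_bounded by (metis mult.assoc mult.commute)

text \<open>For \<open>T = T0 + D\<close> and \<open>l y = 0\<close>, the eigenvalue equation of
  \<open>r + y\<close> with eigenvalue \<open>1 + l (D (r + y))\<close> reads
  \<open>y - T0 y = z D y\<close>, with \<open>z\<close> as defined in the proof. As
  \<open>N\<close> inverts \<open>1 - T0\<close> on the kernel of \<open>l\<close>, this is the
  fixed point equation \<open>y = N (z D y)\<close>, a contraction for small \<open>D\<close>. The
  subspace \<open>V\<close> is there for the dual, where not every bounded functional is complex
  linear.\<close>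

lemma right_perturbation: fixes T0 N :: "'b op" and l :: "'b fn" assumes V: "subspace V" "closed V" "!!c x. x : V ==> sc c x : V"
 and l: "!!c x. x : V ==> l (sc c x) = c * l x" "l r = 1" "r : V"
 and T0: "!!x. x : V ==> T0 x : V" "T0 r = r"
 and N: "!!x. x : V ==> N x : V" "!!x. x : V ==> l x = 0 ==> N x - T0 (N x) = x" "!!x. x : V ==> l x = 0 ==> l (N x) = 0"
obtains et C Y where "0 < et" "0 <= C"
 "!!T :: 'b op. (!!x. x : V ==> bap T x : V) ==> norm (T - T0) <= et ==>
   Y T : V & l (Y T) = 0 & bap T (r + Y T) = sc (1 + l (bap (T - T0) (r + Y T))) (r + Y T) & norm (Y T) <= C * norm (T - T0)
   & norm (Y T - N (bap (T - T0) r - sc (l (bap (T - T0) r)) r)) <= C * (norm (T - T0))^2"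
 "!!(T :: 'b op) (T' :: 'b op). (!!x. x : V ==> bap T x : V) ==> norm (T - T0) <= et ==> (!!x. x : V ==> bap T' x : V) ==> norm (T' - T0) <= et ==>
   norm (Y T - Y T') <= C * norm (T - T')"
proof -
obtain K where K: "0 <= K" "!!a x. norm (sc a x) <= K * norm a * norm x" by (rule sc_bound) blast
define n a rh where "n = norm N" and "a = norm l" and "rh = norm r"
have n: "0 <= n" "0 <= a" "0 <= rh" by (auto simp: n_def a_def rh_def)
define M where "M = (rh + 1) * (1 + 2 * K * a * (rh + 1))"
have M: "0 <= M" using n K by (simp add: M_def)
define z where "z D y = D (r + y) - sc (l (D (r + y))) (r + y)" for D :: "'b op" and y
define W where "W = {y : V. l y = 0 & norm y <= 1}"
have Wadd: "norm (r + y) <= rh + 1" if "y : W" for y using that norm_triangle_ineq[of r y] by (auto simp: W_def rh_def)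
have zD: "norm (z D y - z D' y) <= M * norm (D - D')" if y: "y : W" for D D' y
proof -
 have "z D y - z D' y = bap (D - D') (r + y) - sc (l (bap (D - D') (r + y))) (r + y)" by (simp add: z_def blinfun.diff_left blinfun.diff_right sc.diff_left)
 also have "norm ... <= norm (D - D') * (rh + 1) + K * (a * (norm (D - D') * (rh + 1))) * (rh + 1)"
 proof (rule norm_triangle_le_diff, rule add_mono)
  show 1: "norm (bap (D - D') (r + y)) <= norm (D - D') * (rh + 1)" using norm_blinfun[of "D - D'" "r + y"] mlm[OF Wadd[OF y] norm_ge_zero[of "D - D'"]] by linarith
  have "norm (l (bap (D - D') (r + y))) <= a * (norm (D - D') * (rh + 1))" using norm_blinfun[of l "bap (D - D') (r + y)"] mlm[OF 1 n(2)] by (simp add: a_def)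
  thus "norm (sc (l (bap (D - D') (r + y))) (r + y)) <= K * (a * (norm (D - D') * (rh + 1))) * (rh + 1)"
   using K(2)[of "l (bap (D - D') (r + y))" "r + y"] K(1) Wadd[OF y] n by (elim order_trans) (intro mult_mono; simp)
 qed
 also have "... = (rh + 1) * (1 + K * a * (rh + 1)) * norm (D - D')" by (simp add: alg)
 also have "... <= M * norm (D - D')" unfolding M_def using n K by (intro mrm mlm) auto
 finally show ?thesis .
qed
have zy: "norm (z D y - z D y') <= M * norm D * norm (y - y')" if y: "y : W" "y' : W" for D y y'
proof -
 have "z D y - z D y' = D (y - y') - (sc (l (D (y - y'))) (r + y) + sc (l (D (r + y'))) (y - y'))"
  by (simp add: z_def blinfun.diff_right blinfun.add_right sc.diff_left sc.diff_right sc.add_left sc.add_right)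
 also have "norm ... <= norm D * norm (y - y') + (K * (a * (norm D * norm (y - y'))) * (rh + 1) + K * (a * (norm D * (rh + 1))) * norm (y - y'))"
 proof (rule norm_triangle_le_diff, rule add_mono, rule norm_blinfun, rule norm_triangle_le, rule add_mono)
  have "norm (l (D (y - y'))) <= a * (norm D * norm (y - y'))" using norm_blinfun[of l "D (y - y')"] mlm[OF norm_blinfun[of D "y - y'"] n(2)] by (simp add: a_def)
  thus "norm (sc (l (D (y - y'))) (r + y)) <= K * (a * (norm D * norm (y - y'))) * (rh + 1)" using K(2)[of "l (D (y - y'))" "r + y"] K(1) Wadd[OF y(1)] n
   by (elim order_trans) (intro mult_mono; simp)
  have "norm (D (r + y')) <= norm D * (rh + 1)" using norm_blinfun[of D "r + y'"] mlm[OF Wadd[OF y(2)] norm_ge_zero[of D]] by linarith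
  hence "norm (l (D (r + y'))) <= a * (norm D * (rh + 1))"
   using norm_blinfun[of l "D (r + y')"] mlm[of "norm (D (r + y'))" _ a] n(2) by (simp add: a_def) (meson order_trans mlm norm_ge_zero)
  thus "norm (sc (l (D (r + y'))) (y - y')) <= K * (a * (norm D * (rh + 1))) * norm (y - y')" using K(2)[of "l (D (r + y'))" "y - y'"] K(1) n
   by (elim order_trans) (intro mult_mono; simp)
 qed
 also have "... = (1 + 2 * K * a * (rh + 1)) * norm D * norm (y - y')" by (simp add: alg)
 also have "... <= M * norm D * norm (y - y')"
 proof -
  have "0 <= 1 + 2 * K * a * (rh + 1)" using n K by simp
  hence "1 + 2 * K * a * (rh + 1) <= M" unfolding M_def using mrm[of 1 "rh + 1" "1 + 2 * K * a * (rh + 1)"] n by simp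
  thus ?thesis by (intro mrm) auto
 qed
 finally show ?thesis .
qed
have W0: "0 : W" using V by (auto simp: W_def subspace_0 blinfun.zero_right)
have z0: "z 0 y = 0" for y by (simp add: z_def blinfun.zero_right sc.zero_left)
\<comment> \<open>Makes \<open>n * M * norm (T - T0)\<close> at most 1/2, which is the contraction
  factor and also keeps \<open>W\<close> invariant.\<close>
define et where "et = 1 / (2 * (n * M + 1))"
have nM: "0 < n * M + 1" using n M by (intro add_nonneg_pos) auto
have et: "0 < et" using nM by (simp add: et_def)
have et': "n * (M * t) <= 1/2" if "t <= et" "0 <= t" for t
proof -
 have "n * M * t <= n * M * et" using that n M by (intro mlm) auto
 also have "... <= 1/2" using nM by (simp add: et_def divide_le_eq)
 finally show ?thesis by (simp add: mult.assoc)
qed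
have fix_ex: "EX! y:W. N (z (T - T0) y) = y" if T: "!!x. x : V ==> bap T x : V" "norm (T - T0) <= et" for T :: "'b op"
proof (rule Banach_fix)
 have "W = V \<inter> {y. l y = 0} \<inter> cball 0 1" by (auto simp: W_def)
 moreover have "closed {y. l y = 0}" by (intro closed_Collect_eq continuous_intros)
 ultimately have "closed W" using V(2) by auto
 thus "complete W" by (simp add: complete_eq_closed)
 show "W ~= {}" using W0 by auto
 show "(%y. N (z (T - T0) y)) ` W <= W"
 proof (clarsimp simp: W_def)
  fix y assume y: "y : V" "l y = 0" "norm y <= 1"
  hence yW: "y : W" by (simp add: W_def)
  have D: "bap (T - T0) (r + y) : V" using T(1) T0(1) V(1) y l(3) by (auto simp: blinfun.diff_left intro!: subspace_diff subspace_add)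
  have zV: "z (T - T0) y : V" unfolding z_def using D V y l(3) by (intro subspace_diff V subspace_add) auto
  have lz: "l (z (T - T0) y) = 0" using y l V(1) D by (simp add: z_def blinfun.diff_right blinfun.add_right subspace_add)
  have "norm (N (z (T - T0) y)) <= n * norm (z (T - T0) y)" unfolding n_def by (rule norm_blinfun)
  also have "... <= n * (M * norm (T - T0))" using zD[OF yW, of "T - T0" 0] n by (intro mlm) (auto simp: z0)
  also have "... <= 1/2" by (rule et') (use T in auto)
  finally show "N (z (T - T0) y) : V & l (N (z (T - T0) y)) = 0 & norm (N (z (T - T0) y)) <= 1" using N(1)[OF zV] N(3)[OF zV lz] by simp
 qed
 show "dist (N (z (T - T0) x)) (N (z (T - T0) y)) <= 1/2 * dist x y" if "x : W" "y : W" for x y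
 proof -
  have "dist (N (z (T - T0) x)) (N (z (T - T0) y)) = norm (N (z (T - T0) x - z (T - T0) y))" by (simp add: dist_norm blinfun.diff_right)
  also have "... <= n * norm (z (T - T0) x - z (T - T0) y)" unfolding n_def by (rule norm_blinfun)
  also have "... <= n * (M * norm (T - T0) * norm (x - y))" using n zy[OF that] by (intro mlm) auto
  also have "... = n * (M * norm (T - T0)) * norm (x - y)" by simp
  also have "... <= 1/2 * norm (x - y)" by (intro mrm et') (use T in auto)
  finally show ?thesis by (simp add: dist_norm)
 qed
qed auto
define Y where "Y T = (THE y. y : W & N (z (T - T0) y) = y)" for T
have Y: "Y T : W" "N (z (T - T0) (Y T)) = Y T" if T: "!!x. x : V ==> bap T x : V" "norm (T - T0) <= et" for T :: "'b op"
 using theI'[OF fix_ex[OF T]] unfolding Y_def by auto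
define C where "C = max (2 * n * M) (n * M * (n * M))"
have C: "0 <= C" "2 * n * M <= C" "n * M * (n * M) <= C" using n M by (auto simp: C_def le_max_iff_disj)
have Lip: "norm (Y T - Y T') <= C * norm (T - T')"
 if T: "!!x. x : V ==> bap T x : V" "norm (T - T0) <= et" and T': "!!x. x : V ==> bap T' x : V" "norm (T' - T0) <= et" for T T' :: "'b op"
proof -
 let ?D = "T - T0" and ?D' = "T' - T0"
 have "Y T - Y T' = N (z ?D (Y T)) - N (z ?D' (Y T'))" using Y(2)[OF T] Y(2)[OF T'] by simp
 also have "... = N ((z ?D (Y T) - z ?D' (Y T)) + (z ?D' (Y T) - z ?D' (Y T')))" by (simp add: blinfun.diff_right blinfun.add_right)
 also have "norm ... <= n * norm ((z ?D (Y T) - z ?D' (Y T)) + (z ?D' (Y T) - z ?D' (Y T')))" unfolding n_def by (rule norm_blinfun)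
 also have "... <= n * (M * norm (?D - ?D') + M * norm ?D' * norm (Y T - Y T'))" by (intro mlm n norm_triangle_le add_mono zD zy Y T T')
 also have "... = n * M * norm (T - T') + n * (M * norm ?D') * norm (Y T - Y T')" by (simp add: alg)
 also have "... <= n * M * norm (T - T') + 1/2 * norm (Y T - Y T')" by (intro add_left_mono mrm et') (use T' in auto)
 finally have "norm (Y T - Y T') <= 2 * n * M * norm (T - T')" by simp
 also have "... <= C * norm (T - T')" using C by (intro mrm) auto
 finally show ?thesis .
qed
have Yn: "norm (Y T) <= n * M * norm (T - T0)" if T: "!!x. x : V ==> bap T x : V" "norm (T - T0) <= et" for T :: "'b op"
proof -
 have "norm (Y T) <= n * norm (z (T - T0) (Y T))" unfolding n_def by (subst Y(2)[OF T, symmetric]) (auto intro: norm_blinfun T)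
 also have "... <= n * (M * norm (T - T0))" using zD[OF Y(1)[OF T], of "T - T0" 0] n by (intro mlm) (auto simp: z0)
 finally show ?thesis by simp
qed
have main: "Y T : V & l (Y T) = 0 & bap T (r + Y T) = sc (1 + l (bap (T - T0) (r + Y T))) (r + Y T) & norm (Y T) <= C * norm (T - T0)
   & norm (Y T - N (bap (T - T0) r - sc (l (bap (T - T0) r)) r)) <= C * (norm (T - T0))^2"
 if 1: "!!x. x : V ==> bap T x : V" "norm (T - T0) <= et" for T :: "'b op"
proof -
 let ?D = "T - T0"
 have y: "Y T : V" "l (Y T) = 0" using Y(1)[OF 1] by (auto simp: W_def)
 let ?w = "r + Y T"
 have D: "?D ?w : V" using 1(1) T0(1) V(1) y l(3) by (auto simp: blinfun.diff_left intro!: subspace_diff subspace_add)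
 have zV: "z ?D (Y T) : V" unfolding z_def using D V y l(3) by (intro subspace_diff V subspace_add) auto
 have lz: "l (z ?D (Y T)) = 0" using y l V(1) D by (simp add: z_def blinfun.diff_right blinfun.add_right subspace_add)
 have "Y T - T0 (Y T) = z ?D (Y T)" using N(2)[OF zV lz] by (simp add: Y(2)[OF 1])
 hence "T ?w = ?w + sc (l (?D ?w)) ?w" using T0(2) by (simp add: z_def blinfun.diff_left blinfun.add_right alg)
 hence eig: "T ?w = sc (1 + l (?D ?w)) ?w" by (simp add: sc.add_left sc_1)
 have "norm (Y T - N (z ?D 0)) = norm (N (z ?D (Y T) - z ?D 0))" by (simp add: blinfun.diff_right Y(2)[OF 1])
 also have "... <= n * norm (z ?D (Y T) - z ?D 0)" unfolding n_def by (rule norm_blinfun)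
 also have "... <= n * (M * norm ?D * norm (Y T - 0))" by (intro mlm n zy Y W0 1)
 also have "... <= n * (M * norm ?D * (n * M * norm ?D))" using Yn[OF 1] n M by (intro mlm) auto
 also have "... = n * M * (n * M) * (norm ?D)^2" by (simp add: power2_eq_square)
 also have "... <= C * (norm ?D)^2" using C by (intro mrm) auto
 finally have o2: "norm (Y T - N (z ?D 0)) <= C * (norm ?D)^2" .
 have "norm (Y T) <= n * M * norm ?D" by (rule Yn[OF 1])
 also have "... <= C * norm ?D" using C n M by (intro mrm) auto
 finally show ?thesis using y eig o2 by (simp add: z_def)
qed
show ?thesis by (rule that[of et C Y]) (fact et, fact C(1), fact main, fact Lip)
qed

text \<open>Lets the fixed point lemma produce left eigenvectors, as eigenvectors of the transposed
  operator.\<close>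

lemma dual: "complex_banach (%c (m :: 'b fn). blinfun_mult_right c o\<^sub>L m)"
proof (rule complex_banach.intro)
show "bounded_bilinear (%c (m :: 'b fn). blinfun_mult_right c o\<^sub>L m)"
 by (rule bounded_bilinear.comp1[OF bounded_bilinear_blinfun_compose bounded_linear_blinfun_mult_right])
qed (auto intro!: blinfun_eqI)

abbreviation eigen where
"eigen T0 N r l C T R x L == bap T R = sc x R & (ALL y. bap L (bap T y) = x * bap L y) & (ALL c x. bap L (sc c x) = c * bap L x)
 & norm (R - r) <= C * norm (T - T0) & norm (L - l) <= C * norm (T - T0)
 & norm (R - r - bap N (bap (T - T0) r)) <= C * (norm (T - T0))^2
 & norm (L - l - (l o\<^sub>L (T - T0) o\<^sub>L N)) <= C * (norm (T - T0))^2 & norm (bap L R - 1) <= 1/2"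

text \<open>\<open>right_perturbation\<close> on the space gives \<open>R\<close>; on the dual, with
  the roles of \<open>l\<close> and \<open>r\<close> exchanged, it gives \<open>L\<close>. Both have
  the same eigenvalue because \<open>L\<close> does not vanish on \<open>R\<close>. The first order
  terms are recorded with quadratic errors for the derivatives at the unperturbed operator, and the
  Lipschitz bound gives continuity away from it.\<close>

theorem perturbation: fixes T0 N :: "'b op" and l :: "'b fn" assumes l: "!!c x. l (sc c x) = c * l x" "l r = 1" "!!x. l (T0 x) = l x"
 and T0: "!!c x. T0 (sc c x) = sc c (T0 x)" "T0 r = r"
 and N: "!!c x. N (sc c x) = sc c (N x)" "!!x. N x - T0 (N x) = x - sc (l x) r" "!!x. N (x - T0 x) = x - sc (l x) r" "N r = 0" "!!x. l (N x) = 0"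
obtains et C R L La where "0 < et" "0 <= C"
 "!!T :: 'b op. (!!c x. bap T (sc c x) = sc c (bap T x)) ==> norm (T - T0) <= et ==>
   eigen T0 N r l C T (R T) (La T) (L T)"
 "!!(T :: 'b op) (T' :: 'b op). (!!c x. bap T (sc c x) = sc c (bap T x)) ==> norm (T - T0) <= et ==> (!!c x. bap T' (sc c x) = sc c (bap T' x)) ==> norm (T' - T0) <= et ==>
   norm (L T - L T') <= C * norm (T - T')"
proof -
obtain et1 C1 Y where Y: "0 < et1" "0 <= C1"
 "!!T :: 'b op. (!!x. x : UNIV ==> bap T x : UNIV) ==> norm (T - T0) <= et1 ==>
   Y T : UNIV & l (Y T) = 0 & bap T (r + Y T) = sc (1 + l (bap (T - T0) (r + Y T))) (r + Y T) & norm (Y T) <= C1 * norm (T - T0)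
   & norm (Y T - N (bap (T - T0) r - sc (l (bap (T - T0) r)) r)) <= C1 * (norm (T - T0))^2"
 by (rule right_perturbation[of UNIV l r T0 N]) (use l T0 N in \<open>auto simp: sc.zero_left\<close>)
interpret d: complex_banach "%c (m :: 'b fn). blinfun_mult_right c o\<^sub>L m" by (rule dual)
\<comment> \<open>As a type the dual contains all real linear bounded maps; \<open>V\<close> singles
  out the complex linear ones.\<close>
define V :: "('b fn) set" where "V = {m. ALL c x. bap m (sc c x) = c * bap m x}"
define tr where "tr T = Blinfun (%m :: 'b fn. m o\<^sub>L T)" for T :: "'b op"
have trT: "bap (tr T) m = m o\<^sub>L T" for T m
 unfolding tr_def by (subst bounded_linear_Blinfun_apply) (auto intro: bounded_linear_intros bounded_bilinear.bounded_linear_left[OF bounded_bilinear_blinfun_compose])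
have tr_diff: "tr T - tr T' = tr (T - T')" for T T' by (rule blinfun_eqI, rule blinfun_eqI) (simp add: trT blinfun.diff_left blinfun.diff_right)
have tr_norm: "norm (tr T) <= norm T" for T by (rule norm_blinfun_bound) (auto simp: trT mult.commute intro: order_trans[OF norm_blinfun_compose])
define rr where "rr = Blinfun (%m :: 'b fn. m r)"
have rr: "bap rr m = m r" for m unfolding rr_def by (subst bounded_linear_Blinfun_apply) (auto intro: blinfun.bounded_linear_left)
have V: "subspace V" "closed V" "!!c m. m : V ==> (blinfun_mult_right c o\<^sub>L m) : V"
proof -
 show "subspace V" by (auto simp: V_def subspace_def blinfun.add_left blinfun.scaleR_left alg)
 have "V = (\<Inter>c. \<Inter>x. {m. bap m (sc c x) = c * bap m x})" by (auto simp: V_def)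
 moreover have "closed {m :: 'b fn. bap m (sc c x) = c * bap m x}" for c x by (intro closed_Collect_eq continuous_intros)
 ultimately show "closed V" by auto
qed (auto simp: V_def)
have lV: "l : V" using l by (simp add: V_def)
have trV: "tr T m : V" if "!!c x. T (sc c x) = sc c (T x)" "m : V" for T :: "'b op" and m using that by (simp add: trT V_def)
obtain et2 C2 Z where Z: "0 < et2" "0 <= C2"
 "!!T :: ('b fn) \<Rightarrow>\<^sub>L ('b fn). (!!x. x : V ==> bap T x : V) ==> norm (T - tr T0) <= et2 ==>
   Z T : V & rr (Z T) = 0 & bap T (l + Z T) = blinfun_mult_right (1 + rr (bap (T - tr T0) (l + Z T))) o\<^sub>L (l + Z T) & norm (Z T) <= C2 * norm (T - tr T0)
   & norm (Z T - tr N (bap (T - tr T0) l - (blinfun_mult_right (rr (bap (T - tr T0) l)) o\<^sub>L l))) <= C2 * (norm (T - tr T0))^2"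
 "!!(T :: ('b fn) \<Rightarrow>\<^sub>L ('b fn)) (T' :: ('b fn) \<Rightarrow>\<^sub>L ('b fn)). (!!x. x : V ==> bap T x : V) ==> norm (T - tr T0) <= et2 ==> (!!x. x : V ==> bap T' x : V) ==> norm (T' - tr T0) <= et2 ==>
   norm (Z T - Z T') <= C2 * norm (T - T')"
proof (rule d.right_perturbation[of V rr l "tr T0" "tr N"])
 show "rr l = 1" using l by (simp add: rr)
 show "tr T0 l = l" by (rule blinfun_eqI) (simp add: trT l)
 fix m assume m: "m : V" "rr m = 0"
 have mr: "m r = 0" using m by (simp add: rr)
 have "m (sc c r) = 0" for c using m mr by (simp add: V_def)
 thus "tr N m - tr T0 (tr N m) = m" using N(3) by (intro blinfun_eqI) (simp add: trT blinfun.diff_left blinfun.diff_right[symmetric], simp add: blinfun.diff_right)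
 show "rr (tr N m) = 0" by (simp add: rr trT N blinfun.zero_right)
qed (use V lV trV T0 N in \<open>auto simp: rr\<close>)
let ?A = "norm l"
define C where "C = max C1 C2"
have C: "0 <= C" "C1 <= C" "C2 <= C" using Y Z by (auto simp: C_def)
\<comment> \<open>The last entry forces \<open>norm (L R - 1) <= 1/2\<close>, hence a nonzero
  pairing of the two eigenvectors.\<close>
define et where "et = min (min et1 et2) (min 1 (1 / (2 * (C * (?A + C) + 1))))"
have pos: "0 < C * (?A + C) + 1" using C by (intro add_nonneg_pos mult_nonneg_nonneg) auto
have et: "0 < et" "et <= et1" "et <= et2" "et <= 1" "et <= 1 / (2 * (C * (?A + C) + 1))" using Y Z pos by (auto simp: et_def)
define R where "R T = r + Y T" for T :: "'b op"
define L where "L T = l + Z (tr T)" for T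
define La where "La T = 1 + l (bap (T - T0) (R T))" for T :: "'b op"
have main: "eigen T0 N r l C T (R T) (La T) (L T)"
 if 1: "!!c x. bap T (sc c x) = sc c (bap T x)" "norm (T - T0) <= et" for T :: "'b op"
proof -
 let ?D = "T - T0"
 note YT = Y(3)[of T, simplified, OF order_trans[OF 1(2) et(2)]]
 have nD: "norm (tr T - tr T0) <= norm ?D" by (simp add: tr_diff tr_norm)
 have Z': "Z (tr T) : V & rr (Z (tr T)) = 0 & tr T (l + Z (tr T)) = blinfun_mult_right (1 + rr (bap (tr T - tr T0) (l + Z (tr T)))) o\<^sub>L (l + Z (tr T))
  & norm (Z (tr T)) <= C2 * norm (tr T - tr T0)
   & norm (Z (tr T) - tr N (bap (tr T - tr T0) l - (blinfun_mult_right (rr (bap (tr T - tr T0) l)) o\<^sub>L l))) <= C2 * (norm (tr T - tr T0))^2"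
  by (rule Z(3)) (use trV 1 nD et in \<open>auto intro: order_trans\<close>)
 have Rn: "norm (R T - r) <= C * norm ?D" using YT mrm[OF C(2) norm_ge_zero[of ?D]] by (auto simp: R_def)
 have "norm (Z (tr T)) <= C2 * norm ?D" using Z' mlm[OF nD Z(2)] by linarith
 hence Zn: "norm (Z (tr T)) <= C * norm ?D" using mrm[OF C(3) norm_ge_zero[of ?D]] by linarith
 have Ln: "norm (L T - l) <= C * norm ?D" using Zn by (simp add: L_def)
 have Llin: "L T (sc c x) = c * L T x" for c x using Z' l by (simp add: L_def V_def blinfun.add_left distrib_left)
 have "Y T - N (?D r) = Y T - N (?D r - sc (l (?D r)) r)" by (simp add: blinfun.diff_right N sc.zero_right)
 hence R2: "norm (R T - r - N (?D r)) <= C * (norm ?D)^2" using YT mrm[OF C(2) zero_le_power2[of "norm ?D"]] by (auto simp: R_def)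
 have "tr N (bap (tr T - tr T0) l - (blinfun_mult_right (rr (bap (tr T - tr T0) l)) o\<^sub>L l)) = l o\<^sub>L ?D o\<^sub>L N"
  by (rule blinfun_eqI) (simp add: tr_diff trT blinfun.diff_left N)
 hence "norm (Z (tr T) - (l o\<^sub>L ?D o\<^sub>L N)) <= C2 * (norm (tr T - tr T0))^2" using Z' by simp
 also have "... <= C * (norm ?D)^2" using nD C Z by (intro mult_mono power_mono) auto
 finally have L2: "norm (L T - l - (l o\<^sub>L ?D o\<^sub>L N)) <= C * (norm ?D)^2" by (simp add: L_def)
 have LT: "L T (T x) = (1 + rr (bap (tr T - tr T0) (L T))) * L T x" for x
 proof -
  have "bap (tr T (L T)) x = bap (blinfun_mult_right (1 + rr (bap (tr T - tr T0) (L T))) o\<^sub>L L T) x" using Z' by (simp add: L_def)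
  thus ?thesis by (simp add: trT)
 qed
 have RT: "T (R T) = sc (La T) (R T)" using YT by (simp add: R_def La_def)
 have "L T (R T) - 1 = L T (Y T)" using Z' l by (simp add: R_def L_def blinfun.add_left blinfun.add_right rr)
 also have "norm ... <= norm (L T) * norm (Y T)" by (rule norm_blinfun)
 also have "... <= (?A + C) * (C * norm ?D)"
 proof (rule mult_mono)
  have "norm (L T) <= ?A + norm (Z (tr T))" unfolding L_def by (rule norm_triangle_ineq)
  also have "norm (Z (tr T)) <= C * 1" using Zn mlm[OF order_trans[OF 1(2) et(4)] C(1)] by linarith
  finally show "norm (L T) <= ?A + C" by simp
  show "norm (Y T) <= C * norm ?D" using Rn by (simp add: R_def)
 qed (use C in auto)
 also have "... <= (?A + C) * (C * (1 / (2 * (C * (?A + C) + 1))))" using 1(2) et(5) C by (intro mlm) auto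
 also have "... = C * (?A + C) / (2 * (C * (?A + C) + 1))" by simp
 also have "... <= 1/2"
 proof -
  have "t / (2 * (t + 1)) <= 1/2" if "0 < t + 1" for t :: real using that by (simp add: field_simps)
  from this[OF pos] show ?thesis .
 qed
 finally have LR: "norm (L T (R T) - 1) <= 1/2" .
 have LR0: "L T (R T) ~= 0" using LR by auto
 have "(1 + rr (bap (tr T - tr T0) (L T))) * L T (R T) = La T * L T (R T)" using LT[of "R T"] unfolding RT Llin by (rule sym)
 hence "1 + rr (bap (tr T - tr T0) (L T)) = La T" unfolding mult_right_cancel[OF LR0] .
 with LT have "ALL x. L T (T x) = La T * L T x" by simp
 thus ?thesis using RT Llin Rn Ln R2 L2 LR by blast
qed
have Lip: "norm (L T - L T') <= C * norm (T - T')"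
 if 2: "!!c x. bap T (sc c x) = sc c (bap T x)" "norm (T - T0) <= et"
  "!!c x. bap T' (sc c x) = sc c (bap T' x)" "norm (T' - T0) <= et" for T T' :: "'b op"
proof -
 have "norm (tr T - tr T0) <= et2" "norm (tr T' - tr T0) <= et2" using 2 et tr_norm[of "T - T0"] tr_norm[of "T' - T0"] by (auto simp: tr_diff)
 hence "norm (Z (tr T) - Z (tr T')) <= C2 * norm (tr T - tr T')" using trV 2 by (intro Z(4)) auto
 also have "... <= C * norm (T - T')" using C Z tr_norm[of "T - T'"] by (intro mult_mono) (auto simp: tr_diff)
 finally show ?thesis by (simp add: L_def)
qed
show ?thesis by (rule that[of et C R La L]) (fact et(1), fact C(1), fact main, fact Lip)
qed

end

section \<open>Bounded measurable functions of a sequence\<close>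

abbreviation seqM :: "(nat => 'a::topological_space) measure" where
"seqM == PiM UNIV (%_. borel)"

text \<open>Functions of a whole sequence, although only finitely many letters will matter: a type
  cannot depend on the length \<open>Q\<close> of a state.\<close>

typedef (overloaded) 'a bmf = "{f :: (nat => 'a::topological_space) => complex. f : bmeas seqM & bounded (range f)}"
morphisms ap Bmf by (intro exI[of _ "%_. 0"]) auto

setup_lifting type_definition_bmf

lemma ap_measurable [measurable]: "ap f : bmeas seqM" and ap_bounded: "bounded (range (ap f))" using ap[of f] by auto

lemma ap_Bmf: "f : bmeas seqM ==> (!!x. norm (f x) <= B) ==> ap (Bmf f) = f" by (intro Bmf_inverse) (auto simp: bounded_iff)

lemma bmf_eqI: "(!!x. ap f x = ap g x) ==> f = g" by (simp add: ap_inject[symmetric] fun_eq_iff)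

instantiation bmf :: (topological_space) real_vector
begin

lift_definition zero_bmf :: "'a bmf" is "%_. 0" by auto
lift_definition plus_bmf :: "'a bmf => 'a bmf => 'a bmf" is "%f g x. f x + g x" by (auto intro: bounded_plus_comp)
lift_definition minus_bmf :: "'a bmf => 'a bmf => 'a bmf" is "%f g x. f x - g x" by (auto intro: bounded_minus_comp)
lift_definition uminus_bmf :: "'a bmf => 'a bmf" is "%f x. - f x" by auto
lift_definition scaleR_bmf :: "real => 'a bmf => 'a bmf" is "%r f x. r *\<^sub>R f x" by (auto intro: bounded_scaleR_comp)

instance by standard (transfer, simp add: alg)+

end

instantiation bmf :: (topological_space) real_normed_vector
begin

definition norm_bmf :: "'a bmf => real" where "norm_bmf f = (SUP x. norm (ap f x))"
definition dist_bmf :: "'a bmf => 'a bmf => real" where "dist_bmf f g = norm (f - g)"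
definition sgn_bmf :: "'a bmf => 'a bmf" where "sgn_bmf f = f /\<^sub>R norm f"
definition uniformity_bmf :: "('a bmf \<times> 'a bmf) filter"
where "uniformity_bmf = (INF e\<in>{0 <..}. principal {(x, y). dist x y < e})"
definition open_bmf :: "'a bmf set => bool"
where "open_bmf S = (ALL x:S. \<forall>\<^sub>F (x', y) in uniformity. x' = x --> y : S)"

lemma norm_ap: "norm (ap f x) <= norm f"
proof -
have "bdd_above (range (%x. norm (ap f x)))" using ap_bounded[of f] by (auto simp: bounded_iff bdd_above_def)
thus ?thesis unfolding norm_bmf_def by (rule cSUP_upper2) auto
qed

lemma norm_bmfI: "(!!x. norm (ap f x) <= b) ==> norm f <= b" unfolding norm_bmf_def by (rule cSUP_least) auto

instance
proof
fix f g :: "'a bmf" and r :: real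
show "norm f = 0 \<longleftrightarrow> f = 0"
proof
 assume "norm f = 0"
 thus "f = 0" using norm_ap[of f] by (intro bmf_eqI) (simp add: zero_bmf.rep_eq)
next
 assume "f = 0"
 thus "norm f = 0" by (simp add: norm_bmf_def zero_bmf.rep_eq)
qed
show "norm (f + g) <= norm f + norm g" by (rule norm_bmfI) (simp only: plus_bmf.rep_eq, intro norm_triangle_le add_mono norm_ap)
show "norm (r *\<^sub>R f) = abs r * norm f"
proof (rule antisym)
 show "norm (r *\<^sub>R f) <= abs r * norm f" by (rule norm_bmfI) (auto simp: scaleR_bmf.rep_eq norm_ap intro!: mlm)
 show "abs r * norm f <= norm (r *\<^sub>R f)"
 proof (cases "r = 0")
  case True thus ?thesis by (simp add: norm_bmf_def scaleR_bmf.rep_eq zero_bmf.rep_eq)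
 next
  case False
  have "norm f <= norm (r *\<^sub>R f) / abs r" using norm_ap[of "r *\<^sub>R f"] False by (intro norm_bmfI) (simp add: scaleR_bmf.rep_eq le_divide_eq mult.commute)
  thus ?thesis using False by (simp add: le_divide_eq mult.commute)
 qed
qed
qed (auto simp: dist_bmf_def sgn_bmf_def uniformity_bmf_def open_bmf_def)

end

lemma ap_simps [simp]:
"ap 0 x = 0" "ap (f + g) x = ap f x + ap g x" "ap (f - g) x = ap f x - ap g x"
"ap (- f) x = - ap f x" "ap (r *\<^sub>R f) x = r *\<^sub>R ap f x"
by (simp_all add: zero_bmf.rep_eq plus_bmf.rep_eq minus_bmf.rep_eq uminus_bmf.rep_eq scaleR_bmf.rep_eq)

instance bmf :: (topological_space) banach
proof
fix X :: "nat => 'a bmf" assume X: "Cauchy X"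
have C: "Cauchy (%n. ap (X n) x)" for x
proof (rule metric_CauchyI)
 fix e :: real assume "0 < e"
 then obtain M where M: "!!m n. M <= m ==> M <= n ==> dist (X m) (X n) < e" using X unfolding Cauchy_def by blast
 have "dist (ap (X m) x) (ap (X n) x) < e" if "M <= m" "M <= n" for m n using le_less_trans[OF norm_ap[of "X m - X n" x]] M[OF that] by (simp add: dist_norm)
 thus "EX M. ALL m>=M. ALL n>=M. dist (ap (X m) x) (ap (X n) x) < e" by blast
qed
define L where "L x = lim (%n. ap (X n) x)" for x
have L: "(%n. ap (X n) x) ----> L x" for x using C[of x] unfolding L_def by (simp add: Cauchy_convergent_iff convergent_LIMSEQ_iff)
obtain B where B: "!!n. norm (X n) <= B" using cauchy_imp_bounded[OF X] by (auto simp: bounded_iff)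
have LB: "norm (L x) <= B" for x by (rule LIMSEQ_le_const2[OF tendsto_norm[OF L]]) (use norm_ap[of "X _" x] B order_trans in blast)
have LM: "L : bmeas seqM" unfolding L_def by (rule borel_measurable_lim_metric) measurable
have apL: "ap (Bmf L) = L" by (rule ap_Bmf[OF LM LB])
have "X ----> Bmf L"
proof (rule LIMSEQ_I)
 fix e :: real assume e: "0 < e"
 then obtain M where M: "!!m n. M <= m ==> M <= n ==> norm (X m - X n) < e / 2" using X unfolding Cauchy_def dist_norm by (meson half_gt_zero)
 have "norm (X n - Bmf L) < e" if n: "M <= n" for n
 proof -
  have "norm (X n - Bmf L) <= e / 2"
  proof (rule norm_bmfI)
   fix x
   have "norm (ap (X n) x - ap (X m) x) <= e / 2" if "M <= m" for m using norm_ap[of "X n - X m" x] M[OF n that] by simp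
   hence "norm (ap (X n) x - L x) <= e / 2" by (intro LIMSEQ_le_const2[OF tendsto_norm[OF tendsto_diff[OF tendsto_const L]]]) auto
   thus "norm (ap (X n - Bmf L) x) <= e / 2" by (simp add: apL)
  qed
  thus ?thesis using e by simp
 qed
 thus "EX no. ALL n>=no. norm (X n - Bmf L) < e" by blast
qed
thus "convergent X" by (rule convergentI)
qed

lift_definition csc :: "complex => 'a::topological_space bmf => 'a bmf" is "%c f x. c * f x" by (auto simp: bounded_iff norm_mult intro!: exI[of _ "_ * _"] mlm)

lemma ap_csc [simp]: "ap (csc c f) x = c * ap f x" by transfer simp

lemma norm_csc_le: "norm (csc c f) <= norm c * norm f" by (rule norm_bmfI) (auto simp: norm_mult intro!: mlm norm_ap)

lemma bounded_bilinear_csc: "bounded_bilinear csc"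
proof
show "EX K. ALL a (b :: 'a bmf). norm (csc a b) <= norm a * norm b * K" by (rule exI[of _ 1]) (simp add: norm_csc_le)
qed (auto intro!: bmf_eqI simp: alg)

section \<open>Windows of a cyclic sequence, transfer operators and the trace formula\<close>

text \<open>Beyond the window the value is \<open>undefined\<close>, and likewise for
  \<open>st\<close>. Windows with equal letters are then equal as functions, and states lie in the
  extensional product space that carries the product measure.\<close>

definition win :: "nat => (nat => 'a) => nat => nat => 'a" where
"win Q x i = (%m. if m <= Q then x (i + m) else undefined)"

definition st :: "nat => (nat => 'a) => nat => nat => 'a" where
"st Q x i = (%m. if m < Q then x (i + m) else undefined)"

definition cat :: "nat => (nat => 'a) => (nat => 'a) => nat => 'a" where
"cat Q u y = (%i. if i < Q then u i else y i)"

definition per :: "nat => (nat => 'a) => nat => 'a" where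
"per N x = (%i. x (i mod N))"

lemma measurable_seq_if: assumes "!!i. (%x. f x i) : measurable M borel" shows "(%x. f x) : measurable M seqM"
proof -
have "(%x i. f x i) : measurable M seqM" by (rule measurable_abs_UNIV) (rule assms)
thus ?thesis by simp
qed

lemma win_measurable [measurable]: "(%x. win Q x i) : measurable seqM seqM" unfolding win_def by (rule measurable_seq_if) auto

lemma st_measurable [measurable]: "(%x. st Q x i) : measurable seqM seqM" unfolding st_def by (rule measurable_seq_if) auto

lemma per_measurable [measurable]: "(%x. per N x) : measurable seqM seqM" unfolding per_def by (rule measurable_seq_if) auto

lemma cat_measurable [measurable]: "(%(u, y). cat Q u y) : measurable (seqM \<Otimes>\<^sub>M seqM) seqM" unfolding cat_def case_prod_beta
proof (rule measurable_seq_if)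
fix i show "(%x. if i < Q then fst x i else snd x i) : bmeas (seqM \<Otimes>\<^sub>M seqM)" by (cases "i < Q") auto
qed

lemma upd_measurable [measurable]: "(%(u, y). u(Q := y)) : measurable (seqM \<Otimes>\<^sub>M borel) seqM" unfolding case_prod_beta
proof (rule measurable_seq_if)
fix i show "(%x. ((fst x)(Q := snd x)) i) : bmeas (seqM \<Otimes>\<^sub>M borel)" by (cases "i = Q") auto
qed

locale chain = fixes vu :: "'a::topological_space measure" and Q :: nat
assumes prob_nu: "prob_space vu" and sets_nu [measurable_cong]: "sets vu = sets borel" and Q_pos: "0 < Q"
begin

sublocale nu: prob_space vu by (rule prob_nu)
sublocale PP: product_prob_space "%_ :: nat. vu" UNIV by unfold_locales

lemma space_nu: "space vu = UNIV" using sets_eq_imp_space_eq[OF sets_nu] by simp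

lemma prob_space_Pi: "prob_space (PiM I (%_ :: nat. vu))" by (rule prob_space_PiM) (rule prob_nu)

lemma id_measurable: "(%y. y) : measurable (PiM I (%_. vu)) seqM"
proof (rule measurable_seq_if)
fix i :: nat
show "(%y. y i) : bmeas (PiM I (%_. vu))"
proof (cases "i : I")
 case True
 hence "(%y. y i) : measurable (PiM I (%_. vu)) vu" by (rule measurable_component_singleton)
 thus ?thesis by (simp cong: measurable_cong_sets add: sets_nu)
next
 case False
 hence "y i = undefined" if "y : space (PiM I (%_. vu))" for y using that by (auto simp: space_PiM PiE_def extensional_def)
 hence "(%y. y i) : bmeas (PiM I (%_. vu)) \<longleftrightarrow> (%y. undefined :: 'a) : bmeas (PiM I (%_. vu))" by (rule measurable_cong)
 thus ?thesis by simp
qed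
qed

lemma from_seq: "f : measurable seqM N ==> f : measurable (PiM I (%_. vu)) N" using measurable_compose[OF id_measurable] by blast

lemma bounded_integrable: assumes "f : bmeas (PiM I (%_. vu))" "!!x. norm (f x) <= B"
shows "integrable (PiM I (%_ :: nat. vu)) (f :: _ => 'c::{banach, second_countable_topology})"
proof -
interpret P: prob_space "PiM I (%_ :: nat. vu)" by (rule prob_space_Pi)
show ?thesis by (rule P.integrable_const_bound[where B=B]) (use assms in auto)
qed

text \<open>The transfer operator in backward form: \<open>f\<close> is evaluated at the state after
  the step, so that a product of such operators reads the cycle from left to right.\<close>

definition tfun :: "((nat => 'a) => complex) => ((nat => 'a) => complex) => (nat => 'a) => complex" where
"tfun ps f u = (LINT y|vu. ps (win Q (u(Q := y)) 0) * f (st Q (u(Q := y)) 1))"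

lemma tfun_joint: "(%(u, y). ap ps (win Q (u(Q := y)) 0) * ap f (st Q (u(Q := y)) 1)) : bmeas (seqM \<Otimes>\<^sub>M vu)"
proof -
have m: "(%(u, y). ap ps (win Q (u(Q := y)) 0) * ap f (st Q (u(Q := y)) 1)) : bmeas (seqM \<Otimes>\<^sub>M borel)"
 unfolding case_prod_beta using upd_measurable[of Q, unfolded case_prod_beta]
 by (intro borel_measurable_times measurable_compose[OF _ ap_measurable] measurable_compose[OF _ win_measurable]
   measurable_compose[OF _ st_measurable])
have s: "sets (seqM \<Otimes>\<^sub>M vu) = sets ((seqM :: (nat => 'a) measure) \<Otimes>\<^sub>M borel)" by (rule sets_pair_measure_cong[OF refl sets_nu])
show ?thesis by (subst measurable_cong_sets[OF s refl]) (rule m)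
qed

lemma tfun_measurable: "tfun (ap ps) (ap f) : bmeas seqM" unfolding tfun_def[abs_def] by (rule nu.borel_measurable_lebesgue_integral) (rule tfun_joint)

lemma tfun_bound: "norm (ap ps x * ap f y) <= norm ps * norm f" unfolding norm_mult by (intro mult_mono norm_ap norm_ge_zero)

lemma tfun_integrable: "integrable vu (%y. ap ps (win Q (u(Q := y)) 0) * ap f (st Q (u(Q := y)) 1))"
proof (rule nu.integrable_const_bound[where B="norm ps * norm f"])
have "u : space (seqM :: (nat => 'a) measure)" by (simp add: space_PiM)
from measurable_compose_Pair1[OF this tfun_joint]
show "(%y. ap ps (win Q (u(Q := y)) 0) * ap f (st Q (u(Q := y)) 1)) : bmeas vu" by simp
qed (rule AE_I2, rule tfun_bound)

lemma tfun_norm: "norm (tfun (ap ps) (ap f) u) <= norm ps * norm f"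
proof -
have "norm (tfun (ap ps) (ap f) u) <= (LINT y|vu. norm (ap ps (win Q (u(Q := y)) 0) * ap f (st Q (u(Q := y)) 1)))" unfolding tfun_def by (rule integral_norm_bound)
also have "... <= (LINT y|vu. norm ps * norm f)" by (intro integral_mono integrable_norm tfun_integrable tfun_bound nu.integrable_const)
finally show ?thesis by (simp add: nu.prob_space)
qed

definition T :: "'a bmf => 'a bmf \<Rightarrow>\<^sub>L 'a bmf" where
"T ps = Blinfun (%f. Bmf (tfun (ap ps) (ap f)))"

lemma ap_Bmf_tfun: "ap (Bmf (tfun (ap ps) (ap f))) = tfun (ap ps) (ap f)" by (rule ap_Bmf[OF tfun_measurable tfun_norm])

lemma T_apply: "bap (T ps) f = Bmf (tfun (ap ps) (ap f))"
proof -
have "bounded_linear (%f. Bmf (tfun (ap ps) (ap f)))"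
proof (rule bounded_linear_intro[of _ "norm ps"])
 fix f g :: "'a bmf" and r :: real
 show "Bmf (tfun (ap ps) (ap (f + g))) = Bmf (tfun (ap ps) (ap f)) + Bmf (tfun (ap ps) (ap g))"
  by (rule bmf_eqI) (simp only: ap_Bmf_tfun ap_simps, simp add: tfun_def distrib_left Lintegral_add[OF tfun_integrable[unfolded One_nat_def] tfun_integrable[unfolded One_nat_def]])
 show "Bmf (tfun (ap ps) (ap (r *\<^sub>R f))) = r *\<^sub>R Bmf (tfun (ap ps) (ap f))" by (rule bmf_eqI) (simp only: ap_Bmf_tfun ap_simps, simp add: tfun_def)
 show "norm (Bmf (tfun (ap ps) (ap f))) <= norm f * norm ps" by (rule norm_bmfI) (simp add: ap_Bmf_tfun tfun_norm mult.commute[of "norm f"])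
qed
thus ?thesis unfolding T_def by (simp add: bounded_linear_Blinfun_apply)
qed

lemma ap_T: "ap (T ps f) u = (LINT y|vu. ap ps (win Q (u(Q := y)) 0) * ap f (st Q (u(Q := y)) 1))" unfolding T_apply ap_Bmf_tfun tfun_def ..

lemma T_diff: "T (a - b) = T a - T b" by (rule blinfun_eqI, rule bmf_eqI)
 (simp add: blinfun.diff_left ap_T left_diff_distrib Lintegral_diff[OF tfun_integrable[unfolded One_nat_def] tfun_integrable[unfolded One_nat_def]])

lemma T_scaleR: "T (r *\<^sub>R a) = r *\<^sub>R T a" by (rule blinfun_eqI, rule bmf_eqI) (simp add: blinfun.scaleR_left ap_T)

lemma T_csc_left: "T (csc c a) f = csc c (T a f)" by (rule bmf_eqI) (simp add: ap_T mult.assoc)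

lemma T_csc: "T a (csc c f) = csc c (T a f)" by (rule bmf_eqI) (simp add: ap_T mult.left_commute)

lemma norm_T: "norm (T a) <= norm a" by (rule norm_blinfun_bound) (auto intro!: norm_bmfI simp: T_apply ap_Bmf_tfun tfun_norm)

text \<open>The weight may differ from site to site, so that observables can be inserted at chosen
  sites. The operator of site 0 stands outermost.\<close>

primrec ops :: "(nat => 'a bmf) => nat => 'a bmf \<Rightarrow>\<^sub>L 'a bmf" where
"ops Ps 0 = id_blinfun"
| "ops Ps (Suc n) = ops Ps n o\<^sub>L T (Ps n)"

definition loc :: "'a bmf => bool" where "loc f \<longleftrightarrow> (ALL u. ap f (st Q u 0) = ap f u)"

lemma loc_T: "loc (T ps f)"
proof -
have "win Q ((st Q u 0)(Q := y)) 0 = win Q (u(Q := y)) 0" "st Q ((st Q u 0)(Q := y)) 1 = st Q (u(Q := y)) 1" for u :: "nat => 'a" and y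
 by (auto simp: win_def st_def fun_eq_iff)
thus ?thesis by (simp add: loc_def ap_T)
qed

definition path :: "(nat => 'a bmf) => nat => 'a bmf => (nat => 'a) => complex" where
"path Ps n f x = (PROD i<n. ap (Ps i) (win Q x i)) * ap f (st Q x n)"

lemma path_measurable [measurable]: "path Ps n f : bmeas seqM" unfolding path_def by measurable

lemma path_bound: "norm (path Ps n f x) <= (PROD i<n. norm (Ps i)) * norm f" unfolding path_def norm_mult prod_norm[symmetric]
by (intro mult_mono prod_mono norm_ap conjI norm_ge_zero prod_nonneg)

lemma path_cat_measurable: "(%y. path Ps n f (cat Q u y)) : bmeas (PiM I (%_. vu))"
proof (rule from_seq)
have "u : space (seqM :: (nat => 'a) measure)" by (simp add: space_PiM)
from measurable_compose_Pair1[OF this cat_measurable]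
have "(%y. cat Q u y) : measurable seqM seqM" by simp
thus "(%y. path Ps n f (cat Q u y)) : bmeas seqM" by (rule measurable_compose) simp
qed

text \<open>Each transfer integrates one new letter. After \<open>n\<close> of them the letters from
  position \<open>Q\<close> on have been integrated, and \<open>f\<close> reads the last
  \<open>Q\<close> letters.\<close>

lemma path_formula: assumes "loc f" shows "ap (ops Ps n f) u = (LINT y|(PiM {Q..<Q + n} (%_. vu)). path Ps n f (cat Q u y))" using assms
proof (induction n arbitrary: f)
case 0
have "st Q (cat Q u y) 0 = st Q u 0" for y by (auto simp: st_def cat_def fun_eq_iff)
hence "path Ps 0 f (cat Q u y) = ap f u" for y using 0 by (simp add: path_def loc_def)
thus ?case using prob_space.prob_space[OF prob_space_Pi[of "{}"]] by simp
next
case (Suc n)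
have I: "{Q..<Q + Suc n} = insert (Q + n) {Q..<Q + n}" by auto
have "ap (ops Ps (Suc n) f) u = ap (ops Ps n (T (Ps n) f)) u" by simp
also have "... = (LINT y|(PiM {Q..<Q + n} (%_. vu)). path Ps n (T (Ps n) f) (cat Q u y))" by (rule Suc.IH[OF loc_T])
also have "... = (LINT y|(PiM {Q..<Q + n} (%_. vu)). (LINT z|vu. path Ps (Suc n) f (cat Q u (y(Q + n := z)))))"
proof (rule Lintegral_cong[OF refl])
 fix y :: "nat => 'a"
 have 1: "win Q (cat Q u (y(Q + n := z))) i = win Q (cat Q u y) i" if "i < n" for i z using that by (auto simp: win_def cat_def fun_eq_iff)
 have 2: "win Q ((st Q (cat Q u y) n)(Q := z)) 0 = win Q (cat Q u (y(Q + n := z))) n" for z using Q_pos by (auto simp: win_def cat_def st_def fun_eq_iff)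
 have 3: "st Q ((st Q (cat Q u y) n)(Q := z)) 1 = st Q (cat Q u (y(Q + n := z))) (Suc n)" for z by (auto simp: win_def cat_def st_def fun_eq_iff)
 show "path Ps n (T (Ps n) f) (cat Q u y) = (LINT z|vu. path Ps (Suc n) f (cat Q u (y(Q + n := z))))" unfolding path_def ap_T 2 3 using 1 by (simp add: mult.assoc)
qed
also have "... = (LINT y|(PiM {Q..<Q + Suc n} (%_. vu)). path Ps (Suc n) f (cat Q u y))" unfolding I
 by (rule PP.product_integral_insert[symmetric]) (auto intro!: bounded_integrable[OF path_cat_measurable path_bound])
finally show ?case .
qed

lemma reindex_integral: fixes F :: "(nat => 'a) => 'c::{banach, second_countable_topology}" assumes "inj_on h I" "h : I \<rightarrow> J" "F : bmeas (PiM I (%_. vu))"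
shows "(LINT x|(PiM I (%_. vu)). F x) = (LINT x|(PiM J (%_. vu)). F (\<lambda>i\<in>I. x (h i)))"
proof -
have d: "distr (PiM J (%_. vu)) (PiM I (%_. vu)) (%x. \<lambda>i\<in>I. x (h i)) = PiM I (%_. vu)" using distr_PiM_reindex[of J "%_. vu" h I] assms prob_nu by simp
have m: "(%x. \<lambda>i\<in>I. x (h i)) : measurable (PiM J (%_. vu)) (PiM I (%_. vu))"
 using assms(2) by (intro measurable_restrict measurable_component_singleton) auto
show ?thesis by (subst d[symmetric]) (rule integral_distr[OF m assms(3)])
qed

text \<open>The weight of the \<open>Q\<close> windows that lead from the state \<open>u\<close> to
  the state \<open>v\<close>. It serves twice: as the integral kernel of \<open>Q\<close> transfer
  steps and, through \<open>kern\<close>, as the function of \<open>u\<close> that closes a cycle at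
  \<open>v\<close>.\<close>

definition kernv :: "(nat => 'a bmf) => nat => (nat => 'a) => (nat => 'a) => complex" where
"kernv Ps n v u = (PROD i<Q. ap (Ps (n + i)) (win Q (cat Q u (%j. v (j - Q))) i))"

definition kern :: "(nat => 'a bmf) => nat => (nat => 'a) => 'a bmf" where
"kern Ps n v = Bmf (kernv Ps n v)"

lemma kernv_joint [measurable]: "(%(u, v). kernv Ps n v u) : bmeas (seqM \<Otimes>\<^sub>M seqM)"
proof -
have "(%p. (fst p, %j. snd p (j - Q))) : measurable (seqM \<Otimes>\<^sub>M seqM) (seqM \<Otimes>\<^sub>M seqM)" by (intro measurable_Pair measurable_seq_if) auto
from measurable_compose[OF this cat_measurable[of Q]]
have "(%p. cat Q (fst p) (%j. snd p (j - Q))) : measurable (seqM \<Otimes>\<^sub>M seqM) seqM" by simp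
thus ?thesis unfolding kernv_def case_prod_beta by (intro borel_measurable_prod measurable_compose[OF _ ap_measurable] measurable_compose[OF _ win_measurable])
qed

lemma kernv_bound: "norm (kernv Ps n v u) <= (PROD i<Q. norm (Ps (n + i)))" unfolding kernv_def prod_norm[symmetric] by (intro prod_mono conjI norm_ge_zero norm_ap)

lemma ap_kern: "ap (kern Ps n v) = kernv Ps n v" unfolding kern_def
proof (rule ap_Bmf[OF _ kernv_bound])
have v: "v : space (seqM :: (nat => 'a) measure)" by (simp add: space_PiM)
show "kernv Ps n v : bmeas seqM" using measurable_compose[OF measurable_Pair2'[OF v] kernv_joint[of Ps n]] by simp
qed

lemma norm_kern: "norm (kern Ps n v) <= (PROD i<Q. norm (Ps (n + i)))" by (rule norm_bmfI) (simp add: ap_kern kernv_bound)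

lemma loc_kern: "loc (kern Ps n v)"
proof -
have "cat Q (st Q u 0) w = cat Q u w" for u w :: "nat => 'a" by (auto simp: cat_def st_def fun_eq_iff)
thus ?thesis by (simp add: loc_def ap_kern kernv_def)
qed

lemma ops_Q: assumes "loc f" shows "ap (ops Ps Q f) u = (LINT v|(PiM {..<Q} (%_. vu)). kernv Ps 0 v u * ap f v)"
proof -
have "ap (ops Ps Q f) u = (LINT y|(PiM {Q..<Q + Q} (%_. vu)). path Ps Q f (cat Q u y))" by (rule path_formula[OF assms])
also have "... = (LINT v|(PiM {..<Q} (%_. vu)). path Ps Q f (cat Q u (\<lambda>i\<in>{Q..<Q + Q}. v (i - Q))))"
 by (rule reindex_integral[OF _ _ path_cat_measurable]) (auto simp: inj_on_def)
also have "... = (LINT v|(PiM {..<Q} (%_. vu)). kernv Ps 0 v u * ap f v)"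
proof (rule Lintegral_cong[OF refl])
 fix v assume "v : space (PiM {..<Q} (%_. vu))"
 hence v: "v i = undefined" if "\<not> i < Q" for i using that by (auto simp: space_PiM PiE_def extensional_def)
 let ?y = "\<lambda>i\<in>{Q..<Q + Q}. v (i - Q)"
 have 1: "win Q (cat Q u ?y) i = win Q (cat Q u (%j. v (j - Q))) i" if "i < Q" for i using that by (auto simp: win_def cat_def fun_eq_iff)
 have 2: "st Q (cat Q u ?y) Q = v" using v by (auto simp: st_def cat_def fun_eq_iff)
 show "path Ps Q f (cat Q u ?y) = kernv Ps 0 v u * ap f v" using 1 by (simp add: path_def kernv_def 2)
qed
finally show ?thesis .
qed

definition cyc :: "(nat => 'a bmf) => nat => (nat => 'a) => complex" where
"cyc Ps N x = (PROD i<N. ap (Ps i) (win Q (per N x) i))"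

definition integ :: "(nat => 'a bmf) => nat => complex" where
"integ Ps N = (LINT x|(PiM {..<N} (%_. vu)). cyc Ps N x)"

lemma cyc_measurable [measurable]: "cyc Ps N : bmeas seqM" unfolding cyc_def by measurable

lemma cyc_bound: "norm (cyc Ps N x) <= (PROD i<N. norm (Ps i))" unfolding cyc_def prod_norm[symmetric] by (intro prod_mono conjI norm_ge_zero norm_ap)

lemma cyc_integrable: "integrable (PiM {..<N} (%_. vu)) (cyc Ps N)" by (rule bounded_integrable[OF from_seq[OF cyc_measurable] cyc_bound])

text \<open>The first \<open>n\<close> windows do not wrap around; the last \<open>Q\<close> run
  from the final state back into \<open>v\<close>, and \<open>kern\<close> collects them.\<close>

lemma cyc_split: assumes "N = n + Q" "0 < N" shows "cyc Ps N (%i. if i < Q then v i else y i) = path Ps n (kern Ps n v) (cat Q v y)"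
proof -
let ?x = "%i. if i < Q then v i else y i"
have 1: "win Q (per N ?x) i = win Q (cat Q v y) i" if "i < n" for i using that assms by (auto simp: win_def per_def cat_def fun_eq_iff)
have 2: "win Q (per N ?x) (n + i) = win Q (cat Q (st Q (cat Q v y) n) (%j. v (j - Q))) i" if i: "i < Q" for i
proof (rule ext)
 fix m
 show "win Q (per N ?x) (n + i) m = win Q (cat Q (st Q (cat Q v y) n) (%j. v (j - Q))) i m"
 proof (cases "m <= Q & Q <= i + m")
  case True
  have "n + i + m = i + m - Q + N" using True assms(1) by arith
  hence "(n + i + m) mod N = (i + m - Q + N) mod N" by (rule arg_cong)
  also have "... = i + m - Q"
  proof -
   have "i + m - Q < N" using True i assms(1) by arith
   thus ?thesis by (simp only: mod_add_self2 mod_less)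
  qed
  finally have "(n + i + m) mod N = i + m - Q" .
  moreover have "i + m - Q < Q" using True i by arith
  ultimately show ?thesis using True i by (simp add: win_def per_def cat_def)
 next
  case False
  thus ?thesis using assms by (auto simp: win_def per_def cat_def st_def add.assoc)
 qed
qed
have "cyc Ps N ?x = (PROD i<n. ap (Ps i) (win Q (per N ?x) i)) * (PROD i<Q. ap (Ps (n + i)) (win Q (per N ?x) (n + i)))"
 proof -
 have "{..<N} = {..<n} \<union> (%i. n + i) ` {..<Q}"
 proof (rule Set.set_eqI)
  fix x show "x : {..<N} \<longleftrightarrow> x : {..<n} \<union> (%i. n + i) ` {..<Q}" using assms(1) by (cases "x < n") (auto intro!: image_eqI[of _ _ "x - n"])
 qed
 moreover have "{..<n} \<inter> (%i. n + i) ` {..<Q} = {}" by auto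
 ultimately show ?thesis unfolding cyc_def by (simp add: prod.union_disjoint prod.reindex)
qed
thus ?thesis unfolding path_def ap_kern kernv_def using 1 2 by simp
qed

lemma trace_joint: "(%(v, y). path Ps n (kern Ps n v) (cat Q v y)) : bmeas (seqM \<Otimes>\<^sub>M seqM)"
proof -
have "path Ps n (kern Ps n v) (cat Q v y) = cyc Ps (n + Q) (cat Q v y)" for v y using cyc_split[of "n + Q" n Ps v y] Q_pos by (simp add: cat_def)
thus ?thesis using measurable_compose[OF cat_measurable cyc_measurable] by (simp add: case_prod_beta)
qed

lemma ops_kern_measurable: "(%v. ap (ops Ps n (kern Ps n v)) v) : bmeas (PiM {..<Q} (%_. vu))"
proof (rule from_seq)
interpret P: prob_space "PiM {Q..<Q + n} (%_ :: nat. vu)" by (rule prob_space_Pi)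
have "(%p. (fst p, snd p)) : measurable (seqM \<Otimes>\<^sub>M PiM {Q..<Q + n} (%_. vu)) (seqM \<Otimes>\<^sub>M seqM)"
 by (intro measurable_Pair measurable_fst measurable_compose[OF measurable_snd id_measurable])
from measurable_compose[OF this trace_joint[of Ps n]]
have "(%(v, y). path Ps n (kern Ps n v) (cat Q v y)) : bmeas (seqM \<Otimes>\<^sub>M PiM {Q..<Q + n} (%_. vu))" by (simp add: case_prod_beta)
thus "(%v. ap (ops Ps n (kern Ps n v)) v) : bmeas seqM" unfolding path_formula[OF loc_kern] by (rule P.borel_measurable_lebesgue_integral)
qed

text \<open>Cutting the cycle at the state \<open>v\<close> writes the integral as a diagonal
  integral of an operator product, which takes the place of an operator trace.\<close>

lemma trace_formula: assumes N: "N = n + Q" shows "integ Ps N = (LINT v|(PiM {..<Q} (%_. vu)). ap (ops Ps n (kern Ps n v)) v)"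
proof -
have I: "{..<N} = {..<Q} \<union> {Q..<Q + n}" using N by auto
have "integ Ps N = (LINT v|(PiM {..<Q} (%_. vu)). (LINT y|(PiM {Q..<Q + n} (%_. vu)). cyc Ps N (merge {..<Q} {Q..<Q + n} (v, y))))"
 unfolding integ_def I by (rule PP.product_integral_fold) (auto simp: I[symmetric] cyc_integrable)
also have "... = (LINT v|(PiM {..<Q} (%_. vu)). ap (ops Ps n (kern Ps n v)) v)"
proof (rule Lintegral_cong[OF refl])
 fix v
 have "cyc Ps N (merge {..<Q} {Q..<Q + n} (v, y)) = path Ps n (kern Ps n v) (cat Q v y)" for y
 proof -
  have p: "per N (merge {..<Q} {Q..<Q + n} (v, y)) = per N (%i. if i < Q then v i else y i)"
  proof (rule ext)
   fix i
   have "i mod N < Q + n" using N Q_pos by (metis add.commute mod_less_divisor add_gr_0)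
   thus "per N (merge {..<Q} {Q..<Q + n} (v, y)) i = per N (%i. if i < Q then v i else y i) i" by (auto simp: per_def merge_def)
  qed
  show ?thesis using cyc_split[OF N, of Ps v y] Q_pos N unfolding cyc_def p by simp
 qed
 thus "(LINT y|(PiM {Q..<Q + n} (%_. vu)). cyc Ps N (merge {..<Q} {Q..<Q + n} (v, y))) = ap (ops Ps n (kern Ps n v)) v" by (simp add: path_formula[OF loc_kern])
qed
finally show ?thesis .
qed

text \<open>Used to turn an inserted observable to a place far from the cut made by
  \<open>trace_formula\<close>, and to see that pairs of insertions matter only through their
  distance.\<close>

lemma rotation: assumes N: "0 < N" shows "integ (%i. Ps ((i + a) mod N)) N = integ Ps N"
proof -
have inj: "inj_on (%i. (i + a) mod N) {..<N}"
proof (rule inj_onI)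
 fix i j assume ij: "i : {..<N}" "j : {..<N}" "(i + a) mod N = (j + a) mod N"
 have aux: "i = j" if "j <= i" "i < N" "(i + a) mod N = (j + a) mod N" for i j
 proof -
  have "N dvd (i + a) - (j + a)" using that mod_eq_dvd_iff_nat[of "j + a" "i + a" N] by simp
  hence "N dvd i - j" by simp
  thus ?thesis using that by (metis diff_is_0_eq' dvd_imp_le le_antisym less_imp_diff_less not_le zero_less_diff)
 qed
 show "i = j" using aux[of i j] aux[of j i] ij by (cases "j <= i") auto
qed
have img: "(%i. (i + a) mod N) ` {..<N} = {..<N}" using N by (intro card_subset_eq) (auto simp: card_image[OF inj])
have "integ (%i. Ps ((i + a) mod N)) N =
  (LINT x|(PiM {..<N} (%_. vu)). cyc (%i. Ps ((i + a) mod N)) N (\<lambda>i\<in>{..<N}. x ((i + a) mod N)))"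
 unfolding integ_def using N by (intro reindex_integral[OF inj _ from_seq[OF cyc_measurable]]) auto
also have "... = integ Ps N" unfolding integ_def
proof (rule Lintegral_cong[OF refl])
 fix x :: "nat => 'a"
 have w: "win Q (per N (\<lambda>i\<in>{..<N}. x ((i + a) mod N))) i = win Q (per N x) ((i + a) mod N)" for i
 proof (rule ext)
  fix m
  have "((i + m) mod N + a) mod N = ((i + a) mod N + m) mod N" by (simp add: mod_simps ac_simps)
  thus "win Q (per N (\<lambda>i\<in>{..<N}. x ((i + a) mod N))) i m = win Q (per N x) ((i + a) mod N) m" using N by (simp add: win_def per_def)
 qed
 have "cyc (%i. Ps ((i + a) mod N)) N (\<lambda>i\<in>{..<N}. x ((i + a) mod N)) = (PROD i<N. ap (Ps ((i + a) mod N)) (win Q (per N x) ((i + a) mod N)))"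
  unfolding cyc_def w ..
 also have "... = (PROD i:(%i. (i + a) mod N) ` {..<N}. ap (Ps i) (win Q (per N x) i))" by (simp add: prod.reindex[OF inj])
 finally show "cyc (%i. Ps ((i + a) mod N)) N (\<lambda>i\<in>{..<N}. x ((i + a) mod N)) = cyc Ps N x" unfolding img cyc_def .
qed
finally show ?thesis .
qed

end

section \<open>Powers of an operator with a spectral gap and of its neighbours\<close>

lemma funpow_linear: fixes A :: "'b::real_normed_vector \<Rightarrow>\<^sub>L 'b" shows "(bap A ^^ n) (x - y) = (bap A ^^ n) x - (bap A ^^ n) y"
 "(bap A ^^ n) (x + y) = (bap A ^^ n) x + (bap A ^^ n) y"
 "(bap A ^^ n) (a *\<^sub>R x) = a *\<^sub>R (bap A ^^ n) x" by (induction n) (simp_all add: blinfun.diff_right blinfun.add_right blinfun.scaleR_right)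

lemma funpow_norm: fixes A :: "'b::real_normed_vector \<Rightarrow>\<^sub>L 'b" assumes "norm A <= m" "0 <= m" shows "norm ((bap A ^^ n) x) <= m ^ n * norm x"
proof (induction n)
case (Suc n)
have "norm ((bap A ^^ Suc n) x) <= norm A * norm ((bap A ^^ n) x)" by (simp add: norm_blinfun)
also have "... <= m * (m ^ n * norm x)" using Suc assms by (intro mult_mono) auto
finally show ?case by (simp add: mult_ac)
qed simp

text \<open>Some power \<open>p\<close> of \<open>A0\<close> shrinks by 1/4; by continuity the same
  power of a nearby \<open>A\<close> shrinks by 1/2, and \<open>root p (1/2)\<close> is the common
  rate. The decay of \<open>A0\<close> is asked from \<open>n = 1\<close> on because
  \<open>A0\<close> will be an operator minus its eigenprojection, whose zeroth power is still the
  identity.\<close>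

lemma power_decay: fixes A0 :: "'b::real_normed_vector \<Rightarrow>\<^sub>L 'b" assumes decay: "!!n f. 1 <= n ==> norm ((bap A0 ^^ n) f) <= D * th ^ n * norm f"
 and th: "0 <= th" "th < 1"
obtains et D' th' where "0 < et" "0 <= D'" "0 < th'" "th' < 1"
 "!!(A :: 'b op) n f. norm (A - A0) <= et ==> norm ((bap A ^^ n) f) <= D' * th' ^ n * norm f"
proof -
have "(%n. D * th ^ n) ----> D * 0" using th by (intro tendsto_intros LIMSEQ_realpow_zero) auto
hence "\<forall>\<^sub>F n in sequentially. D * th ^ n < 1/4" by (intro order_tendstoD(2)[where y="D * 0"]) auto
hence "\<forall>\<^sub>F n in sequentially. D * th ^ n < 1/4 & 1 <= n" using eventually_ge_at_top[of 1] by eventually_elim auto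
then obtain p where p: "D * th ^ p < 1/4" "1 <= p" by (auto dest: eventually_happens)
define m where "m = norm A0 + 1"
have m: "1 <= m" by (simp add: m_def)
have diff: "norm ((bap A ^^ n) f - (bap A0 ^^ n) f) <= of_nat n * m ^ n * norm (A - A0) * norm f"
 if A: "norm A <= m" for A :: "'b op" and n f
proof (induction n)
 case (Suc n)
 have "(bap A ^^ Suc n) f - (bap A0 ^^ Suc n) f = A ((bap A ^^ n) f - (bap A0 ^^ n) f) + bap (A - A0) ((bap A0 ^^ n) f)"
  by (simp add: blinfun.diff_right blinfun.diff_left)
 also have "norm ... <= m * (of_nat n * m ^ n * norm (A - A0) * norm f) + norm (A - A0) * (m ^ n * norm f)"
 proof (intro norm_triangle_le add_mono)
  show "norm (A ((bap A ^^ n) f - (bap A0 ^^ n) f)) <= m * (of_nat n * m ^ n * norm (A - A0) * norm f)"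
   using A m Suc by (intro order_trans[OF norm_blinfun] mult_mono) auto
  have "norm ((bap A0 ^^ n) f) <= m ^ n * norm f" by (rule funpow_norm) (auto simp: m_def)
  thus "norm (bap (A - A0) ((bap A0 ^^ n) f)) <= norm (A - A0) * (m ^ n * norm f)" by (intro order_trans[OF norm_blinfun] mlm) auto
 qed
 also have "... <= m * (of_nat n * m ^ n * norm (A - A0) * norm f) + m * (norm (A - A0) * (m ^ n * norm f))"
  using mrm[OF m, of "norm (A - A0) * (m ^ n * norm f)"] m by simp
 finally show ?case by (simp add: alg)
qed simp
define et where "et = min 1 (1 / (4 * (of_nat p * m ^ p)))"
have pm: "0 < of_nat p * m ^ p" using p m by simp
have et: "0 < et" "et <= 1" "of_nat p * m ^ p * et <= 1/4" using pm by (auto simp: et_def min_def field_simps)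
define th' where "th' = root p (1/2)"
have th': "0 < th'" "th' < 1" "th' ^ p = 1/2" using p by (auto simp: th'_def)
have main: "norm ((bap A ^^ n) f) <= (2 * m ^ p) * th' ^ n * norm f" if A: "norm (A - A0) <= et" for A :: "'b op" and n f
proof -
 have "norm A <= norm A0 + norm (A - A0)" using norm_triangle_ineq[of A0 "A - A0"] by simp
 hence Am: "norm A <= m" using A et by (simp add: m_def)
 have half: "norm ((bap A ^^ p) f) <= 1/2 * norm f" for f
 proof -
  have "norm ((bap A ^^ p) f) <= norm ((bap A ^^ p) f - (bap A0 ^^ p) f) + norm ((bap A0 ^^ p) f)"
   using norm_triangle_ineq[of "(bap A ^^ p) f - (bap A0 ^^ p) f" "(bap A0 ^^ p) f"] by simp
  also have "... <= of_nat p * m ^ p * et * norm f + D * th ^ p * norm f" using A m by (intro add_mono order_trans[OF diff[OF Am]] decay p mrm mlm) auto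
  also have "... <= 1/4 * norm f + 1/4 * norm f" using et p by (intro add_mono mrm) auto
  finally show ?thesis by simp
 qed
 have q: "norm ((bap A ^^ (p * q)) f) <= (1/2) ^ q * norm f" for q f
 proof (induction q)
  case (Suc q)
  have "norm ((bap A ^^ (p * Suc q)) f) = norm ((bap A ^^ p) ((bap A ^^ (p * q)) f))" by (simp add: funpow_add)
  also have "... <= 1/2 * ((1/2) ^ q * norm f)" using half Suc by (meson mlm order_trans zero_le_divide_1_iff zero_le_numeral)
  finally show ?case by simp
 qed simp
 have "norm ((bap A ^^ n) f) = norm ((bap A ^^ (n mod p)) ((bap A ^^ (p * (n div p))) f))"
  using funpow_add[of "n mod p" "p * (n div p)" "bap A"] by (simp add: fun_eq_iff)
 also have "... <= m ^ (n mod p) * norm ((bap A ^^ (p * (n div p))) f)" using m by (intro funpow_norm[OF Am]) auto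
 also have "... <= m ^ (n mod p) * ((1/2) ^ (n div p) * norm f)" using q m by (intro mlm) auto
 also have "... <= m ^ p * ((2 * th' ^ n) * norm f)"
 proof (intro mult_mono)
  show "m ^ (n mod p) <= m ^ p" using m p by (intro power_increasing) (auto intro: less_imp_le)
  have "(1/2) ^ Suc (n div p) = th' ^ (p * Suc (n div p))" unfolding power_mult th'(3) ..
  also have "... <= th' ^ n"
  proof (intro power_decreasing)
   have "n mod p < p" using p by simp
   thus "n <= p * Suc (n div p)" using mult_div_mod_eq[of p n] unfolding mult_Suc_right by linarith
  qed (use th' in auto)
  finally show "(1/2) ^ (n div p) <= 2 * th' ^ n" by simp
 qed (use m th' in auto)
 finally show ?thesis by (simp add: mult_ac)
qed
show ?thesis by (rule that[of et "2 * m ^ p" th']) (use et m th' main in auto)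
qed

locale complex_banach1 = complex_banach sc for sc :: "complex => 'b::banach => 'b" + assumes norm_sc: "norm (sc a x) = norm a * norm x"
begin

lemma sc_of_real: "sc (of_real a) x = a *\<^sub>R x" using sc.scaleR_left[of a 1 x] by (simp add: sc_1 scaleR_conv_of_real)

lemma funpow_sc: assumes "!!c x. bap A (sc c x) = sc c (bap A x)" shows "(bap A ^^ n) (sc c x) = sc c ((bap A ^^ n) x)" by (induction n) (simp_all add: assms)

text \<open>The coefficient in the asymptotics of the powers is unique since \<open>th < 1\<close>.
  Uniqueness makes the chosen coefficients complex linear in \<open>f\<close>, and the estimate at
  \<open>n = 0\<close> makes them bounded.\<close>

lemma gap_functional: fixes S :: "'b op" assumes S: "!!c x. bap S (sc c x) = sc c (bap S x)" and r: "r ~= 0" "S r = La *\<^sub>R r"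
 and La: "0 < La" and th: "0 <= th" "th < 1" "0 <= D"
 and gap: "!!f. EX c. ALL n. norm ((bap S ^^ n) f - sc (of_real (La ^ n) * c) r) <= D * th ^ n * La ^ n * norm f"
obtains l :: "'b fn" where "!!c x. l (sc c x) = c * l x" "l r = 1"
 "!!f n. norm ((bap S ^^ n) f - sc (of_real (La ^ n) * l f) r) <= D * th ^ n * La ^ n * norm f"
 "!!f c E. (!!n. norm ((bap S ^^ n) f - sc (of_real (La ^ n) * c) r) <= E * th ^ n * La ^ n) ==> c = l f"
proof -
have uniq: "c = c'" if "!!n. norm ((bap S ^^ n) f - sc (of_real (La ^ n) * c) r) <= E * th ^ n * La ^ n"
 "!!n. norm ((bap S ^^ n) f - sc (of_real (La ^ n) * c') r) <= E' * th ^ n * La ^ n" for f c c' E E'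
proof -
 have "norm (c - c') * norm r <= (E + E') * th ^ n" for n
 proof -
  have "sc (of_real (La ^ n) * (c - c')) r = ((bap S ^^ n) f - sc (of_real (La ^ n) * c') r) - ((bap S ^^ n) f - sc (of_real (La ^ n) * c) r)"
   by (simp add: right_diff_distrib sc.diff_left)
  also have "norm ... <= E' * th ^ n * La ^ n + E * th ^ n * La ^ n" by (rule norm_triangle_le_diff, rule add_mono) (rule that)+
  also have "... = La ^ n * ((E + E') * th ^ n)" by (simp add: alg)
  also have "norm (sc (of_real (La ^ n) * (c - c')) r) = La ^ n * (norm (c - c') * norm r)" using La by (simp add: norm_sc norm_mult norm_power)
  finally have "La ^ n * (norm (c - c') * norm r) <= La ^ n * ((E + E') * th ^ n)" .
  thus ?thesis using La by simp
 qed
 moreover have "(%n. (E + E') * th ^ n) ----> (E + E') * 0" using th by (intro tendsto_intros LIMSEQ_realpow_zero) auto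
 ultimately have "norm (c - c') * norm r <= 0" by (intro LIMSEQ_le_const[where X="%n. (E + E') * th ^ n"]) auto
 thus ?thesis using r by (simp add: mult_le_0_iff)
qed
define l0 where "l0 f = (SOME c. ALL n. norm ((bap S ^^ n) f - sc (of_real (La ^ n) * c) r) <= D * th ^ n * La ^ n * norm f)" for f
have l0: "norm ((bap S ^^ n) f - sc (of_real (La ^ n) * l0 f) r) <= D * th ^ n * La ^ n * norm f" for n f using someI_ex[OF gap[of f]] unfolding l0_def by blast
have l0': "norm ((bap S ^^ n) f - sc (of_real (La ^ n) * l0 f) r) <= (D * norm f) * th ^ n * La ^ n" for n f using l0[of n f] by (simp add: mult_ac)
have add: "l0 (f + g) = l0 f + l0 g" for f g
proof (rule uniq[OF l0'])
 fix n
 have "(bap S ^^ n) (f + g) - sc (of_real (La ^ n) * (l0 f + l0 g)) r =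
   ((bap S ^^ n) f - sc (of_real (La ^ n) * l0 f) r) + ((bap S ^^ n) g - sc (of_real (La ^ n) * l0 g) r)" by (simp add: funpow_linear distrib_left sc.add_left)
 thus "norm ((bap S ^^ n) (f + g) - sc (of_real (La ^ n) * (l0 f + l0 g)) r) <= (D * norm f + D * norm g) * th ^ n * La ^ n"
  using add_mono[OF l0'[of n f] l0'[of n g]] by (simp add: distrib_right norm_triangle_le)
qed
have scl: "l0 (sc c f) = c * l0 f" for c f
proof (rule uniq[OF l0'])
 fix n
 have "(bap S ^^ n) (sc c f) - sc (of_real (La ^ n) * (c * l0 f)) r = sc c ((bap S ^^ n) f - sc (of_real (La ^ n) * l0 f) r)"
  by (simp add: funpow_sc[OF S] sc.diff_right sc_sc mult_ac)
 thus "norm ((bap S ^^ n) (sc c f) - sc (of_real (La ^ n) * (c * l0 f)) r) <= (norm c * (D * norm f)) * th ^ n * La ^ n"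
  using mlm[OF l0'[of n f] norm_ge_zero[of c]] by (simp add: norm_sc mult_ac)
qed
have bl: "bounded_linear l0"
proof (rule bounded_linear_intro[of _ "(1 + D) / norm r"])
 fix f g and a :: real
 show "l0 (f + g) = l0 f + l0 g" by (rule add)
 show "l0 (a *\<^sub>R f) = a *\<^sub>R l0 f" using scl[of "of_real a" f] by (simp add: sc_of_real scaleR_conv_of_real)
 have "norm (sc (l0 f) r) <= norm f + norm (f - sc (l0 f) r)" using norm_triangle_ineq4[of f "f - sc (l0 f) r"] by simp
 also have "... <= norm f + D * norm f" using l0[of 0 f] by simp
 finally show "norm (l0 f) <= norm f * ((1 + D) / norm r)" using r by (simp add: norm_sc field_simps)
qed
define l where "l = Blinfun l0"
have l: "bap l = l0" unfolding l_def by (rule bounded_linear_Blinfun_apply[OF bl])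
have "(bap S ^^ n) r = sc (of_real (La ^ n) * 1) r" for n by (induction n) (simp_all add: r S sc_of_real[symmetric] sc_sc sc_1 mult_ac)
hence "1 = l0 r" using th La by (intro uniq[OF _ l0', of r 1 0]) auto
show ?thesis
proof (rule that[of l])
 fix f c E assume "!!n. norm ((bap S ^^ n) f - sc (of_real (La ^ n) * c) r) <= E * th ^ n * La ^ n"
 thus "c = l f" unfolding l by (rule uniq[OF _ l0'])
next
 show "norm ((bap S ^^ n) f - sc (of_real (La ^ n) * l f) r) <= D * th ^ n * La ^ n * norm f" for f n unfolding l by (rule l0)
qed (use scl \<open>1 = l0 r\<close> in \<open>auto simp: l\<close>)
qed

text \<open>\<open>T\<close> commutes with its power \<open>S\<close>, so it maps the leading term
  for \<open>f\<close> to the leading term for \<open>T f\<close>. Comparing the two shows that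
  \<open>r\<close> and \<open>l\<close> are eigenvectors of \<open>T\<close> as well, and
  \<open>sg ^ p = La\<close>. The fewer than \<open>p\<close> left-over steps cost a
  constant.\<close>

lemma gap_root: fixes S T :: "'b op" and l :: "'b fn" assumes S: "!!c x. bap S (sc c x) = sc c (bap S x)"
 and T: "!!c x. bap T (sc c x) = sc c (bap T x)" "!!x. S x = (bap T ^^ p) x" "0 < p"
 and r: "r ~= 0" "S r = La *\<^sub>R r" and La: "0 < La" and th: "0 <= th" "th < 1" "0 <= D"
 and l: "!!c x. l (sc c x) = c * l x" "l r = 1"
  "!!f n. norm ((bap S ^^ n) f - sc (of_real (La ^ n) * l f) r) <= D * th ^ n * La ^ n * norm f"
 and sg: "l (T r) = of_real sg" "0 <= sg" shows "T r = sg *\<^sub>R r" "!!f. l (T f) = of_real sg * l f" "0 < sg"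
 "EX D' th'. 0 <= D' & 0 <= th' & th' < 1 & (ALL f n. norm ((bap T ^^ n) f - sc (of_real (sg ^ n) * l f) r) <= D' * th' ^ n * sg ^ n * norm f)"
proof -
have lim0: "(%n. a * th ^ n) ----> 0" for a
proof -
 have "(%n. a * th ^ n) ----> a * 0" using th by (intro tendsto_intros LIMSEQ_realpow_zero) auto
 thus ?thesis by simp
qed
have comm: "T ((bap S ^^ n) f) = (bap S ^^ n) (T f)" for n f
proof (induction n)
 case (Suc n)
 have TS: "T (S x) = S (T x)" for x unfolding T(2) using funpow_swap1[of "bap T" p x] by simp
 show ?case using Suc by (simp add: TS)
qed simp
have lim: "sc (l f) (T r) = sc (l (T f)) r" for f
proof -
 have "norm (sc (l f) (T r) - sc (l (T f)) r) <= ((norm T * D * norm f) + D * norm (T f)) * th ^ n" for n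
 proof -
  have "La ^ n *\<^sub>R (sc (l f) (T r) - sc (l (T f)) r) =
    ((bap S ^^ n) (T f) - sc (of_real (La ^ n) * l (T f)) r) - T ((bap S ^^ n) f - sc (of_real (La ^ n) * l f) r)"
   by (simp add: comm[symmetric] blinfun.diff_right T(1) sc_of_real[symmetric] sc_sc sc.diff_right del: of_real_power)
  also have "norm ... <= D * th ^ n * La ^ n * norm (T f) + norm T * (D * th ^ n * La ^ n * norm f)"
   by (rule norm_triangle_le_diff, rule add_mono, rule l, rule order_trans[OF norm_blinfun]) (intro mlm l norm_ge_zero)
  also have "... = La ^ n * (((norm T * D * norm f) + D * norm (T f)) * th ^ n)" by (simp add: alg)
  also have "norm (La ^ n *\<^sub>R (sc (l f) (T r) - sc (l (T f)) r)) = La ^ n * norm (sc (l f) (T r) - sc (l (T f)) r)" using La by simp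
  finally have "La ^ n * norm (sc (l f) (T r) - sc (l (T f)) r) <= La ^ n * (((norm T * D * norm f) + D * norm (T f)) * th ^ n)" .
  thus ?thesis using La by simp
 qed
 hence "norm (sc (l f) (T r) - sc (l (T f)) r) <= 0" by (intro LIMSEQ_le_const[OF lim0]) auto
 thus ?thesis by simp
qed
show Tr: "T r = sg *\<^sub>R r" using lim[of r] by (simp add: l sc_1 sg sc_of_real)
show "l (T f) = of_real sg * l f" for f
proof -
 have "sc (l f * of_real sg) r = sc (l (T f)) r" using lim[of f] by (simp add: Tr sc_of_real[symmetric] sc_sc)
 hence "sc (l f * of_real sg - l (T f)) r = 0" by (simp add: sc.diff_left)
 thus ?thesis using norm_sc[of "l f * of_real sg - l (T f)" r] r by (simp add: mult.commute)
qed
have Tn: "(bap T ^^ n) r = sg ^ n *\<^sub>R r" for n by (induction n) (simp_all add: Tr blinfun.scaleR_right mult.commute)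
have "sg ^ p *\<^sub>R r = La *\<^sub>R r" using Tn[of p] T(2)[of r] r by simp
hence sgp: "sg ^ p = La" using r by simp
show sg0: "0 < sg" using sgp La sg(2) T(3) by (cases "sg = 0") (auto simp: zero_power)
define m where "m = max 1 (norm T / sg)"
define th' where "th' = root p (max th (1/2))"
have th': "0 < th'" "th' < 1" "th' ^ p = max th (1/2)" using th T(3) by (auto simp: th'_def)
define D' where "D' = m ^ p * D / th' ^ p"
have m: "1 <= m" "norm T <= m * sg" using sg0 by (auto simp: m_def max_def field_simps)
have "norm ((bap T ^^ n) f - sc (of_real (sg ^ n) * l f) r) <= D' * th' ^ n * sg ^ n * norm f" for f n
proof -
 define q s where "q = n div p" and "s = n mod p"
 have n: "n = s + p * q" and s: "s < p" using T(3) by (auto simp: q_def s_def)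
 have Spow: "(bap S ^^ q) x = (bap T ^^ (p * q)) x" for q x by (induction q) (simp_all add: T(2) funpow_add)
 have "(bap T ^^ n) f - sc (of_real (sg ^ n) * l f) r = (bap T ^^ s) ((bap S ^^ q) f - sc (of_real (La ^ q) * l f) r)"
 proof -
  have "(bap T ^^ s) (sc (of_real (La ^ q) * l f) r) = sc (of_real (La ^ q) * l f) (sc (of_real (sg ^ s)) r)" by (simp only: funpow_sc[OF T(1)] Tn sc_of_real)
  also have "... = sc (of_real (sg ^ n) * l f) r" unfolding sc_sc sgp[symmetric] n by (simp add: power_add power_mult mult_ac)
  finally show ?thesis by (simp add: funpow_linear Spow n funpow_add)
 qed
 also have "norm ... <= (m * sg) ^ s * (D * th ^ q * La ^ q * norm f)" using m sg0 by (intro order_trans[OF funpow_norm[OF m(2)]] mlm l) auto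
 also have "... = (m ^ s * D * th ^ q) * (sg ^ n * norm f)" by (simp add: n sgp[symmetric] power_add power_mult power_mult_distrib mult_ac)
 also have "... <= (D' * th' ^ n) * (sg ^ n * norm f)"
 proof (intro mrm)
  have "m ^ s * D * th ^ q <= m ^ p * D * (max th (1/2)) ^ q" using m s th by (intro mult_mono power_increasing power_mono) auto
  also have "(max th (1/2)) ^ q = th' ^ (p * q)" by (simp add: power_mult th')
  finally have fin: "m ^ s * D * th ^ q <= m ^ p * D * th' ^ (p * q)" .
  have "th' ^ p <= th' ^ s" using th'(1,2) s by (intro power_decreasing) auto
  hence "th' ^ (p * q) * th' ^ p <= th' ^ (p * q) * th' ^ s" using th'(1) by (intro mlm) auto
  hence "th' ^ (p * q) <= th' ^ n / th' ^ p" using th'(1) by (simp add: n power_add le_divide_eq mult_ac)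
  hence "m ^ p * D * th' ^ (p * q) <= m ^ p * D * (th' ^ n / th' ^ p)" using m th by (intro mlm) auto
  with fin show "m ^ s * D * th ^ q <= D' * th' ^ n" by (simp add: D'_def)
 qed (use sg0 in auto)
 finally show ?thesis by (simp add: mult_ac)
qed
thus "EX D' th'. 0 <= D' & 0 <= th' & th' < 1 & (ALL f n. norm ((bap T ^^ n) f - sc (of_real (sg ^ n) * l f) r) <= D' * th' ^ n * sg ^ n * norm f)"
 using th' m th by (intro exI[of _ D'] exI[of _ th']) (auto simp: D'_def)
qed

end

context complex_banach1
begin

text \<open>The series is the reduced resolvent of \<open>T0\<close> at the eigenvalue 1. It is
  returned together with its value because its terms will become the correlations of two
  observables.\<close>

lemma neumann: fixes T0 :: "'b op" and l :: "'b fn" assumes l: "!!c x. l (sc c x) = c * l x" "l r = 1" "!!x. l (T0 x) = l x"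
 and T0: "!!c x. T0 (sc c x) = sc c (T0 x)" "T0 r = r"
 and th: "0 <= th" "th < 1" "0 <= D"
 and gap: "!!f n. norm ((bap T0 ^^ n) f - sc (l f) r) <= D * th ^ n * norm f"
obtains N :: "'b op" where "!!c x. N (sc c x) = sc c (N x)" "!!x. N x - T0 (N x) = x - sc (l x) r"
 "!!x. N (x - T0 x) = x - sc (l x) r" "N r = 0" "!!x. l (N x) = 0" "!!f. (%n. (bap T0 ^^ n) f - sc (l f) r) sums N f"
proof -
define Rn where "Rn n f = (bap T0 ^^ n) f - sc (l f) r" for n f
have sm: "summable (%n. Rn n f)" for f by (rule summable_comparison_test'[of "%n. (D * norm f) * th ^ n" 0])
  (use th gap in \<open>auto simp: Rn_def mult_ac intro!: summable_mult summable_geometric\<close>)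
have add: "Rn n (f + g) = Rn n f + Rn n g" and diff: "Rn n (f - g) = Rn n f - Rn n g" and scal: "Rn n (a *\<^sub>R f) = a *\<^sub>R Rn n f"
 and csc: "Rn n (sc c f) = sc c (Rn n f)" for n f g a c
 by (simp_all add: Rn_def funpow_linear blinfun.add_right blinfun.diff_right blinfun.scaleR_right sc.add_left sc.diff_left sc.scaleR_left
   alg l funpow_sc[OF T0(1)] sc.diff_right sc_sc)
have bl: "bounded_linear (%f. \<Sum>n. Rn n f)"
proof (rule bounded_linear_intro[of _ "D / (1 - th)"])
 fix f g and a :: real
 show "(\<Sum>n. Rn n (f + g)) = (\<Sum>n. Rn n f) + (\<Sum>n. Rn n g)" by (simp add: add suminf_add[OF sm sm])
 show "(\<Sum>n. Rn n (a *\<^sub>R f)) = a *\<^sub>R (\<Sum>n. Rn n f)" by (simp add: scal suminf_scaleR_right[OF sm])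
 have "norm (\<Sum>n. Rn n f) <= (\<Sum>n. (D * norm f) * th ^ n)"
  by (rule norm_suminf_le) (use th gap in \<open>auto simp: Rn_def mult_ac intro!: summable_mult summable_geometric\<close>)
 also have "... = norm f * (D / (1 - th))" using th by (subst suminf_mult) (auto simp: suminf_geometric)
 finally show "norm (\<Sum>n. Rn n f) <= norm f * (D / (1 - th))" .
qed
define N where "N = Blinfun (%f. \<Sum>n. Rn n f)"
have N: "bap N f = (\<Sum>n. Rn n f)" for f unfolding N_def by (simp add: bounded_linear_Blinfun_apply[OF bl])
have T0R: "T0 (Rn n f) = Rn (Suc n) f" for n f by (simp add: Rn_def blinfun.diff_right T0)
have RT0: "Rn n (T0 f) = Rn (Suc n) f" for n f using funpow_swap1[of "bap T0" n f] by (simp add: Rn_def l)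
have tele: "(\<Sum>n. Rn n f) - (\<Sum>n. Rn (Suc n) f) = f - sc (l f) r" for f using suminf_split_head[OF sm[of f]] by (simp add: Rn_def)
show ?thesis
proof (rule that[of N])
 fix c x
 show "N (sc c x) = sc c (N x)" unfolding N csc by (rule bounded_linear.suminf[OF sc.bounded_linear_right sm, symmetric])
 show "N x - T0 (N x) = x - sc (l x) r" unfolding N bounded_linear.suminf[OF blinfun.bounded_linear_right sm] T0R by (rule tele)
 show "N (x - T0 x) = x - sc (l x) r" unfolding N diff RT0 using tele[of x] suminf_diff[OF sm[of x] summable_Suc_iff[THEN iffD2, OF sm[of x]]] by simp
 have "(bap T0 ^^ n) r = r" for n by (induction n) (simp_all add: T0)
 thus "N r = 0" by (simp add: N Rn_def l sc_1)
 have "l ((bap T0 ^^ n) x) = l x" for n by (induction n) (simp_all add: l)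
 thus "l (N x) = 0" unfolding N bounded_linear.suminf[OF blinfun.bounded_linear_right sm] by (simp add: Rn_def blinfun.diff_right l)
 show "(%n. (bap T0 ^^ n) f - sc (l f) r) sums N f" for f using summable_sums[OF sm[of f]] unfolding N Rn_def .
qed
qed

text \<open>Removing the eigenprojection from \<open>T0\<close> leaves an operator with decaying
  powers. The deflated operator of a nearby \<open>T\<close> is close to it, because
  \<open>R\<close>, \<open>L\<close> and \<open>La\<close> are close to their unperturbed values, so
  \<open>power_decay\<close> applies. As \<open>norm (La T) >= (1 + th') / 2 > th'\<close>, the
  remainder is exponentially smaller than the leading term.\<close>

theorem near_gap: fixes T0 N :: "'b op" and l :: "'b fn" assumes l: "!!c x. l (sc c x) = c * l x" "l r = 1" "!!x. l (T0 x) = l x"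
 and T0: "!!c x. T0 (sc c x) = sc c (T0 x)" "T0 r = r"
 and th: "0 <= th" "th < 1" "0 <= D"
 and gap: "!!f n. norm ((bap T0 ^^ n) f - sc (l f) r) <= D * th ^ n * norm f"
 and N: "!!c x. N (sc c x) = sc c (N x)" "!!x. N x - T0 (N x) = x - sc (l x) r" "!!x. N (x - T0 x) = x - sc (l x) r" "N r = 0" "!!x. l (N x) = 0"
obtains et C th' R L La where "0 < et" "0 <= C" "0 < th'" "th' < 1"
 "!!T :: 'b op. (!!c x. bap T (sc c x) = sc c (bap T x)) ==> norm (T - T0) <= et ==>
   eigen T0 N r l C T (R T) (La T) (L T)
   & norm (La T - 1) <= C * norm (T - T0) & norm (La T - 1) <= (1 - th') / 2
   & (ALL f n. norm ((bap T ^^ n) f - sc (La T ^ n * (bap (L T) f / bap (L T) (R T))) (R T)) <= C * th' ^ n * norm f)"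
 "!!(T :: 'b op) (T' :: 'b op). (!!c x. bap T (sc c x) = sc c (bap T x)) ==> norm (T - T0) <= et ==> (!!c x. bap T' (sc c x) = sc c (bap T' x)) ==> norm (T' - T0) <= et ==>
   norm (L T - L T') <= C * norm (T - T')"
proof -
obtain et1 C R La L where et1: "0 < et1" and C: "0 <= C" and pert:
 "!!T :: 'b op. (!!c x. bap T (sc c x) = sc c (bap T x)) ==> norm (T - T0) <= et1 ==>
   eigen T0 N r l C T (R T) (La T) (L T)"
 and lip: "!!(T :: 'b op) (T' :: 'b op). (!!c x. bap T (sc c x) = sc c (bap T x)) ==> norm (T - T0) <= et1 ==> (!!c x. bap T' (sc c x) = sc c (bap T' x)) ==> norm (T' - T0) <= et1 ==>
   norm (L T - L T') <= C * norm (T - T')" by (rule perturbation[of l r T0 N]) (use l T0 N in \<open>blast+\<close>)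
define a rh where "a = norm l" and "rh = norm r"
have arh: "0 <= a" "0 <= rh" by (auto simp: a_def rh_def)
define rk where "rk m x = Blinfun (%f. sc (bap m f) x)" for m :: "'b fn" and x
have rk: "bap (rk m x) f = sc (m f) x" for m x f unfolding rk_def
 by (subst bounded_linear_Blinfun_apply) (auto intro: bounded_linear_compose[OF sc.bounded_linear_left blinfun.bounded_linear_right])
define V0 where "V0 = T0 - rk l r"
have V0: "V0 f = T0 f - sc (l f) r" for f by (simp add: V0_def blinfun.diff_left rk)
have V0n: "(bap V0 ^^ n) f = (bap T0 ^^ n) f - sc (l f) r" if "1 <= n" for n f using that
proof (induction n rule: nat_induct_at_least)
 case base
 show ?case by (simp add: V0)
next
 case (Suc n)
 have "l ((bap T0 ^^ n) f) = l f" by (induction n) (simp_all add: l)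
 thus ?case using Suc.IH by (simp add: V0 blinfun.diff_right T0 l sc.zero_left)
qed
obtain et2 D2 th2 where et2: "0 < et2" "0 <= D2" "0 < th2" "th2 < 1"
 "!!(A :: 'b op) n f. norm (A - V0) <= et2 ==> norm ((bap A ^^ n) f) <= D2 * th2 ^ n * norm f" by (rule power_decay[of V0 D th]) (use V0n gap th in auto)
\<comment> \<open>Per unit of \<open>norm (T - T0)\<close>, \<open>c1\<close> bounds the change of
  \<open>L R\<close>, \<open>c2\<close> that of the eigenvalue and \<open>c3\<close> that of the
  deflated operator.\<close>
define c1 where "c1 = C * (rh + C) + a * C"
define c2 where "c2 = 2 * a * (rh + C)"
define c3 where "c3 = 1 + 2 * (c1 + c2) * (a + C) * (rh + C) + C * (rh + C) + a * C"
have c: "0 <= c1" "0 <= c2" "1 <= c3" using C arh by (auto simp: c1_def c2_def c3_def)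
define m where "m = 1 + c2 + c3 + a * C"
have m: "1 <= m" "c2 <= m" "c3 <= m" "a * C <= m" using c C arh by (auto simp: m_def)
define et where "et = min (min et1 1) (min (1 / 2) (min et2 ((1 - th2) / 2)) / m)"
have pos: "0 < min (1 / 2) (min et2 ((1 - th2) / 2))" using et2 by auto
have et: "0 < et" "et <= et1" "et <= 1" using et1 pos m by (auto simp: et_def)
have etm: "m * et <= min (1 / 2) (min et2 ((1 - th2) / 2))"
proof -
 have "et <= min (1 / 2) (min et2 ((1 - th2) / 2)) / m" by (simp add: et_def)
 thus ?thesis using m by (simp add: le_divide_eq mult.commute)
qed
have small: "k * e <= 1/2" "k * e <= et2" "k * e <= (1 - th2) / 2" if "k <= m" "0 <= e" "e <= et" for k e
proof -
 have "k * e <= m * et" using that m by (intro mult_mono) auto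
 thus "k * e <= 1/2" "k * e <= et2" "k * e <= (1 - th2) / 2" using etm by auto
qed
define C' where "C' = max (max C c2) (max D2 (1 + 2 * (a + C) * (rh + C)))"
have C': "C <= C'" "c2 <= C'" "D2 <= C'" "1 + 2 * (a + C) * (rh + C) <= C'" "0 <= C'" using C by (auto simp: C'_def le_max_iff_disj)
have main: "norm (La T - 1) <= C' * norm (T - T0) & norm (La T - 1) <= (1 - th2) / 2
   & (ALL f n. norm ((bap T ^^ n) f - sc (La T ^ n * (bap (L T) f / bap (L T) (R T))) (R T)) <= C' * th2 ^ n * norm f)"
 if T: "!!c x. bap T (sc c x) = sc c (bap T x)" "norm (T - T0) <= et" for T :: "'b op"
proof -
 let ?e = "norm (T - T0)" and ?R = "R T" and ?L = "L T" and ?x = "La T"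
 note p = pert[OF T(1) order_trans[OF T(2) et(2)]]
 have e: "0 <= ?e" "?e <= 1" using T(2) et by auto
 have Rn: "norm ?R <= rh + C"
 proof -
  have "norm ?R <= norm r + norm (?R - r)" using norm_triangle_ineq[of r "?R - r"] by simp
  also have "... <= rh + C * ?e" using p by (simp add: rh_def)
  also have "... <= rh + C" using mlm[OF e(2) C] by simp
  finally show ?thesis .
 qed
 have Ln: "norm ?L <= a + C"
 proof -
  have "norm ?L <= norm l + norm (?L - l)" using norm_triangle_ineq[of l "?L - l"] by simp
  also have "... <= a + C * ?e" using p by (simp add: a_def)
  also have "... <= a + C" using mlm[OF e(2) C] by simp
  finally show ?thesis .
 qed
 have lR: "norm (l ?R - 1) <= a * (C * ?e)"
 proof -
  have "norm (l (?R - r)) <= a * norm (?R - r)" unfolding a_def by (rule norm_blinfun)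
  also have "... <= a * (C * ?e)" using p arh by (intro mlm) auto
  finally show ?thesis by (simp add: blinfun.diff_right l)
 qed
 have lR2: "1/2 <= norm (l ?R)"
 proof -
  have "norm (l ?R - 1) <= 1/2" using lR small(1)[of "a * C" ?e] m T(2) by (simp add: mult.assoc)
  thus ?thesis using norm_triangle_ineq2[of 1 "1 - l ?R"] by (simp add: norm_minus_commute)
 qed
 have "(?x - 1) * l ?R = l (bap (T - T0) ?R)" using p by (simp add: blinfun.diff_left blinfun.diff_right l alg)
 hence "norm (?x - 1) * norm (l ?R) = norm (l (bap (T - T0) ?R))" by (metis norm_mult)
 also have "... <= a * (?e * (rh + C))" unfolding a_def using Rn by (intro order_trans[OF norm_blinfun] mlm order_trans[OF norm_blinfun[of "T - T0"]]) auto
 finally have "norm (?x - 1) * norm (l ?R) <= a * (?e * (rh + C))" .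
 moreover have "norm (?x - 1) * (1/2) <= norm (?x - 1) * norm (l ?R)" using lR2 by (intro mlm) auto
 moreover have "c2 * ?e = 2 * (a * (?e * (rh + C)))" by (simp add: c2_def)
 ultimately have x1: "norm (?x - 1) <= c2 * ?e" by linarith
 have LR: "norm (?L ?R - 1) <= c1 * ?e"
 proof -
  have "?L ?R - 1 = bap (?L - l) ?R + l (?R - r)" by (simp add: blinfun.diff_left blinfun.diff_right l)
  also have "norm ... <= (C * ?e) * (rh + C) + a * (C * ?e)"
  proof (intro norm_triangle_le add_mono)
   show "norm (bap (?L - l) ?R) <= (C * ?e) * (rh + C)" using p Rn C by (intro order_trans[OF norm_blinfun] mult_mono) auto
   show "norm (l (?R - r)) <= a * (C * ?e)" unfolding a_def using p by (intro order_trans[OF norm_blinfun] mlm) auto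
  qed
  finally show ?thesis by (simp add: c1_def alg)
 qed
 have LR2: "1/2 <= norm (?L ?R)"
 proof -
  have "norm (?L ?R - 1) <= 1/2" using p by blast
  thus ?thesis using norm_triangle_ineq2[of 1 "1 - ?L ?R"] by (simp add: norm_minus_commute)
 qed
 have LR0: "?L ?R ~= 0" using LR2 by auto
 define q where "q = ?x / ?L ?R"
 have q1: "norm (q - 1) <= 2 * (c1 + c2) * ?e"
 proof -
  have "q - 1 = ((?x - 1) - (?L ?R - 1)) / ?L ?R" using LR0 by (simp add: q_def diff_divide_distrib)
  hence "norm (q - 1) * norm (?L ?R) = norm ((?x - 1) - (?L ?R - 1))" using LR0 by (simp add: norm_divide)
  also have "... <= c2 * ?e + c1 * ?e" by (rule norm_triangle_le_diff, rule add_mono, rule x1, rule LR)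
  finally have "norm (q - 1) * norm (?L ?R) <= c2 * ?e + c1 * ?e" .
  moreover have "norm (q - 1) * (1/2) <= norm (q - 1) * norm (?L ?R)" using LR2 by (intro mlm) auto
  ultimately show ?thesis by (simp add: alg)
 qed
 define V where "V = T - rk (blinfun_mult_right q o\<^sub>L ?L) ?R"
 have V: "V f = T f - sc (?x * (?L f / ?L ?R)) ?R" for f by (simp add: V_def blinfun.diff_left rk q_def)
 have "norm (V - V0) <= c3 * ?e"
 proof (rule norm_blinfun_bound)
  fix f
  have "(V - V0) f = bap (T - T0) f - ((sc ((q - 1) * ?L f) ?R + sc (bap (?L - l) f) ?R) + sc (l f) (?R - r))"
   by (simp add: V V0 blinfun.diff_left q_def alg sc.diff_left sc.diff_right)
  also have "norm ... <= ?e * norm f + (((2 * (c1 + c2) * ?e) * ((a + C) * norm f) * (rh + C) + (C * ?e * norm f) * (rh + C)) + (a * norm f) * (C * ?e))"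
  proof (rule norm_triangle_le_diff, rule add_mono, rule norm_blinfun, intro norm_triangle_le add_mono)
   have "norm (?L f) <= (a + C) * norm f" using Ln by (intro order_trans[OF norm_blinfun] mrm) auto
   thus "norm (sc ((q - 1) * ?L f) ?R) <= (2 * (c1 + c2) * ?e) * ((a + C) * norm f) * (rh + C)"
    unfolding norm_sc norm_mult using q1 Rn c arh C by (intro mult_mono) auto
   show "norm (sc (bap (?L - l) f) ?R) <= (C * ?e * norm f) * (rh + C)" unfolding norm_sc using p Rn C by (intro mult_mono order_trans[OF norm_blinfun]) auto
   show "norm (sc (l f) (?R - r)) <= (a * norm f) * (C * ?e)" unfolding norm_sc a_def using p C by (intro mult_mono norm_blinfun) auto
  qed
  also have "... = c3 * ?e * norm f" by (simp add: c3_def alg)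
  finally show "norm ((V - V0) f) <= c3 * ?e * norm f" .
 qed (use c in auto)
 also have "... <= et2" by (rule small) (use m T in auto)
 finally have Vet: "norm (V - V0) <= et2" .
 have Tsc: "T (sc b ?R) = sc (b * ?x) ?R" for b using p by (simp add: T(1) sc_sc)
 have LV: "?L (V f) = 0" for f using p LR0 by (simp add: V blinfun.diff_right)
 \<comment> \<open>\<open>L\<close> vanishes on the range of \<open>V\<close>, so the eigenpart and
   the powers of \<open>V\<close> do not mix.\<close>
 have Tn: "(bap T ^^ n) f = sc (?x ^ n * (?L f / ?L ?R)) ?R + (bap V ^^ n) f" if "1 <= n" for n f using that
 proof (induction n rule: nat_induct_at_least)
  case base
  show ?case by (simp add: V)
 next
  case (Suc n)
  obtain n' where n': "n = Suc n'" using Suc.hyps by (cases n) auto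
  have "?L ((bap V ^^ n) f) = 0" using LV by (simp add: n')
  hence "T ((bap V ^^ n) f) = (bap V ^^ Suc n) f" by (simp add: V sc.zero_left)
  thus ?case using Suc.IH by (simp add: blinfun.add_right Tsc mult_ac)
 qed
 have "norm ((bap T ^^ n) f - sc (?x ^ n * (?L f / ?L ?R)) ?R) <= C' * th2 ^ n * norm f" for f n
 proof (cases "n = 0")
  case True
  have "norm (?L f / ?L ?R) <= 2 * (a + C) * norm f"
  proof -
   have "norm (?L f) <= (a + C) * norm f" using Ln by (intro order_trans[OF norm_blinfun] mrm) auto
   hence "norm (?L f) / norm (?L ?R) <= ((a + C) * norm f) / (1/2)" using LR2 arh C by (intro frac_le) auto
   thus ?thesis by (simp add: norm_divide mult_ac)
  qed
  hence "norm (sc (?L f / ?L ?R) ?R) <= (2 * (a + C) * norm f) * (rh + C)" unfolding norm_sc using Rn arh C by (intro mult_mono) auto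
  hence "norm (f - sc (?L f / ?L ?R) ?R) <= norm f + (2 * (a + C) * norm f) * (rh + C)" by (intro norm_triangle_le_diff add_mono) auto
  also have "... = (1 + 2 * (a + C) * (rh + C)) * norm f" by (simp add: alg)
  also have "... <= C' * norm f" using C' by (intro mrm) auto
  finally show ?thesis using True by simp
 next
  case False
  have "norm ((bap V ^^ n) f) <= D2 * th2 ^ n * norm f" by (rule et2(5)[OF Vet])
  also have "... <= C' * th2 ^ n * norm f" using C' et2 by (intro mrm) auto
  finally show ?thesis using False by (simp add: Tn)
 qed
 moreover have "norm (?x - 1) <= C' * ?e" using x1 mrm[OF C'(2) e(1)] by linarith
 moreover have "norm (?x - 1) <= (1 - th2) / 2" using x1 small(3)[of c2 ?e] m T(2) by auto
 ultimately show ?thesis by blast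
qed
have all: "eigen T0 N r l C' T (R T) (La T) (L T)
   & norm (La T - 1) <= C' * norm (T - T0) & norm (La T - 1) <= (1 - th2) / 2
   & (ALL f n. norm ((bap T ^^ n) f - sc (La T ^ n * (bap (L T) f / bap (L T) (R T))) (R T)) <= C' * th2 ^ n * norm f)"
 if T: "!!c x. bap T (sc c x) = sc c (bap T x)" "norm (T - T0) <= et" for T :: "'b op"
proof -
 note p = pert[OF T(1) order_trans[OF T(2) et(2)]]
 have "norm (R T - r) <= C' * norm (T - T0)" using p mrm[OF C'(1) norm_ge_zero[of "T - T0"]] by (meson order_trans)
 moreover have "norm (L T - l) <= C' * norm (T - T0)" using p mrm[OF C'(1) norm_ge_zero[of "T - T0"]] by (meson order_trans)
 moreover have "norm (R T - r - N (bap (T - T0) r)) <= C' * (norm (T - T0))^2" using p mrm[OF C'(1) zero_le_power2[of "norm (T - T0)"]] by (meson order_trans)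
 moreover have "norm (L T - l - (l o\<^sub>L (T - T0) o\<^sub>L N)) <= C' * (norm (T - T0))^2"
  using p mrm[OF C'(1) zero_le_power2[of "norm (T - T0)"]] by (meson order_trans)
 ultimately show ?thesis using p main[OF T] by blast
qed
have lip': "norm (L T - L T') <= C' * norm (T - T')"
 if "!!c x. bap T (sc c x) = sc c (bap T x)" "norm (T - T0) <= et"
  "!!c x. bap T' (sc c x) = sc c (bap T' x)" "norm (T' - T0) <= et" for T T' :: "'b op"
 using lip[OF that(1) order_trans[OF that(2) et(2)] that(3) order_trans[OF that(4) et(2)]]
  mrm[OF C'(1) norm_ge_zero[of "T - T'"]] by linarith
show ?thesis by (rule that[of et C' th2 R La L]) (fact et(1), fact C'(5), fact et2(3), fact et2(4), fact all, fact lip')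
qed

end

interpretation bm: complex_banach1 csc
proof (intro complex_banach1.intro complex_banach.intro complex_banach1_axioms.intro)
show "bounded_bilinear (csc :: complex => 'a bmf => 'a bmf)" by (rule bounded_bilinear_csc)
show 1: "csc a (csc b x) = csc (a * b) x" for a b and x :: "'a bmf" by (rule bmf_eqI) simp
show 2: "csc 1 x = x" for x :: "'a bmf" by (rule bmf_eqI) simp
show "norm (csc a x) = norm a * norm x" for a and x :: "'a bmf"
proof (cases "a = 0")
 case True
 hence "csc a x = 0" by (intro bmf_eqI) simp
 thus ?thesis using True by simp
next
 case False
 have "norm x = norm (csc (1 / a) (csc a x))" unfolding 1 using False 2 by simp
 also have "... <= norm (1 / a) * norm (csc a x)" by (rule norm_csc_le)
 finally have "norm a * norm x <= norm (csc a x)" using False by (simp add: norm_divide field_simps)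
 thus ?thesis using norm_csc_le[of a x] by simp
qed
qed

section \<open>Spectral gap of the transfer operator of a nonnegative window weight\<close>

locale gibbs_chain = chain vu Q for vu :: "'a::topological_space measure" and Q +
fixes ph :: "(nat => 'a) => real" and C :: real and A :: "nat => 'a set" and d :: "nat => real" assumes phi_meas [measurable]: "ph : bmeas seqM"
 and phi_nonneg: "!!x. 0 <= ph x" and phi_le: "!!x. ph x <= C" and C_pos: "0 < C"
 and A_sets [measurable]: "!!j. A j : sets borel" and A_mono: "incseq A" and A_lim: "(%j. measure vu (A j)) ----> 1"
 and d_pos: "!!j. 0 < d j" and phi_ge: "!!j x. (!!i. i <= Q ==> x i : A j) ==> d j <= ph x"
begin

abbreviation "M == PiM {..<Q} (%_ :: nat. vu)"
definition "kr u v = (PROD i<Q. ph (win Q (cat Q u (%j. v (j - Q))) i))"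
definition "W = Bmf (%x. cor (ph x))"

lemma ap_W: "ap W = (%x. cor (ph x))" unfolding W_def by (rule ap_Bmf[where B=C]) (use phi_nonneg phi_le in auto)

lemma kernv_W: "kernv (%_. W) n v u = of_real (kr u v)" by (simp add: kernv_def kr_def ap_W)

lemma space_M: "space M = PiE {..<Q} (%_. UNIV)" by (simp add: space_PiM space_nu)

lemma kr_meas: "(%(u, v). kr u v) : bmeas (M \<Otimes>\<^sub>M M)"
proof -
have "(%p. (fst p, snd p)) : measurable (M \<Otimes>\<^sub>M M) (seqM \<Otimes>\<^sub>M seqM)"
 by (intro measurable_Pair measurable_compose[OF measurable_fst id_measurable] measurable_compose[OF measurable_snd id_measurable])
from measurable_compose[OF measurable_compose[OF this kernv_joint[of "%_. W" 0]] borel_measurable_Re]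
show ?thesis by (simp add: kernv_W case_prod_beta)
qed

lemma kr_nonneg: "0 <= kr u v" unfolding kr_def by (intro prod_nonneg) (auto simp: phi_nonneg)

text \<open>A single transfer step replaces one letter of the state only, so in general it has no
  bounded kernel with respect to the product measure. After \<open>Q\<close> steps all letters are
  new, and the kernel is a product of \<open>Q\<close> weights.\<close>

sublocale pk: positive_kernel M kr "C ^ Q" "%j. PiE {..<Q} (%_. A j)" "%j. d j ^ Q"
proof (intro positive_kernel.intro positive_kernel_axioms.intro prob_space_Pi)
show "(%(u, v). kr u v) : bmeas (M \<Otimes>\<^sub>M M)" by (rule kr_meas)
show "0 <= kr u v" for u v by (rule kr_nonneg)
show "kr u v <= C ^ Q" for u v using prod_mono[of "{..<Q}" "%i. ph (win Q (cat Q u (%j. v (j - Q))) i)" "%_. C"] phi_nonneg phi_le by (simp add: kr_def)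
show "0 < C ^ Q" "0 < d j ^ Q" for j using C_pos d_pos by auto
show "PiE {..<Q} (%_. A j) : sets M" for j by (intro sets_PiM_I_finite) (auto simp: sets_nu)
show "incseq (%j. PiE {..<Q} (%_. A j))" using A_mono by (auto simp: incseq_def PiE_mono)
have "measure M (PiE {..<Q} (%_. A j)) = measure vu (A j) ^ Q" for j
proof -
 interpret F: finite_product_prob_space "%_ :: nat. vu" "{..<Q}" by unfold_locales auto
 have "measure M (PiE {..<Q} (%_. A j)) = (PROD i<Q. measure vu (A j))" by (rule F.prob_times) (auto simp: sets_nu)
 thus ?thesis by simp
qed
thus "(%j. measure M (PiE {..<Q} (%_. A j))) ----> 1" using tendsto_power[OF A_lim, of Q] by simp
fix j u v assume u: "u : PiE {..<Q} (%_. A j)" "v : PiE {..<Q} (%_. A j)"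
have "win Q (cat Q u (%j. v (j - Q))) i m : A j" if "i < Q" "m <= Q" for i m
proof (cases "i + m < Q")
 case True thus ?thesis using u that by (auto simp: win_def cat_def)
next
 case False
 hence "i + m - Q < Q" using that by arith
 thus ?thesis using u that False by (auto simp: win_def cat_def)
qed
hence "d j <= ph (win Q (cat Q u (%j. v (j - Q))) i)" if "i < Q" for i using that by (intro phi_ge) auto
hence "(PROD i<Q. d j) <= kr u v" unfolding kr_def using d_pos[of j] by (intro prod_mono) auto
thus "d j ^ Q <= kr u v" by simp
qed

definition "KK = ops (%_. W) Q"

lemma ops_const: "bap (ops (%_. ps) n) f = (bap (T ps) ^^ n) f" by (induction n arbitrary: f) (simp_all add: funpow_swap1)

lemma ap_KK: "loc f ==> ap (KK f) u = pk.Kop (ap f) u" unfolding KK_def by (subst ops_Q) (simp_all add: kernv_W pk.Kop_def scaleR_conv_of_real)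

lemma loc_pow: "loc f ==> loc ((bap (T ps) ^^ n) f)" by (cases n) (auto intro: loc_T)

lemma bdm_ap: "ap f : pk.bdm" by (rule pk.bdmI[OF from_seq[OF ap_measurable] norm_ap])

definition "S = KK o\<^sub>L KK"

lemma S_app: "S y = KK (KK y)" by (simp add: S_def)

lemma S_pow: "loc f ==> ap ((bap S ^^ n) f) = (pk.K2 ^^ n) (ap f) & loc ((bap S ^^ n) f)"
proof (induction n)
case (Suc n)
let ?x = "(bap S ^^ n) f"
have l: "loc ?x" "loc (KK ?x)" using Suc by (auto simp: KK_def ops_const intro: loc_pow)
have "ap (S ?x) = pk.K2 (ap ?x)"
proof
 fix u
 have 1: "ap (KK ?x) = pk.Kop (ap ?x)" using ap_KK[OF l(1)] by auto
 show "ap (S ?x) u = pk.K2 (ap ?x) u" by (simp only: S_app ap_KK[OF l(2)] 1)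
qed
moreover have "loc (S ?x)" using loc_pow[OF l(2), of Q W] by (simp only: S_app) (simp add: KK_def ops_const)
ultimately show ?case using Suc by simp
qed simp

lemma S_T: "S x = (bap (T W) ^^ (Q + Q)) x" by (simp add: S_def KK_def ops_const funpow_add)

lemma S_csc: "S (csc c x) = csc c (S x)" unfolding S_T by (rule bm.funpow_sc) (rule T_csc)

text \<open>The positive kernel sees functions of \<open>Q\<close> letters, while the operators act
  on all of \<open>bmf\<close>. \<open>proj\<close> reduces a function to a local one without
  changing its image under any \<open>T\<close>, so only the zeroth power notices the
  difference.\<close>

definition proj :: "'a bmf => 'a bmf" where "proj f = Bmf (%u. ap f (st Q u 0))"

lemma ap_proj: "ap (proj f) = (%u. ap f (st Q u 0))" unfolding proj_def by (rule ap_Bmf[OF _ norm_ap]) measurable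

lemma st_st: "st Q (st Q u 0) 0 = st Q u 0" "st Q (st Q u 1) 0 = st Q u 1" by (auto simp: st_def)

lemma proj: "loc (proj f)" "T ps (proj f) = T ps f" "norm (proj f) <= norm f"
proof -
show "loc (proj f)" by (simp add: loc_def ap_proj st_st)
show "T ps (proj f) = T ps f" by (rule bmf_eqI) (simp add: ap_T ap_proj st_st del: One_nat_def)
show "norm (proj f) <= norm f" by (rule norm_bmfI) (simp add: ap_proj norm_ap)
qed

lemma T_pow_proj: "1 <= n ==> (bap (T ps) ^^ n) (proj f) = (bap (T ps) ^^ n) f" by (cases n) (simp_all add: funpow_Suc_right proj del: funpow.simps(2))

definition nonneg :: "'a bmf => bool" where "nonneg f \<longleftrightarrow> (ALL u. 0 <= Re (ap f u) & Im (ap f u) = 0)"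

lemma nonneg_T: assumes f: "nonneg f" shows "nonneg (T W f)" unfolding nonneg_def
proof (intro allI)
fix u
let ?F = "%y. ap W (win Q (u(Q := y)) 0) * ap f (st Q (u(Q := y)) 1)"
have "Re (ap (T W f) u) = (LINT y|vu. Re (?F y))" "Im (ap (T W f) u) = (LINT y|vu. Im (?F y))"
 unfolding ap_T using integral_Re[OF tfun_integrable] integral_Im[OF tfun_integrable] by auto
moreover have "0 <= Re (?F y)" "Im (?F y) = 0" for y using f phi_nonneg by (auto simp: ap_W nonneg_def)
ultimately show "0 <= Re (ap (T W f) u) & Im (ap (T W f) u) = 0" by simp
qed

lemma nonneg_pow: "nonneg f ==> nonneg ((bap (T W) ^^ n) f)" by (induction n) (auto intro: nonneg_T)

definition "indA j = Bmf (%u. cor (indicator {u. ALL i<Q. u i : A j} u))"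

lemma ap_indA: "ap (indA j) = (%u. cor (indicator {u. ALL i<Q. u i : A j} u))"
proof -
have "{u :: nat => 'a. ALL i<Q. u i : A j} = (\<Inter>i\<in>{..<Q}. (%u. u i) -` A j \<inter> space seqM)" using Q_pos by (auto simp: space_PiM)
also have "... : sets seqM" using Q_pos by (intro sets.finite_INT measurable_sets[OF measurable_component_singleton]) auto
finally have [measurable]: "{u :: nat => 'a. ALL i<Q. u i : A j} : sets seqM" .
show ?thesis unfolding indA_def by (rule ap_Bmf[where B=1]) (auto simp: indicator_def)
qed

lemma indA_eq: "u : space M ==> indicator {u. ALL i<Q. u i : A j} u = (indicator (PiE {..<Q} (%_. A j)) u :: real)" by (auto simp: indicator_def space_M PiE_def)

lemma loc_indA: "loc (indA j)" by (simp add: loc_def ap_indA st_def indicator_def)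

text \<open>The gap of \<open>S\<close>, two blocks of \<open>Q\<close> steps, comes from the
  positive kernel and passes to its root \<open>T W\<close>. The lower bound on the traces uses only
  the cycles whose state at the cut lies in a fixed \<open>A j\<close>.\<close>

theorem transfer_gap:
obtains sg r and l :: "'a bmf \<Rightarrow>\<^sub>L complex" and D th p where "0 < sg" "0 <= th" "th < 1" "0 <= D"
 "T W r = sg *\<^sub>R r" "!!f. l (T W f) = of_real sg * l f" "!!c f. l (csc c f) = c * l f" "l r = 1"
 "!!f n. norm ((bap (T W) ^^ n) f - csc (of_real (sg ^ n) * l f) r) <= D * th ^ n * sg ^ n * norm f"
 "0 < p" "\<forall>\<^sub>F n in sequentially. p * sg ^ n <= Re (LINT v|M. ap (ops (%_. W) n (kern (%_. W) n v)) v)"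
proof -
obtain La r0 D th where g: "0 < La" "0 <= D" "0 <= th" "th < 1" "r0 : pk.bdm" "!!u. u : space M ==> 0 <= r0 u"
 "(LINT u|M. r0 u) = (1 :: real)" "!!u. u : space M ==> pk.K2 r0 u = La * r0 u"
 "!!(f :: (nat => 'a) => complex) B. f : pk.bdm ==> (!!x. x : space M ==> norm (f x) <= B) ==> 0 <= B ==>
   EX c. ALL n. ALL u:space M. norm ((pk.K2 ^^ n) f u - of_real (La ^ n) * c * of_real (r0 u)) <= D * th ^ n * La ^ n * B"
 "EX j p. 0 < p & 0 < (LINT u|M. indicator (PiE {..<Q} (%_. A j)) u * r0 u) & (ALL n. p * La ^ n <= (LINT u|M. (pk.K2 ^^ n) (indicator (PiE {..<Q} (%_. A j))) u))"
 by (rule pk.spectral_gap) blast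
have st_M: "st Q u 0 : space M" for u :: "nat => 'a" by (auto simp: space_M st_def PiE_def extensional_def)
have st_id: "st Q u 0 = u" if "u : space M" for u using that by (auto simp: space_M st_def PiE_def extensional_def fun_eq_iff)
define r where "r = Bmf (%u. cor (r0 (st Q u 0)))"
have ap_r: "ap r = (%u. cor (r0 (st Q u 0)))"
proof -
 have "(%u. st Q u 0) : measurable seqM M"
 proof -
  have "(%u. \<lambda>i\<in>{..<Q}. u i) : measurable (seqM :: (nat => 'a) measure) M"
   by (intro measurable_restrict) (simp add: measurable_cong_sets[OF refl sets_nu])
  moreover have "(%u. \<lambda>i\<in>{..<Q}. u i) = (%u :: nat => 'a. st Q u 0)" by (auto simp: st_def fun_eq_iff)
  ultimately show ?thesis by simp
 qed
 moreover have "r0 : bmeas M" using g(5) unfolding pk.bdm_def by blast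
 ultimately have "(%u. r0 (st Q u 0)) : bmeas seqM" by (rule measurable_compose)
 hence m: "(%u. cor (r0 (st Q u 0))) : bmeas seqM" by simp
 have "EX B. ALL u:space M. norm (r0 u) <= B" using g(5) unfolding pk.bdm_def by blast
 then obtain B where "ALL u:space M. norm (r0 u) <= B" ..
 hence "norm (cor (r0 (st Q u 0))) <= B" for u using st_M[of u] by simp
 thus ?thesis unfolding r_def by (intro ap_Bmf[OF m])
qed
have loc_r: "loc r" by (simp add: loc_def ap_r st_st)
have ap_rM: "ap r u = of_real (r0 u)" if "u : space M" for u using that by (simp add: ap_r st_id)
have loc_st: "ap f u = ap f (st Q u 0)" if "loc f" for f u using that by (simp add: loc_def)
have Sr: "S r = La *\<^sub>R r"
proof (rule bmf_eqI)
 fix u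
 have "ap (S r) u = ap (S r) (st Q u 0)" using S_pow[OF loc_r, of 1] by (intro loc_st) simp
 also have "... = pk.K2 (ap r) (st Q u 0)" using S_pow[OF loc_r, of 1] by simp
 also have "... = pk.K2 (%u. cor (r0 u)) (st Q u 0)" by (intro pk.K2_cong ap_rM)
 also have "... = of_real (pk.K2 r0 (st Q u 0))" by (simp add: pk.Kop_of_real[abs_def])
 also have "... = La *\<^sub>R ap r u" using g(8)[OF st_M] by (simp add: ap_r scaleR_conv_of_real)
 finally show "ap (S r) u = ap (La *\<^sub>R r) u" by simp
qed
have r0: "r ~= 0"
proof
 assume "r = 0"
 hence "r0 u = 0" if "u : space M" for u using ap_rM[OF that] by simp
 hence "(LINT u|M. r0 u) = (LINT u|M. 0)" by (intro Lintegral_cong) auto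
 thus False using g(7) by simp
qed
have gapl: "EX c. ALL n. norm ((bap S ^^ n) f - csc (of_real (La ^ n) * c) r) <= D * th ^ n * La ^ n * norm f" if f: "loc f" for f
proof -
 obtain c where c: "!!n u. u : space M ==> norm ((pk.K2 ^^ n) (ap f) u - of_real (La ^ n) * c * of_real (r0 u)) <= D * th ^ n * La ^ n * norm f"
  using g(9)[OF bdm_ap norm_ap norm_ge_zero] by blast
 have "norm ((bap S ^^ n) f - csc (of_real (La ^ n) * c) r) <= D * th ^ n * La ^ n * norm f" for n
 proof (rule norm_bmfI)
  fix u
  have "ap ((bap S ^^ n) f) u = (pk.K2 ^^ n) (ap f) (st Q u 0)" using S_pow[OF f, of n] loc_st[of "(bap S ^^ n) f" u] by simp
  thus "norm (ap ((bap S ^^ n) f - csc (of_real (La ^ n) * c) r) u) <= D * th ^ n * La ^ n * norm f" using c[OF st_M, of n u] by (simp add: ap_r)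
 qed
 thus ?thesis by blast
qed
have S_proj: "(bap S ^^ n) (proj f) = (bap S ^^ n) f" if "1 <= n" for n f
proof -
 have "(bap S ^^ n) x = (bap (T W) ^^ ((Q + Q) * n)) x" for x by (induction n) (simp_all add: S_T funpow_add)
 thus ?thesis using that Q_pos by (simp add: T_pow_proj)
qed
\<comment> \<open>The additional 2 covers \<open>n = 0\<close>, where \<open>f - proj f\<close> is
  still present.\<close>
have gap: "EX c. ALL n. norm ((bap S ^^ n) f - csc (of_real (La ^ n) * c) r) <= (D + 2) * th ^ n * La ^ n * norm f" for f
proof -
 obtain c where c: "!!n. norm ((bap S ^^ n) (proj f) - csc (of_real (La ^ n) * c) r) <= D * th ^ n * La ^ n * norm (proj f)" using gapl[OF proj(1)] by blast
 have "norm ((bap S ^^ n) f - csc (of_real (La ^ n) * c) r) <= (D + 2) * th ^ n * La ^ n * norm f" for n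
 proof (cases "n = 0")
  case True
  have "norm (f - csc c r) = norm ((f - proj f) + (proj f - csc c r))" by simp
  also have "... <= (norm f + norm (proj f)) + D * norm (proj f)" using c[of 0] by (intro norm_triangle_le add_mono norm_triangle_ineq4) simp
  also have "... <= (norm f + norm f) + D * norm f" using proj(3) g by (intro add_mono mlm) auto
  finally show ?thesis using True by (simp add: alg)
 next
  case False
  hence "norm ((bap S ^^ n) f - csc (of_real (La ^ n) * c) r) <= D * th ^ n * La ^ n * norm (proj f)" using c[of n] S_proj[of n f] by simp
  also have "... <= (D + 2) * th ^ n * La ^ n * norm f" using proj(3) g by (intro mult_mono) auto
  finally show ?thesis .
 qed
 thus ?thesis by blast
qed
obtain l where l: "!!c x. bap l (csc c x) = c * l x" "l r = 1"
 "!!f n. norm ((bap S ^^ n) f - csc (of_real (La ^ n) * l f) r) <= (D + 2) * th ^ n * La ^ n * norm f"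
 "!!f c E. (!!n. norm ((bap S ^^ n) f - csc (of_real (La ^ n) * c) r) <= E * th ^ n * La ^ n) ==> c = l f"
 by (rule bm.gap_functional[OF S_csc r0 Sr g(1,3,4) _ gap]) (use g in auto)
have lim0: "(%n. a * th ^ n) ----> 0" for a
proof -
 have "(%n. a * th ^ n) ----> a * 0" using g by (intro tendsto_intros LIMSEQ_realpow_zero) auto
 thus ?thesis by simp
qed
have int_r: "(LINT u|M. ap r u) = 1"
proof -
 have "(LINT u|M. ap r u) = (LINT u|M. cor (r0 u))" by (intro Lintegral_cong) (auto simp: ap_rM)
 thus ?thesis using g(7) by simp
qed
have l_int: "norm ((LINT u|M. ap ((bap S ^^ n) f) u) - of_real (La ^ n) * l f) <= (D + 2) * th ^ n * La ^ n * norm f" for f n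
proof -
 have "(LINT u|M. ap ((bap S ^^ n) f) u) - of_real (La ^ n) * l f = (LINT u|M. ap ((bap S ^^ n) f - csc (of_real (La ^ n) * l f) r) u)"
  using pk.bdm_int[OF bdm_ap] by (simp add: int_r)
 also have "norm ... <= (D + 2) * th ^ n * La ^ n * norm f" using g by (intro pk.integral_bound order_trans[OF norm_ap] l(3)) auto
 finally show ?thesis .
qed
\<comment> \<open>\<open>l f\<close> is a limit of normalized integrals of iterates, hence real and
  nonnegative on nonnegative functions. This makes \<open>l (T W r)\<close> a real number
  \<open>sg\<close>, as \<open>gap_root\<close> requires.\<close>
have l_nonneg: "0 <= Re (l f) & Im (l f) = 0" if f: "nonneg f" for f
proof -
 define z where "z n = (LINT u|M. ap ((bap S ^^ n) f) u) / of_real (La ^ n)" for n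
 have "norm (z n - l f) <= ((D + 2) * norm f) * th ^ n" for n
 proof -
  have "z n - l f = ((LINT u|M. ap ((bap S ^^ n) f) u) - of_real (La ^ n) * l f) / of_real (La ^ n)" using g(1) by (simp add: z_def diff_divide_distrib)
  hence "norm (z n - l f) = norm ((LINT u|M. ap ((bap S ^^ n) f) u) - of_real (La ^ n) * l f) / La ^ n" using g(1) by (simp add: norm_divide norm_power)
  also have "... <= ((D + 2) * th ^ n * La ^ n * norm f) / La ^ n" using l_int[of n f] g(1) by (intro divide_right_mono) auto
  finally show ?thesis using g(1) by (simp add: mult_ac)
 qed
 hence z: "z ----> l f" by (intro LIM_zero_cancel[OF Lim_null_comparison[OF _ lim0[of "(D + 2) * norm f"]]]) auto
 have zn: "0 <= Re (z n) & Im (z n) = 0" for n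
 proof -
  have nn: "nonneg ((bap S ^^ n) f)" using nonneg_pow[OF f, of "(Q + Q) * n"] by (induction n) (auto simp: S_T intro!: nonneg_pow f)
  have i: "integrable M (ap ((bap S ^^ n) f))" by (rule pk.bdm_int[OF bdm_ap])
  have "0 <= (LINT u|M. Re (ap ((bap S ^^ n) f) u))" "(LINT u|M. Im (ap ((bap S ^^ n) f) u)) = 0" using nn by (auto simp: nonneg_def)
  thus ?thesis using g(1) integral_Re[OF i] integral_Im[OF i] by (simp add: z_def Re_divide_of_real Im_divide_of_real flip: of_real_power)
 qed
 have "0 <= Re (l f)" using tendsto_Re[OF z] by (rule LIMSEQ_le_const) (use zn in auto)
 moreover have "Im (l f) = 0" using tendsto_Im[OF z] zn by (simp add: LIMSEQ_const_iff)
 ultimately show ?thesis by simp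
qed
have nn_r: "nonneg r" using g(6) st_M by (auto simp: nonneg_def ap_r)
define sg where "sg = Re (l (T W r))"
have sg: "l (T W r) = of_real sg" "0 <= sg" using l_nonneg[OF nonneg_T[OF nn_r]] by (auto simp: sg_def complex_eq_iff)
note root = bm.gap_root[OF S_csc T_csc S_T _ r0 Sr g(1,3,4) _ l(1,2,3) sg]
have Q2: "0 < Q + Q" "0 <= D + 2" using Q_pos g by auto
note root = root[OF Q2]
obtain D' th' where D': "0 <= D'" "0 <= th'" "th' < 1"
 "!!f n. norm ((bap (T W) ^^ n) f - csc (of_real (sg ^ n) * l f) r) <= D' * th' ^ n * sg ^ n * norm f" using root(4) by blast
have lim0': "(%n. a * th' ^ n) ----> 0" for a
proof -
 have "(%n. a * th' ^ n) ----> a * 0" using D' by (intro tendsto_intros LIMSEQ_realpow_zero) auto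
 thus ?thesis by simp
qed
obtain j p0 where jp: "0 < p0" "0 < (LINT u|M. indicator (PiE {..<Q} (%_. A j)) u * r0 u)"
 "!!n. p0 * La ^ n <= (LINT u|M. (pk.K2 ^^ n) (indicator (PiE {..<Q} (%_. A j))) u)" using g(10) by blast
let ?b = "indA j" and ?I = "indicator (PiE {..<Q} (%_. A j)) :: (nat => 'a) => real"
define al where "al = (LINT u|M. ?I u * r0 u)"
have Ib: "?I : pk.bdm" by (rule pk.bdm_indicator) (rule pk.A_sets)
have lb: "p0 <= Re (l ?b)"
proof -
 have "p0 - Re (l ?b) <= ((D + 2) * norm ?b) * th ^ n" for n
 proof -
  have K2I: "(pk.K2 ^^ n) (ap ?b) u = of_real ((pk.K2 ^^ n) ?I u)" if "u : space M" for u
  proof -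
   have "(pk.K2 ^^ n) (ap ?b) u = (pk.K2 ^^ n) (%u. cor (?I u)) u" using that
   proof (induction n arbitrary: u)
    case 0 thus ?case by (simp add: ap_indA indA_eq)
   next
    case (Suc n) thus ?case by (auto intro: pk.K2_cong)
   qed
   thus ?thesis by (simp only: pk.K2_pow_of_real)
  qed
  have "(LINT u|M. ap ((bap S ^^ n) ?b) u) = (LINT u|M. cor ((pk.K2 ^^ n) ?I u))" using S_pow[OF loc_indA, of n j] K2I by (intro Lintegral_cong) auto
  also have "... = of_real (LINT u|M. (pk.K2 ^^ n) ?I u)" by simp
  finally have "norm (of_real (LINT u|M. (pk.K2 ^^ n) ?I u) - of_real (La ^ n) * l ?b) <= (D + 2) * th ^ n * La ^ n * norm ?b" using l_int[of n ?b] by simp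
  hence "(LINT u|M. (pk.K2 ^^ n) ?I u) - La ^ n * Re (l ?b) <= (D + 2) * th ^ n * La ^ n * norm ?b"
   using complex_Re_le_cmod[of "of_real (LINT u|M. (pk.K2 ^^ n) ?I u) - of_real (La ^ n) * l ?b"] by (simp flip: of_real_power)
  hence "p0 * La ^ n - La ^ n * Re (l ?b) <= (D + 2) * th ^ n * La ^ n * norm ?b" using jp(3)[of n] by linarith
  hence "La ^ n * (p0 - Re (l ?b)) <= La ^ n * (((D + 2) * norm ?b) * th ^ n)" by (simp add: alg)
  thus ?thesis using g(1) by simp
 qed
 hence "p0 - Re (l ?b) <= 0" by (intro LIMSEQ_le_const[OF lim0]) auto
 thus ?thesis by simp
qed
have dj: "0 < d j ^ Q" using d_pos by simp
define p where "p = d j ^ Q * (p0 * al) / 2"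
have p: "0 < p" using jp dj by (simp add: p_def al_def)
\<comment> \<open>For \<open>v\<close> in \<open>A j\<close> the closing function dominates
  \<open>d j ^ Q\<close> times \<open>indA j\<close>, and \<open>T W\<close> preserves this order;
  for other \<open>v\<close> the integrand is merely nonnegative.\<close>
have low: "d j ^ Q * (sg ^ n * (p0 * al) - D' * th' ^ n * sg ^ n * norm ?b) <= Re (LINT v|M. ap (ops (%_. W) n (kern (%_. W) n v)) v)" for n
proof -
 let ?k = "%v. kern (%_. W) n v"
 let ?x = "%f. (bap (T W) ^^ n) f"
 have i: "integrable M (%v. ap (ops (%_. W) n (?k v)) v)"
 proof (rule pk.bdm_int, rule pk.bdmI[OF ops_kern_measurable])
  fix v show "norm (ap (ops (%_. W) n (?k v)) v) <= norm (ops (%_. W) n) * norm W ^ Q"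
   using norm_kern[of "%_. W" n v] by (intro order_trans[OF norm_ap] order_trans[OF norm_blinfun] mlm) auto
 qed
 have bi: "integrable M (%v. ?I v * Re (ap (?x ?b) v))"
 proof -
  have m: "ap (?x ?b) : bmeas M" by (rule from_seq[OF ap_measurable])
  have "(%v. Re (ap (?x ?b) v)) : pk.bdm" by (rule pk.bdmI[of _ "norm (?x ?b)", OF measurable_compose[OF m borel_measurable_Re]])
    (simp add: order_trans[OF abs_Re_le_cmod norm_ap])
  thus ?thesis by (intro pk.bdm_int pk.bdm_mult Ib)
 qed
 have nnk: "nonneg (?k v)" for v by (simp add: nonneg_def ap_kern kernv_W kr_nonneg)
 have ge: "d j ^ Q * (?I v * Re (ap (?x ?b) v)) <= Re (ap (ops (%_. W) n (?k v)) v)" if v: "v : space M" for v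
 proof (cases "v : PiE {..<Q} (%_. A j)")
  case True
  have "nonneg (?k v - d j ^ Q *\<^sub>R ?b)" unfolding nonneg_def
  proof (intro allI)
   fix u :: "nat => 'a"
   have kst: "kr u v = kr (st Q u 0) v"
   proof -
    have "cat Q (st Q u 0) w = cat Q u w" for w :: "nat => 'a" by (auto simp: cat_def st_def fun_eq_iff)
    thus ?thesis by (simp add: kr_def)
   qed
   have "d j ^ Q * indicator {u. ALL i<Q. u i : A j} u <= kr u v"
   proof (cases "ALL i<Q. u i : A j")
    case T': True
    hence "st Q u 0 : PiE {..<Q} (%_. A j)" by (auto simp: st_def PiE_def extensional_def)
    thus ?thesis using pk.k_ge[OF _ True] T' unfolding kst by simp
   qed (simp add: kr_nonneg)
   thus "0 <= Re (ap (?k v - d j ^ Q *\<^sub>R ?b) u) & Im (ap (?k v - d j ^ Q *\<^sub>R ?b) u) = 0" by (simp add: ap_kern kernv_W ap_indA)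
  qed
  from nonneg_pow[OF this, of n] have "0 <= Re (ap (?x (?k v) - d j ^ Q *\<^sub>R ?x ?b) v)" by (simp add: nonneg_def funpow_linear del: ap_simps)
  thus ?thesis using True by (simp add: ops_const)
 next
  case False
  thus ?thesis using nonneg_pow[OF nnk[of v], of n] by (simp add: ops_const nonneg_def)
 qed
 have "sg ^ n * (p0 * al) - D' * th' ^ n * sg ^ n * norm ?b <= (LINT v|M. (sg ^ n * Re (l ?b)) * (?I v * r0 v) - D' * th' ^ n * sg ^ n * norm ?b)"
 proof -
  have "integrable M (%v. (sg ^ n * Re (l ?b)) * (?I v * r0 v))" by (intro pk.bdm_int pk.bdm_mult Ib g(5) pk.bdm_const)
  hence "(LINT v|M. (sg ^ n * Re (l ?b)) * (?I v * r0 v) - D' * th' ^ n * sg ^ n * norm ?b) = (sg ^ n * Re (l ?b)) * al - D' * th' ^ n * sg ^ n * norm ?b"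
   by (subst Lintegral_diff) (auto simp: al_def pk.prob_space)
  moreover have "sg ^ n * (p0 * al) <= (sg ^ n * Re (l ?b)) * al" using lb jp(2) root(3) mrm[OF lb, of al] by (simp add: al_def mult.assoc)
  ultimately show ?thesis by linarith
 qed
 also have "... <= (LINT v|M. ?I v * Re (ap (?x ?b) v))"
 proof (rule integral_mono[OF _ bi])
  show "integrable M (%v. (sg ^ n * Re (l ?b)) * (?I v * r0 v) - D' * th' ^ n * sg ^ n * norm ?b)"
   by (intro pk.bdm_int pk.bdm_minus pk.bdm_mult Ib g(5) pk.bdm_const)
  fix v assume v: "v : space M"
  have "norm (ap (?x ?b - csc (of_real (sg ^ n) * l ?b) r) v) <= D' * th' ^ n * sg ^ n * norm ?b" by (rule order_trans[OF norm_ap D'(4)])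
  hence "norm (of_real (sg ^ n) * l ?b * of_real (r0 v) - ap (?x ?b) v) <= D' * th' ^ n * sg ^ n * norm ?b" by (simp add: ap_rM[OF v] norm_minus_commute)
  hence "Re (of_real (sg ^ n) * l ?b * of_real (r0 v) - ap (?x ?b) v) <= D' * th' ^ n * sg ^ n * norm ?b" using complex_Re_le_cmod order_trans by blast
  hence "sg ^ n * Re (l ?b) * r0 v - Re (ap (?x ?b) v) <= D' * th' ^ n * sg ^ n * norm ?b" by (simp flip: of_real_power)
  moreover have "0 <= D' * th' ^ n * sg ^ n * norm ?b" using D' root(3) by (intro mult_nonneg_nonneg zero_le_power) auto
  ultimately show "(sg ^ n * Re (l ?b)) * (?I v * r0 v) - D' * th' ^ n * sg ^ n * norm ?b <= ?I v * Re (ap (?x ?b) v)" by (auto simp: indicator_def)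
 qed
 finally have "d j ^ Q * (sg ^ n * (p0 * al) - D' * th' ^ n * sg ^ n * norm ?b) <= d j ^ Q * (LINT v|M. ?I v * Re (ap (?x ?b) v))" using dj by (intro mlm) auto
 also have "... = (LINT v|M. d j ^ Q * (?I v * Re (ap (?x ?b) v)))" by simp
 also have "... <= (LINT v|M. Re (ap (ops (%_. W) n (?k v)) v))" using bi i by (intro integral_mono ge) auto
 also have "... = Re (LINT v|M. ap (ops (%_. W) n (?k v)) v)" by (rule integral_Re[OF i])
 finally show ?thesis .
qed
have "0 < p0 * al" using jp by (simp add: al_def)
hence "\<forall>\<^sub>F n in sequentially. (D' * norm ?b) * th' ^ n < p0 * al / 2" using order_tendstoD(2)[OF lim0', of "p0 * al / 2"] by simp
hence "\<forall>\<^sub>F n in sequentially. p * sg ^ n <= Re (LINT v|M. ap (ops (%_. W) n (kern (%_. W) n v)) v)"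
proof eventually_elim
 case (elim n)
 have "p * sg ^ n = d j ^ Q * (sg ^ n * (p0 * al / 2))" by (simp add: p_def)
 also have "... <= d j ^ Q * (sg ^ n * (p0 * al - (D' * norm ?b) * th' ^ n))"
 proof -
  have "p0 * al / 2 <= p0 * al - (D' * norm ?b) * th' ^ n" using elim by linarith
  thus ?thesis using dj root(3) by (intro mlm) auto
 qed
 also have "... = d j ^ Q * (sg ^ n * (p0 * al) - D' * th' ^ n * sg ^ n * norm ?b)" by (simp add: alg)
 finally show ?case using low[of n] by linarith
qed
thus ?thesis using root D' p l by (intro that[of sg th' D' r l p]) auto
qed

end

section \<open>Mixed derivative of an eigenvalue\<close>

lemma vderivI: fixes f :: "real => 'c::real_normed_vector" assumes "0 < e" "!!t. abs t < e ==> norm (f t - f 0 - t *\<^sub>R v) <= K * t^2"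
shows "(f has_vector_derivative v) (at 0)" unfolding has_vector_derivative_def has_derivative_at
proof (intro conjI bounded_linear_scaleR_left)
show "(%h. norm (f (0 + h) - f 0 - h *\<^sub>R v) / norm h) \<midarrow>0\<rightarrow> 0"
proof (rule Lim_null_comparison[where g="%h. K * abs h"])
 have "norm (norm (f (0 + h) - f 0 - h *\<^sub>R v) / norm h) <= K * abs h" if "h ~= 0" "dist h 0 < e" for h
 proof -
  have "norm (f (0 + h) - f 0 - h *\<^sub>R v) / norm h <= K * h^2 / norm h" using assms(2)[of h] that by (intro divide_right_mono) auto
  also have "... = K * abs h" using that by (simp add: power2_eq_square abs_if)
  finally show ?thesis by simp
 qed
 thus "\<forall>\<^sub>F h in at 0. norm (norm (f (0 + h) - f 0 - h *\<^sub>R v) / norm h) <= K * abs h"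
  unfolding eventually_at using assms(1) by (intro exI[of _ e]) auto
 show "(%h. K * abs h) \<midarrow>0\<rightarrow> 0" by (auto intro!: tendsto_eq_intros)
qed
qed

text \<open>Continuity of \<open>q\<close> is enough because \<open>p\<close> vanishes at 0: only
  the numerator of \<open>p / q\<close> is differentiated. In the application \<open>q s\<close> is
  a left eigenvector, known to be Lipschitz in \<open>s\<close>, applied to a fixed vector.\<close>

lemma vderiv_quotient_zero: fixes f p q :: "real => complex"
assumes "0 < e" "!!s. abs s < e ==> (f s - f 0) * q s = p s" and p: "(p has_vector_derivative p') (at 0)"
 and q: "isCont q 0" "q 0 ~= 0" shows "(f has_vector_derivative p' / q 0) (at 0)" unfolding has_vector_derivative_def has_derivative_at
proof (intro conjI bounded_linear_scaleR_left)
have p0: "p 0 = 0" using assms(2)[of 0] assms(1) by simp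
have "((%h. (p h - h *\<^sub>R p') /\<^sub>R norm h) \<longlongrightarrow> 0) (at 0)"
 using p p0 unfolding has_vector_derivative_def has_derivative_at_within by simp
hence 1: "((%h. (p h - h *\<^sub>R p') /\<^sub>R norm h / q h + (h / abs h) *\<^sub>R (p' / q h - p' / q 0)) \<longlongrightarrow> 0 / q 0 + 0) (at 0)"
proof (intro tendsto_add tendsto_divide)
 show q0: "(q \<longlongrightarrow> q 0) (at 0)" using q(1) by (simp add: isCont_def)
 have "((%h. p' / q h - p' / q 0) \<longlongrightarrow> p' / q 0 - p' / q 0) (at 0)" by (intro tendsto_intros q0 q(2))
 hence "((%h. norm (p' / q h - p' / q 0)) \<longlongrightarrow> 0) (at 0)" using tendsto_norm_zero by simp
 thus "((%h. (h / abs h) *\<^sub>R (p' / q h - p' / q 0)) \<longlongrightarrow> 0) (at 0)"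
  by (rule Lim_null_comparison[rotated]) (auto intro!: always_eventually simp: divide_le_eq_1 mult_left_le_one_le)
qed (use q in auto)
have "\<forall>\<^sub>F h in nhds 0. q h ~= 0" using q by (intro tendsto_imp_eventually_ne[of q "q 0"]) (simp_all add: isCont_def tendsto_nhds_iff continuous_at)
hence "\<forall>\<^sub>F h in at 0. q h ~= 0" by (simp add: eventually_at_filter eventually_mono)
moreover have "\<forall>\<^sub>F h in at 0. abs h < e" using assms(1) by (auto simp: eventually_at intro!: exI[of _ e])
moreover have "\<forall>\<^sub>F h :: real in at 0. h ~= 0" by (simp add: eventually_at_filter)
ultimately have "\<forall>\<^sub>F h in at 0. norm (f (0 + h) - f 0 - h *\<^sub>R (p' / q 0)) / norm h = norm ((p h - h *\<^sub>R p') /\<^sub>R norm h / q h + (h / abs h) *\<^sub>R (p' / q h - p' / q 0))"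
proof eventually_elim
 case (elim h)
 have f: "f h - f 0 = p h / q h" using assms(2)[of h] elim by (simp add: field_simps)
 have "f (0 + h) - f 0 - h *\<^sub>R (p' / q 0) = norm h *\<^sub>R ((p h - h *\<^sub>R p') /\<^sub>R norm h / q h + (h / abs h) *\<^sub>R (p' / q h - p' / q 0))"
  using elim by (simp add: f scaleR_conv_of_real field_simps)
 thus ?case using elim by simp
qed
thus "(%h. norm (f (0 + h) - f 0 - h *\<^sub>R (p' / q 0)) / norm h) \<midarrow>0\<rightarrow> 0" using tendsto_norm[OF 1] by (simp add: filterlim_cong)
qed

context complex_banach1 begin

text \<open>A left eigenvector at \<open>(t, s)\<close> paired with a right one at
  \<open>(t, 0)\<close> gives \<open>(Lat t s - Lat t 0) * L (R) = L ((Tt t s - Tt t 0) R)\<close>,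
  hence the derivative in \<open>s\<close> without differentiating eigenvectors. The derivative in
  \<open>t\<close> is then taken at \<open>s = 0\<close>, where \<open>N\<close> provides first
  order expansions of \<open>L\<close> and \<open>R\<close>.\<close>

lemma mixed_derivative_eigenvalue: fixes Tt :: "real => real => 'b op" and Rt :: "real => real => 'b" and Lt :: "real => real => 'b fn"
 and Lat :: "real => real => complex" and T0 N A1 A2 A12 :: "'b op" and B :: "real => 'b op" and l :: "'b fn" assumes e: "0 < e" "0 <= K"
 and R: "!!t s. abs t < e ==> abs s < e ==> Tt t s (Rt t s) = sc (Lat t s) (Rt t s)"
 and L: "!!t s x. abs t < e ==> abs s < e ==> Lt t s (Tt t s x) = Lat t s * Lt t s x"
 and Lsc: "!!t s c x. abs t < e ==> abs s < e ==> Lt t s (sc c x) = c * Lt t s x"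
 and LR: "!!t s. abs t < e ==> abs s < e ==> Lt t s (Rt t s) ~= 0"
 and La1: "!!t s. abs t < e ==> abs s < e ==> norm (Lat t s - 1) < 1"
 and Lip: "!!t s. abs t < e ==> abs s < e ==> norm (Lt t s - Lt t 0) <= K * abs s"
 and R1: "!!t. abs t < e ==> norm (Rt t 0 - r - t *\<^sub>R N (A1 r)) <= K * t^2"
 and L1: "!!t. abs t < e ==> norm (Lt t 0 - l - t *\<^sub>R (l o\<^sub>L A1 o\<^sub>L N)) <= K * t^2"
 and T1: "!!t. abs t < e ==> norm (Tt t 0 - T0 - t *\<^sub>R A1) <= K * t^2"
 and T2: "!!t s. abs t < e ==> abs s < e ==> norm (Tt t s - Tt t 0 - s *\<^sub>R B t) <= K * s^2"
 and B1: "!!t. abs t < e ==> norm (B t - A2 - t *\<^sub>R A12) <= K * t^2"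
 and l: "l r = 1" "!!x. l (T0 x) = l x" and T0: "T0 r = r" and N: "N r = 0" "!!x. l (N x) = 0"
shows "has_mixed_derivative_at_0 (%(t, s). c0 - Ln (Lat t s)) (- (l (A12 r) + l (A1 (N (A2 r))) + l (A2 (N (A1 r))) - l (A1 r) * l (A2 r)))"
proof -
have 0: "abs 0 < e" using e by simp
have at0: "Rt 0 0 = r" "Lt 0 0 = l" "Tt 0 0 = T0" "B 0 = A2" using R1[OF 0] L1[OF 0] T1[OF 0] B1[OF 0] by auto
\<comment> \<open>\<open>L (T R) = Lat * L (R)\<close>, so the denominator contains the factor
  \<open>1 / Lat\<close> of the logarithmic derivative.\<close>
define g where "g t = - (Lt t 0 (B t (Rt t 0)) / Lt t 0 (Tt t 0 (Rt t 0)))" for t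
note ba = bounded_bilinear.has_vector_derivative[OF bounded_bilinear_blinfun_apply]
have dR: "((%t. Rt t 0) has_vector_derivative N (A1 r)) (at 0)" using R1 by (intro vderivI[OF e(1), of _ _ K]) (simp add: at0)
have dL: "((%t. Lt t 0) has_vector_derivative (l o\<^sub>L A1 o\<^sub>L N)) (at 0)" using L1 by (intro vderivI[OF e(1), of _ _ K]) (simp add: at0)
have dT: "((%t. Tt t 0) has_vector_derivative A1) (at 0)" using T1 by (intro vderivI[OF e(1), of _ _ K]) (simp add: at0)
have dB: "(B has_vector_derivative A12) (at 0)" using B1 by (intro vderivI[OF e(1), of _ _ K]) (simp add: at0)
have num: "((%t. Lt t 0 (B t (Rt t 0))) has_vector_derivative (l (A12 r) + l (A1 (N (A2 r))) + l (A2 (N (A1 r))))) (at 0)"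
 using ba[OF dL ba[OF dB dR]] by (simp add: at0 alg blinfun.bilinear_simps)
have den: "((%t. Lt t 0 (Tt t 0 (Rt t 0))) has_vector_derivative l (A1 r)) (at 0)" using ba[OF dL ba[OF dT dR]] by (simp add: at0 N T0 l blinfun.bilinear_simps)
have inv: "((%t. inverse (Lt t 0 (Tt t 0 (Rt t 0)))) has_vector_derivative (- l (A1 r))) (at 0)"
 using field_vector_diff_chain_at[OF den, of inverse "-1"] DERIV_inverse[of "1 :: complex" UNIV] by (simp add: at0 l T0 o_def)
have dg: "(g has_vector_derivative (- (l (A12 r) + l (A1 (N (A2 r))) + l (A2 (N (A1 r))) - l (A1 r) * l (A2 r)))) (at 0)"
proof -
 have "(g has_vector_derivative (- (l (A2 r) * (- l (A1 r)) + (l (A12 r) + l (A1 (N (A2 r))) + l (A2 (N (A1 r)))) * 1))) (at 0)"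
  unfolding g_def divide_inverse using has_vector_derivative_minus[OF has_vector_derivative_mult[OF num inv]] by (simp add: at0 l T0)
 thus ?thesis by (simp add: alg)
qed
have pt: "((%s. c0 - Ln (Lat t s)) has_vector_derivative g t) (at 0)" if t: "abs t < e" for t
proof -
 define q where "q s = Lt t s (Rt t 0)" for s
 define p where "p s = Lt t s ((Tt t s - Tt t 0) (Rt t 0))" for s
 have dp: "(p has_vector_derivative Lt t 0 (B t (Rt t 0))) (at 0)"
 proof (rule vderivI[OF e(1), where K="K * (norm (B t) + K * e) * norm (Rt t 0) + norm (Lt t 0) * K * norm (Rt t 0)"])
  fix s assume s: "abs s < e"
  have ss: "s^2 = abs s * abs s" by (simp add: power2_eq_square)
  have n1: "norm (Tt t s - Tt t 0) <= (norm (B t) + K * e) * abs s"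
  proof -
   have "norm (Tt t s - Tt t 0) <= norm (s *\<^sub>R B t) + norm (Tt t s - Tt t 0 - s *\<^sub>R B t)" using norm_triangle_ineq[of "s *\<^sub>R B t" "Tt t s - Tt t 0 - s *\<^sub>R B t"] by simp
   also have "... <= abs s * norm (B t) + K * s^2" using T2[OF t s] by simp
   also have "K * s^2 <= K * e * abs s" unfolding ss mult.assoc using e s by (intro mlm mrm) auto
   finally show ?thesis by (simp add: alg)
  qed
  have "p s - p 0 - s *\<^sub>R Lt t 0 (B t (Rt t 0)) = (Lt t s - Lt t 0) ((Tt t s - Tt t 0) (Rt t 0)) + Lt t 0 ((Tt t s - Tt t 0 - s *\<^sub>R B t) (Rt t 0))"
   by (simp add: p_def blinfun.bilinear_simps)
  also have "norm ... <= (K * abs s) * ((norm (B t) + K * e) * abs s * norm (Rt t 0)) + norm (Lt t 0) * (K * s^2 * norm (Rt t 0))" using Lip[OF t s] n1 T2[OF t s]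
   by (intro order_trans[OF norm_triangle_ineq] add_mono order_trans[OF norm_blinfun] mult_mono) (auto simp: e less_imp_le)
  also have "... = (K * (norm (B t) + K * e) * norm (Rt t 0) + norm (Lt t 0) * K * norm (Rt t 0)) * s^2" unfolding ss by (simp only: alg)
  finally show "norm (p s - p 0 - s *\<^sub>R Lt t 0 (B t (Rt t 0))) <= (K * (norm (B t) + K * e) * norm (Rt t 0) + norm (Lt t 0) * K * norm (Rt t 0)) * s^2" .
 qed
 have cq: "isCont q 0"
 proof -
  have "((%s. q s - q 0) \<longlongrightarrow> 0) (at 0)"
  proof (rule Lim_null_comparison)
   have "norm (q s - q 0) <= K * abs s * norm (Rt t 0)" if "abs s < e" for s
    unfolding q_def blinfun.diff_left[symmetric] using Lip[OF t that] by (intro order_trans[OF norm_blinfun] mrm) auto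
   thus "\<forall>\<^sub>F s in at 0. norm (q s - q 0) <= K * abs s * norm (Rt t 0)" using e by (auto simp: eventually_at intro!: exI[of _ e])
   show "((%s. K * abs s * norm (Rt t 0)) \<longlongrightarrow> 0) (at 0)" by (auto intro!: tendsto_eq_intros)
  qed
  thus ?thesis unfolding isCont_def by (rule LIM_zero_cancel)
 qed
 have dLa: "(Lat t has_vector_derivative Lt t 0 (B t (Rt t 0)) / q 0) (at 0)"
 proof (rule vderiv_quotient_zero[OF e(1) _ dp cq])
  show "q 0 ~= 0" using LR[OF t 0] by (simp add: q_def)
  fix s assume s: "abs s < e"
  show "(Lat t s - Lat t 0) * q s = p s" using L[OF t s, of "Rt t 0"] R[OF t 0] Lsc[OF t s] by (simp add: p_def q_def blinfun.bilinear_simps alg)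
 qed
 have nn: "Lat t 0 \<notin> \<real>\<^sub>\<le>\<^sub>0"
 proof
  assume "Lat t 0 : \<real>\<^sub>\<le>\<^sub>0"
  hence "Re (Lat t 0) <= 0" by (auto elim: nonpos_Reals_cases)
  thus False using La1[OF t 0] complex_Re_le_cmod[of "1 - Lat t 0"] by (simp add: norm_minus_commute)
 qed
 have "((%s. c0 - Ln (Lat t s)) has_vector_derivative (0 - Lt t 0 (B t (Rt t 0)) / q 0 * inverse (Lat t 0))) (at 0)"
  by (intro has_vector_derivative_diff has_vector_derivative_const field_vector_diff_chain_at[OF dLa, unfolded o_def] has_field_derivative_Ln nn)
 moreover have "0 - Lt t 0 (B t (Rt t 0)) / q 0 * inverse (Lat t 0) = g t" using L[OF t 0, of "Rt t 0"] by (simp add: g_def q_def divide_inverse)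
 ultimately show ?thesis by simp
qed
have "\<forall>\<^sub>F t in nhds 0. ((%s. case (t, s) of (t, s) => c0 - Ln (Lat t s)) has_vector_derivative g t) (at 0)"
 using e pt by (auto simp: eventually_nhds_metric dist_real_def)
thus ?thesis unfolding has_mixed_derivative_at_0_def using dg by blast
qed

end

section \<open>Free energy of a chain with two observables\<close>

text \<open>The third power in \<open>h_bound\<close>: a second order Taylor remainder of the phase
  in one parameter costs two factors of an observable, and the derivative in the other parameter
  costs one more.\<close>

locale gibbs_pair = gibbs_chain vu Q ph C A d for vu :: "'a::topological_space measure" and Q ph C A d + fixes h1 h2 :: "(nat => 'a) => real"
assumes h1_meas [measurable]: "h1 : bmeas seqM" and h2_meas [measurable]: "h2 : bmeas seqM"
 and h_bound: "!!x. ph x * (1 + abs (h1 x) + abs (h2 x)) ^ 3 <= C"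
begin

definition "H x = 1 + abs (h1 x) + abs (h2 x)"
definition "Pphi N x = (PROD i<N. ph (win Q (per N x) i))"
definition "HS h N x = (SUM i<N. h (win Q (per N x) i))" for h :: "(nat => 'a) => real"
definition "ZZ N t s = (LINT x|(PiM {..<N} (%_. vu)). of_real (Pphi N x) * iexp (- (t * HS h1 N x + s * HS h2 N x)))"

lemma H_ge: "1 <= H x" "abs (h1 x) <= H x" "abs (h2 x) <= H x" by (auto simp: H_def)

lemma H3: "j <= 3 ==> H x ^ j <= H x ^ 3" using H_ge by (intro power_increasing) auto

end

locale gibbs_gap = gibbs_pair vu Q ph C A d h1 h2 for vu :: "'a::topological_space measure" and Q ph C A d h1 h2 +
fixes sg p D th :: real and r :: "'a bmf" and l :: "'a bmf \<Rightarrow>\<^sub>L complex" and N :: "'a bmf \<Rightarrow>\<^sub>L 'a bmf"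
assumes sg: "0 < sg" and p: "0 < p" and D: "0 <= D" and th: "0 <= th" "th < 1"
 and TW: "T W r = sg *\<^sub>R r" "!!f. l (T W f) = of_real sg * l f" and l: "!!c f. l (csc c f) = c * l f" "l r = 1"
 and gapW: "!!f n. norm ((bap (T W) ^^ n) f - csc (of_real (sg ^ n) * l f) r) <= D * th ^ n * sg ^ n * norm f"
 and pW: "\<forall>\<^sub>F n in sequentially. p * sg ^ n <= Re (LINT v|M. ap (ops (%_. W) n (kern (%_. W) n v)) v)"
 and N: "!!c x. N (csc c x) = csc c (N x)"
  "!!x. N x - (1 / sg) *\<^sub>R T W (N x) = x - csc (l x) r" "!!x. N (x - (1 / sg) *\<^sub>R T W x) = x - csc (l x) r" "N r = 0" "!!x. l (N x) = 0"
  "!!f. (%n. (1 / sg ^ n) *\<^sub>R (bap (T W) ^^ n) f - csc (l f) r) sums N f"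
begin

definition "Kc = C / sg"
text \<open>The weight is divided by \<open>sg\<close>, which normalizes the unperturbed eigenvalue
  to 1. The function \<open>f\<close> may be unbounded; for \<open>adm f\<close> its product with
  the weight is an element of \<open>bmf\<close>.\<close>

definition "w f = Bmf (%x. of_real (ph x / sg) * f x)" for f :: "(nat => 'a) => complex"
definition "adm f \<longleftrightarrow> f : bmeas seqM & (ALL x. norm (f x) <= H x ^ 2)" for f :: "(nat => 'a) => complex"
definition "ee t s x = iexp (- (t * h1 x + s * h2 x))"
definition "ps t s = w (ee t s)"
definition "Bt t = w (%x. - \<i> * of_real (h2 x) * ee t 0 x)"
definition "i1 = w (%x. of_real (h1 x))"
definition "i2 = w (%x. of_real (h2 x))"
definition "i12 = w (%x. of_real (h1 x * h2 x))"
abbreviation "Tt t s == T (ps t s)"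
abbreviation "T0 == T (ps 0 0)"
text \<open>The sum of the correlations of \<open>h1\<close> and \<open>h2\<close> over all
  distances: the first and the last term belong to distance 0, the two terms with \<open>N\<close>
  to positive distances in either direction.\<close>

definition "cc = l (T i12 r) + l (T i1 (N (T i2 r))) + l (T i2 (N (T i1 r))) - l (T i1 r) * l (T i2 r)"

lemma Kc: "0 < Kc" using C_pos sg by (simp add: Kc_def)

lemma ap_w: assumes "adm f" shows "ap (w f) x = of_real (ph x / sg) * f x"
proof -
have "norm (of_real (ph x / sg) * f x) <= C / sg" for x
proof -
 have "norm (of_real (ph x / sg) * f x) <= ph x / sg * H x ^ 3"
  unfolding norm_mult norm_of_real using assms H3[of 2 x] phi_nonneg[of x] sg by (intro mult_mono) (auto simp: adm_def intro: order_trans)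
 also have "... <= C / sg" using h_bound[of x] sg by (simp add: H_def divide_right_mono)
 finally show ?thesis .
qed
thus ?thesis unfolding w_def using assms by (subst ap_Bmf[where B="C / sg"]) (auto simp: adm_def)
qed

lemma norm_wI: assumes "!!x. norm (ap X x) <= ph x / sg * (c * H x ^ 3)" "0 <= c" shows "norm X <= c * Kc"
proof (rule norm_bmfI)
fix x
have "ph x / sg * (c * H x ^ 3) = c / sg * (ph x * H x ^ 3)" by simp
also have "... <= c / sg * C" using h_bound[of x] sg assms(2) by (intro mlm) (auto simp: H_def)
finally show "norm (ap X x) <= c * Kc" using assms(1)[of x] by (simp add: Kc_def)
qed

lemma norm_ee: "norm (ee t s x) = 1" by (simp add: ee_def)

lemma ee_meas [measurable]: "ee t s : bmeas seqM" unfolding ee_def[abs_def] by measurable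

lemma adm: "adm (ee t s)" "adm (%x. - \<i> * of_real (h2 x) * ee t 0 x)" "adm (%x. of_real (h1 x))" "adm (%x. of_real (h2 x))" "adm (%x. of_real (h1 x * h2 x))"
proof -
have H2: "1 <= H x ^ 2" "abs (h1 x) <= H x ^ 2" "abs (h2 x) <= H x ^ 2" for x
proof -
 have "H x <= H x ^ 2" using mlm[OF H_ge(1)[of x], of "H x"] H_ge(1)[of x] by (simp add: power2_eq_square)
 thus "1 <= H x ^ 2" "abs (h1 x) <= H x ^ 2" "abs (h2 x) <= H x ^ 2" using H_ge[of x] by auto
qed
show "adm (ee t s)" "adm (%x. - \<i> * of_real (h2 x) * ee t 0 x)" "adm (%x. of_real (h1 x))" "adm (%x. of_real (h2 x))"
 using H2 by (auto simp: adm_def norm_mult norm_ee)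
have "abs (h1 x) * abs (h2 x) <= H x ^ 2" for x unfolding power2_eq_square using H_ge[of x] by (intro mult_mono) auto
thus "adm (%x. of_real (h1 x * h2 x))" by (auto simp: adm_def norm_mult)
qed

lemma ap_psi: "ap (ps t s) x = of_real (ph x / sg) * ee t s x" unfolding ps_def by (rule ap_w[OF adm(1)])
lemma ap_Bt: "ap (Bt t) x = of_real (ph x / sg) * (- \<i> * of_real (h2 x) * ee t 0 x)" unfolding Bt_def by (rule ap_w[OF adm(2)])
lemma ap_i1: "ap i1 x = of_real (ph x / sg) * of_real (h1 x)" unfolding i1_def by (rule ap_w[OF adm(3)])
lemma ap_i2: "ap i2 x = of_real (ph x / sg) * of_real (h2 x)" unfolding i2_def by (rule ap_w[OF adm(4)])
lemma ap_i12: "ap i12 x = of_real (ph x / sg) * of_real (h1 x * h2 x)" unfolding i12_def by (rule ap_w[OF adm(5)])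

lemma ee_0: "ee 0 0 x = 1" by (simp add: ee_def)

lemma psi_Lip: "norm (ps t s - ps t' s') <= (abs (t - t') + abs (s - s')) * Kc"
proof (rule norm_wI)
fix x
define de where "de = - ((t - t') * h1 x + (s - s') * h2 x)"
have "ee t s x = ee t' s' x * iexp de" unfolding ee_def de_def by (simp add: alg flip: exp_add)
hence "ap (ps t s - ps t' s') x = of_real (ph x / sg) * (ee t' s' x * (iexp de - 1))" by (simp add: ap_psi alg)
also have "norm ... = ph x / sg * norm (iexp de - 1)" using phi_nonneg[of x] sg by (simp add: norm_mult norm_ee norm_divide)
also have "... <= ph x / sg * ((abs (t - t') + abs (s - s')) * H x ^ 3)"
proof (intro mlm)
 have "norm (iexp de - 1) <= abs de" using iexp_approx1[of de 0] by simp
 also have "... <= abs (t - t') * abs (h1 x) + abs (s - s') * abs (h2 x)" unfolding de_def abs_minus_cancel by (intro order_trans[OF abs_triangle_ineq]) (simp add: abs_mult)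
 also have "... <= abs (t - t') * H x + abs (s - s') * H x" using H_ge[of x] by (intro add_mono mlm) auto
 also have "... = (abs (t - t') + abs (s - s')) * H x ^ 1" by (simp add: alg)
 also have "... <= (abs (t - t') + abs (s - s')) * H x ^ 3" by (intro mlm H3) auto
 finally show "norm (iexp de - 1) <= (abs (t - t') + abs (s - s')) * H x ^ 3" .
qed (use phi_nonneg[of x] sg in auto)
finally show "norm (ap (ps t s - ps t' s') x) <= ph x / sg * ((abs (t - t') + abs (s - s')) * H x ^ 3)" .
qed auto

lemma second_order: assumes c: "norm c <= H x" and h: "abs h <= H x"
shows "norm (of_real (ph x / sg) * (c * (iexp (- (t * h)) - 1 + \<i> * of_real (t * h)))) <= ph x / sg * (t^2 * H x ^ 3)"
proof -
have "norm (iexp (- (t * h)) - 1 + \<i> * of_real (t * h)) <= (t * h)^2"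
proof -
 have "norm (iexp (- (t * h)) - 1 + \<i> * of_real (t * h)) <= (t * h)^2 / 2" using iexp_approx1[of "- (t * h)" 1] by (simp add: fact_numeral power2_eq_square alg)
 also have "... <= (t * h)^2" by simp
 finally show ?thesis .
qed
also have "... <= t^2 * (H x)^2" unfolding power_mult_distrib using power_mono[OF h, of 2] by (intro mlm) auto
finally have "norm (c * (iexp (- (t * h)) - 1 + \<i> * of_real (t * h))) <= H x * (t^2 * (H x)^2)"
 unfolding norm_mult using c H_ge(1)[of x] by (intro mult_mono) auto
also have "... = t^2 * H x ^ 3" by (simp add: power2_eq_square power3_eq_cube)
finally show ?thesis unfolding norm_mult[of "of_real (ph x / sg)"] norm_of_real using phi_nonneg[of x] sg by (intro mult_mono) auto
qed

lemma psi_s: "norm (ps t s - ps t 0 - s *\<^sub>R Bt t) <= s^2 * Kc"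
proof (rule norm_wI)
fix x
have "ee t s x = ee t 0 x * iexp (- (s * h2 x))" unfolding ee_def by (simp add: alg flip: exp_add)
hence "ap (ps t s - ps t 0 - s *\<^sub>R Bt t) x = of_real (ph x / sg) * (ee t 0 x * (iexp (- (s * h2 x)) - 1 + \<i> * of_real (s * h2 x)))"
 by (simp add: ap_psi ap_Bt scaleR_conv_of_real alg)
thus "norm (ap (ps t s - ps t 0 - s *\<^sub>R Bt t) x) <= ph x / sg * (s^2 * H x ^ 3)"
 by (simp only:) (rule second_order, use H_ge[of x] in \<open>auto simp: norm_ee\<close>)
qed auto

lemma psi_t: "norm (ps t 0 - ps 0 0 - t *\<^sub>R csc (- \<i>) i1) <= t^2 * Kc"
proof (rule norm_wI)
fix x
have "ap (ps t 0 - ps 0 0 - t *\<^sub>R csc (- \<i>) i1) x = of_real (ph x / sg) * (1 * (iexp (- (t * h1 x)) - 1 + \<i> * of_real (t * h1 x)))"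
 by (simp add: ap_psi ap_i1 scaleR_conv_of_real alg ee_def)
thus "norm (ap (ps t 0 - ps 0 0 - t *\<^sub>R csc (- \<i>) i1) x) <= ph x / sg * (t^2 * H x ^ 3)" by (simp only:) (rule second_order, use H_ge[of x] in auto)
qed auto

lemma Bt_t: "norm (Bt t - csc (- \<i>) i2 - t *\<^sub>R csc (- 1) i12) <= t^2 * Kc"
proof (rule norm_wI)
fix x
have "ap (Bt t - csc (- \<i>) i2 - t *\<^sub>R csc (- 1) i12) x = of_real (ph x / sg) * ((- \<i> * of_real (h2 x)) * (iexp (- (t * h1 x)) - 1 + \<i> * of_real (t * h1 x)))"
 by (simp add: ap_Bt ap_i2 ap_i12 scaleR_conv_of_real alg ee_def)
thus "norm (ap (Bt t - csc (- \<i>) i2 - t *\<^sub>R csc (- 1) i12) x) <= ph x / sg * (t^2 * H x ^ 3)"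
 by (simp only:) (rule second_order, use H_ge[of x] in \<open>auto simp: norm_mult\<close>)
qed auto

lemma norm_psi: "norm (ps t s) <= Kc"
proof -
have "norm (ap (ps t s) x) <= ph x / sg * (1 * H x ^ 3)" for x
 using phi_nonneg[of x] sg H3[of 0 x] mlm[of 1 "H x ^ 3" "ph x / sg"] by (simp add: ap_psi norm_mult norm_ee norm_divide)
from norm_wI[OF this] show ?thesis by simp
qed

lemma norm_i: "norm i1 <= Kc" "norm i2 <= Kc" "norm i12 <= Kc"
proof -
have *: "norm (w f) <= Kc" if "adm f" for f
proof -
 have "norm (ap (w f) x) <= ph x / sg * (1 * H x ^ 3)" for x
  unfolding ap_w[OF that] norm_mult norm_of_real using that H3[of 2 x] phi_nonneg[of x] sg by (intro mult_mono) (auto simp: adm_def intro: order_trans)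
 from norm_wI[OF this] show ?thesis by simp
qed
show "norm i1 <= Kc" "norm i2 <= Kc" "norm i12 <= Kc" unfolding i1_def i2_def i12_def by (intro * adm)+
qed

lemma psi_0: "ps 0 0 = (1 / sg) *\<^sub>R W" by (rule bmf_eqI) (simp add: ap_psi ee_0 ap_W scaleR_conv_of_real)

lemma T0_W: "T0 x = (1 / sg) *\<^sub>R T W x" by (simp add: psi_0 T_scaleR blinfun.scaleR_left)

lemma T0_pow: "(bap T0 ^^ n) x = (1 / sg ^ n) *\<^sub>R (bap (T W) ^^ n) x" by (induction n) (simp_all add: T0_W blinfun.scaleR_right)

lemma T0_r: "T0 r = r" using sg by (simp add: T0_W TW)
lemma l_T0: "l (T0 x) = l x" using sg by (simp add: T0_W blinfun.scaleR_right TW scaleR_conv_of_real)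

lemma gap0: "norm ((bap T0 ^^ n) f - csc (l f) r) <= D * th ^ n * norm f"
proof -
have "csc (l f) r = (1 / sg ^ n) *\<^sub>R csc (of_real (sg ^ n) * l f) r" using sg by (intro bmf_eqI) (simp add: scaleR_conv_of_real)
hence "(bap T0 ^^ n) f - csc (l f) r = (1 / sg ^ n) *\<^sub>R ((bap (T W) ^^ n) f - csc (of_real (sg ^ n) * l f) r)" by (simp only: T0_pow scaleR_diff_right)
also have "norm ... = (1 / sg ^ n) * norm ((bap (T W) ^^ n) f - csc (of_real (sg ^ n) * l f) r)" using sg by simp
also have "... <= (1 / sg ^ n) * (D * th ^ n * sg ^ n * norm f)" using sg gapW by (intro mlm) auto
also have "... = D * th ^ n * norm f" using sg by simp
finally show ?thesis .
qed

lemma N0: "N x - T0 (N x) = x - csc (l x) r" "N (x - T0 x) = x - csc (l x) r" "(%n. (bap T0 ^^ n) f - csc (l f) r) sums N f" using N by (simp_all add: T0_W T0_pow)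

lemma kern_const: "kern (%_. Ps) n = kern (%_. Ps) 0" by (simp add: kern_def[abs_def] kernv_def[abs_def])

lemma kern_W: "kern (%_. ps 0 0) n v = (1 / sg ^ Q) *\<^sub>R kern (%_. W) n v"
by (rule bmf_eqI) (simp add: ap_kern kernv_def psi_0 scaleR_conv_of_real prod.distrib prod_dividef)

lemma integ_0: "integ (%_. ps 0 0) (n + Q) = of_real (1 / sg ^ (n + Q)) * (LINT v|M. ap (ops (%_. W) n (kern (%_. W) n v)) v)" unfolding trace_formula[OF refl]
by (simp add: ops_const T0_pow kern_W funpow_linear blinfun.scaleR_right scaleR_conv_of_real power_add mult_ac flip: integral_mult_right_zero)

lemma integ_pos: "\<forall>\<^sub>F n in sequentially. p / sg ^ Q <= Re (integ (%_. ps 0 0) (n + Q))" using pW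
proof eventually_elim
case (elim n)
have "p / sg ^ Q = (1 / sg ^ (n + Q)) * (p * sg ^ n)" using sg by (simp add: power_add)
also have "... <= (1 / sg ^ (n + Q)) * Re (LINT v|M. ap (ops (%_. W) n (kern (%_. W) n v)) v)" using elim sg by (intro mlm) auto
finally show ?case unfolding integ_0 by (simp only: times_complex.sel Re_complex_of_real Im_complex_of_real mult_zero_left diff_zero)
qed

lemma cyc_psi: "cyc (%_. ps t s) n x = of_real (1 / sg ^ n) * (of_real (Pphi n x) * iexp (- (t * HS h1 n x + s * HS h2 n x)))"
proof -
have "(PROD i<n. ee t s (win Q (per n x) i)) = iexp (- (t * HS h1 n x + s * HS h2 n x))"
 unfolding ee_def HS_def by (simp add: exp_sum[symmetric] sum_negf sum.distrib sum_distrib_left[symmetric] sum_subtractf)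
thus ?thesis by (simp add: cyc_def ap_psi prod.distrib prod_dividef Pphi_def)
qed

lemma ZZ_integ: "ZZ n t s = of_real (sg ^ n) * integ (%_. ps t s) n" unfolding integ_def cyc_psi ZZ_def using sg by simp

end

context gibbs_gap begin

lemma integ_continuous: "continuous_on UNIV (%(t, s). integ (%_. ps t s) n)"
proof -
have b: "norm (cyc (%_. ps t s) n x) <= Kc ^ n" for t s x
proof -
 have "norm (cyc (%_. ps t s) n x) <= (PROD i<n. norm (ps t s))" by (rule cyc_bound)
 also have "... <= Kc ^ n" using norm_psi[of t s] by (simp add: power_mono)
 finally show ?thesis .
qed
have "(%k. integ (%_. ps (fst (z k)) (snd (z k))) n) ----> integ (%_. ps (fst a) (snd a)) n" if z: "z ----> a" for z :: "nat => real \<times> real" and a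
 unfolding integ_def
proof (rule integral_dominated_convergence[where w="%_. Kc ^ n"])
 interpret PN: prob_space "PiM {..<n} (%_ :: nat. vu)" by (rule prob_space_Pi)
 show "integrable (PiM {..<n} (%_. vu)) (%_. Kc ^ n)" by simp
 show "AE x in PiM {..<n} (%_. vu). (%k. cyc (%_. ps (fst (z k)) (snd (z k))) n x) ----> cyc (%_. ps (fst a) (snd a)) n x"
  unfolding cyc_psi using z by (intro AE_I2 tendsto_intros tendsto_fst tendsto_snd)
 show "AE x in PiM {..<n} (%_. vu). norm (cyc (%_. ps (fst (z k)) (snd (z k))) n x) <= Kc ^ n" for k using b by (intro AE_I2)
qed (rule from_seq[OF cyc_measurable])+
thus ?thesis by (auto simp: continuous_on_sequentially o_def case_prod_beta)
qed

lemma integ_real: "Im (integ (%_. ps 0 0) n) = 0"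
proof -
have "cyc (%_. ps 0 0) n = (%x. of_real (Pphi n x / sg ^ n))" unfolding cyc_psi by (simp add: fun_eq_iff)
hence "integ (%_. ps 0 0) n = of_real (LINT x|(PiM {..<n} (%_. vu)). Pphi n x / sg ^ n)" unfolding integ_def by (simp only: integral_complex_of_real)
thus ?thesis by simp
qed

lemma trace_bound: assumes "!!v. norm (ap (X v) v) <= B" "(%v. ap (X v) v) : bmeas M" shows "norm (LINT v|M. ap (X v) v) <= B"
proof -
have "norm (LINT v|M. ap (X v) v) <= (LINT v|M. norm (ap (X v) v))" by (rule integral_norm_bound)
also have "... <= (LINT v|M. B)" using assms order_trans[OF norm_ge_zero assms(1)] by (intro integral_mono bounded_integrable[where B=B]) auto
finally show ?thesis by (simp add: pk.prob_space)
qed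

lemma norm_kern_const: "norm (kern (%_. ps t s) n v) <= Kc ^ Q"
proof -
have "norm (kern (%_. ps t s) n v) <= norm (ps t s) ^ Q" using norm_kern[of "%_. ps t s" n v] by simp
also have "... <= Kc ^ Q" by (intro power_mono norm_psi) simp
finally show ?thesis .
qed

text \<open>Divided by \<open>Lat ^ n\<close>, the normalized partition functions converge
  geometrically, and their real parts stay away from 0: at the origin by the lower bound on traces,
  nearby by continuity. The principal logarithm therefore serves on one disc for all large
  \<open>n\<close>, and in the limit of \<open>1 / n\<close> times the logarithm only
  \<open>sg\<close> and \<open>Lat\<close> are left.\<close>

theorem free_energy:
"EX de>0. EX Ph lN. (\<forall>\<^sub>F n in sequentially. continuous_log de (%(t, s). ZZ n t s) (lN n)) &
  (ALL t:ball (0, 0) de. (%n. - (lN n t / of_nat n)) ----> Ph t) & has_mixed_derivative_at_0 Ph cc"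
proof -
obtain et C0 th' R L La where et: "0 < et" "0 <= C0" "0 < th'" "th' < 1" and
 near: "!!T :: 'a bmf \<Rightarrow>\<^sub>L 'a bmf. (!!c x. bap T (csc c x) = csc c (bap T x)) ==> norm (T - T0) <= et ==>
   bm.eigen T0 N r l C0 T (R T) (La T) (L T)
   & norm (La T - 1) <= C0 * norm (T - T0) & norm (La T - 1) <= (1 - th') / 2
   & (ALL f n. norm ((bap T ^^ n) f - csc (La T ^ n * (bap (L T) f / bap (L T) (R T))) (R T)) <= C0 * th' ^ n * norm f)"
 and LLip: "!!(T :: 'a bmf \<Rightarrow>\<^sub>L 'a bmf) (T' :: 'a bmf \<Rightarrow>\<^sub>L 'a bmf). (!!c x. bap T (csc c x) = csc c (bap T x)) ==> norm (T - T0) <= et ==> (!!c x. bap T' (csc c x) = csc c (bap T' x)) ==> norm (T' - T0) <= et ==>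
   norm (L T - L T') <= C0 * norm (T - T')" by (rule bm.near_gap[OF l l_T0 T_csc T0_r th D gap0 N(1) N0(1,2) N(4,5)]) blast
\<comment> \<open>The first bound keeps the operators within \<open>et\<close> of \<open>T0\<close>;
  the second keeps \<open>L\<close> nonzero on the fixed vector \<open>r\<close>, by which
  \<open>La_eq\<close> divides.\<close>
define e0 where "e0 = min (et / (2 * Kc)) (1 / (2 * Kc * (C0 * norm r + 1) + 1))"
have e0: "0 < e0" using et Kc by (simp add: e0_def divide_simps add_nonneg_pos)
have TL: "norm (Tt t s - Tt t' s') <= Kc * (abs (t - t') + abs (s - s'))" for t s t' s'
 unfolding T_diff[symmetric] using order_trans[OF norm_T psi_Lip] by (simp add: mult.commute)
have Tsmall: "norm (Tt t s - T0) <= et" if "abs t < e0" "abs s < e0" for t s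
proof -
 have "norm (Tt t s - T0) <= Kc * (abs t + abs s)" using TL[of t s 0 0] by simp
 also have "... <= Kc * (et / (2 * Kc) + et / (2 * Kc))" using that Kc by (intro mlm add_mono) (auto simp: e0_def)
 also have "... = et" using Kc by (simp add: field_simps)
 finally show ?thesis .
qed
note near' = near[OF T_csc Tsmall]
define Lat where "Lat t s = La (Tt t s)" for t s
have La_half: "norm (Lat t s - 1) <= (1 - th') / 2" if "abs t < e0" "abs s < e0" for t s using near'[OF that] by (simp add: Lat_def)
define m where "m = (1 + th') / 2"
have m: "0 < m" "th' < m" using et by (auto simp: m_def)
have La_ge: "m <= norm (Lat t s)" "norm (Lat t s) <= 2" "Lat t s ~= 0" if "abs t < e0" "abs s < e0" for t s
proof -
 show 1: "m <= norm (Lat t s)" using La_half[OF that] norm_triangle_ineq2[of 1 "1 - Lat t s"] unfolding m_def by (simp add: norm_minus_commute field_simps)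
 show "norm (Lat t s) <= 2" using La_half[OF that] norm_triangle_ineq[of 1 "Lat t s - 1"] et by simp
 show "Lat t s ~= 0" using 1 m by auto
qed
have La_re: "Lat t s \<notin> \<real>\<^sub>\<le>\<^sub>0" if "abs t < e0" "abs s < e0" for t s
proof
 assume "Lat t s : \<real>\<^sub>\<le>\<^sub>0"
 hence "Re (Lat t s) <= 0" by (auto elim: nonpos_Reals_cases)
 thus False using La_half[OF that] complex_Re_le_cmod[of "1 - Lat t s"] et by (simp add: norm_minus_commute)
qed
have 00: "abs 0 < e0" using e0 by simp
have La0: "Lat 0 0 = 1" using near'[OF 00 00] by (simp add: Lat_def)
define B where "B = {z :: real \<times> real. abs (fst z) < e0 & abs (snd z) < e0}"
have Tcont: "continuous_on B (%(t, s). Tt t s)"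
proof -
 have "(2 * Kc)-lipschitz_on B (%(t, s). Tt t s)"
 proof (rule lipschitz_onI)
  fix x y assume "x : B" "y : B"
  have "dist (Tt (fst x) (snd x)) (Tt (fst y) (snd y)) <= Kc * (abs (fst x - fst y) + abs (snd x - snd y))" using TL by (simp add: dist_norm)
  also have "... <= Kc * (dist x y + dist x y)" using Kc dist_fst_le[of x y] dist_snd_le[of x y] by (intro mlm add_mono) (auto simp: dist_real_def)
  finally show "dist (case x of (t, s) => Tt t s) (case y of (t, s) => Tt t s) <= 2 * Kc * dist x y" by (simp add: case_prod_beta)
 qed (use Kc in simp)
 thus ?thesis by (rule lipschitz_on_continuous_on)
qed
have Lcont: "continuous_on B (%(t, s). L (Tt t s))"
proof -
 have "(C0 * (2 * Kc))-lipschitz_on B (%(t, s). L (Tt t s))"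
 proof (rule lipschitz_onI)
  fix x y assume xy: "x : B" "y : B"
  have "dist (L (Tt (fst x) (snd x))) (L (Tt (fst y) (snd y))) <= C0 * norm (Tt (fst x) (snd x) - Tt (fst y) (snd y))"
   unfolding dist_norm using xy by (intro LLip T_csc Tsmall) (auto simp: B_def)
  also have "... <= C0 * (Kc * (abs (fst x - fst y) + abs (snd x - snd y)))" using et by (intro mlm TL) auto
  also have "... <= C0 * (Kc * (dist x y + dist x y))" using Kc et dist_fst_le[of x y] dist_snd_le[of x y] by (intro mlm add_mono) (auto simp: dist_real_def)
  finally show "dist (case x of (t, s) => L (Tt t s)) (case y of (t, s) => L (Tt t s)) <= C0 * (2 * Kc) * dist x y" by (simp add: case_prod_beta mult_ac)
 qed (use Kc et in simp)
 thus ?thesis by (rule lipschitz_on_continuous_on)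
qed
have Lr: "L (Tt t s) r ~= 0" if "abs t < e0" "abs s < e0" for t s
proof
 assume 0: "L (Tt t s) r = 0"
 have "1 = norm ((L (Tt t s) - l) r)" by (simp add: blinfun.diff_left 0 l)
 also have "... <= norm (L (Tt t s) - l) * norm r" by (rule norm_blinfun)
 also have "... <= C0 * (Kc * (abs t + abs s)) * norm r" using near'[OF that] TL[of t s 0 0] et by (intro mrm) (auto intro: order_trans[OF _ mlm])
 also have "... <= C0 * (Kc * (e0 + e0)) * norm r" using that Kc et by (intro mrm mlm) auto
 also have "... <= (2 * Kc * (C0 * norm r)) * (1 / (2 * Kc * (C0 * norm r + 1) + 1))"
 proof -
  have "C0 * (Kc * (e0 + e0)) * norm r = (2 * Kc * (C0 * norm r)) * e0" by (simp add: alg)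
  thus ?thesis using Kc et by (simp only:) (intro mlm, auto simp: e0_def)
 qed
 also have "... < 1" using Kc et by (simp add: divide_less_eq add_nonneg_pos) (simp add: alg add_pos_pos)
 finally show False by simp
qed
\<comment> \<open>Expresses the eigenvalue through \<open>L\<close> alone, whose Lipschitz
  dependence on the operator is known; this gives the continuity of \<open>Lat\<close>.\<close>
have La_eq: "Lat t s = L (Tt t s) (Tt t s r) / L (Tt t s) r" if "abs t < e0" "abs s < e0" for t s using near'[OF that] Lr[OF that] by (simp add: Lat_def)
have Lacont: "continuous_on B (%(t, s). Lat t s)"
proof -
 have "continuous_on B (%z. L (Tt (fst z) (snd z)) (Tt (fst z) (snd z) r) / L (Tt (fst z) (snd z)) r)"
  using Tcont Lcont Lr unfolding case_prod_beta by (intro continuous_intros bounded_bilinear.continuous_on[OF bounded_bilinear_blinfun_apply]) (auto simp: B_def)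
 thus ?thesis unfolding case_prod_beta by (rule continuous_on_eq) (auto simp: B_def La_eq)
qed
define ws where "ws n = (%(t, s). integ (%_. ps t s) (n + Q) / Lat t s ^ n)" for n
define q where "q = th' / m"
have q: "0 <= q" "q < 1" using m et by (auto simp: q_def)
define C1 where "C1 = (Kc + 2) * C0 * Kc ^ Q / m"
have C1: "0 <= C1" using Kc et m by (simp add: C1_def)
have wstep: "norm (ws (Suc n) z - ws n z) <= C1 * q ^ n" if z: "z : B" for n z
proof -
 obtain t s where zz: "z = (t, s)" by (cases z)
 have ts: "abs t < e0" "abs s < e0" using z by (auto simp: zz B_def)
 let ?T = "Tt t s" and ?k = "kern (%_. ps t s) 0" and ?La = "Lat t s"
 have kc: "kern (%_. ps t s) n = ?k" for n by (rule kern_const)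
 have tr: "integ (%_. ps t s) (n + Q) = (LINT v|M. ap ((bap ?T ^^ n) (?k v)) v)" for n unfolding trace_formula[OF refl] kc[of n] ops_const ..
 have ms: "(%v. ap ((bap ?T ^^ n) (?k v)) v) : bmeas M" for n using ops_kern_measurable[of "%_. ps t s" n] unfolding kc[of n] ops_const .
 have bd: "norm (ap ((bap ?T ^^ n) (?k v)) v) <= norm ?T ^ n * Kc ^ Q" for n v
  by (rule order_trans[OF norm_ap order_trans[OF funpow_norm[OF order_refl norm_ge_zero] mlm[OF norm_kern_const]]]) simp
 note ii = bounded_integrable[OF ms bd]
 \<comment> \<open>Applying \<open>T - Lat\<close> removes the leading term exactly, so that
   consecutive \<open>ws\<close> differ only by the remainder of the gap.\<close>
 define X where "X v = (bap ?T ^^ Suc n) (?k v) - csc ?La ((bap ?T ^^ n) (?k v))" for v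
 have Xb: "norm (X v) <= (Kc + 2) * (C0 * th' ^ n * Kc ^ Q)" for v
 proof -
  define c where "c = ?La ^ n * (L ?T (?k v) / L ?T (R ?T))"
  define E where "E = (bap ?T ^^ n) (?k v) - csc c (R ?T)"
  have "norm E <= C0 * th' ^ n * norm (?k v)" using near'[OF ts] by (simp add: E_def c_def Lat_def)
  also have "... <= C0 * th' ^ n * Kc ^ Q" using et by (intro mlm norm_kern_const) auto
  finally have E: "norm E <= C0 * th' ^ n * Kc ^ Q" .
  have "?T (csc c (R ?T)) = csc ?La (csc c (R ?T))" using near'[OF ts] by (intro bmf_eqI) (simp add: T_csc Lat_def)
  hence "X v = ?T E - csc ?La E" by (intro bmf_eqI) (simp add: X_def E_def blinfun.diff_right alg)
  also have "norm ... <= norm ?T * norm E + norm ?La * norm E" by (intro order_trans[OF norm_triangle_ineq4] add_mono norm_blinfun norm_csc_le)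
  also have "... = (norm ?T + norm ?La) * norm E" by (simp add: alg)
  also have "... <= (Kc + 2) * (C0 * th' ^ n * Kc ^ Q)" using E La_ge(2)[OF ts] order_trans[OF norm_T norm_psi, of t s] Kc by (intro mult_mono add_mono) auto
  finally show ?thesis .
 qed
 have "ws (Suc n) z - ws n z = (integ (%_. ps t s) (Suc n + Q) - ?La * integ (%_. ps t s) (n + Q)) / ?La ^ Suc n"
  using La_ge(3)[OF ts] by (simp add: ws_def zz diff_divide_distrib)
 also have "integ (%_. ps t s) (Suc n + Q) - ?La * integ (%_. ps t s) (n + Q) = (LINT v|M. ap (X v) v)"
  unfolding tr X_def ap_simps ap_csc using ii by (subst Lintegral_diff) (auto simp del: funpow.simps)
 also have "norm ((LINT v|M. ap (X v) v) / ?La ^ Suc n) <= (Kc + 2) * (C0 * th' ^ n * Kc ^ Q) / m ^ Suc n" unfolding norm_divide norm_power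
 proof (rule frac_le)
  show "norm (LINT v|M. ap (X v) v) <= (Kc + 2) * (C0 * th' ^ n * Kc ^ Q)"
  proof (rule trace_bound[OF order_trans[OF norm_ap Xb]])
   show "(%v. ap (X v) v) : bmeas M" unfolding X_def ap_simps ap_csc by (intro borel_measurable_diff borel_measurable_times borel_measurable_const ms)
  qed
  show "m ^ Suc n <= norm ?La ^ Suc n" using La_ge(1)[OF ts] m by (intro power_mono) auto
 qed (use m Kc et in auto)
 also have "... = C1 * q ^ n" using m by (simp add: C1_def q_def power_divide)
 finally show ?thesis .
qed
have wlim: "EX wl. (%n. ws n z) ----> wl & (ALL n. norm (ws n z - wl) <= C1 / (1 - q) * q ^ n)" if "z : B" for z
 by (rule geometric_Cauchy[OF q C1 wstep[OF that]]) blast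
have "(%n. C1 / (1 - q) * q ^ n) ----> C1 / (1 - q) * 0" using q by (intro tendsto_intros LIMSEQ_realpow_zero) auto
define p' where "p' = p / sg ^ Q"
have p': "0 < p'" using p sg by (simp add: p'_def)
from \<open>(%n. C1 / (1 - q) * q ^ n) ----> C1 / (1 - q) * 0\<close> have "\<forall>\<^sub>F n in sequentially. C1 / (1 - q) * q ^ n < p' / 16"
 by (rule order_tendstoD(2)) (use p' in simp)
from eventually_conj[OF this integ_pos] obtain n0 where n0: "!!n. n0 <= n ==> C1 / (1 - q) * q ^ n < p' / 16" "!!n. n0 <= n ==> p' <= Re (ws n (0, 0))"
 unfolding eventually_sequentially p'_def ws_def by (auto simp: La0)
have Q2: "norm (ws n z - ws n' z) <= p' / 8" if "z : B" "n0 <= n" "n0 <= n'" for n n' z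
proof -
 obtain wl where wl: "!!n. norm (ws n z - wl) <= C1 / (1 - q) * q ^ n" using wlim[OF \<open>z : B\<close>] by blast
 have "norm (ws n z - ws n' z) <= norm (ws n z - wl) + norm (ws n' z - wl)" using norm_triangle_ineq4[of "ws n z - wl" "ws n' z - wl"] by simp
 thus ?thesis using wl[of n] wl[of n'] n0(1)[of n] n0(1)[of n'] that by linarith
qed
have wcont: "continuous_on B (ws n)" for n
 unfolding ws_def case_prod_beta using Lacont[unfolded case_prod_beta] continuous_on_subset[OF integ_continuous[of "n + Q", unfolded case_prod_beta] subset_UNIV[of B]] La_ge(3)
 by (intro continuous_intros) (auto simp: B_def)
have openB: "open B"
proof -
 have "B = {-e0<..<e0} \<times> {-e0<..<e0}" by (auto simp: B_def)
 thus ?thesis by (simp add: open_Times)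
qed
have 0: "(0, 0) : B" using e0 by (auto simp: B_def)
have "isCont (ws n0) (0, 0)" using wcont openB 0 by (simp add: continuous_on_eq_continuous_at)
then obtain de1 where de1: "0 < de1" "!!z. dist z (0, 0) < de1 ==> dist (ws n0 z) (ws n0 (0, 0)) < p' / 4"
 using p' unfolding continuous_at_eps_delta by (metis zero_less_divide_iff zero_less_numeral)
obtain de2 where de2: "0 < de2" "ball (0, 0) de2 <= B" using openB 0 open_contains_ball by blast
define de where "de = min de1 de2"
have de: "0 < de" "ball (0, 0) de <= B" using de1 de2 by (auto simp: de_def)
\<comment> \<open>At most \<open>p' / 4\<close> is lost in moving from the origin to
  \<open>z\<close> at the fixed index \<open>n0\<close>, and at most \<open>p' / 8\<close> in moving
  from \<open>n0\<close> to \<open>n\<close>.\<close>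
have wre: "p' / 2 <= Re (ws n z)" if z: "z : ball (0, 0) de" and n: "n0 <= n" for n z
proof -
 have zB: "z : B" using z de by auto
 have "norm (ws n0 z - ws n0 (0, 0)) < p' / 4" using de1(2)[of z] z by (simp add: de_def dist_norm norm_minus_commute dist_commute)
 hence "Re (ws n0 (0, 0)) - Re (ws n0 z) <= p' / 4" using complex_Re_le_cmod[of "ws n0 (0, 0) - ws n0 z"] by (simp add: norm_minus_commute)
 moreover have "Re (ws n0 z) - Re (ws n z) <= p' / 8" using complex_Re_le_cmod[of "ws n0 z - ws n z"] Q2[OF zB order_refl n] by simp
 moreover have "p' <= Re (ws n0 (0, 0))" using n0(2) by simp
 ultimately show ?thesis using p' by (simp add: field_simps)
qed
have nonpos: "z \<notin> \<real>\<^sub>\<le>\<^sub>0" if "p' / 2 <= Re z" for z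
proof
 assume "z : \<real>\<^sub>\<le>\<^sub>0"
 hence "Re z <= 0" by (auto elim: nonpos_Reals_cases)
 thus False using that p' by simp
qed
\<comment> \<open>A cycle of length \<open>n\<close> corresponds to \<open>ws\<close> at the index
  \<open>n - Q\<close>, since \<open>Q\<close> windows are spent on closing it.\<close>
define lN where "lN n = (%(t, s). of_real (real n * ln sg) + of_nat (n - Q) * Ln (Lat t s) + Ln (ws (n - Q) (t, s)))" for n
define Ph where "Ph = (%(t, s). - of_real (ln sg) - Ln (Lat t s))"
have log: "continuous_log de (%(t, s). ZZ n t s) (lN n)" if n: "n0 + Q <= n" for n unfolding continuous_log_def
proof (intro conjI ballI)
 have nQ: "n0 <= n - Q" "n - Q + Q = n" using n by auto
 have "continuous_on (ball (0, 0) de) (%z. of_real (real n * ln sg) + of_nat (n - Q) * Ln (Lat (fst z) (snd z)) + Ln (ws (n - Q) z))"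
 proof -
  have c1: "continuous_on (ball (0, 0) de) (%z. Ln (Lat (fst z) (snd z)))"
  proof (rule continuous_on_Ln')
   show "continuous_on (ball (0, 0) de) (%z. Lat (fst z) (snd z))" using continuous_on_subset[OF Lacont de(2)] by (simp add: case_prod_beta)
   fix z :: "real \<times> real" assume "z : ball (0, 0) de"
   hence "z : B" using de(2) by blast
   thus "Lat (fst z) (snd z) \<notin> \<real>\<^sub>\<le>\<^sub>0" by (intro La_re) (auto simp: B_def)
  qed
  have c2: "continuous_on (ball (0, 0) de) (%z. Ln (ws (n - Q) z))" using n by (intro continuous_on_Ln' continuous_on_subset[OF wcont de(2)] nonpos wre) auto
  show ?thesis by (intro continuous_intros c1 c2)
 qed
 thus "continuous_on (ball (0, 0) de) (lN n)" by (simp add: lN_def case_prod_beta)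
 fix z :: "real \<times> real" assume z: "z : ball (0, 0) de"
 obtain t s where zz: "z = (t, s)" by (cases z)
 have ts: "abs t < e0" "abs s < e0" using z de(2) by (auto simp: zz B_def)
 have w0: "ws (n - Q) (t, s) ~= 0" using wre[OF z nQ(1)] p' by (auto simp: zz)
 have "exp (lN n z) = exp (of_real (real n * ln sg)) * exp (Ln (Lat t s)) ^ (n - Q) * exp (Ln (ws (n - Q) (t, s)))" by (simp add: lN_def zz exp_add exp_of_nat_mult)
 also have "exp (of_real (real n * ln sg)) = (of_real (sg ^ n) :: complex)" unfolding exp_of_real using sg by (simp add: exp_of_nat_mult)
 also have "of_real (sg ^ n) * exp (Ln (Lat t s)) ^ (n - Q) * exp (Ln (ws (n - Q) (t, s))) = of_real (sg ^ n) * integ (%_. ps t s) n"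
  using La_ge(3)[OF ts] w0 n by (simp add: exp_Ln) (simp add: ws_def)
 finally show "exp (lN n z) = (case z of (t, s) => ZZ n t s)" by (simp add: ZZ_integ zz)
next
 have "ws (n - Q) (0, 0) = of_real (Re (ws (n - Q) (0, 0)))" using integ_real[of "n - Q + Q"] by (simp add: ws_def La0 complex_eq_iff)
 moreover have "n0 <= n - Q" using n by simp
 hence "0 < Re (ws (n - Q) (0, 0))" using n0(2)[of "n - Q"] p' by simp
 ultimately have "Ln (ws (n - Q) (0, 0)) : \<real>" by (metis Ln_of_real Reals_of_real)
 thus "lN n (0, 0) : \<real>" by (simp add: lN_def La0)
qed
have lim: "(%n. - (lN n z / of_nat n)) ----> Ph z" if z: "z : ball (0, 0) de" for z
proof -
 obtain t s where zz: "z = (t, s)" by (cases z)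
 obtain wl where wl: "(%n. ws n z) ----> wl" using wlim[of z] z de(2) by blast
 have "p' / 2 <= Re wl" by (rule LIMSEQ_le_const[OF tendsto_Re[OF wl]]) (use wre[OF z] in blast)
 hence "(%n. Ln (ws n z)) ----> Ln wl" by (intro tendsto_Ln wl nonpos)
 hence Lw: "(%n. Ln (ws (n - Q) z)) ----> Ln wl" by (rule LIMSEQ_offset[where k=Q, OF _, of "%n. Ln (ws (n - Q) z)", simplified add_diff_cancel_right'])
 have inv: "(%n. 1 / of_nat n :: complex) ----> 0" using lim_inverse_n by (simp add: inverse_eq_divide)
 have "(%n. - of_real (ln sg) - (1 - of_nat Q * (1 / of_nat n)) * Ln (Lat t s) - Ln (ws (n - Q) z) * (1 / of_nat n)) ----> - of_real (ln sg) - (1 - of_nat Q * 0) * Ln (Lat t s) - Ln wl * 0"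
  by (intro tendsto_intros inv Lw)
 hence "(%n. - of_real (ln sg) - (1 - of_nat Q * (1 / of_nat n)) * Ln (Lat t s) - Ln (ws (n - Q) z) * (1 / of_nat n)) ----> Ph z" by (simp add: Ph_def zz)
 moreover have "\<forall>\<^sub>F n in sequentially. - of_real (ln sg) - (1 - of_nat Q * (1 / of_nat n)) * Ln (Lat t s) - Ln (ws (n - Q) z) * (1 / of_nat n) = - (lN n z / of_nat n)"
  using eventually_ge_at_top[of "Q + 1"]
 proof eventually_elim
  case (elim n)
  hence nq: "(of_nat (n - Q) :: complex) = of_nat n - of_nat Q" and n: "(of_nat n :: complex) ~= 0" by (auto simp: of_nat_diff)
  show ?case unfolding lN_def zz case_prod_conv nq using n by (simp add: field_simps)
 qed
 ultimately show ?thesis by (rule Lim_transform_eventually)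
qed
have mixed: "has_mixed_derivative_at_0 Ph cc"
proof -
 let ?A1 = "T (csc (- \<i>) i1)" and ?A2 = "T (csc (- \<i>) i2)" and ?A12 = "T (csc (- 1) i12)"
 define K where "K = C0 * Kc^2 + norm N * Kc * norm r + norm l * Kc * norm N + Kc + C0 * Kc"
 have Kge: "C0 * Kc^2 + norm N * Kc * norm r <= K" "C0 * Kc^2 + norm l * Kc * norm N <= K" "Kc <= K" "C0 * Kc <= K" "0 <= K" using Kc et by (auto simp: K_def)
 have T1: "norm (Tt t 0 - T0 - t *\<^sub>R ?A1) <= Kc * t^2" for t using order_trans[OF norm_T psi_t, of t] by (simp add: T_diff T_scaleR mult.commute)
 have sq: "(norm (Tt t 0 - T0))^2 <= Kc^2 * t^2" for t using power_mono[OF TL[of t 0 0 0], of 2] by (simp add: power_mult_distrib)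
 have "has_mixed_derivative_at_0 (%(t, s). - of_real (ln sg) - Ln (Lat t s)) (- (l (?A12 r) + l (?A1 (N (?A2 r))) + l (?A2 (N (?A1 r))) - l (?A1 r) * l (?A2 r)))"
 proof (rule bm.mixed_derivative_eigenvalue[where e=e0 and K=K and Tt=Tt and Rt="%t s. R (Tt t s)" and Lt="%t s. L (Tt t s)" and B="%t. T (Bt t)" and ?T0.0=T0])
  show "0 < e0" "0 <= K" by (fact e0 Kge)+
  show "l r = 1" "l (T0 x) = l x" "T0 r = r" "N r = 0" "l (N x) = 0" for x by (simp_all add: l l_T0 T0_r N)
  fix t assume t: "abs t < e0"
  note n0' = near'[OF t 00]
  show "norm (R (Tt t 0) - r - t *\<^sub>R N (?A1 r)) <= K * t^2"
  proof -
   have "R (Tt t 0) - r - t *\<^sub>R N (?A1 r) = (R (Tt t 0) - r - N ((Tt t 0 - T0) r)) + N ((Tt t 0 - T0 - t *\<^sub>R ?A1) r)" by (simp add: blinfun.bilinear_simps)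
   also have "norm ... <= C0 * (Kc^2 * t^2) + norm N * (Kc * t^2 * norm r)"
    using n0' sq[of t] T1[of t] et by (intro order_trans[OF norm_triangle_ineq] add_mono order_trans[OF norm_blinfun] mlm mrm)
      (auto intro: order_trans[OF _ mlm[OF sq]])
   also have "... = (C0 * Kc^2 + norm N * Kc * norm r) * t^2" by (simp add: alg)
   also have "... <= K * t^2" by (intro mrm Kge) auto
   finally show ?thesis .
  qed
  show "norm (L (Tt t 0) - l - t *\<^sub>R (l o\<^sub>L ?A1 o\<^sub>L N)) <= K * t^2"
  proof -
   have "L (Tt t 0) - l - t *\<^sub>R (l o\<^sub>L ?A1 o\<^sub>L N) = (L (Tt t 0) - l - (l o\<^sub>L (Tt t 0 - T0) o\<^sub>L N)) + (l o\<^sub>L (Tt t 0 - T0 - t *\<^sub>R ?A1) o\<^sub>L N)"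
    by (rule blinfun_eqI) (simp add: blinfun.bilinear_simps)
   also have "norm ... <= C0 * (Kc^2 * t^2) + norm l * (Kc * t^2) * norm N"
    using n0' sq[of t] T1[of t] et by (intro order_trans[OF norm_triangle_ineq] add_mono order_trans[OF norm_blinfun_compose] mlm mrm)
      (auto intro: order_trans[OF _ mlm[OF sq]])
   also have "... = (C0 * Kc^2 + norm l * Kc * norm N) * t^2" by (simp add: alg)
   also have "... <= K * t^2" by (intro mrm Kge) auto
   finally show ?thesis .
  qed
  show "norm (Tt t 0 - T0 - t *\<^sub>R ?A1) <= K * t^2" using order_trans[OF T1 mrm[OF Kge(3)]] by simp
  have "norm (T (Bt t) - ?A2 - t *\<^sub>R ?A12) <= Kc * t^2" using order_trans[OF norm_T Bt_t, of t] by (simp add: T_diff T_scaleR mult.commute)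
  thus "norm (T (Bt t) - ?A2 - t *\<^sub>R ?A12) <= K * t^2" using order_trans[OF _ mrm[OF Kge(3)]] by simp
  fix s assume s: "abs s < e0"
  note ns = near'[OF t s]
  show "Tt t s (R (Tt t s)) = csc (Lat t s) (R (Tt t s))" "L (Tt t s) (Tt t s x) = Lat t s * L (Tt t s) x" "L (Tt t s) (csc c x) = c * L (Tt t s) x" for c x
   using ns by (auto simp: Lat_def)
  show "L (Tt t s) (R (Tt t s)) ~= 0" using ns by auto
  show "norm (Lat t s - 1) < 1" using La_half[OF t s] et by simp
  have "norm (L (Tt t s) - L (Tt t 0)) <= C0 * norm (Tt t s - Tt t 0)" by (intro LLip T_csc Tsmall t s 00)
  also have "... <= C0 * (Kc * abs s)" using et TL[of t s t 0] by (intro mlm) auto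
  also have "... <= K * abs s" using mrm[OF Kge(4), of "abs s"] by (simp add: mult.assoc)
  finally show "norm (L (Tt t s) - L (Tt t 0)) <= K * abs s" .
  have "norm (Tt t s - Tt t 0 - s *\<^sub>R T (Bt t)) <= Kc * s^2" using order_trans[OF norm_T psi_s, of t s] by (simp add: T_diff T_scaleR mult.commute)
  thus "norm (Tt t s - Tt t 0 - s *\<^sub>R T (Bt t)) <= K * s^2" using order_trans[OF _ mrm[OF Kge(3)]] by simp
 qed
 \<comment> \<open>Each first derivative carries the factor \<open>- \<i>\<close> and the second one
   the factor \<open>- 1\<close>, so the overall sign cancels the minus of the free energy.\<close>
 moreover have "- (l (?A12 r) + l (?A1 (N (?A2 r))) + l (?A2 (N (?A1 r))) - l (?A1 r) * l (?A2 r)) = cc"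
 proof -
  have ii: "\<i> * x * (\<i> * y) = - (x * y)" for x y
  proof -
   have "\<i> * x * (\<i> * y) = (\<i> * \<i>) * (x * y)" by (simp only: mult_ac)
   thus ?thesis by simp
  qed
  show ?thesis by (simp add: T_csc_left N l cc_def T_csc ii)
 qed
 ultimately show ?thesis by (simp add: Ph_def)
qed
have "\<forall>\<^sub>F n in sequentially. continuous_log de (%(t, s). ZZ n t s) (lN n)" using eventually_ge_at_top[of "n0 + Q"] by eventually_elim (rule log)
thus ?thesis using de(1) lim mixed by blast
qed

end

section \<open>Inserted observables, correlations and the limiting covariance\<close>

context chain begin

lemma ops_split: "bap (ops Ps (a + s)) f = ops Ps a (ops (%i. Ps (a + i)) s f)" by (induction s arbitrary: f) simp_all

lemma ops_cong: "(!!i. i < n ==> Ps i = Ps' i) ==> ops Ps n = ops Ps' n" by (induction n) simp_all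

lemma integ_cong: "(!!i. i < n ==> Ps i = Ps' i) ==> integ Ps n = integ Ps' n" unfolding integ_def cyc_def[abs_def] by (intro Lintegral_cong prod.cong refl) simp

lemma integ_shift: assumes "!!i. i < n ==> Ps' i = Ps ((i + a) mod n)" "0 < n" shows "integ Ps' n = integ Ps n"
using rotation[OF assms(2), of Ps a] integ_cong[of n Ps' "%i. Ps ((i + a) mod n)"] assms(1) by simp

end

context gibbs_gap begin

abbreviation "P0 == ps 0 0"
definition "M0 = norm l * norm r + D"
definition "KI = D * (2 * (norm l * norm r) + M0)"

lemma M0: "0 <= M0" "0 <= KI" using D by (auto simp: M0_def KI_def)

lemma norm_T0_pow: "norm ((bap T0 ^^ a) x) <= M0 * norm x"
proof -
have "norm ((bap T0 ^^ a) x) <= norm (csc (l x) r) + norm ((bap T0 ^^ a) x - csc (l x) r)"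
 using norm_triangle_ineq[of "csc (l x) r" "(bap T0 ^^ a) x - csc (l x) r"] by simp
also have "norm (csc (l x) r) <= norm l * norm x * norm r" by (rule order_trans[OF norm_csc_le mrm[OF norm_blinfun]]) simp
also have "norm ((bap T0 ^^ a) x - csc (l x) r) <= D * 1 * norm x" using th D by (intro order_trans[OF gap0] mrm mlm power_le_one) auto
finally show ?thesis by (simp add: M0_def alg)
qed

text \<open>\<open>Sx\<close> stands for a stretch of the chain with inserted observables. On both
  sides of it the powers of \<open>T0\<close> are nearly the projection onto \<open>r\<close>, so
  the stretch acts like the number \<open>l (Sx r)\<close>; what remains is again nearly the
  projection, as is every power with exponent at least \<open>a\<close>.\<close>

lemma insertion_op: fixes Sx :: "'a bmf \<Rightarrow>\<^sub>L 'a bmf" assumes Sx: "!!c x. bap Sx (csc c x) = csc c (bap Sx x)" and a: "a <= k"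
shows "norm ((bap T0 ^^ a) (Sx ((bap T0 ^^ b) f)) - csc (l (Sx r)) ((bap T0 ^^ k) f)) <= KI * norm Sx * (th ^ a + th ^ b) * norm f"
proof -
let ?p = "%n. bap T0 ^^ n"
define E where "E = ?p b f - csc (l f) r"
define E1 where "E1 = ?p a (Sx r) - csc (l (Sx r)) r"
define E2 where "E2 = ?p k f - csc (l f) r"
have E: "norm E <= D * th ^ b * norm f" unfolding E_def by (rule gap0)
have E1: "norm E1 <= D * th ^ a * (norm Sx * norm r)" unfolding E1_def using D th by (intro order_trans[OF gap0] mlm norm_blinfun) auto
have "th ^ k <= th ^ a" using a th by (intro power_decreasing) auto
hence E2: "norm E2 <= D * th ^ a * norm f" unfolding E2_def using D by (intro order_trans[OF gap0] mrm mlm) auto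
have pc: "?p a (csc c x) = csc c (?p a x)" for c x by (rule bm.funpow_sc) (rule T_csc)
have "?p b f = csc (l f) r + E" by (simp add: E_def)
hence "?p a (Sx (?p b f)) = csc (l f) (?p a (Sx r)) + ?p a (Sx E)" by (simp add: blinfun.add_right Sx funpow_linear pc)
moreover have "?p a (Sx r) = csc (l (Sx r)) r + E1" "?p k f = csc (l f) r + E2" by (simp_all add: E1_def E2_def)
ultimately have "?p a (Sx (?p b f)) - csc (l (Sx r)) (?p k f) = csc (l f) E1 + ?p a (Sx E) - csc (l (Sx r)) E2" by (intro bmf_eqI) (simp add: alg)
also have "norm ... <= norm l * norm f * (D * th ^ a * (norm Sx * norm r)) + M0 * (norm Sx * (D * th ^ b * norm f)) + norm l * (norm Sx * norm r) * (D * th ^ a * norm f)"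
proof -
 have "norm (csc (l f) E1) <= norm l * norm f * (D * th ^ a * (norm Sx * norm r))" by (intro order_trans[OF norm_csc_le] mult_mono norm_blinfun E1) auto
 moreover have "norm (?p a (Sx E)) <= M0 * (norm Sx * (D * th ^ b * norm f))"
  using M0 by (intro order_trans[OF norm_T0_pow] mlm order_trans[OF norm_blinfun] E) auto
 moreover have "norm (csc (l (Sx r)) E2) <= norm l * (norm Sx * norm r) * (D * th ^ a * norm f)"
  by (intro order_trans[OF norm_csc_le] mult_mono order_trans[OF norm_blinfun] E2 mlm norm_blinfun) auto
 ultimately show ?thesis using norm_triangle_ineq4[of "csc (l f) E1 + ?p a (Sx E)" "csc (l (Sx r)) E2"] norm_triangle_ineq[of "csc (l f) E1" "?p a (Sx E)"] by linarith
qed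
also have "... = D * norm Sx * norm f * (2 * (norm l * norm r) * th ^ a + M0 * th ^ b)" by (simp add: alg)
also have "... <= D * norm Sx * norm f * ((2 * (norm l * norm r) + M0) * (th ^ a + th ^ b))" using D M0 th by (intro mlm) (auto simp: alg)
finally show ?thesis by (simp add: KI_def mult_ac)
qed

lemma ops_csc: "bap (ops Ps n) (csc c x) = csc c (ops Ps n x)" by (induction n arbitrary: x) (simp_all add: T_csc)

lemma insertion_integ: assumes P: "!!i. i < a \<or> a + s <= i ==> Ps i = P0" and Sx: "Sx = ops (%i. Ps (a + i)) s"
 and n: "n = a + s + b + Q" shows "norm (integ Ps n - l (Sx r) * integ (%_. P0) n) <= KI * norm Sx * (th ^ a + th ^ b) * Kc ^ Q"
proof -
let ?m = "a + s + b" and ?p = "%n. bap T0 ^^ n"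
let ?k = "kern (%_. P0) ?m"
have k: "kern Ps ?m = ?k" using P by (simp add: kern_def[abs_def] kernv_def[abs_def])
have o1: "ops Ps a = ops (%_. P0) a" using P by (intro ops_cong) auto
have o2: "ops (%i. Ps (a + s + i)) b = ops (%_. P0) b" using P by (intro ops_cong) auto
have op: "ops Ps ?m f = ?p a (Sx (?p b f))" for f by (simp add: ops_split[of Ps "a + s" b] ops_split[of Ps a s] o1 o2 Sx ops_const)
define X where "X v = ?p a (Sx (?p b (?k v))) - csc (l (Sx r)) (?p ?m (?k v))" for v
have m1: "(%v. ap (?p a (Sx (?p b (?k v)))) v) : bmeas M" using ops_kern_measurable[of Ps ?m] unfolding k op .
have m2: "(%v. ap (?p ?m (?k v)) v) : bmeas M" using ops_kern_measurable[of "%_. P0" ?m] unfolding ops_const .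
have i1: "integrable M (%v. ap (?p a (Sx (?p b (?k v)))) v)"
proof (rule bounded_integrable[OF m1])
 show "norm (ap (?p a (Sx (?p b (?k v)))) v) <= M0 * (norm Sx * (M0 * Kc ^ Q))" for v
  using M0 by (intro order_trans[OF norm_ap] order_trans[OF norm_T0_pow] mlm order_trans[OF norm_blinfun] order_trans[OF norm_T0_pow] norm_kern_const) auto
qed
have i2: "integrable M (%v. ap (?p ?m (?k v)) v)"
proof (rule bounded_integrable[OF m2])
 show "norm (ap (?p ?m (?k v)) v) <= M0 * Kc ^ Q" for v using M0 by (intro order_trans[OF norm_ap] order_trans[OF norm_T0_pow] mlm norm_kern_const) auto
qed
have "integ Ps n - l (Sx r) * integ (%_. P0) n = (LINT v|M. ap (X v) v)"
 unfolding trace_formula[OF n] k op ops_const X_def ap_simps ap_csc using i1 i2 by (subst Lintegral_diff) auto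
also have "norm ... <= KI * norm Sx * (th ^ a + th ^ b) * Kc ^ Q"
proof (rule trace_bound)
 show "(%v. ap (X v) v) : bmeas M" unfolding X_def ap_simps ap_csc by (intro borel_measurable_diff borel_measurable_times borel_measurable_const m1 m2)
 fix v
 have Sc: "Sx (csc c x) = csc c (Sx x)" for c x by (simp add: Sx ops_csc)
 have "norm (X v) <= KI * norm Sx * (th ^ a + th ^ b) * norm (?k v)" unfolding X_def by (rule insertion_op[OF Sc]) simp_all
 also have "... <= KI * norm Sx * (th ^ a + th ^ b) * Kc ^ Q" using M0 th by (intro mlm norm_kern_const) auto
 finally show "norm (ap (X v) v) <= KI * norm Sx * (th ^ a + th ^ b) * Kc ^ Q" by (rule order_trans[OF norm_ap])
qed
finally show ?thesis .
qed

text \<open>A lower bound for the free steps on either side of the insertions: a pair at distance at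
  most half the cycle, together with the \<open>Q\<close> closing windows, leaves at least
  \<open>n div 2 - Q - 1\<close> steps, which are split in two.\<close>

definition "mm n = (n div 2 - Q - 1) div 2"
definition "KS = KI * (Kc + Kc * M0 * Kc) * 2 * Kc ^ Q"

lemma KS: "0 <= KS" using M0 Kc by (simp add: KS_def)

lemma single_integ: assumes n: "2 * Q + 4 <= n" and x: "norm x <= Kc" shows "norm (integ ((%_. P0)(0 := x)) n - l (T x r) * integ (%_. P0) n) <= KS * th ^ mm n"
proof -
\<comment> \<open>The cycle is rotated so that the insertion lies opposite the cut, with about
  equally many free steps on both sides.\<close>
define a where "a = (n - Q - 1) div 2"
define b where "b = n - Q - 1 - a"
have nab: "n = a + 1 + b + Q" "mm n <= a" "mm n <= b" "a < n" using n by (auto simp: a_def b_def mm_def)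
let ?Ps = "(%_. P0)(a := x)"
have "integ ((%_. P0)(0 := x)) n = integ ?Ps n"
proof (rule integ_shift[of _ _ _ a])
 fix i assume i: "i < n"
 have "(i + a) mod n = (if i + a < n then i + a else i + a - n)" using i nab(4) by (simp add: mod_if)
 thus "((%_. P0)(0 := x)) i = ?Ps ((i + a) mod n)" using i nab(4) by auto
qed (use n in auto)
moreover have "norm (integ ?Ps n - l (ops (%i. ?Ps (a + i)) 1 r) * integ (%_. P0) n) <= KI * norm (ops (%i. ?Ps (a + i)) 1) * (th ^ a + th ^ b) * Kc ^ Q"
 by (rule insertion_integ[where Ps="?Ps" and a=a and s=1 and b=b, OF _ refl nab(1)]) auto
moreover have "ops (%i. ?Ps (a + i)) 1 = T x" by (rule blinfun_eqI) simp
moreover have "KI * norm (T x) * (th ^ a + th ^ b) * Kc ^ Q <= KI * (Kc + Kc * M0 * Kc) * (th ^ mm n + th ^ mm n) * Kc ^ Q"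
 using order_trans[OF norm_T x] M0 Kc th nab by (intro mrm mult_mono mlm add_mono power_decreasing) (auto intro: order_trans)
ultimately show ?thesis by (simp add: KS_def alg)
qed

text \<open>Distances beyond half the cycle are covered by exchanging the two insertions. The
  \<open>g - 1\<close> free steps between them are kept exactly, so that the error does not depend
  on the distance.\<close>

lemma pair_integ: assumes n: "2 * Q + 4 <= n" and x: "norm x <= Kc" "norm y <= Kc" and g: "1 <= g" "2 * g <= n"
shows "norm (integ ((%_. P0)(0 := x, g := y)) n - l (T x ((bap T0 ^^ (g - 1)) (T y r))) * integ (%_. P0) n) <= KS * th ^ mm n"
proof -
define a where "a = (n - Q - g - 1) div 2"
define b where "b = n - Q - g - 1 - a"
have nab: "n = a + (g + 1) + b + Q" "mm n <= a" "mm n <= b" "a < n" "a + g < n" using n g by (auto simp: a_def b_def mm_def)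
let ?Ps = "(%_. P0)(a := x, a + g := y)"
have "integ ((%_. P0)(0 := x, g := y)) n = integ ?Ps n"
proof (rule integ_shift[of _ _ _ a])
 fix i assume i: "i < n"
 have "(i + a) mod n = (if i + a < n then i + a else i + a - n)" using i nab(4) by (simp add: mod_if)
 thus "((%_. P0)(0 := x, g := y)) i = ?Ps ((i + a) mod n)" using i nab g by auto
qed (use n in auto)
moreover have "norm (integ ?Ps n - l (ops (%i. ?Ps (a + i)) (g + 1) r) * integ (%_. P0) n) <= KI * norm (ops (%i. ?Ps (a + i)) (g + 1)) * (th ^ a + th ^ b) * Kc ^ Q"
 by (rule insertion_integ[where Ps="?Ps" and a=a and s="g + 1" and b=b, OF _ refl nab(1)]) (use g in auto)
moreover have op: "ops (%i. ?Ps (a + i)) (g + 1) f = T x ((bap T0 ^^ (g - 1)) (T y f))" for f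
proof -
 have "ops (%i. ?Ps (a + i)) (1 + (g - 1) + 1) f = T x (ops (%i. ?Ps (a + (1 + i))) (g - 1) (ops (%i. ?Ps (a + (1 + (g - 1) + i))) 1 f))"
  unfolding ops_split[of _ "1 + (g - 1)" 1] ops_split[of _ 1 "g - 1"] using g by simp
 also have "ops (%i. ?Ps (a + (1 + i))) (g - 1) = ops (%_. P0) (g - 1)" using g by (intro ops_cong) auto
 also have "ops (%i. ?Ps (a + (1 + (g - 1) + i))) 1 f = T y f" using g by simp
 also have "1 + (g - 1) + 1 = g + 1" using g by simp
 finally show ?thesis unfolding ops_const .
qed
moreover have "norm (ops (%i. ?Ps (a + i)) (g + 1)) <= Kc * M0 * Kc"
proof (rule norm_blinfun_bound)
 fix f
 have "norm (T x ((bap T0 ^^ (g - 1)) (T y f))) <= Kc * (M0 * (Kc * norm f))" using M0 Kc order_trans[OF norm_T x(1)] order_trans[OF norm_T x(2)]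
  by (intro order_trans[OF norm_blinfun] mult_mono order_trans[OF norm_T0_pow] mlm) (auto intro: order_trans)
 thus "norm (ops (%i. ?Ps (a + i)) (g + 1) f) <= Kc * M0 * Kc * norm f" unfolding op by (simp add: mult_ac)
qed (use M0 Kc in auto)
hence "KI * norm (ops (%i. ?Ps (a + i)) (g + 1)) * (th ^ a + th ^ b) * Kc ^ Q <= KI * (Kc + Kc * M0 * Kc) * (th ^ mm n + th ^ mm n) * Kc ^ Q"
 using M0 Kc th nab by (intro mrm mult_mono mlm add_mono power_decreasing) auto
ultimately show ?thesis unfolding KS_def op by (simp add: alg)
qed

abbreviation "MN n == PiM {..<n} (%_ :: nat. vu)"
definition "insert1 x i = (%_ :: nat. P0)(i := x)"
definition "insert2 i j = (if i = j then (%_ :: nat. P0)(i := i12) else (%_. P0)(i := i1, j := i2))"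

lemma cyc_P0: "cyc (%_. P0) n x = of_real (Pphi n x / sg ^ n)" unfolding cyc_psi by simp

lemma cyc_insert: assumes "!!k. k < n ==> ap (Ps k) (win Q (per n x) k) = of_real (ph (win Q (per n x) k) / sg * f k)"
shows "cyc Ps n x = of_real (Pphi n x / sg ^ n * (PROD k<n. f k))"
proof -
have "cyc Ps n x = (PROD k<n. of_real (ph (win Q (per n x) k) / sg * f k))" unfolding cyc_def using assms by (intro prod.cong) auto
also have "... = of_real (Pphi n x / sg ^ n * (PROD k<n. f k))" by (simp add: prod.distrib prod_dividef Pphi_def)
finally show ?thesis .
qed

lemma cyc_insert1: assumes i: "i < n" shows "cyc (insert1 i1 i) n x = of_real (Pphi n x / sg ^ n * h1 (win Q (per n x) i))"
 "cyc (insert1 i2 i) n x = of_real (Pphi n x / sg ^ n * h2 (win Q (per n x) i))"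
proof -
have "cyc (insert1 i1 i) n x = of_real (Pphi n x / sg ^ n * (PROD k<n. if k = i then h1 (win Q (per n x) k) else 1))"
 by (rule cyc_insert) (auto simp: insert1_def ap_i1 ap_psi ee_0)
thus "cyc (insert1 i1 i) n x = of_real (Pphi n x / sg ^ n * h1 (win Q (per n x) i))" using i by simp
have "cyc (insert1 i2 i) n x = of_real (Pphi n x / sg ^ n * (PROD k<n. if k = i then h2 (win Q (per n x) k) else 1))"
 by (rule cyc_insert) (auto simp: insert1_def ap_i2 ap_psi ee_0)
thus "cyc (insert1 i2 i) n x = of_real (Pphi n x / sg ^ n * h2 (win Q (per n x) i))" using i by simp
qed

lemma cyc_insert2: assumes i: "i < n" "j < n" shows "cyc (insert2 i j) n x = of_real (Pphi n x / sg ^ n * (h1 (win Q (per n x) i) * h2 (win Q (per n x) j)))"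
proof -
have "cyc (insert2 i j) n x = of_real (Pphi n x / sg ^ n * (PROD k<n. (if k = i then h1 (win Q (per n x) k) else 1) * (if k = j then h2 (win Q (per n x) k) else 1)))"
 by (rule cyc_insert) (auto simp: insert2_def ap_i1 ap_i2 ap_i12 ap_psi ee_0)
thus ?thesis using i by (simp add: prod.distrib)
qed

lemma real_cyc: assumes "!!x. cyc Ps n x = of_real (f x / sg ^ n)" shows "integrable (MN n) f" "of_real (LINT x|MN n. f x) = of_real (sg ^ n) * integ Ps n"
proof -
have "cyc Ps n = (%x. of_real (f x / sg ^ n))" using assms by auto
note i = cyc_integrable[of n Ps, unfolded this]
have "integrable (MN n) (%x. sg ^ n * Re (of_real (f x / sg ^ n)))" by (intro integrable_mult_right integrable_Re i)
thus "integrable (MN n) f" using sg by simp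
have "integ Ps n = of_real (LINT x|MN n. f x / sg ^ n)" unfolding integ_def assms by (simp only: integral_complex_of_real)
thus "of_real (LINT x|MN n. f x) = of_real (sg ^ n) * integ Ps n" using sg by simp
qed

lemma E0: "integrable (MN n) (Pphi n)" "of_real (LINT x|MN n. Pphi n x) = of_real (sg ^ n) * integ (%_. P0) n" using real_cyc[OF cyc_P0] by simp_all

lemma E1: assumes "i < n"
shows "integrable (MN n) (%x. Pphi n x * h1 (win Q (per n x) i))" "of_real (LINT x|MN n. Pphi n x * h1 (win Q (per n x) i)) = of_real (sg ^ n) * integ (insert1 i1 i) n"
 "integrable (MN n) (%x. Pphi n x * h2 (win Q (per n x) i))" "of_real (LINT x|MN n. Pphi n x * h2 (win Q (per n x) i)) = of_real (sg ^ n) * integ (insert1 i2 i) n"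
proof -
have "cyc (insert1 i1 i) n x = of_real (Pphi n x * h1 (win Q (per n x) i) / sg ^ n)" "cyc (insert1 i2 i) n x = of_real (Pphi n x * h2 (win Q (per n x) i) / sg ^ n)" for x
 unfolding cyc_insert1[OF assms] by simp_all
from real_cyc[OF this(1)] real_cyc[OF this(2)] show
 "integrable (MN n) (%x. Pphi n x * h1 (win Q (per n x) i))" "of_real (LINT x|MN n. Pphi n x * h1 (win Q (per n x) i)) = of_real (sg ^ n) * integ (insert1 i1 i) n"
 "integrable (MN n) (%x. Pphi n x * h2 (win Q (per n x) i))" "of_real (LINT x|MN n. Pphi n x * h2 (win Q (per n x) i)) = of_real (sg ^ n) * integ (insert1 i2 i) n"
 by blast+
qed

lemma E2: assumes "i < n" "j < n" shows "integrable (MN n) (%x. Pphi n x * (h1 (win Q (per n x) i) * h2 (win Q (per n x) j)))"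
 "of_real (LINT x|MN n. Pphi n x * (h1 (win Q (per n x) i) * h2 (win Q (per n x) j))) = of_real (sg ^ n) * integ (insert2 i j) n"
proof -
have "cyc (insert2 i j) n x = of_real (Pphi n x * (h1 (win Q (per n x) i) * h2 (win Q (per n x) j)) / sg ^ n)" for x unfolding cyc_insert2[OF assms] by simp
from real_cyc[OF this] show "integrable (MN n) (%x. Pphi n x * (h1 (win Q (per n x) i) * h2 (win Q (per n x) j)))"
 "of_real (LINT x|MN n. Pphi n x * (h1 (win Q (per n x) i) * h2 (win Q (per n x) j))) = of_real (sg ^ n) * integ (insert2 i j) n" by blast+
qed

lemma integ_insert1: "i < n ==> integ (insert1 x i) n = integ (insert1 x 0) n"
proof -
assume i: "i < n"
have "integ (insert1 x 0) n = integ (insert1 x i) n"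
proof (rule integ_shift[of _ _ _ i])
 fix k assume k: "k < n"
 have "(k + i) mod n = (if k + i < n then k + i else k + i - n)" using k i by (simp add: mod_if)
 thus "insert1 x 0 k = insert1 x i ((k + i) mod n)" using k i by (auto simp: insert1_def)
qed (use i in auto)
thus ?thesis by simp
qed

lemma integ_insert2: "i < n ==> j < n ==> integ (insert2 i j) n = integ (insert2 0 ((j + n - i) mod n)) n"
proof -
assume i: "i < n" "j < n"
have j': "(j + n - i) mod n = (if i <= j then j - i else j + n - i)" using i by (simp add: mod_if)
have "integ (insert2 0 ((j + n - i) mod n)) n = integ (insert2 i j) n"
proof (rule integ_shift[of _ _ _ i])
 fix k assume k: "k < n"
 have "(k + i) mod n = (if k + i < n then k + i else k + i - n)" using k i by (simp add: mod_if)
 thus "insert2 0 ((j + n - i) mod n) k = insert2 i j ((k + i) mod n)" unfolding j' using k i by (auto simp: insert2_def)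
qed (use i in auto)
thus ?thesis by simp
qed

lemma EH1:
shows "integrable (MN n) (%x. Pphi n x * HS h1 n x)" "of_real (LINT x|MN n. Pphi n x * HS h1 n x) = of_real (sg ^ n) * (of_nat n * integ (insert1 i1 0) n)"
 "integrable (MN n) (%x. Pphi n x * HS h2 n x)" "of_real (LINT x|MN n. Pphi n x * HS h2 n x) = of_real (sg ^ n) * (of_nat n * integ (insert1 i2 0) n)"
proof -
show "integrable (MN n) (%x. Pphi n x * HS h1 n x)" "integrable (MN n) (%x. Pphi n x * HS h2 n x)"
 unfolding HS_def sum_distrib_left by (auto intro!: Lintegrable_sum E1)
have "of_real (LINT x|MN n. Pphi n x * HS h1 n x) = (SUM i<n. of_real (sg ^ n) * integ (insert1 i1 i) n)"
 unfolding HS_def sum_distrib_left by (subst Lintegral_sum) (auto simp: E1 simp del: of_real_power)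
also have "... = (SUM i<n. of_real (sg ^ n) * integ (insert1 i1 0) n)" by (intro sum.cong refl arg_cong2[where f="(*)"] integ_insert1) auto
finally show "of_real (LINT x|MN n. Pphi n x * HS h1 n x) = of_real (sg ^ n) * (of_nat n * integ (insert1 i1 0) n)" by simp
have "of_real (LINT x|MN n. Pphi n x * HS h2 n x) = (SUM i<n. of_real (sg ^ n) * integ (insert1 i2 i) n)"
 unfolding HS_def sum_distrib_left by (subst Lintegral_sum) (auto simp: E1 simp del: of_real_power)
also have "... = (SUM i<n. of_real (sg ^ n) * integ (insert1 i2 0) n)" by (intro sum.cong refl arg_cong2[where f="(*)"] integ_insert1) auto
finally show "of_real (LINT x|MN n. Pphi n x * HS h2 n x) = of_real (sg ^ n) * (of_nat n * integ (insert1 i2 0) n)" by simp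
qed

text \<open>Rotation reduces the double sum to one sum over the distance, with a factor
  \<open>n\<close> that the division by \<open>n\<close> in the covariance removes.\<close>

lemma EH2: shows "integrable (MN n) (%x. Pphi n x * (HS h1 n x * HS h2 n x))"
 "of_real (LINT x|MN n. Pphi n x * (HS h1 n x * HS h2 n x)) = of_real (sg ^ n) * (of_nat n * (SUM d<n. integ (insert2 0 d) n))"
proof -
have e: "Pphi n x * (HS h1 n x * HS h2 n x) = (SUM i<n. SUM j<n. Pphi n x * (h1 (win Q (per n x) i) * h2 (win Q (per n x) j)))" for x
 by (simp only: HS_def sum_product) (simp only: sum_distrib_left)
show "integrable (MN n) (%x. Pphi n x * (HS h1 n x * HS h2 n x))" unfolding e by (auto intro!: Lintegrable_sum E2)
have "of_real (LINT x|MN n. Pphi n x * (HS h1 n x * HS h2 n x)) = (SUM i<n. SUM j<n. of_real (sg ^ n) * integ (insert2 i j) n)"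
proof -
 have "(LINT x|MN n. Pphi n x * (HS h1 n x * HS h2 n x)) = (SUM i<n. \<integral>x. (SUM j<n. Pphi n x * (h1 (win Q (per n x) i) * h2 (win Q (per n x) j))) \<partial>MN n)"
  unfolding e by (rule Lintegral_sum) (auto intro!: Lintegrable_sum E2)
 also have "... = (SUM i<n. SUM j<n. \<integral>x. Pphi n x * (h1 (win Q (per n x) i) * h2 (win Q (per n x) j)) \<partial>MN n)"
  by (intro sum.cong refl Lintegral_sum E2) auto
 finally show ?thesis by (simp add: E2 del: of_real_power)
qed
also have "... = (SUM i<n. SUM j<n. of_real (sg ^ n) * integ (insert2 0 ((j + n - i) mod n)) n)"
 by (intro sum.cong refl arg_cong2[where f="(*)"] integ_insert2) auto
also have "... = (SUM i<n. SUM d<n. of_real (sg ^ n) * integ (insert2 0 d) n)"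
proof (rule sum.cong[OF refl])
 fix i assume i: "i : {..<n}"
 show "(SUM j<n. of_real (sg ^ n) * integ (insert2 0 ((j + n - i) mod n)) n) = (SUM d<n. of_real (sg ^ n) * integ (insert2 0 d) n)"
 proof (rule sum.reindex_bij_witness[of _ "%d. (d + i) mod n" "%j. (j + n - i) mod n"])
  fix j assume j: "j : {..<n}"
  have 1: "(j + n - i) mod n = (if i <= j then j - i else j + n - i)" and 2: "(j + i) mod n = (if j + i < n then j + i else j + i - n)"
   using i j by (auto simp: mod_if)
  show "((j + n - i) mod n + i) mod n = j" unfolding 1 using i j by (auto simp: mod_if)
  show "((j + i) mod n + n - i) mod n = j" unfolding 2 using i j by (auto simp: mod_if)
  show "(j + n - i) mod n : {..<n}" "(j + i) mod n : {..<n}" using j by auto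
 qed simp
qed
finally show "of_real (LINT x|MN n. Pphi n x * (HS h1 n x * HS h2 n x)) = of_real (sg ^ n) * (of_nat n * (SUM d<n. integ (insert2 0 d) n))"
 by (simp add: sum_distrib_left mult_ac)
qed

end

context gibbs_gap begin

text \<open>Each of the \<open>n\<close> distances contributes an error of order
  \<open>th ^ mm n\<close>, whence the factor \<open>real n\<close>; it is harmless as
  \<open>mm n\<close> grows like \<open>n / 4\<close>.\<close>

lemma mm_lim: "(%n. real n * th ^ mm n) ----> 0" "(%n. th ^ mm n) ----> 0"
proof -
have n1: "norm th < 1" using th by simp
have "filterlim mm at_top sequentially"
proof (unfold filterlim_at_top, intro allI)
 fix k
 have "\<forall>\<^sub>F n in sequentially. 4 * k + 2 * Q + 8 <= n" by (rule eventually_ge_at_top)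
 thus "\<forall>\<^sub>F n in sequentially. k <= mm n" by eventually_elim (auto simp: mm_def)
qed
note comp = filterlim_compose[OF _ this]
have l1: "(%k. real k * th ^ k) ----> 0" by (rule powser_times_n_limit_0[OF n1])
have l2: "(%k. th ^ k) ----> 0" using n1 by (rule LIMSEQ_power_zero)
show "(%n. th ^ mm n) ----> 0" by (rule comp[OF l2])
have "(%k. 4 * (real k * th ^ k) + real (4 * Q + 10) * th ^ k) ----> 4 * 0 + real (4 * Q + 10) * 0" by (intro tendsto_intros l1 l2)
from comp[OF this] have *: "(%n. 4 * (real (mm n) * th ^ mm n) + real (4 * Q + 10) * th ^ mm n) ----> 0" by simp
show "(%n. real n * th ^ mm n) ----> 0"
proof (rule Lim_null_comparison[OF _ *], intro always_eventually allI)
 fix n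
 have "n <= 4 * mm n + (4 * Q + 10)" unfolding mm_def by presburger
 hence "real n <= 4 * real (mm n) + real (4 * Q + 10)" by linarith
 hence "real n * th ^ mm n <= (4 * real (mm n) + real (4 * Q + 10)) * th ^ mm n" using th by (intro mrm) auto
 thus "norm (real n * th ^ mm n) <= 4 * (real (mm n) * th ^ mm n) + real (4 * Q + 10) * th ^ mm n" using th by (simp add: alg)
qed
qed

definition "cr x y k = l (T x ((bap T0 ^^ k) (T y r))) - l (T x r) * l (T y r)"

text \<open>This is the series of \<open>N\<close> under \<open>l\<close> and \<open>T x\<close>.
  Its index \<open>k\<close> belongs to the distance \<open>k + 1\<close>, the transfers with
  \<open>x\<close> and \<open>y\<close> being steps themselves.\<close>

lemma cr_sums: "cr x y sums l (T x (N (T y r)))"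
proof -
have "(%k. l (T x ((bap T0 ^^ k) (T y r) - csc (l (T y r)) r))) sums l (T x (N (T y r)))" by (intro bounded_linear.sums[OF blinfun.bounded_linear_right] N0(3))
thus ?thesis by (simp add: cr_def[abs_def] blinfun.diff_right T_csc l mult.commute)
qed

definition "corr n g = integ (insert2 0 g) n / integ (%_. P0) n - (integ (insert1 i1 0) n / integ (%_. P0) n) * (integ (insert1 i2 0) n / integ (%_. P0) n)"
text \<open>On the cycle a pair is close in one of two directions: forwards up to half of the cycle,
  beyond that backwards, with the roles of the observables exchanged.\<close>

definition "target n g = (if g = 0 then l (T i12 r) - l (T i1 r) * l (T i2 r) else if 2 * g <= n then cr i1 i2 (g - 1) else cr i2 i1 (n - g - 1))"

lemma sum_target: "0 < n ==> (SUM g<n. target n g) = l (T i12 r) - l (T i1 r) * l (T i2 r) + (SUM k<n div 2. cr i1 i2 k) + (SUM k<n - 1 - n div 2. cr i2 i1 k)"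
if n: "2 <= n"
proof -
have "{..<n} = insert 0 ({1..n div 2} \<union> {n div 2 + 1..<n})" using n by auto
moreover have "(SUM g:insert 0 ({1..n div 2} \<union> {n div 2 + 1..<n}). target n g) = target n 0 + (SUM g:{1..n div 2} \<union> {n div 2 + 1..<n}. target n g)"
 by (rule sum.insert) auto
moreover have "(SUM g:{1..n div 2} \<union> {n div 2 + 1..<n}. target n g) = (SUM g:{1..n div 2}. target n g) + (SUM g:{n div 2 + 1..<n}. target n g)"
 by (rule sum.union_disjoint) auto
moreover have "(SUM g:{1..n div 2}. target n g) = (SUM k<n div 2. cr i1 i2 k)"
 by (rule sum.reindex_bij_witness[of _ "%k. k + 1" "%k. k - 1"]) (auto simp: target_def)
moreover have "(SUM g:{n div 2 + 1..<n}. target n g) = (SUM k<n - 1 - n div 2. cr i2 i1 k)"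
 by (rule sum.reindex_bij_witness[of _ "%k. n - 1 - k" "%k. n - k - 1"]) (use n in \<open>auto simp: target_def\<close>)
ultimately have "(SUM g<n. target n g) = target n 0 + ((SUM k<n div 2. cr i1 i2 k) + (SUM k<n - 1 - n div 2. cr i2 i1 k))" by metis
thus ?thesis by (simp add: target_def)
qed

lemma sum_target_lim: "(%n. SUM g<n. target n g) ----> cc"
proof -
have f: "filterlim (%n :: nat. n div 2) at_top sequentially" "filterlim (%n :: nat. n - 1 - n div 2) at_top sequentially"
proof (unfold filterlim_at_top, safe)
 fix k :: nat
 have "\<forall>\<^sub>F n in sequentially. 2 * k + 3 <= n" by (rule eventually_ge_at_top)
 thus "\<forall>\<^sub>F n in sequentially. k <= n div 2" "\<forall>\<^sub>F n in sequentially. k <= n - 1 - n div 2" by (eventually_elim, auto)+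
qed
have "(%n. l (T i12 r) - l (T i1 r) * l (T i2 r) + (SUM k<n div 2. cr i1 i2 k) + (SUM k<n - 1 - n div 2. cr i2 i1 k))
 ----> l (T i12 r) - l (T i1 r) * l (T i2 r) + l (T i1 (N (T i2 r))) + l (T i2 (N (T i1 r)))"
 using cr_sums unfolding sums_def by (intro tendsto_intros filterlim_compose[OF _ f(1)] filterlim_compose[OF _ f(2)])
hence "(%n. l (T i12 r) - l (T i1 r) * l (T i2 r) + (SUM k<n div 2. cr i1 i2 k) + (SUM k<n - 1 - n div 2. cr i2 i1 k)) ----> cc" by (simp add: cc_def alg)
moreover have "\<forall>\<^sub>F n in sequentially. l (T i12 r) - l (T i1 r) * l (T i2 r) + (SUM k<n div 2. cr i1 i2 k) + (SUM k<n - 1 - n div 2. cr i2 i1 k) = (SUM g<n. target n g)"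
 using eventually_ge_at_top[of 2] by eventually_elim (simp add: sum_target)
ultimately show ?thesis by (rule Lim_transform_eventually)
qed

text \<open>The errors of the insertion estimates survive the division by the unperturbed integral,
  because \<open>integ_pos\<close> keeps that integral away from 0.\<close>

lemma corr_bound: "EX K. \<forall>\<^sub>F n in sequentially. ALL g<n. norm (corr n g - target n g) <= K * th ^ mm n"
proof -
define p' where "p' = p / sg ^ Q"
have p': "0 < p'" using p sg by (simp add: p'_def)
define ep where "ep = KS / p'"
have ep: "0 <= ep" using KS p' by (simp add: ep_def)
define K where "K = ep + ep * (norm (l (T i1 r)) + norm (l (T i2 r)) + ep)"
have ev: "\<forall>\<^sub>F n in sequentially. p' <= Re (integ (%_. P0) n)"
proof -
 obtain n1 where n1: "!!n. n1 <= n ==> p' <= Re (integ (%_. P0) (n + Q))" using integ_pos unfolding eventually_sequentially p'_def by blast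
 have "p' <= Re (integ (%_. P0) n)" if "n1 + Q <= n" for n using n1[of "n - Q"] that by simp
 thus ?thesis unfolding eventually_sequentially by blast
qed
have "\<forall>\<^sub>F n in sequentially. ALL g<n. norm (corr n g - target n g) <= K * th ^ mm n" using ev eventually_ge_at_top[of "2 * Q + 4"]
proof eventually_elim
 case (elim n)
 let ?Z = "integ (%_. P0) n"
 have Z: "p' <= norm ?Z" using elim(1) complex_Re_le_cmod[of ?Z] by linarith
 hence Z0: "?Z ~= 0" using p' by auto
 have quot: "norm (x / ?Z - y) <= ep * th ^ mm n" if "norm (x - y * ?Z) <= KS * th ^ mm n" for x y
 proof -
  have "norm (x / ?Z - y) = norm (x - y * ?Z) / norm ?Z" using Z0 by (simp add: norm_divide[symmetric] diff_divide_distrib)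
  also have "... <= (KS * th ^ mm n) / p'" using that Z p' KS th by (intro frac_le) auto
  finally show ?thesis by (simp add: ep_def)
 qed
 define a where "a = integ (insert1 i1 0) n / ?Z"
 define b where "b = integ (insert1 i2 0) n / ?Z"
 have a: "norm (a - l (T i1 r)) <= ep * th ^ mm n" and b: "norm (b - l (T i2 r)) <= ep * th ^ mm n"
  unfolding a_def b_def insert1_def by (intro quot single_integ elim norm_i)+
 have th1: "ep * th ^ mm n <= ep" using ep th by (simp add: mult_left_le power_le_one)
 have ab: "norm (a * b - l (T i1 r) * l (T i2 r)) <= ep * (norm (l (T i1 r)) + norm (l (T i2 r)) + ep) * th ^ mm n"
 proof -
  have "a * b - l (T i1 r) * l (T i2 r) = (a - l (T i1 r)) * (b - l (T i2 r)) + (a - l (T i1 r)) * l (T i2 r) + l (T i1 r) * (b - l (T i2 r))" by (simp add: alg)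
  also have "norm ... <= (ep * th ^ mm n) * ep + (ep * th ^ mm n) * norm (l (T i2 r)) + norm (l (T i1 r)) * (ep * th ^ mm n)"
   using a b th1 ep th by (intro order_trans[OF norm_triangle_ineq] add_mono) (auto simp: norm_mult intro!: mult_mono)
  finally show ?thesis by (simp add: alg)
 qed
 show ?case
 proof (intro allI impI)
  fix g assume g: "g < n"
  define s where "s = (if g = 0 then l (T i12 r) else if 2 * g <= n then l (T i1 ((bap T0 ^^ (g - 1)) (T i2 r))) else l (T i2 ((bap T0 ^^ (n - g - 1)) (T i1 r))))"
  have tg: "target n g = s - l (T i1 r) * l (T i2 r)" by (auto simp: target_def s_def cr_def)
  have "norm (integ (insert2 0 g) n - s * ?Z) <= KS * th ^ mm n"
  proof -
   consider "g = 0" | "0 < g" "2 * g <= n" | "0 < g" "n < 2 * g" by linarith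
   thus ?thesis
   proof cases
    case 1
    thus ?thesis using single_integ[OF elim(2) norm_i(3)] by (simp add: insert2_def s_def)
   next
    case 2
    thus ?thesis using pair_integ[OF elim(2) norm_i(1,2), of g] by (simp add: insert2_def s_def)
   next
    case 3
    have "integ ((%_. P0)(0 := i2, n - g := i1)) n = integ (insert2 0 g) n"
    proof (rule integ_shift[of _ _ _ g])
     fix i assume i: "i < n"
     have "(i + g) mod n = (if i + g < n then i + g else i + g - n)" using i g by (simp add: mod_if)
     thus "((%_. P0)(0 := i2, n - g := i1)) i = insert2 0 g ((i + g) mod n)" using i g 3 by (auto simp: insert2_def)
    qed (use g in auto)
    thus ?thesis using pair_integ[OF elim(2) norm_i(2,1), of "n - g"] 3 g by (simp add: s_def)
   qed
  qed
  from quot[OF this] ab have "norm ((integ (insert2 0 g) n / ?Z - s) - (a * b - l (T i1 r) * l (T i2 r))) <= ep * th ^ mm n + ep * (norm (l (T i1 r)) + norm (l (T i2 r)) + ep) * th ^ mm n"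
   by (rule order_trans[OF norm_triangle_ineq4 add_mono])
  thus "norm (corr n g - target n g) <= K * th ^ mm n" unfolding corr_def tg a_def[symmetric] b_def[symmetric] by (simp add: K_def alg)
 qed
qed
thus ?thesis by blast
qed

definition "Exn n f = (LINT x|MN n. Pphi n x * f x) / (LINT x|MN n. Pphi n x)" for f :: "(nat => 'a) => real"

theorem covariance_limit:
"EX c. cor c = cc & (%n. (Exn n (%x. HS h1 n x * HS h2 n x) - Exn n (HS h1 n) * Exn n (HS h2 n)) / real n) ----> c"
proof -
obtain K where K: "\<forall>\<^sub>F n in sequentially. ALL g<n. norm (corr n g - target n g) <= K * th ^ mm n" using corr_bound by blast
have "(%n. (SUM g<n. corr n g) - (SUM g<n. target n g)) ----> 0"
proof (rule Lim_null_comparison)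
 show "\<forall>\<^sub>F n in sequentially. norm ((SUM g<n. corr n g) - (SUM g<n. target n g)) <= K * (real n * th ^ mm n)" using K
 proof eventually_elim
  case (elim n)
  have "norm ((SUM g<n. corr n g) - (SUM g<n. target n g)) <= (SUM g<n. K * th ^ mm n)" unfolding sum_subtractf[symmetric] using elim by (intro sum_norm_le) auto
  thus ?case by (simp add: mult.left_commute)
 qed
 show "(%n. K * (real n * th ^ mm n)) ----> 0" using tendsto_mult_right_zero[OF mm_lim(1)] by simp
qed
from tendsto_add[OF this sum_target_lim] have lim: "(%n. SUM g<n. corr n g) ----> cc" by simp
define cov where "cov n = (Exn n (%x. HS h1 n x * HS h2 n x) - Exn n (HS h1 n) * Exn n (HS h2 n)) / real n" for n
have ex: "of_real (Exn n f) = X / integ (%_. P0) n" if "of_real (LINT x|MN n. Pphi n x * f x) = of_real (sg ^ n) * X" for n f X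
 using sg unfolding Exn_def of_real_divide that E0 by simp
have "\<forall>\<^sub>F n in sequentially. (SUM g<n. corr n g) = of_real (cov n)" using eventually_gt_at_top[of 0]
proof eventually_elim
 case (elim n)
 have "of_real (cov n) = (of_nat n * (SUM g<n. integ (insert2 0 g) n) / integ (%_. P0) n - (of_nat n * integ (insert1 i1 0) n / integ (%_. P0) n) * (of_nat n * integ (insert1 i2 0) n / integ (%_. P0) n)) / of_nat n"
  unfolding cov_def by (simp only: of_real_divide of_real_diff of_real_mult ex[OF EH2(2)] ex[OF EH1(2)] ex[OF EH1(4)] of_real_of_nat_eq)
 also have "... = (SUM g<n. integ (insert2 0 g) n) / integ (%_. P0) n - of_nat n * ((integ (insert1 i1 0) n / integ (%_. P0) n) * (integ (insert1 i2 0) n / integ (%_. P0) n))"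
  using elim by (simp add: diff_divide_distrib)
 also have "... = (SUM g<n. corr n g)" by (simp add: corr_def sum_subtractf sum_divide_distrib)
 finally show ?case by simp
qed
from Lim_transform_eventually[OF lim this] have c: "(%n. cor (cov n)) ----> cc" .
have "Im cc = 0" using tendsto_Im[OF c] by (simp add: LIMSEQ_const_iff)
hence "cor (Re cc) = cc" by (simp add: complex_eq_iff)
moreover have "cov ----> Re cc" using tendsto_Re[OF c] by simp
ultimately show ?thesis unfolding cov_def by blast
qed

end

context gibbs_pair begin

definition "Ev n f = (LINT x|(PiM {..<n} (%_. vu)). Pphi n x * f x) / (LINT x|(PiM {..<n} (%_. vu)). Pphi n x)" for f :: "(nat => 'a) => real"

theorem gibbs_pair_main:
obtains c de Ph lN where
 "!!n. integrable (PiM {..<n} (%_. vu)) (Pphi n)"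
 "!!n. integrable (PiM {..<n} (%_. vu)) (%x. Pphi n x * HS h1 n x)"
 "!!n. integrable (PiM {..<n} (%_. vu)) (%x. Pphi n x * HS h2 n x)"
 "!!n. integrable (PiM {..<n} (%_. vu)) (%x. Pphi n x * (HS h1 n x * HS h2 n x))"
 "(%n. (Ev n (%x. HS h1 n x * HS h2 n x) - Ev n (HS h1 n) * Ev n (HS h2 n)) / real n) ----> c"
 "0 < de" "\<forall>\<^sub>F n in sequentially. continuous_log de (%(t, s). ZZ n t s) (lN n)"
 "!!t. t : ball (0, 0) de ==> (%n. - (lN n t / of_nat n)) ----> Ph t" "has_mixed_derivative_at_0 Ph (cor c)"
proof -
obtain sg r and l :: "'a bmf \<Rightarrow>\<^sub>L complex" and D th p where tg: "0 < sg" "0 <= th" "th < 1" "0 <= D"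
 "T W r = sg *\<^sub>R r" "!!f. l (T W f) = of_real sg * l f" "!!c f. l (csc c f) = c * l f" "l r = 1"
 "!!f n. norm ((bap (T W) ^^ n) f - csc (of_real (sg ^ n) * l f) r) <= D * th ^ n * sg ^ n * norm f"
 "0 < p" "\<forall>\<^sub>F n in sequentially. p * sg ^ n <= Re (LINT v|M. ap (ops (%_. W) n (kern (%_. W) n v)) v)" by (rule transfer_gap) blast
define T1 where "T1 = (1 / sg) *\<^sub>R T W"
have T1: "T1 x = (1 / sg) *\<^sub>R T W x" for x by (simp add: T1_def blinfun.scaleR_left)
have T1p: "(bap T1 ^^ n) x = (1 / sg ^ n) *\<^sub>R (bap (T W) ^^ n) x" for n x by (induction n) (simp_all add: T1 blinfun.scaleR_right)
have gap: "norm ((bap T1 ^^ n) f - csc (l f) r) <= D * th ^ n * norm f" for n f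
proof -
 have "csc (l f) r = (1 / sg ^ n) *\<^sub>R csc (of_real (sg ^ n) * l f) r" using tg(1) by (intro bmf_eqI) (simp add: scaleR_conv_of_real)
 hence "(bap T1 ^^ n) f - csc (l f) r = (1 / sg ^ n) *\<^sub>R ((bap (T W) ^^ n) f - csc (of_real (sg ^ n) * l f) r)" by (simp only: T1p scaleR_diff_right)
 also have "norm ... = (1 / sg ^ n) * norm ((bap (T W) ^^ n) f - csc (of_real (sg ^ n) * l f) r)" using tg(1) by simp
 also have "... <= (1 / sg ^ n) * (D * th ^ n * sg ^ n * norm f)" using tg(1,9) by (intro mlm) auto
 finally show ?thesis using tg(1) by simp
qed
have T1l: "l (T1 x) = l x" "T1 r = r" "T1 (csc c x) = csc c (T1 x)" for x c
proof -
 show "l (T1 x) = l x" "T1 r = r" using tg(1) by (simp_all add: T1 blinfun.scaleR_right tg(5,6) scaleR_conv_of_real)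
 show "T1 (csc c x) = csc c (T1 x)" unfolding T1 T_csc by (rule bmf_eqI) (simp add: scaleR_conv_of_real)
qed
obtain N :: "'a bmf \<Rightarrow>\<^sub>L 'a bmf" where N: "!!c x. N (csc c x) = csc c (N x)" "!!x. N x - T1 (N x) = x - csc (l x) r"
 "!!x. N (x - T1 x) = x - csc (l x) r" "N r = 0" "!!x. l (N x) = 0" "!!f. (%n. (bap T1 ^^ n) f - csc (l f) r) sums N f"
 by (rule bm.neumann[OF tg(7,8) T1l(1) T1l(3) T1l(2) tg(2,3,4) gap]) blast
interpret g: gibbs_gap vu Q ph C A d h1 h2 sg p D th r l N by unfold_locales (use tg N in \<open>simp_all add: T1 T1p\<close>)
obtain c where c: "cor c = g.cc" "(%n. (g.Exn n (%x. HS h1 n x * HS h2 n x) - g.Exn n (HS h1 n) * g.Exn n (HS h2 n)) / real n) ----> c"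
 using g.covariance_limit by blast
obtain de Ph lN where f: "0 < de" "\<forall>\<^sub>F n in sequentially. continuous_log de (%(t, s). ZZ n t s) (lN n)"
  "ALL t:ball (0, 0) de. (%n. - (lN n t / of_nat n)) ----> Ph t" "has_mixed_derivative_at_0 Ph g.cc" using g.free_energy by blast
show ?thesis using that[of c de lN Ph] c f g.E0(1) g.EH1(1,3) g.EH2(1) unfolding g.Exn_def Ev_def by auto
qed

end

section \<open>From a matrix model with window traces to the chain\<close>

lemma PiM_density_prod: fixes f :: "'a::euclidean_space => real"
assumes [measurable]: "f : bmeas borel" and f0: "!!x. 0 <= f x" and I: "finite I" and p: "prob_space (density lborel f)"
shows "density (PiM I (%_. lborel)) (%x. ennreal (PROD i:I. f (x i))) = PiM I (%_. density lborel f)"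
proof -
interpret d: prob_space "density lborel f" by (rule p)
interpret D: product_sigma_finite "%_. density lborel f" by unfold_locales
interpret L: product_sigma_finite "%_. lborel :: 'a measure" by unfold_locales
show ?thesis
proof (rule D.PiM_eqI[OF I])
 show "sets (density (PiM I (%_. lborel)) (%x. ennreal (PROD i:I. f (x i)))) = sets (PiM I (%_. density lborel f))" by (simp cong: sets_PiM_cong)
 fix A assume A: "!!i. i : I ==> A i : sets (density lborel f)"
 have Am [measurable]: "i : I ==> A i : sets borel" for i using A by simp
 have PA: "PiE I A : sets (PiM I (%_. lborel))" using A by (intro sets_PiM_I_finite I) auto
 have "emeasure (density (PiM I (%_. lborel)) (%x. ennreal (PROD i:I. f (x i)))) (PiE I A) = (\<integral>\<^sup>+ x. ennreal (PROD i:I. f (x i)) * indicator (PiE I A) x \<partial>PiM I (%_. lborel))"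
  by (rule emeasure_density[OF _ PA]) measurable
 also have "... = (\<integral>\<^sup>+ x. (PROD i:I. ennreal (f (x i)) * indicator (A i) (x i)) \<partial>PiM I (%_. lborel))"
 proof (rule nn_integral_cong)
  fix x assume x: "x : space (PiM I (%_. lborel :: 'a measure))"
  have "indicator (PiE I A) x = (PROD i:I. indicator (A i) (x i) :: ennreal)"
  proof (cases "ALL i:I. x i : A i")
   case True
   hence "x : PiE I A" using x by (auto simp: space_PiM PiE_def)
   thus ?thesis using True by simp
  next
   case False
   then obtain i where i: "i : I" "x i \<notin> A i" by blast
   hence "x \<notin> PiE I A" by (auto simp: PiE_def)
   moreover have "(PROD i:I. indicator (A i) (x i) :: ennreal) = 0" by (rule prod_zero[OF I bexI[OF _ i(1)]]) (simp add: i)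
   ultimately show ?thesis by simp
  qed
  thus "ennreal (PROD i:I. f (x i)) * indicator (PiE I A) x = (PROD i:I. ennreal (f (x i)) * indicator (A i) (x i))"
   using f0 by (simp add: prod.distrib prod_ennreal)
 qed
 also have "... = (PROD i:I. \<integral>\<^sup>+ x. ennreal (f x) * indicator (A i) x \<partial>lborel)" by (rule L.product_nn_integral_prod[OF I]) (use Am in measurable)
 also have "... = (PROD i:I. emeasure (density lborel f) (A i))" using Am by (intro prod.cong refl emeasure_density[symmetric]) auto
 finally show "emeasure (density (PiM I (%_. lborel)) (%x. ennreal (PROD i:I. f (x i)))) (PiE I A) = (PROD i:I. emeasure (density lborel f) (A i))" .
qed
qed

text \<open>Matrix variables are numbered from 1 and sites from 0, whence the \<open>Suc\<close> in
  \<open>traces\<close>. The assumption \<open>upper\<close> bounds the weight from below on windows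
  of bounded letters, and the sets of bounded letters exhaust the variable space.\<close>

locale window_model = fixes MM :: "'a::euclidean_space matrix_model" and F :: "'a => real => real" and al :: real and P :: "complex poly" and m n Q :: nat
 and e h1 h2 :: "(nat => 'a) => real" and C :: real assumes X_borel [measurable]: "var_space MM : sets borel"
 and F_nonneg: "!!x. x : var_space MM ==> 0 <= F x al"
 and F_int: "set_integrable lborel (var_space MM) (%x. F x al)"
 and Z_pos: "\<forall>\<^sub>F N in large (sizes MM). 0 < partition_function MM F al N (trace_fun MM P N)"
 and sizes: "large (sizes MM) ~= bot" and Q0: "0 < Q"
 and e_meas [measurable]: "e : bmeas seqM" "h1 : bmeas seqM" "h2 : bmeas seqM"
 and traces: "\<forall>\<^sub>F N in large (sizes MM). ALL x:vectors (var_space MM) N.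
   trace_fun MM P N x = (SUM i<N. e (win Q (per N (%j. x (Suc j))) i)) &
   trace_fun MM (monom 1 m) N x = (SUM i<N. h1 (win Q (per N (%j. x (Suc j))) i)) &
   trace_fun MM (monom 1 n) N x = (SUM i<N. h2 (win Q (per N (%j. x (Suc j))) i))"
 and bound: "!!u. (!!i. i <= Q ==> u i : var_space MM) ==> exp (- e u) * (1 + abs (h1 u) + abs (h2 u)) ^ 3 <= C"
 and upper: "!!j :: nat. EX B. ALL u. (ALL i<=Q. u i : var_space MM & norm (u i) <= real j) --> e u <= B"
begin

abbreviation "X == var_space MM"
definition "g x = indicator X x * F x al"
definition "Z1 = (LINT x|lborel. g x)"
definition "f x = g x / Z1"
definition "vu = density lborel (%x. ennreal (f x))"
text \<open>The total mass \<open>Z1\<close> is moved from the single-site measure, which becomes a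
  probability, into the weight. The indicator makes the weight vanish where \<open>e\<close> is not
  controlled.\<close>

definition "ph u = Z1 * exp (- e u) * indicator {u. ALL i<=Q. u i : X} u"
definition "A j = X \<inter> cball 0 (real j)"

lemma g: "g : bmeas borel" "0 <= g x" "integrable lborel g"
proof -
show i: "integrable lborel g" using F_int by (simp add: set_integrable_def g_def[abs_def])
thus "g : bmeas borel" by auto
show "0 <= g x" using F_nonneg[of x] by (auto simp: g_def indicator_def)
qed

lemma indicator_vectors: assumes "x : space (ref_measure N)" shows "indicator (vectors X N) x * (PROD j=1..N. F (x j) al) = (PROD j=1..N. g (x j))"
proof (cases "ALL j:{1..N}. x j : X")
case True
hence "x : vectors X N" using assms by (auto simp: space_PiM PiE_def)
thus ?thesis using True by (simp add: g_def)
next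
case False
then obtain j where j: "j : {1..N}" "x j \<notin> X" by blast
hence "x \<notin> vectors X N" by (auto simp: PiE_def)
moreover have "(PROD j=1..N. g (x j)) = 0" by (rule prod_zero[OF _ bexI[OF _ j(1)]]) (simp_all add: g_def j)
ultimately show ?thesis by simp
qed

text \<open>If \<open>g\<close> vanished almost everywhere, every partition function of positive
  size would be 0.\<close>

lemma Z1_pos: "0 < Z1"
proof (rule ccontr)
assume "\<not> 0 < Z1"
moreover have "0 <= Z1" unfolding Z1_def using g by (intro Lintegral_nonneg) auto
ultimately have "Z1 = 0" by simp
hence nn: "(\<integral>\<^sup>+x. ennreal (g x) \<partial>lborel) = 0" using nn_integral_eq_integral[OF g(3)] g(2) by (simp add: Z1_def)
have "\<forall>\<^sub>F N in large (sizes MM). 1 <= N" using eventually_ge_at_top[of 1] by (rule filter_leD[rotated]) simp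
from eventually_happens'[OF sizes eventually_conj[OF Z_pos this]]
obtain N where N: "0 < partition_function MM F al N (trace_fun MM P N)" "1 <= N" by blast
interpret L: product_sigma_finite "%_. lborel :: 'a measure" by unfold_locales
have "(\<integral>\<^sup>+x. (PROD j=1..N. ennreal (g (x j))) \<partial>ref_measure N) = (PROD j=1..N. \<integral>\<^sup>+x. ennreal (g x) \<partial>lborel)"
 by (rule L.product_nn_integral_prod) (use g(1) in auto)
also have "... = 0" using N(2) by (simp add: nn)
finally have "AE x in ref_measure N. (PROD j=1..N. ennreal (g (x j))) = 0" using g(1) by (subst (asm) nn_integral_0_iff_AE) auto
hence "AE x in ref_measure N. indicator (vectors X N) x *\<^sub>R (of_real (PROD j=1..N. F (x j) al) * exp (- trace_fun MM P N x)) = 0"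
proof (rule AE_mp, intro AE_I2 impI)
 fix x assume x: "x : space (ref_measure N)" "(PROD j=1..N. ennreal (g (x j))) = 0"
 have "ennreal (PROD j=1..N. g (x j)) = 0" using x(2) g(2) by (simp add: prod_ennreal)
 moreover have "0 <= (PROD j=1..N. g (x j))" using g(2) by (intro prod_nonneg) auto
 ultimately have "(PROD j=1..N. g (x j)) = 0" by (metis antisym ennreal_eq_0_iff)
 thus "indicator (vectors X N) x *\<^sub>R (of_real (PROD j=1..N. F (x j) al) * exp (- trace_fun MM P N x)) = 0"
  using indicator_vectors[OF x(1)] by (auto simp: mult.assoc[symmetric])
qed
hence "partition_function MM F al N (trace_fun MM P N) = 0" unfolding partition_function_def set_lebesgue_integral_def by (rule integral_eq_zero_AE)
thus False using N by simp
qed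

lemma f: "f : bmeas borel" "0 <= f x" "prob_space vu"
proof -
show m: "f : bmeas borel" unfolding f_def[abs_def] using g(1) by simp
show nn: "0 <= f x" for x using g(2) Z1_pos by (simp add: f_def)
show "prob_space vu"
proof
 have i: "integrable lborel f" unfolding f_def[abs_def] using g(3) by simp
 have "emeasure vu (space vu) = (\<integral>\<^sup>+x. ennreal (f x) \<partial>lborel)" unfolding vu_def using m by (simp add: emeasure_density)
 also have "... = ennreal (LINT x|lborel. f x)" using i nn by (intro nn_integral_eq_integral) auto
 also have "(LINT x|lborel. f x) = 1" using Z1_pos by (simp add: f_def[abs_def] Z1_def[symmetric])
 finally show "emeasure vu (space vu) = 1" by simp
qed
qed

lemma A_lim: "(%j. measure vu (A j)) ----> 1"
proof -
interpret vu: prob_space vu by (rule f)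
have "(%j. measure vu (A j)) ----> measure vu (\<Union>j. A j)" by (rule vu.finite_Lim_measure_incseq) (auto simp: A_def vu_def incseq_def)
moreover have "(\<Union>j. A j) = X"
proof -
 have "x : (\<Union>j. A j)" if "x : X" for x
 proof -
  obtain j :: nat where "norm x <= real j" using real_arch_simple by blast
  thus ?thesis using that by (auto simp: A_def)
 qed
 thus ?thesis by (auto simp: A_def)
qed
moreover have "measure vu X = 1"
proof -
 have "emeasure vu (UNIV - X) = (\<integral>\<^sup>+x. ennreal (f x) * indicator (UNIV - X) x \<partial>lborel)" unfolding vu_def using f(1) by (intro emeasure_density) auto
 also have "... = (\<integral>\<^sup>+x. 0 \<partial>(lborel :: 'a measure))" by (intro nn_integral_cong) (auto simp: f_def g_def indicator_def)
 finally have "measure vu (UNIV - X) = 0" by (simp add: measure_def)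
 thus ?thesis using vu.prob_compl[of X] by (simp add: vu_def)
qed
ultimately show ?thesis by simp
qed

lemma chain: "chain vu Q"
proof (rule chain.intro)
show "prob_space vu" by (rule f)
show "sets vu = sets borel" by (simp add: vu_def)
qed (rule Q0)

lemma phi_h: "ph u * (1 + abs (h1 u) + abs (h2 u)) ^ 3 <= Z1 * (max C 1)"
proof (cases "ALL i<=Q. u i : X")
case True
hence "ph u * (1 + abs (h1 u) + abs (h2 u)) ^ 3 = Z1 * (exp (- e u) * (1 + abs (h1 u) + abs (h2 u)) ^ 3)" by (simp add: ph_def)
also have "... <= Z1 * max C 1" using bound[of u] True Z1_pos by (intro mlm) auto
finally show ?thesis .
next
case False
thus ?thesis using Z1_pos by (auto simp: ph_def)
qed

lemma phi_nonneg: "0 <= ph u" using Z1_pos by (simp add: ph_def)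

definition "up j = (SOME B. ALL u. (ALL i<=Q. u i : X & norm (u i) <= real j) --> e u <= B)"

sublocale gp: gibbs_pair vu Q ph "Z1 * max C 1" A "%j. Z1 * exp (- up j)" h1 h2
proof -
interpret chain vu Q by (rule chain)
show "gibbs_pair vu Q ph (Z1 * max C 1) A (%j. Z1 * exp (- up j)) h1 h2"
proof unfold_locales
 show "ph : bmeas seqM" unfolding ph_def[abs_def] by measurable
 show "0 <= ph x" for x by (rule phi_nonneg)
 show "ph x <= Z1 * max C 1" for x
 proof -
  have "ph x * 1 <= ph x * (1 + abs (h1 x) + abs (h2 x)) ^ 3" by (intro mlm phi_nonneg one_le_power) auto
  thus ?thesis using phi_h[of x] by simp
 qed
 show "0 < Z1 * max C 1" "0 < Z1 * exp (- up j)" for j using Z1_pos by auto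
 show "A j : sets borel" for j by (simp add: A_def)
 show "incseq A" by (auto simp: A_def incseq_def)
 show "(%j. measure vu (A j)) ----> 1" by (rule A_lim)
 show "Z1 * exp (- up j) <= ph x" if "!!i. i <= Q ==> x i : A j" for j x
 proof -
  have "ALL u. (ALL i<=Q. u i : X & norm (u i) <= real j) --> e u <= up j" unfolding up_def by (rule someI_ex[OF upper])
  moreover have "ALL i<=Q. x i : X & norm (x i) <= real j" using that by (auto simp: A_def)
  ultimately have "e x <= up j" "ALL i<=Q. x i : X" by auto
  thus ?thesis using Z1_pos by (simp add: ph_def)
 qed
 show "ph x * (1 + abs (h1 x) + abs (h2 x)) ^ 3 <= Z1 * max C 1" for x by (rule phi_h)
qed measurable
qed

definition "good N \<longleftrightarrow> 1 <= N & (ALL x:vectors X N.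
   trace_fun MM P N x = (SUM i<N. e (win Q (per N (%j. x (Suc j))) i)) &
   trace_fun MM (monom 1 m) N x = (SUM i<N. h1 (win Q (per N (%j. x (Suc j))) i)) &
   trace_fun MM (monom 1 n) N x = (SUM i<N. h2 (win Q (per N (%j. x (Suc j))) i)))"

lemma good: "\<forall>\<^sub>F N in large (sizes MM). good N"
proof -
have "\<forall>\<^sub>F N in large (sizes MM). 1 <= N" using eventually_ge_at_top[of 1] by (rule filter_leD[rotated]) simp
from eventually_conj[OF this traces] show ?thesis unfolding good_def .
qed

definition "rh N x = (\<lambda>i\<in>{..<N}. x (Suc i))" for x :: "nat => 'a"

lemma per_rho: "0 < N ==> per N (rh N x) = per N (%j. x (Suc j))" by (auto simp: per_def rh_def fun_eq_iff)

lemma rho_distr: "distr (PiM {1..N} (%_. vu)) (PiM {..<N} (%_. vu)) (rh N) = PiM {..<N} (%_. vu)"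
proof -
have "distr (PiM {1..N} (%_. vu)) (PiM {..<N} (%i. vu)) (%x. \<lambda>i\<in>{..<N}. x (Suc i)) = PiM {..<N} (%_. vu)" by (rule distr_PiM_reindex) (auto intro!: f)
thus ?thesis by (simp add: rh_def[abs_def])
qed

lemma nu_Pi: "PiM {1..N} (%_. vu) = density (ref_measure N) (%x. ennreal (PROD j:{1..N}. f (x j)))"
unfolding vu_def by (rule PiM_density_prod[symmetric]) (use f in \<open>auto simp: vu_def\<close>)

text \<open>The density of \<open>vu\<close> and the weight \<open>Pphi\<close> contain opposite
  powers of \<open>Z1\<close>, so after renumbering the variables both sides integrate the same
  function.\<close>

lemma transfer: fixes Ps Ph :: "(nat => 'a) => 'b::{banach, second_countable_topology}"
assumes N: "good N" and m [measurable]: "Ph : bmeas seqM" and eq: "!!x. x : vectors X N ==> Ps x = Ph (rh N x)"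
shows "(LINT x:vectors X N|ref_measure N. ((PROD j=1..N. F (x j) al) * exp (- trace_fun MM P N x)) *\<^sub>R Ps x) = (LINT y|(PiM {..<N} (%_. vu)). gp.Pphi N y *\<^sub>R Ph y)"
 "integrable (PiM {..<N} (%_. vu)) (%y. gp.Pphi N y *\<^sub>R Ph y) ==> set_integrable (ref_measure N) (vectors X N) (%x. ((PROD j=1..N. F (x j) al) * exp (- trace_fun MM P N x)) *\<^sub>R Ps x)"
proof -
let ?G = "%y. gp.Pphi N y *\<^sub>R Ph y"
have N1: "0 < N" using N by (simp add: good_def)
have Pm: "gp.Pphi N : bmeas seqM" unfolding gp.Pphi_def[abs_def] by measurable
have Gs: "?G : bmeas seqM" using Pm by measurable
have G: "?G : bmeas (PiM {..<N} (%_. vu))" by (rule gp.from_seq[OF Gs])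
have rhm: "rh N : measurable (PiM {1..N} (%_. vu)) (PiM {..<N} (%_. vu))" unfolding rh_def[abs_def] by (intro measurable_restrict measurable_component_singleton) auto
have "(%x. ?G (rh N x)) : bmeas (PiM {1..N} (%_. vu))" using measurable_compose[OF rhm G] .
hence Grh': "(%x. ?G (rh N x)) : bmeas (ref_measure N)" unfolding nu_Pi by simp
have fm: "(%x. PROD j:{1..N}. f (x j)) : bmeas (ref_measure N)" using f(1) by measurable
have fnn: "0 <= (PROD j:{1..N}. f (x j))" for x using f(2) by (intro prod_nonneg) auto
have pt: "indicator (vectors X N) x *\<^sub>R (((PROD j=1..N. F (x j) al) * exp (- trace_fun MM P N x)) *\<^sub>R Ps x) = (PROD j:{1..N}. f (x j)) *\<^sub>R ?G (rh N x)"
 if x: "x : space (ref_measure N)" for x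
proof (cases "x : vectors X N")
 case True
 have xj: "x (Suc (i mod N)) : X" for i using True N1 by (auto simp: PiE_def Pi_def Suc_le_eq)
 have "gp.Pphi N (rh N x) = (PROD i<N. Z1 * exp (- e (win Q (per N (%j. x (Suc j))) i)))" unfolding gp.Pphi_def per_rho[OF N1]
  by (intro prod.cong refl) (auto simp: ph_def win_def per_def xj)
 also have "... = Z1 ^ N * exp (- trace_fun MM P N x)" using N True by (simp add: good_def prod.distrib exp_sum[symmetric] sum_negf)
 finally have 1: "gp.Pphi N (rh N x) = Z1 ^ N * exp (- trace_fun MM P N x)" .
 have "(PROD j:{1..N}. f (x j)) = (PROD j=1..N. F (x j) al) / Z1 ^ N" using indicator_vectors[OF x] True by (simp add: f_def prod_dividef)
 hence "(PROD j:{1..N}. f (x j)) * gp.Pphi N (rh N x) = (PROD j=1..N. F (x j) al) * exp (- trace_fun MM P N x)" unfolding 1 using Z1_pos by simp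
 thus ?thesis using True eq[OF True] by simp
next
 case False
 hence "(PROD j:{1..N}. g (x j)) = 0" using indicator_vectors[OF x] by simp
 hence "(PROD j:{1..N}. f (x j)) = 0" by (simp add: f_def prod_dividef)
 thus ?thesis using False by simp
qed
have "(LINT y|(PiM {..<N} (%_. vu)). ?G y) = (LINT x|(PiM {1..N} (%_. vu)). ?G (rh N x))" using integral_distr[OF rhm G] unfolding rho_distr .
also have "... = (LINT x|ref_measure N. (PROD j:{1..N}. f (x j)) *\<^sub>R ?G (rh N x))" unfolding nu_Pi by (rule integral_density[OF Grh' fm]) (use fnn in auto)
also have "... = (LINT x:vectors X N|ref_measure N. ((PROD j=1..N. F (x j) al) * exp (- trace_fun MM P N x)) *\<^sub>R Ps x)"
 unfolding set_lebesgue_integral_def by (intro Lintegral_cong refl pt[symmetric])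
finally show "(LINT x:vectors X N|ref_measure N. ((PROD j=1..N. F (x j) al) * exp (- trace_fun MM P N x)) *\<^sub>R Ps x) = (LINT y|(PiM {..<N} (%_. vu)). ?G y)" by simp
assume i: "integrable (PiM {..<N} (%_. vu)) ?G"
hence "integrable (PiM {1..N} (%_. vu)) (%x. ?G (rh N x))" using integrable_distr_eq[OF rhm G] unfolding rho_distr by simp
hence "integrable (ref_measure N) (%x. (PROD j:{1..N}. f (x j)) *\<^sub>R ?G (rh N x))" unfolding nu_Pi using integrable_density[OF Grh' fm] fnn by simp
thus "set_integrable (ref_measure N) (vectors X N) (%x. ((PROD j=1..N. F (x j) al) * exp (- trace_fun MM P N x)) *\<^sub>R Ps x)"
 unfolding set_integrable_def by (subst Lintegrable_cong[OF refl pt]) auto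
qed

end

context window_model begin

lemma HS_rho: assumes "good N" "x : vectors X N" shows "trace_fun MM P N x = (SUM i<N. e (win Q (per N (%j. x (Suc j))) i))"
 "trace_fun MM (monom 1 m) N x = gp.HS h1 N (rh N x)" "trace_fun MM (monom 1 n) N x = gp.HS h2 N (rh N x)"
using assms per_rho[of N x] by (auto simp: good_def gp.HS_def)

lemma HS_meas: "h : bmeas seqM ==> gp.HS h N : bmeas seqM"
unfolding gp.HS_def[abs_def] by (intro borel_measurable_sum measurable_compose[OF measurable_compose[OF per_measurable win_measurable]])

lemma V_sets: "vectors X N \<inter> space (ref_measure N) : sets (ref_measure N)"
proof -
have "vectors X N : sets (ref_measure N)" by (intro sets_PiM_I_finite) auto
thus ?thesis by auto
qed

lemma partition: assumes "good N" shows "partition_function MM F al N (trace_fun MM P N) = (LINT y|(PiM {..<N} (%_. vu)). gp.Pphi N y)"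
using transfer(1)[OF assms, of "%_. 1 :: real" "%_. 1"] by (simp add: partition_function_def)

definition "ZP N = partition_function MM F al N (trace_fun MM P N)"
definition "dens N x = (PROD j=1..N. F (x j) al) * exp (- trace_fun MM P N x)"

lemma gibbs_expectation: fixes Ps Ph :: "(nat => 'a) => real"
assumes N: "good N" and Z: "0 < ZP N" and m: "Ph : bmeas seqM" and eq: "!!x. x : vectors X N ==> Ps x = Ph (rh N x)"
 and i: "integrable (PiM {..<N} (%_. vu)) (%y. gp.Pphi N y * Ph y)" shows "integrable (gibbs MM F al P N) Ps" "(LINT x|gibbs MM F al P N. Ps x) = gp.Ev N Ph"
proof -
let ?R = "restrict_space (ref_measure N) (vectors X N)"
note tr = transfer[OF N m eq, simplified real_scaleR_def, folded dens_def]
have one: "integrable (PiM {..<N} (%_. vu)) (%y. gp.Pphi N y * 1)" using gp.gibbs_pair_main by (metis (no_types, lifting) mult.right_neutral Lintegrable_cong)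
have tr1: "set_integrable (ref_measure N) (vectors X N) (dens N)" using transfer(2)[OF N, of "%_. 1 :: real" "%_. 1"] one by (simp add: dens_def[abs_def])
have i2: "integrable ?R (%x. dens N x * Ps x)" using tr(2) i unfolding integrable_restrict_space[OF V_sets] set_integrable_def by simp
have i1: "integrable ?R (dens N)" using tr1 unfolding integrable_restrict_space[OF V_sets] set_integrable_def by simp
have sp: "space ?R = vectors X N" using V_sets by (auto simp: space_restrict_space space_PiM PiE_def)
have Psm: "Ps : bmeas ?R"
proof -
 have "(%x. rh N x) : measurable (ref_measure N) seqM" unfolding rh_def[abs_def] restrict_def
 proof (rule measurable_seq_if)
  fix i
  show "(%x. if i : {..<N} then x (Suc i) else undefined) : bmeas (ref_measure N)"
  proof (cases "i < N")
   case True
   hence "(%x. x (Suc i)) : measurable (ref_measure N) lborel" by (intro measurable_component_singleton) auto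
   thus ?thesis using True by simp
  qed simp
 qed
 from measurable_restrict_space1[OF measurable_compose[OF this m]] have "(%x. Ph (rh N x)) : bmeas ?R" .
 thus ?thesis using eq by (subst measurable_cong[where g="%x. Ph (rh N x)"]) (auto simp: sp)
qed
have dm: "(%x. dens N x / ZP N) : bmeas ?R" using borel_measurable_integrable[OF i1] by simp
have dn: "AE x in ?R. 0 <= dens N x / ZP N" using Z F_nonneg by (intro AE_I2) (auto simp: sp dens_def intro!: divide_nonneg_pos mult_nonneg_nonneg prod_nonneg)
have gb: "gibbs MM F al P N = density ?R (%x. ennreal (dens N x / ZP N))" by (simp add: gibbs_def dens_def ZP_def)
show "integrable (gibbs MM F al P N) Ps" unfolding gb integrable_density[OF Psm dm dn] using i2 by (simp add: mult.assoc)
have "(LINT x|gibbs MM F al P N. Ps x) = (LINT x|(?R). dens N x * Ps x) / ZP N" unfolding gb integral_density[OF Psm dm dn] by simp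
also have "(LINT x|(?R). dens N x * Ps x) = (LINT x:vectors X N|ref_measure N. dens N x * Ps x)"
 unfolding integral_restrict_space[OF V_sets] set_lebesgue_integral_def ..
finally show "(LINT x|gibbs MM F al P N. Ps x) = gp.Ev N Ph" using tr(1) partition[OF N] by (simp add: gp.Ev_def ZP_def)
qed

lemma perturbed: assumes N: "good N" shows "perturbed_partition_function MM F al P m n N = (%(t, s). gp.ZZ N t s)"
proof (rule ext, clarify)
fix t s
let ?Ph = "%y. iexp (- (t * gp.HS h1 N y + s * gp.HS h2 N y))"
have m: "?Ph : bmeas seqM" using HS_meas[OF e_meas(2), of N] HS_meas[OF e_meas(3), of N] by measurable
have "gp.ZZ N t s = (LINT y|(PiM {..<N} (%_. vu)). gp.Pphi N y *\<^sub>R ?Ph y)" by (simp add: gp.ZZ_def scaleR_conv_of_real)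
also have "... = (LINT x:vectors X N|ref_measure N. ((PROD j=1..N. F (x j) al) * exp (- trace_fun MM P N x)) *\<^sub>R ?Ph (rh N x))"
 by (rule transfer(1)[OF N m refl, symmetric])
also have "... = perturbed_partition_function MM F al P m n N (t, s)"
 unfolding perturbed_partition_function_def partition_function_def case_prod_conv set_lebesgue_integral_def
proof (rule Lintegral_cong[OF refl])
 fix x
 show "indicator (vectors X N) x *\<^sub>R (((PROD j=1..N. F (x j) al) * exp (- trace_fun MM P N x)) *\<^sub>R ?Ph (rh N x)) =
  indicator (vectors X N) x *\<^sub>R (of_real (PROD j = 1..N. F (x j) al) * exp (- (cor (trace_fun MM P N x) + \<i> * cor t * cor (trace_fun MM (monom 1 m) N x) + \<i> * cor s * cor (trace_fun MM (monom 1 n) N x))))"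
 proof (cases "x : vectors X N")
  case True
  have "exp (- (cor (trace_fun MM P N x) + \<i> * cor t * cor (trace_fun MM (monom 1 m) N x) + \<i> * cor s * cor (trace_fun MM (monom 1 n) N x)))
   = of_real (exp (- trace_fun MM P N x)) * iexp (- (t * trace_fun MM (monom 1 m) N x + s * trace_fun MM (monom 1 n) N x))"
   unfolding exp_of_real[symmetric] by (simp add: alg flip: exp_add)
  thus ?thesis using HS_rho(2,3)[OF N True] by (simp add: scaleR_conv_of_real mult.assoc)
 qed simp
qed
finally show "perturbed_partition_function MM F al P m n N (t, s) = gp.ZZ N t s" by simp
qed

theorem window_model_main: "covariance_is_free_energy_derivative MM P F al m n"
proof -
obtain c de Ph lN where main:
 "!!n. integrable (PiM {..<n} (%_. vu)) (gp.Pphi n)"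
 "!!n. integrable (PiM {..<n} (%_. vu)) (%x. gp.Pphi n x * gp.HS h1 n x)"
 "!!n. integrable (PiM {..<n} (%_. vu)) (%x. gp.Pphi n x * gp.HS h2 n x)"
 "!!n. integrable (PiM {..<n} (%_. vu)) (%x. gp.Pphi n x * (gp.HS h1 n x * gp.HS h2 n x))"
 "(%n. (gp.Ev n (%x. gp.HS h1 n x * gp.HS h2 n x) - gp.Ev n (gp.HS h1 n) * gp.Ev n (gp.HS h2 n)) / real n) ----> c"
 "0 < de" "\<forall>\<^sub>F n in sequentially. continuous_log de (%(t, s). gp.ZZ n t s) (lN n)"
 "!!t. t : ball (0, 0) de ==> (%n. - (lN n t / of_nat n)) ----> Ph t" "has_mixed_derivative_at_0 Ph (cor c)" by (rule gp.gibbs_pair_main) blast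
have le: "large (sizes MM) <= sequentially" by simp
have ev: "\<forall>\<^sub>F N in large (sizes MM). good N & 0 < ZP N" using good Z_pos by (simp add: ZP_def eventually_conj_iff)
have H12: "(%x. gp.HS h1 N x * gp.HS h2 N x) : bmeas seqM" for N using HS_meas[OF e_meas(2), of N] HS_meas[OF e_meas(3), of N] by measurable
have ge: "integrable (gibbs MM F al P N) (trace_fun MM (monom 1 m) N)" "(LINT x|gibbs MM F al P N. trace_fun MM (monom 1 m) N x) = gp.Ev N (gp.HS h1 N)"
 "integrable (gibbs MM F al P N) (trace_fun MM (monom 1 n) N)" "(LINT x|gibbs MM F al P N. trace_fun MM (monom 1 n) N x) = gp.Ev N (gp.HS h2 N)"
 "integrable (gibbs MM F al P N) (%x. trace_fun MM (monom 1 m) N x * trace_fun MM (monom 1 n) N x)"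
 "(LINT x|gibbs MM F al P N. trace_fun MM (monom 1 m) N x * trace_fun MM (monom 1 n) N x) = gp.Ev N (%x. gp.HS h1 N x * gp.HS h2 N x)"
 if N: "good N" "0 < ZP N" for N using gibbs_expectation[OF N HS_meas[OF e_meas(2)] HS_rho(2)[OF N(1)] main(2)]
  gibbs_expectation[OF N HS_meas[OF e_meas(3)] HS_rho(3)[OF N(1)] main(3)]
  gibbs_expectation[OF N H12 _ main(4), of "%x. trace_fun MM (monom 1 m) N x * trace_fun MM (monom 1 n) N x"] HS_rho(2,3)[OF N(1)] by simp_all
have cov: "trace_covariance MM F al P m n N = gp.Ev N (%x. gp.HS h1 N x * gp.HS h2 N x) - gp.Ev N (gp.HS h1 N) * gp.Ev N (gp.HS h2 N)"
 if N: "good N" "0 < ZP N" for N unfolding trace_covariance_def Let_def ge(2,4,6)[OF N] ..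
show ?thesis unfolding covariance_is_free_energy_derivative_def
proof (intro conjI exI)
 show "\<forall>\<^sub>F N in large (sizes MM).
   integrable (gibbs MM F al P N) (trace_fun MM (monom 1 m) N) &
   integrable (gibbs MM F al P N) (trace_fun MM (monom 1 n) N) &
   integrable (gibbs MM F al P N) (%x. trace_fun MM (monom 1 m) N x * trace_fun MM (monom 1 n) N x)" using ev by eventually_elim (use ge in blast)
 have "((%n. (gp.Ev n (%x. gp.HS h1 n x * gp.HS h2 n x) - gp.Ev n (gp.HS h1 n) * gp.Ev n (gp.HS h2 n)) / real n) \<longlongrightarrow> c) (large (sizes MM))"
  by (rule tendsto_mono[OF le main(5)])
 thus "((%N. trace_covariance MM F al P m n N / real N) \<longlongrightarrow> c) (large (sizes MM))"
 proof (rule Lim_transform_eventually)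
  show "\<forall>\<^sub>F N in large (sizes MM). (gp.Ev N (%x. gp.HS h1 N x * gp.HS h2 N x) - gp.Ev N (gp.HS h1 N) * gp.Ev N (gp.HS h2 N)) / real N = trace_covariance MM F al P m n N / real N"
   using ev by eventually_elim (simp add: cov)
 qed
 show "0 < de" by (rule main)
 show "has_mixed_derivative_at_0 Ph (cor c)" by (rule main)
 show "is_free_energy MM F al P m n de Ph" unfolding is_free_energy_def
 proof (intro exI[of _ lN] conjI ballI)
  show "\<forall>\<^sub>F N in large (sizes MM). continuous_log de (perturbed_partition_function MM F al P m n N) (lN N)"
   using ev filter_leD[OF le main(7)] by eventually_elim (simp add: perturbed)
  show "((%N. - (lN N t / of_nat N)) \<longlongrightarrow> Ph t) (large (sizes MM))" if "t : ball (0, 0) de" for t by (rule tendsto_mono[OF le main(8)[OF that]])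
 qed
qed
qed

end

section \<open>Local energies on two-sided sequences\<close>

definition tau :: "int => (int => 'a) => int => 'a" where "tau l y = (%k. y (k + l))"

text \<open>The variables are numbered from 1 and the sites from 0: site 0 carries
  \<open>x 1\<close>. Two-sided sequences let all sites be treated by shifts, without boundary
  cases.\<close>

definition zper :: "nat => (nat => 'a) => int => 'a" where "zper N x k = x (Suc (nat (k mod int N)))"

abbreviation "zseq == PiM (UNIV :: int set) (%_. borel)"

definition zloc :: "int => ((int => 'a) => 'b) => bool" where
"zloc R f \<longleftrightarrow> (ALL y y'. (ALL k. abs k <= R --> y k = y' k) --> f y = f y')"

lemma tau_tau: "tau k (tau l y) = tau (k + l) y" by (simp add: tau_def ac_simps)
lemma tau_0: "tau 0 y = y" by (simp add: tau_def)

lemma zlocD: "zloc R f ==> (!!k. abs k <= R ==> y k = y' k) ==> f y = f y'" by (auto simp: zloc_def)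

lemma zloc_mono: "zloc R f ==> R <= R' ==> zloc R' f" by (force simp: zloc_def)

lemma tau_measurable [measurable]: "(%y. tau l y) : measurable zseq (zseq :: (int => 'a::topological_space) measure)"
unfolding tau_def by (rule measurable_PiM_single') auto

text \<open>Under a sum over the cycle a function may be replaced by any of its translates. This is
  what allows the local energy to be changed without changing the trace.\<close>

lemma cyclic_sum: assumes N: "0 < N" shows "(SUM i<N. f (tau (int i + l) (zper N x))) = (SUM i<N. f (tau (int i) (zper N x)))"
proof (rule sum.reindex_bij_witness[of _ "%i. nat ((int i - l) mod int N)" "%i. nat ((int i + l) mod int N)"])
have nn: "0 <= k mod int N" "k mod int N < int N" for k using N by auto
fix i assume i: "i : {..<N}"
show "nat ((int (nat ((int i + l) mod int N)) - l) mod int N) = i" "nat ((int (nat ((int i - l) mod int N)) + l) mod int N) = i"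
 using i nn by (simp_all add: mod_diff_left_eq mod_add_left_eq)
show "nat ((int i + l) mod int N) : {..<N}" "nat ((int i - l) mod int N) : {..<N}" using nn by (simp_all add: nat_less_iff)
show "f (tau (int (nat ((int i + l) mod int N))) (zper N x)) = f (tau (int i + l) (zper N x))"
 using nn by (intro arg_cong[where f=f]) (auto simp: tau_def zper_def fun_eq_iff mod_add_right_eq)
qed

lemma sum_power_le: fixes a :: "'i => real" assumes I: "finite I" "I ~= {}" and a: "!!i. i : I ==> 0 <= a i"
shows "(SUM i:I. a i) ^ k <= real (card I) ^ k * (SUM i:I. a i ^ k)"
proof -
obtain j where j: "j : I" "!!i. i : I ==> a i <= a j"
 using Max_in[of "a ` I"] Max_ge[of "a ` I"] I by (metis (no_types, lifting) finite_imageI imageE image_eqI image_is_empty)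
have "(SUM i:I. a i) <= real (card I) * a j" using sum_bounded_above[of I a "a j"] j by simp
hence "(SUM i:I. a i) ^ k <= (real (card I) * a j) ^ k" using a by (intro power_mono sum_nonneg) auto
also have "... = real (card I) ^ k * a j ^ k" by (simp add: power_mult_distrib)
also have "a j ^ k <= (SUM i:I. a i ^ k)" using I j a by (intro member_le_sum) auto
finally show ?thesis by (simp add: mlm)
qed

text \<open>From \<open>2 * b / c\<close> on, half of the leading term absorbs the lower one; below,
  everything is bounded by the constant.\<close>

lemma poly_gap: fixes c b t :: real assumes "0 < c" "0 <= b" "1 <= t"
shows "c / 2 * t - (b * (max (2 * b / c) 1) ^ k + c / 2 * max (2 * b / c) 1) <= c * t ^ Suc k - b * t ^ k"
proof (cases "max (2 * b / c) 1 <= t")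
case True
hence "b <= c / 2 * t" using assms by (simp add: field_simps)
have "c / 2 * t <= t ^ k * (c * t - b)"
proof -
 have "1 * (c / 2 * t) <= t ^ k * (c * t - b)" using assms \<open>b <= c / 2 * t\<close> by (intro mult_mono) auto
 thus ?thesis by simp
qed
moreover have "0 <= b * (max (2 * b / c) 1) ^ k + c / 2 * max (2 * b / c) 1" using assms by (intro add_nonneg_nonneg mult_nonneg_nonneg) auto
ultimately show ?thesis by (simp add: alg)
next
case False
hence "c / 2 * t <= c / 2 * max (2 * b / c) 1" "b * t ^ k <= b * (max (2 * b / c) 1) ^ k" using assms by (auto intro!: mlm power_mono)
moreover have "0 <= c * t ^ Suc k" using assms by simp
ultimately show ?thesis by linarith
qed

text \<open>From \<open>x <= exp x\<close> at \<open>x = c * t / (j + 1)\<close>, raised to the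
  power \<open>j + 1\<close>. One power of \<open>t\<close> is given away, which is why
  \<open>t <= 1\<close> is separate.\<close>

lemma power_exp_bound: fixes c t :: real assumes "0 < c" "0 <= t" shows "t ^ j * exp (- (c * t)) <= (real (Suc j) / c) ^ Suc j + 1"
proof (cases "t <= 1")
case True
have "t ^ j * exp (- (c * t)) <= 1 * 1" using assms True by (intro mult_mono power_le_one) auto
moreover have "0 <= (real (Suc j) / c) ^ Suc j" using assms by simp
ultimately show ?thesis by linarith
next
case False
have "c * t / real (Suc j) <= exp (c * t / real (Suc j))" using exp_ge_add_one_self[of "c * t / real (Suc j)"] by linarith
hence "(c * t / real (Suc j)) ^ Suc j <= exp (c * t / real (Suc j)) ^ Suc j" using assms by (intro power_mono) auto
also have "... = exp (c * t)" by (simp only: exp_of_nat_mult[symmetric]) simp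
finally have 1: "t ^ Suc j <= (real (Suc j) / c) ^ Suc j * exp (c * t)"   proof -
 assume le: "(c * t / real (Suc j)) ^ Suc j <= exp (c * t)"
 have "t ^ Suc j = (real (Suc j) / c * (c * t / real (Suc j))) ^ Suc j" using assms by (simp del: power_Suc)
 also have "... = (real (Suc j) / c) ^ Suc j * (c * t / real (Suc j)) ^ Suc j" by (rule power_mult_distrib)
 also have "... <= (real (Suc j) / c) ^ Suc j * exp (c * t)" using le assms by (intro mlm) auto
 finally show ?thesis .
qed
have "t ^ j <= t ^ Suc j" using False by (intro power_increasing) auto
hence "t ^ j * exp (- (c * t)) <= (real (Suc j) / c) ^ Suc j * exp (c * t) * exp (- (c * t))" using 1 by (intro mrm) auto
thus ?thesis by (simp add: mult.assoc flip: exp_add)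
qed

lemma re_trace_sum: assumes A: "A : carrier_mat N N" shows "re_trace p A = Re (SUM d<=degree p. coeff p d * mat_trace (A ^\<^sub>m d))"
proof -
have "mat_trace (poly_of_mat p A) = (SUM i<N. SUM d<=degree p. coeff p d * (A ^\<^sub>m d) $$ (i, i))" using A by (auto simp: mat_trace_def poly_of_mat_def)
also have "... = (SUM d<=degree p. coeff p d * (SUM i<N. (A ^\<^sub>m d) $$ (i, i)))" by (subst sum.swap) (simp add: sum_distrib_left)
also have "... = (SUM d<=degree p. coeff p d * mat_trace (A ^\<^sub>m d))" using A by (simp add: mat_trace_def)
finally show ?thesis by (simp add: re_trace_def)
qed

text \<open>\<open>q d\<close> is the density at site 0 of the trace of the \<open>d\<close>-th
  power, and \<open>g\<close> measures the size of the variables there. The top power bounds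
  \<open>g ^ K\<close> from below at a single site, whereas lower powers may involve
  \<open>g\<close> at nearby sites, but with exponents at most \<open>K - 1\<close>.\<close>

locale local_model = fixes MM :: "'a::euclidean_space matrix_model" and F :: "'a => real => real" and al :: real and P :: "complex poly" and m n :: nat
 and q :: "nat => (int => 'a) => complex" and g :: "(int => 'a) => real" and K :: nat and ka :: "nat => nat" assumes X_borel: "var_space MM : sets borel"
 and hyp: "standing_hypotheses MM P F al" "0 < al"
 and sizes: "large (sizes MM) ~= bot"
 and lax_dim: "!!N x. lax MM N x : carrier_mat N N"
 and trace: "!!d. \<forall>\<^sub>F N in large (sizes MM). ALL x:vectors (var_space MM) N. mat_trace (lax MM N x ^\<^sub>m d) = (SUM i<N. q d (tau (int i) (zper N x)))"
 and q_meas [measurable]: "!!d. q d : bmeas zseq" and g_meas [measurable]: "g : bmeas zseq"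
 and q_loc: "!!d. EX R. zloc R (q d)" and g_loc: "EX R. zloc R g"
 and g_ge: "!!y. range y <= var_space MM ==> 1 <= g y"
 and g_bdd: "!!j :: nat. EX B. ALL y. range y <= var_space MM & (ALL k. norm (y k) <= real j) --> g y <= B"
 and q_bound: "!!d. EX B R. ALL y. range y <= var_space MM --> norm (q d y) <= B * (SUM l:{-R..R}. g (tau l y)) ^ ka d"
 and coercive: "EX c>0. EX C'. ALL y. range y <= var_space MM --> c * g y ^ K - C' <= Re (coeff P (degree P) * q (degree P) y)"
 and K: "1 <= K" and ka: "!!d. d < degree P ==> ka d <= K - 1"
begin

abbreviation "XX == var_space MM"
definition "SS R y = (SUM l:{-R..R}. g (tau l y))" for R :: int
definition "WW y = Re (SUM d<=degree P. coeff P d * q d y)"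

lemma range_tau: "range y <= XX ==> range (tau l y) <= XX" by (auto simp: tau_def)

lemma SS_mono: "range y <= XX ==> R <= R' ==> SS R y <= SS R' y" unfolding SS_def using g_ge[OF range_tau] by (intro sum_mono2) (auto intro: order_trans[of 0 1])

lemma SS_ge: "range y <= XX ==> 0 <= R ==> 1 <= SS R y" using SS_mono[of y 0 R] g_ge[of y] by (simp add: SS_def tau_0)

lemma uniform:
obtains R B where "0 <= R" "0 <= B" "zloc R g" "!!d. d : {..degree P} \<union> {m, n} ==> zloc R (q d)"
 "!!d y. d : {..degree P} \<union> {m, n} ==> range y <= XX ==> norm (q d y) <= B * SS R y ^ ka d"
proof -
let ?D = "{..degree P} \<union> {m, n}"
have "ALL d. EX B R. ALL y. range y <= XX --> norm (q d y) <= B * SS R y ^ ka d" using q_bound unfolding SS_def by blast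
then obtain Bd Rd where b: "!!d y. range y <= XX ==> norm (q d y) <= Bd d * SS (Rd d) y ^ ka d" by metis
obtain Rq where rq: "!!d. zloc (Rq d) (q d)" using q_loc by metis
obtain Rg where rg: "zloc Rg g" using g_loc by blast
define R where "R = (SUM d:?D. abs (Rd d) + abs (Rq d)) + abs Rg"
define B where "B = (SUM d:?D. abs (Bd d))"
have Rle: "abs (Rd d) + abs (Rq d) <= R" "abs (Bd d) <= B" if "d : ?D" for d
 using member_le_sum[of d ?D "%d. abs (Rd d) + abs (Rq d)"] member_le_sum[of d ?D "%d. abs (Bd d)"] that unfolding R_def B_def by auto
have "abs Rg <= R" unfolding R_def by (simp add: sum_nonneg)
have bb: "norm (q d y) <= B * SS R y ^ ka d" if "d : ?D" "range y <= XX" for d y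
proof -
 have "SS (Rd d) y <= SS R y" using Rle(1)[OF that(1)] that(2) by (intro SS_mono) auto
 moreover have "0 <= SS (Rd d) y" unfolding SS_def using g_ge[OF range_tau[OF that(2)]] by (intro sum_nonneg) (auto intro: order_trans[of 0 1])
 ultimately have "SS (Rd d) y ^ ka d <= SS R y ^ ka d" "0 <= SS (Rd d) y ^ ka d" by (auto intro: power_mono)
 hence "Bd d * SS (Rd d) y ^ ka d <= B * SS R y ^ ka d" using Rle(2)[OF that(1)] by (intro mult_mono) auto
 thus ?thesis using b[OF that(2), of d] by linarith
qed
show ?thesis
proof (rule that[of R B])
 show "0 <= R" "zloc R g" using \<open>abs Rg <= R\<close> by (auto intro: zloc_mono[OF rg])
 show "0 <= B" by (simp add: B_def sum_nonneg)
 show "zloc R (q d)" if "d : ?D" for d using Rle(1)[OF that] by (intro zloc_mono[OF rq]) auto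
qed (rule bb)
qed

lemma trace_WW:
"\<forall>\<^sub>F N in large (sizes MM). ALL x:vectors XX N. trace_fun MM P N x = (SUM i<N. WW (tau (int i) (zper N x)))"
"\<forall>\<^sub>F N in large (sizes MM). ALL x:vectors XX N. trace_fun MM (monom 1 s) N x = (SUM i<N. Re (q s (tau (int i) (zper N x))))"
proof -
have "\<forall>\<^sub>F N in large (sizes MM). ALL d:{..degree P}. ALL x:vectors XX N. mat_trace (lax MM N x ^\<^sub>m d) = (SUM i<N. q d (tau (int i) (zper N x)))"
 by (intro eventually_ball_finite ballI trace finite_atMost)
thus "\<forall>\<^sub>F N in large (sizes MM). ALL x:vectors XX N. trace_fun MM P N x = (SUM i<N. WW (tau (int i) (zper N x)))"
proof eventually_elim
 case (elim N)
 show ?case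
 proof
  fix x assume x: "x : vectors XX N"
  have "trace_fun MM P N x = Re (SUM d<=degree P. coeff P d * (SUM i<N. q d (tau (int i) (zper N x))))"
   unfolding re_trace_sum[OF lax_dim] using elim x by (intro arg_cong[where f=Re] sum.cong refl) auto
  also have "... = (SUM i<N. WW (tau (int i) (zper N x)))" unfolding WW_def Re_sum[symmetric] sum_distrib_left by (subst sum.swap) simp
  finally show "trace_fun MM P N x = (SUM i<N. WW (tau (int i) (zper N x)))" .
 qed
qed
show "\<forall>\<^sub>F N in large (sizes MM). ALL x:vectors XX N. trace_fun MM (monom 1 s) N x = (SUM i<N. Re (q s (tau (int i) (zper N x))))" using trace[of s]
proof eventually_elim
 case (elim N)
 show ?case
 proof
  fix x assume x: "x : vectors XX N"
  have "(SUM d<=degree (monom (1 :: complex) s). coeff (monom 1 s) d * mat_trace (lax MM N x ^\<^sub>m d)) = mat_trace (lax MM N x ^\<^sub>m s)"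
   by (simp add: degree_monom_eq if_distrib[where f="%z. z * _"] cong: if_cong)
  thus "trace_fun MM (monom 1 s) N x = (SUM i<N. Re (q s (tau (int i) (zper N x))))" unfolding re_trace_sum[OF lax_dim] using elim x by simp
 qed
qed
qed

text \<open>The trace density \<open>WW\<close> is corrected by terms with zero sum over the cycle.
  In \<open>WW\<close> the own site appears with exponent \<open>k + 1\<close> against neighbours
  with exponent \<open>k\<close>; \<open>W'\<close> trades the powers of the neighbours for powers
  of the own site and is bounded below. \<open>E\<close> averages \<open>W'\<close> over translates
  and so dominates \<open>g\<close> at all these sites, whence \<open>exp (- E)\<close> beats the
  polynomial growth of the observables.\<close>

theorem local_model_main: "covariance_is_free_energy_derivative MM P F al m n"
proof -
obtain R B where R: "0 <= R" "0 <= B" "zloc R g" "!!d. d : {..degree P} \<union> {m, n} ==> zloc R (q d)"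
 "!!d y. d : {..degree P} \<union> {m, n} ==> range y <= XX ==> norm (q d y) <= B * SS R y ^ ka d" by (rule uniform) blast
obtain c C0 where c: "0 < c" "!!y. range y <= XX ==> c * g y ^ K - C0 <= Re (coeff P (degree P) * q (degree P) y)" using coercive by blast
obtain k where k: "K = Suc k" using K by (cases K) auto
define nn where "nn = real (card {-R..R})"
have nn: "1 <= nn" "nn > 0" using R(1) by (auto simp: nn_def)
define B1 where "B1 = (SUM d<degree P. norm (coeff P d)) * B"
have B1: "0 <= B1" using R by (auto simp: B1_def intro!: mult_nonneg_nonneg sum_nonneg)
have W1: "c * g y ^ Suc k - C0 - B1 * SS R y ^ k <= WW y" if y: "range y <= XX" for y
proof -
 have "norm (SUM d<degree P. coeff P d * q d y) <= (SUM d<degree P. norm (coeff P d) * (B * SS R y ^ k))"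
 proof (rule sum_norm_le)
  fix d assume d: "d : {..<degree P}"
  have "SS R y ^ ka d <= SS R y ^ k" using ka[of d] d k SS_ge[OF y R(1)] by (intro power_increasing) auto
  hence "norm (q d y) <= B * SS R y ^ k" using R(5)[of d y] d y R(2) by (auto intro: order_trans mlm)
  thus "norm (coeff P d * q d y) <= norm (coeff P d) * (B * SS R y ^ k)" by (simp add: norm_mult mlm)
 qed
 also have "... = B1 * SS R y ^ k" by (simp add: B1_def sum_distrib_right mult.assoc)
 finally have "- (B1 * SS R y ^ k) <= Re (SUM d<degree P. coeff P d * q d y)" using abs_Re_le_cmod[of "SUM d<degree P. coeff P d * q d y"] by linarith
 moreover have "WW y = Re (SUM d<degree P. coeff P d * q d y) + Re (coeff P (degree P) * q (degree P) y)" by (simp add: WW_def lessThan_Suc_atMost[symmetric])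
 ultimately show ?thesis using c(2)[OF y] k by simp
qed
define B2 where "B2 = B1 * nn ^ k"
have B2: "0 <= B2" using B1 nn by (simp add: B2_def)
define W' where "W' y = WW y + B2 * (SUM l:{-R..R}. g (tau l y) ^ k - g y ^ k)" for y
define b where "b = B2 * nn"
have b: "0 <= b" using B2 nn by (simp add: b_def)
define C2 where "C2 = b * (max (2 * b / c) 1) ^ k + c / 2 * max (2 * b / c) 1 + C0"
have W2: "c / 2 * g y - C2 <= W' y" if y: "range y <= XX" for y
proof -
 have "SS R y ^ k <= nn ^ k * (SUM l:{-R..R}. g (tau l y) ^ k)"
  unfolding SS_def nn_def using R(1) g_ge[OF range_tau[OF y]] by (intro sum_power_le) (auto intro: order_trans[of 0 1])
 hence "B1 * SS R y ^ k <= B2 * (SUM l:{-R..R}. g (tau l y) ^ k)" unfolding B2_def mult.assoc using B1 by (intro mlm)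
 moreover have "W' y = WW y + B2 * (SUM l:{-R..R}. g (tau l y) ^ k) - b * g y ^ k" by (simp add: W'_def sum_subtractf b_def nn_def alg)
 ultimately have "c * g y ^ Suc k - b * g y ^ k - C0 <= W' y" using W1[OF y] by linarith
 thus ?thesis using poly_gap[OF c(1) b g_ge[OF y], of k] by (simp add: C2_def)
qed
define E where "E y = (SUM l:{-R..R}. W' (tau l y)) / nn" for y
define c' where "c' = c / (2 * nn)"
have c': "0 < c'" using c nn by (simp add: c'_def)
have E1: "c' * SS R y - C2 <= E y" if y: "range y <= XX" for y
proof -
 have "(SUM l:{-R..R}. c / 2 * g (tau l y) - C2) <= (SUM l:{-R..R}. W' (tau l y))" by (intro sum_mono W2 range_tau y)
 moreover have eq1: "(SUM l:{-R..R}. c / 2 * g (tau l y) - C2) = c / 2 * SS R y - nn * C2" by (simp only: sum_subtractf SS_def sum_distrib_left nn_def sum_constant)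
 ultimately have "(c / 2 * SS R y - nn * C2) / nn <= E y" unfolding E_def using nn eq1 by (intro divide_right_mono) simp_all
 moreover have "(c / 2 * SS R y - nn * C2) / nn = c' * SS R y - C2" using nn by (simp add: c'_def field_simps)
 ultimately show ?thesis by simp
qed
define h where "h s y = Re (q s y)" for s y
define ka' where "ka' = ka m + ka n"
define C3 where "C3 = exp C2 * (1 + 2 * B) ^ 3 * ((real (Suc (3 * ka')) / c') ^ Suc (3 * ka') + 1)"
have bound: "exp (- E y) * (1 + abs (h m y) + abs (h n y)) ^ 3 <= C3" if y: "range y <= XX" for y
proof -
 let ?S = "SS R y"
 have S: "1 <= ?S" by (rule SS_ge[OF y R(1)])
 have hb: "abs (h s y) <= B * ?S ^ ka'" if "s : {m, n}" for s
 proof -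
  have "abs (h s y) <= norm (q s y)" unfolding h_def by (rule abs_Re_le_cmod)
  also have "... <= B * ?S ^ ka s" using R(5)[of s y] that y by auto
  also have "... <= B * ?S ^ ka'" using S that R(2) by (intro mlm power_increasing) (auto simp: ka'_def)
  finally show ?thesis .
 qed
 have "1 <= ?S ^ ka'" using S by simp
 hence "1 + abs (h m y) + abs (h n y) <= ?S ^ ka' + B * ?S ^ ka' + B * ?S ^ ka'" using hb[of m] hb[of n] by simp
 also have "... = (1 + 2 * B) * ?S ^ ka'" by (simp add: alg)
 finally have "(1 + abs (h m y) + abs (h n y)) ^ 3 <= ((1 + 2 * B) * ?S ^ ka') ^ 3" by (intro power_mono) auto
 also have "... = (1 + 2 * B) ^ 3 * ?S ^ (3 * ka')" by (simp add: power_mult_distrib power_mult[symmetric] mult.commute)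
 finally have "exp (- E y) * (1 + abs (h m y) + abs (h n y)) ^ 3 <= exp (C2 - c' * ?S) * ((1 + 2 * B) ^ 3 * ?S ^ (3 * ka'))"
  using E1[OF y] by (intro mult_mono) auto
 also have "... = exp C2 * (1 + 2 * B) ^ 3 * (?S ^ (3 * ka') * exp (- (c' * ?S)))" by (simp add: exp_diff exp_minus field_simps)
 also have "... <= C3" unfolding C3_def using S R(2) by (intro mlm power_exp_bound c') auto
 finally show ?thesis .
qed
\<comment> \<open>\<open>E\<close> reads \<open>3 * R\<close> sites to each side: \<open>R\<close>
  for the densities and \<open>g\<close>, \<open>R\<close> for the shifts in \<open>W'\<close> and
  \<open>R\<close> for those in \<open>E\<close>. The extra 1 makes \<open>Q\<close> positive when
  \<open>R = 0\<close>.\<close>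
define T where "T = 3 * R + 1"
have zW: "zloc R WW" unfolding zloc_def
proof (intro allI impI)
 fix y y' :: "int => 'a" assume eq: "ALL k. abs k <= R --> y k = y' k"
 have "q d y = q d y'" if "d <= degree P" for d using that eq by (intro zlocD[OF R(4)]) auto
 thus "WW y = WW y'" by (simp add: WW_def)
qed
have zW': "zloc (2 * R) W'" unfolding zloc_def
proof (intro allI impI)
 fix y y' :: "int => 'a" assume eq: "ALL k. abs k <= 2 * R --> y k = y' k"
 have "WW y = WW y'" "g y = g y'" using eq R(1) by (auto intro!: zlocD[OF zW] zlocD[OF R(3)])
 moreover have "g (tau l y) = g (tau l y')" if "l : {-R..R}" for l using eq that by (intro zlocD[OF R(3)]) (auto simp: tau_def)
 ultimately show "W' y = W' y'" by (simp add: W'_def)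
qed
have zE: "zloc (3 * R) E" unfolding zloc_def
proof (intro allI impI)
 fix y y' :: "int => 'a" assume eq: "ALL k. abs k <= 3 * R --> y k = y' k"
 have "W' (tau l y) = W' (tau l y')" if "l : {-R..R}" for l using eq that by (intro zlocD[OF zW']) (auto simp: tau_def)
 thus "E y = E y'" by (simp add: E_def)
qed
have zTE: "zloc T E" by (rule zloc_mono[OF zE]) (simp add: T_def)
have zq: "zloc T (h s)" if "s : {m, n}" for s
proof -
 have "zloc T (q s)" using that R(1) by (intro zloc_mono[OF R(4)]) (auto simp: T_def)
 from zlocD[OF this] show ?thesis unfolding zloc_def h_def by (intro allI impI arg_cong[where f=Re]) blast
qed
have zT: "zloc T E" "zloc T (h m)" "zloc T (h n)" using zTE zq by auto
have T0: "0 < T" using R(1) by (simp add: T_def)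
define Q where "Q = nat (2 * T)"
\<comment> \<open>A window becomes a two-sided sequence by clamping the index: all its values are
  letters of the window, hence in \<open>XX\<close>, and the middle letter sits at site 0.\<close>
define emb where "emb u = (%k. u (nat (max 0 (min (2 * T) (k + T)))))" for u :: "nat => 'a"
have emb_m: "(%u. emb u) : measurable seqM zseq" unfolding emb_def by (rule measurable_PiM_single') auto
have emb_range: "range (emb u) <= XX" if "!!i. i <= Q ==> u i : XX" for u using that T0 by (auto simp: emb_def Q_def)
have emb_win: "f (emb (win Q (per N (%j. x (Suc j))) i)) = f (tau (int i + T) (zper N x))" if f: "zloc T f" and N: "0 < N" for f :: "(int => 'a) => real" and N x i
proof (rule zlocD[OF f])
 fix k :: int assume k: "abs k <= T"
 hence "max 0 (min (2 * T) (k + T)) = k + T" "nat (k + T) <= Q" by (auto simp: Q_def)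
 moreover have "(i + nat (k + T)) mod N = nat ((k + (int i + T)) mod int N)"
 proof -
  have "k + (int i + T) = int (i + nat (k + T))" using k by simp
  thus ?thesis by (simp only: zmod_int[symmetric] nat_int)
 qed
 ultimately show "emb (win Q (per N (%j. x (Suc j))) i) k = tau (int i + T) (zper N x) k" by (simp add: emb_def win_def per_def tau_def zper_def)
qed
have sums: "(SUM i<N. f (emb (win Q (per N (%j. x (Suc j))) i))) = (SUM i<N. f (tau (int i) (zper N x)))" if f: "zloc T f" and N: "0 < N" for f :: "(int => 'a) => real" and N x
 using cyclic_sum[OF N, of f T x] by (simp add: emb_win[OF f N])
have sumE: "(SUM i<N. E (tau (int i) (zper N x))) = (SUM i<N. WW (tau (int i) (zper N x)))" if N: "0 < N" for N and x :: "nat => 'a"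
proof -
 let ?y = "zper N x"
 have sW': "(SUM i<N. W' (tau (int i) ?y)) = (SUM i<N. WW (tau (int i) ?y))"
 proof -
  have "(SUM i<N. SUM l:{-R..R}. g (tau l (tau (int i) ?y)) ^ k - g (tau (int i) ?y) ^ k) = (SUM l:{-R..R}. (SUM i<N. g (tau (int i + l) ?y) ^ k) - (SUM i<N. g (tau (int i) ?y) ^ k))"
   by (subst sum.swap) (simp add: sum_subtractf tau_tau add.commute)
  also have "... = 0" using cyclic_sum[OF N, of "%y. g y ^ k" _ x] by simp
  finally show ?thesis by (simp add: W'_def sum.distrib sum_distrib_left[symmetric])
 qed
 have "(SUM i<N. E (tau (int i) ?y)) = (SUM l:{-R..R}. SUM i<N. W' (tau (int i + l) ?y)) / nn"
  unfolding E_def sum_divide_distrib[symmetric] by (subst sum.swap) (simp add: tau_tau add.commute)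
 also have "... = (SUM l:{-R..R}. SUM i<N. W' (tau (int i) ?y)) / nn" by (simp only: cyclic_sum[OF N])
 also have "... = (SUM i<N. W' (tau (int i) ?y))" using nn by (simp add: nn_def)
 finally show ?thesis using sW' by simp
qed
have E_meas: "E : bmeas zseq" unfolding E_def[abs_def] W'_def WW_def by measurable
have h_meas: "h s : bmeas zseq" for s unfolding h_def[abs_def] by measurable
note st = hyp(1)[unfolded standing_hypotheses_def]
interpret window_model MM F al P m n Q "%u. E (emb u)" "%u. h m (emb u)" "%u. h n (emb u)" C3
proof
 show "XX : sets borel" by (rule X_borel)
 show "0 <= F x al" if "x : XX" for x using st hyp(2) that by (auto simp: HP2_def)
 show "set_integrable lborel XX (%x. F x al)" using st hyp(2) by (auto simp: HP4_def)
 show "\<forall>\<^sub>F N in large (sizes MM). 0 < partition_function MM F al N (trace_fun MM P N)" using st by blast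
 show "large (sizes MM) ~= bot" by (rule sizes)
 show "0 < Q" using T0 by (simp add: Q_def)
 show "(%u. E (emb u)) : bmeas seqM" "(%u. h m (emb u)) : bmeas seqM" "(%u. h n (emb u)) : bmeas seqM" by (intro measurable_compose[OF emb_m] E_meas h_meas)+
 have "\<forall>\<^sub>F N in large (sizes MM). 1 <= N" using eventually_ge_at_top[of 1] by (rule filter_leD[rotated]) simp
 thus "\<forall>\<^sub>F N in large (sizes MM). ALL x:vectors XX N.
   trace_fun MM P N x = (SUM i<N. E (emb (win Q (per N (%j. x (Suc j))) i))) &
   trace_fun MM (monom 1 m) N x = (SUM i<N. h m (emb (win Q (per N (%j. x (Suc j))) i))) &
   trace_fun MM (monom 1 n) N x = (SUM i<N. h n (emb (win Q (per N (%j. x (Suc j))) i)))"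
  using trace_WW(1) trace_WW(2)[of m, folded h_def] trace_WW(2)[of n, folded h_def] by eventually_elim (simp add: sums[OF zT(1)] sums[OF zT(2)] sums[OF zT(3)] sumE)
 show "exp (- E (emb u)) * (1 + abs (h m (emb u)) + abs (h n (emb u))) ^ 3 <= C3" if "!!i. i <= Q ==> u i : XX" for u by (intro bound emb_range that)
 fix j :: nat
 obtain Bg where Bg: "!!y. range y <= XX ==> (ALL k. norm (y k) <= real j) ==> g y <= Bg" using g_bdd[of j] by blast
 define CW where "CW = (SUM d<=degree P. norm (coeff P d) * (B * (nn * Bg) ^ ka d))"
 have WB: "W' y <= CW + B2 * (nn * Bg ^ k)" if y: "range y <= XX" "ALL k. norm (y k) <= real j" for y
 proof -
  have gt: "g (tau l y) <= Bg" "1 <= g (tau l y)" for l using y by (auto intro!: Bg g_ge range_tau simp: tau_def)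
  have "SS R y <= nn * Bg" unfolding SS_def nn_def using sum_bounded_above[of "{-R..R}" "%l. g (tau l y)" Bg] gt by simp
  hence "norm (q d y) <= B * (nn * Bg) ^ ka d" if "d <= degree P" for d
   using R(5)[of d y] that y R(2) SS_ge[OF y(1) R(1)] by (auto intro!: order_trans[OF R(5)] mlm power_mono)
  hence "norm (SUM d<=degree P. coeff P d * q d y) <= CW" unfolding CW_def by (intro sum_norm_le) (auto simp: norm_mult intro!: mlm)
  hence "WW y <= CW" using complex_Re_le_cmod[of "SUM d<=degree P. coeff P d * q d y"] by (simp add: WW_def)
  moreover have "B2 * (SUM l:{-R..R}. g (tau l y) ^ k - g y ^ k) <= B2 * (nn * Bg ^ k)"
  proof (intro mlm B2)
   have "(SUM l:{-R..R}. g (tau l y) ^ k - g y ^ k) <= (SUM l:{-R..R}. Bg ^ k)"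
   proof (rule sum_mono)
    fix l
    have "g (tau l y) ^ k <= Bg ^ k" using gt[of l] by (intro power_mono) auto
    moreover have "0 <= g y ^ k" using g_ge[OF y(1)] by simp
    ultimately show "g (tau l y) ^ k - g y ^ k <= Bg ^ k" by linarith
   qed
   thus "(SUM l:{-R..R}. g (tau l y) ^ k - g y ^ k) <= nn * Bg ^ k" by (simp only: nn_def sum_constant)
  qed
  ultimately show ?thesis by (simp add: W'_def)
 qed
 show "EX B. ALL u. (ALL i<=Q. u i : XX & norm (u i) <= real j) --> E (emb u) <= B"
 proof (intro exI allI impI)
  fix u :: "nat => 'a" assume u: "ALL i<=Q. u i : XX & norm (u i) <= real j"
  have y: "range (emb u) <= XX" "ALL k. norm (emb u k) <= real j" using u T0 by (auto simp: emb_def Q_def)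
  have "(SUM l:{-R..R}. W' (tau l (emb u))) <= (SUM l:{-R..R}. CW + B2 * (nn * Bg ^ k))"
   by (intro sum_mono WB range_tau y) (use y in \<open>auto simp: tau_def\<close>)
  also have "... = nn * (CW + B2 * (nn * Bg ^ k))" by (simp only: nn_def sum_constant)
  finally show "E (emb u) <= CW + B2 * (nn * Bg ^ k)" unfolding E_def using nn by (simp add: divide_le_eq mult.commute)
 qed
qed
show ?thesis by (rule window_model_main)
qed

end

section \<open>Band operators on two-sided sequences and their periodizations\<close>

definition band :: "int => (int => int => 'c::comm_ring_1) => bool" where
"band w C \<longleftrightarrow> 0 <= w & (ALL i j. w < abs (i - j) --> C i j = 0)"

text \<open>The finite sum is the full operator product when the right factor has width
  \<open>w\<close>; \<open>comp_eq\<close> and \<open>comp_eq_left\<close> let it run over any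
  larger finite set.\<close>

definition comp :: "int => (int => int => 'c::comm_ring_1) => (int => int => 'c) => int => int => 'c" where
"comp w B C i j = (SUM k:{j - w..j + w}. B i k * C k j)"

primrec cpow :: "int => (int => int => 'c::comm_ring_1) => nat => int => int => 'c" where
"cpow w C 0 = (%i j. if i = j then 1 else 0)"
| "cpow w C (Suc d) = comp w (cpow w C d) C"

text \<open>\<open>A\<close> is the matrix of the operator with kernel \<open>C\<close> on \<open>N\<close>-periodic sequences.\<close>

definition lifts :: "nat => int => (int => int => complex) => complex mat => bool" where
"lifts N w C A \<longleftrightarrow> 0 < N & A : carrier_mat N N & band w C &
  (ALL i. ALL j<N. A $$ (nat (i mod int N), j) = (SUM j':{j':{i - w..i + w}. nat (j' mod int N) = j}. C i j'))"

lemma band_comp: "band v B ==> band w C ==> band (v + w) (comp w B C)" unfolding band_def comp_def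
proof (intro conjI allI impI)
assume a: "0 <= v & (ALL i j. v < abs (i - j) --> B i j = 0)" "0 <= w & (ALL i j. w < abs (i - j) --> C i j = 0)"
thus "0 <= v + w" by simp
fix i j assume ij: "v + w < abs (i - j)"
show "(SUM k:{j - w..j + w}. B i k * C k j) = 0"
proof (rule sum.neutral, rule ballI)
 fix k assume "k : {j - w..j + w}"
 hence "v < abs (i - k)" using ij by auto
 thus "B i k * C k j = 0" using a by simp
qed
qed

lemma comp_eq: assumes C: "band w C" and K: "finite K" "{j - w..j + w} <= K" shows "comp w B C i j = (SUM k:K. B i k * C k j)" unfolding comp_def
proof (rule sum.mono_neutral_left[OF K])
show "ALL k:K - {j - w..j + w}. B i k * C k j = 0"
proof
 fix k assume "k : K - {j - w..j + w}"
 hence "w < abs (k - j)" by auto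
 thus "B i k * C k j = 0" using C by (simp add: band_def)
qed
qed

lemma comp_eq_left: assumes B: "band v B" and C: "band w C" and K: "finite K" "{i - v..i + v} <= K" shows "comp w B C i j = (SUM k:K. B i k * C k j)"
proof -
have "comp w B C i j = (SUM k:K \<union> {j - w..j + w}. B i k * C k j)" by (rule comp_eq[OF C]) (use K in auto)
also have "... = (SUM k:K. B i k * C k j)"
proof (rule sum.mono_neutral_right)
 show "ALL k:K \<union> {j - w..j + w} - K. B i k * C k j = 0"
 proof
  fix k assume "k : K \<union> {j - w..j + w} - K"
  hence "k \<notin> {i - v..i + v}" using K(2) by blast
  hence "v < abs (i - k)" by auto
  thus "B i k * C k j = 0" using B by (simp add: band_def)
 qed
qed (use K in auto)
finally show ?thesis .
qed

lemma lifts_sum: assumes "lifts N w C A" "j < N" "finite K" "{i - w..i + w} <= K"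
shows "A $$ (nat (i mod int N), j) = (SUM j':{j':K. nat (j' mod int N) = j}. C i j')"
proof -
have "A $$ (nat (i mod int N), j) = (SUM j':{j':{i - w..i + w}. nat (j' mod int N) = j}. C i j')" using assms by (simp add: lifts_def)
also have "... = (SUM j':{j':K. nat (j' mod int N) = j}. C i j')"
proof (rule sum.mono_neutral_left)
 show "ALL k:{j':K. nat (j' mod int N) = j} - {j':{i - w..i + w}. nat (j' mod int N) = j}. C i k = 0"
 proof
  fix k assume "k : {j':K. nat (j' mod int N) = j} - {j':{i - w..i + w}. nat (j' mod int N) = j}"
  hence "w < abs (i - k)" by auto
  thus "C i k = 0" using assms(1) by (simp add: lifts_def band_def)
 qed
qed (use assms in auto)
finally show ?thesis .
qed

text \<open>Periodization respects products. \<open>lifts\<close> speaks of all rows of the operator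
  and not of one period only, so the row of \<open>A'\<close> for a reduced index may be expanded
  around the unreduced one.\<close>

lemma lifts_comp: assumes A: "lifts N v B A" and A': "lifts N w C A'" shows "lifts N (v + w) (comp w B C) (A * A')"
proof -
have N: "0 < N" and c: "A : carrier_mat N N" "A' : carrier_mat N N" and b: "band v B" "band w C" using A A' by (auto simp: lifts_def)
have "(A * A') $$ (nat (i mod int N), j) = (SUM j':{j':{i - (v + w)..i + (v + w)}. nat (j' mod int N) = j}. comp w B C i j')" if j: "j < N" for i j
proof -
 let ?I = "{i - v..i + v}" and ?J = "{j':{i - (v + w)..i + (v + w)}. nat (j' mod int N) = j}"
 have ir: "nat (k mod int N) < N" for k using N by (simp add: nat_less_iff)
 have "(A * A') $$ (nat (i mod int N), j) = (SUM m<N. A $$ (nat (i mod int N), m) * A' $$ (m, j))" using c j ir by (simp add: scalar_prod_def atLeast0LessThan)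
 also have "... = (SUM m<N. SUM k:{k:?I. nat (k mod int N) = m}. B i k * A' $$ (nat (k mod int N), j))"
  by (intro sum.cong refl) (simp add: lifts_sum[OF A _ finite_atLeastAtMost_int order_refl] sum_distrib_right)
 also have "... = (SUM k:?I. B i k * A' $$ (nat (k mod int N), j))" by (rule sum.group) (use ir in auto)
 also have "... = (SUM k:?I. SUM j':?J. B i k * C k j')"
 proof (intro sum.cong refl)
  fix k assume "k : ?I"
  hence "{k - w..k + w} <= {i - (v + w)..i + (v + w)}" by auto
  from lifts_sum[OF A' j _ this] show "B i k * A' $$ (nat (k mod int N), j) = (SUM j':?J. B i k * C k j')" by (simp add: sum_distrib_left)
 qed
 also have "... = (SUM j':?J. comp w B C i j')" by (subst sum.swap) (intro sum.cong refl comp_eq_left[OF b, symmetric], auto)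
 finally show ?thesis .
qed
thus ?thesis using N c band_comp[OF b] by (auto simp: lifts_def)
qed

lemma band_cpow: "band w C ==> band (int d * w) (cpow w C d)"
proof (induction d)
case (Suc d)
thus ?case using band_comp[of "int d * w" "cpow w C d" w C] by (simp add: alg)
qed (simp add: band_def)

lemma lifts_pow: assumes A: "lifts N w C A" shows "lifts N (int d * w) (cpow w C d) (A ^\<^sub>m d)"
proof (induction d)
case 0
have "nat (i mod int N) < N" if "0 < N" for i using that by (simp add: nat_less_iff)
moreover have "{j'. j' = i & nat (j' mod int N) = j} = (if nat (i mod int N) = j then {i} else {})" for i j by auto
ultimately show ?case using A by (auto simp: lifts_def band_def)
next
case (Suc d)
show ?case using lifts_comp[OF Suc A] by (simp add: alg)
qed

text \<open>With width below \<open>N\<close>, the diagonal is the only position of its residue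
  class inside the band, so nothing wraps around.\<close>

lemma lifts_trace: assumes A: "lifts N w C A" and w: "w < int N" shows "mat_trace A = (SUM p<N. C (int p) (int p))"
proof -
have "A $$ (p, p) = C (int p) (int p)" if p: "p < N" for p
proof -
 have "{j':{int p - w..int p + w}. nat (j' mod int N) = p} = {int p}"
 proof (intro equalityI subsetI)
  fix j assume j: "j : {j':{int p - w..int p + w}. nat (j' mod int N) = p}"
  hence "j mod int N = int p mod int N" using p by auto
  hence "int N dvd j - int p" by (simp add: mod_eq_dvd_iff)
  moreover have "j : {int p - w..int p + w}" using j by blast
  hence "abs (j - int p) < int N" using w unfolding atLeastAtMost_iff by linarith
  ultimately have "j - int p = 0" using zdvd_not_zless[of "abs (j - int p)" "int N"] by fastforce
  thus "j : {int p}" by simp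
 next
  fix j assume "j : {int p}"
  thus "j : {j':{int p - w..int p + w}. nat (j' mod int N) = p}" using p A by (auto simp: lifts_def band_def)
 qed
 moreover have "A $$ (nat (int p mod int N), p) = (SUM j':{j':{int p - w..int p + w}. nat (j' mod int N) = p}. C (int p) j')" using A p unfolding lifts_def by blast
 moreover have "nat (int p mod int N) = p" using p by simp
 ultimately show ?thesis by (simp only:) simp
qed
moreover have "dim_row A = N" using A by (auto simp: lifts_def)
ultimately show ?thesis by (simp add: mat_trace_def)
qed

lemma lifts_add: assumes "lifts N w B (mat N N f)" "lifts N w C (mat N N g)" shows "lifts N w (%i j. B i j + C i j) (mat N N (%p. f p + g p))"
proof -
have N: "0 < N" using assms by (simp add: lifts_def)
hence "nat (i mod int N) < N" for i by (simp add: nat_less_iff)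
thus ?thesis using assms by (auto simp: lifts_def band_def sum.distrib)
qed

lemma lifts_cong: "lifts N w B A ==> B = C ==> A = A' ==> lifts N w C A'" by simp

text \<open>Rows count from 0 and matrix units from 1: row \<open>i\<close> meets the unit with
  \<open>k + s = i + 1\<close> modulo \<open>N\<close>, which explains the \<open>Suc\<close> in the
  coefficient.\<close>

lemma lifts_stencil: assumes N: "0 < N" and w: "abs (int t - int s) <= w"
shows "lifts N w (%i j. if j = i - int s + int t then f (Suc (nat ((i - int s) mod int N))) else 0)
 (mat N N (%(p, q). SUM j=1..N. f j * unit_entry N (j + s) (j + t) p q))"
proof -
have "(SUM k=1..N. f k * unit_entry N (k + s) (k + t) (nat (i mod int N)) j) = (SUM j':{j':{i - w..i + w}. nat (j' mod int N) = j}. if j' = i - int s + int t then f (Suc (nat ((i - int s) mod int N))) else 0)"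
 if j: "j < N" for i j
proof -
 define k0 where "k0 = Suc (nat ((i - int s) mod int N))"
 have k0: "k0 : {1..N}" using N by (simp add: k0_def Suc_le_eq nat_less_iff)
 have ik0: "int k0 = (i - int s) mod int N + 1" using N by (simp add: k0_def)
 have row: "((nat (i mod int N) + 1) mod N = (k + s) mod N) = (k = k0)" if k: "k : {1..N}" for k
 proof -
  have "((nat (i mod int N) + 1) mod N = (k + s) mod N) \<longleftrightarrow> (int (nat (i mod int N) + 1) mod int N = int (k + s) mod int N)"
   by (metis of_nat_eq_iff zmod_int)
  also have "int (nat (i mod int N) + 1) mod int N = (i + 1) mod int N"
  proof -
   have "int (nat (i mod int N) + 1) = i mod int N + 1" using N by simp
   thus ?thesis by (simp only: mod_add_left_eq)
  qed
  also have "((i + 1) mod int N = int (k + s) mod int N) \<longleftrightarrow> (int N dvd (i + 1) - int (k + s))" by (rule mod_eq_dvd_iff)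
  also have "(i + 1) - int (k + s) = (i - int s) - (int k - 1)" by simp
  also have "(int N dvd (i - int s) - (int k - 1)) \<longleftrightarrow> (i - int s) mod int N = (int k - 1) mod int N" by (rule mod_eq_dvd_iff[symmetric])
  also have "(int k - 1) mod int N = int k - 1" using k by auto
  also have "((i - int s) mod int N = int k - 1) = (k = k0)" using ik0 by auto
  finally show ?thesis .
 qed
 have col: "((j + 1) mod N = (k0 + t) mod N) = (nat ((i - int s + int t) mod int N) = j)"
 proof -
  have "((j + 1) mod N = (k0 + t) mod N) \<longleftrightarrow> (int (k0 + t) mod int N = int (j + 1) mod int N)" by (metis of_nat_eq_iff zmod_int)
  also have "int (k0 + t) mod int N = ((i - int s) mod int N + (1 + int t)) mod int N" using ik0 by (simp add: alg)
  also have "... = (i - int s + (1 + int t)) mod int N" by (simp add: mod_add_left_eq)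
  also have "(... = int (j + 1) mod int N) \<longleftrightarrow> int N dvd (i - int s + (1 + int t)) - int (j + 1)" by (rule mod_eq_dvd_iff)
  also have "(i - int s + (1 + int t)) - int (j + 1) = (i - int s + int t) - int j" by simp
  also have "(int N dvd (i - int s + int t) - int j) \<longleftrightarrow> (i - int s + int t) mod int N = int j mod int N" by (rule mod_eq_dvd_iff[symmetric])
  also have "int j mod int N = int j" using j by simp
  also have "((i - int s + int t) mod int N = int j) = (nat ((i - int s + int t) mod int N) = j)" using N by auto
  finally show ?thesis .
 qed
 have "(SUM k=1..N. f k * unit_entry N (k + s) (k + t) (nat (i mod int N)) j) = (SUM k=1..N. if k = k0 then (if nat ((i - int s + int t) mod int N) = j then f k0 else 0) else 0)"
  using row col by (intro sum.cong refl) (auto simp: unit_entry_def)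
 also have "... = (if nat ((i - int s + int t) mod int N) = j then f k0 else 0)" using k0 by simp
 also have "... = (SUM j':{j':{i - w..i + w}. nat (j' mod int N) = j}. if j' = i - int s + int t then f k0 else 0)"
 proof -
  have fin: "finite {j':{i - w..i + w}. nat (j' mod int N) = j}" by (rule finite_subset[of _ "{i - w..i + w}"]) auto
  show ?thesis using w by (simp only: sum.delta[OF fin]) auto
 qed
 finally show ?thesis unfolding k0_def .
qed
moreover have "nat (i mod int N) < N" for i using N by (simp add: nat_less_iff)
ultimately show ?thesis using N w by (auto simp: lifts_def band_def)
qed

lemma cpow_shift: assumes "!!i j. C i j = B (i + p) (j + p)" shows "cpow w C d i j = cpow w B d (i + p) (j + p)"
proof (induction d arbitrary: i j)
case (Suc d)
have "(SUM k:{j - w..j + w}. cpow w B d (i + p) (k + p) * B (k + p) (j + p)) = (SUM k:{j + p - w..j + p + w}. cpow w B d (i + p) k * B k (j + p))"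
 by (rule sum.reindex_bij_witness[of _ "%k. k - p" "%k. k + p"]) auto
moreover have "cpow w C (Suc d) i j = (SUM k:{j - w..j + w}. cpow w B d (i + p) (k + p) * B (k + p) (j + p))" by (simp only: cpow.simps comp_def Suc.IH assms)
ultimately show ?case by (simp add: comp_def)
qed simp

text \<open>Row 0 of the \<open>d\<close>-th power sees only what \<open>d\<close> steps of length
  at most \<open>w\<close> can reach.\<close>

lemma cpow_loc: assumes "!!i j. abs i <= R ==> abs j <= R ==> C i j = B i j" "band w C" "band w B" "int d * w <= R" shows "cpow w C d 0 j = cpow w B d 0 j"
using assms(4)
proof (induction d arbitrary: j)
case (Suc d)
have w: "0 <= w" using assms(2) by (simp add: band_def)
have d: "int d * w <= R" "int d * w + w <= R" using Suc.prems w by (auto simp: alg)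
show ?case
proof (cases "abs j <= R")
 case True
 have "cpow w C d 0 k * C k j = cpow w B d 0 k * B k j" for k
 proof (cases "abs k <= int d * w")
  case True': True
  thus ?thesis using Suc.IH[OF d(1)] assms(1)[of k j] True d by simp
 next
  case False
  hence "cpow w C d 0 k = 0" using band_cpow[OF assms(2), of d] by (simp add: band_def)
  thus ?thesis using Suc.IH[OF d(1), of k] by simp
 qed
 thus ?thesis by (simp add: comp_def)
next
 case False
 hence "int (Suc d) * w < abs (0 - j)" using Suc.prems by simp
 thus ?thesis using band_cpow[OF assms(2), of "Suc d"] band_cpow[OF assms(3), of "Suc d"] unfolding band_def by metis
qed
qed simp

lemma cpow_bound: fixes C :: "int => int => complex" assumes "!!i j. abs i <= R ==> norm (C i j) <= b" "band w C" "int d * w <= R" "0 <= b"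
shows "norm (cpow w C d 0 j) <= ((2 * real_of_int w + 1) * b) ^ d" using assms(3)
proof (induction d arbitrary: j)
case (Suc d)
have w: "0 <= w" using assms(2) by (simp add: band_def)
have d: "int d * w <= R" using Suc.prems w by (simp add: alg)
have t: "norm (cpow w C d 0 k * C k j) <= ((2 * real_of_int w + 1) * b) ^ d * b" for k
proof (cases "abs k <= int d * w")
 case True
 thus ?thesis unfolding norm_mult using Suc.IH[OF d] assms(1)[of k j] d assms(4) w by (intro mult_mono) auto
next
 case False
 hence "cpow w C d 0 k = 0" using band_cpow[OF assms(2), of d] by (simp add: band_def)
 thus ?thesis using assms(4) w by simp
qed
have "norm (cpow w C (Suc d) 0 j) <= (SUM k:{j - w..j + w}. ((2 * real_of_int w + 1) * b) ^ d * b)" unfolding cpow.simps comp_def by (intro sum_norm_le t)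
also have "... = ((2 * real_of_int w + 1) * b) ^ Suc d" using w by (simp add: alg)
finally show ?case .
qed simp

lemma cpow_of_real: "cpow w (%i j. cor (C i j)) d i j = of_real (cpow w C d i j)" by (induction d arbitrary: i j) (simp_all add: comp_def)

text \<open>
A family of band operators that commutes with the shift of the sequence, whose periodization is
the Lax matrix.
\<close>

locale band_model = fixes C :: "(int => 'a::euclidean_space) => int => int => complex" and w :: int assumes band: "!!y. band w (C y)"
 and shift: "!!y l i j. C (tau l y) i j = C y (i + l) (j + l)"
 and C_meas: "!!i j. (%y. C y i j) : bmeas zseq"
 and C_loc: "EX R. ALL y y' j. (ALL k. abs k <= R --> y k = y' k) --> C y 0 j = C y' 0 j"
begin

definition "qq d y = cpow w (C y) d 0 0"

lemma qq_tau: "cpow w (C y) d l l = qq d (tau l y)" unfolding qq_def using cpow_shift[of "C (tau l y)" "C y" l w d 0 0] shift by simp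

lemma qq_meas: "qq d : bmeas zseq"
proof -
have "(%y. cpow w (C y) d i j) : bmeas zseq" for i j
proof (induction d arbitrary: i j)
 case (Suc d)
 thus ?case unfolding cpow.simps comp_def by (intro borel_measurable_sum borel_measurable_times C_meas)
qed simp
thus ?thesis unfolding qq_def[abs_def] .
qed

lemma qq_loc: "EX R. zloc R (qq d)"
proof -
obtain R0 where R0: "!!y y' j. (!!k. abs k <= R0 ==> y k = y' k) ==> C y 0 j = C y' 0 j" using C_loc by meson
have "zloc (R0 + int d * w) (qq d)" unfolding zloc_def
proof (intro allI impI)
 fix y y' :: "int => 'a" assume eq: "ALL k. abs k <= R0 + int d * w --> y k = y' k"
 have "C y i j = C y' i j" if i: "abs i <= int d * w" for i j
 proof -
  have "C (tau i y) 0 (j - i) = C (tau i y') 0 (j - i)" using eq i by (intro R0) (auto simp: tau_def)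
  thus ?thesis by (simp add: shift)
 qed
 thus "qq d y = qq d y'" unfolding qq_def by (intro cpow_loc[where R="int d * w"] band) auto
qed
thus ?thesis by blast
qed

lemma qq_trace: assumes "lifts N w (C (zper N x)) A" "int d * w < int N" shows "mat_trace (A ^\<^sub>m d) = (SUM i<N. qq d (tau (int i) (zper N x)))"
using lifts_trace[OF lifts_pow[OF assms(1)] assms(2)] by (simp add: qq_tau)

lemma qq_bound: assumes g: "!!y. range y <= X ==> 1 <= g y"
 and b: "!!y j. range y <= X ==> norm (C y 0 j) <= B0 * (SUM l:{-R0..R0}. g (tau l y)) ^ p" and B0: "0 <= B0"
shows "EX B R. ALL y. range y <= X --> norm (qq d y) <= B * (SUM l:{-R..R}. g (tau l y)) ^ (p * d)"
proof (intro exI allI impI)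
define R where "R = int d * w"
have w: "0 <= w" using band by (auto simp: band_def)
fix y :: "int => 'a" assume y: "range y <= X"
have yt: "range (tau l y) <= X" for l using y by (auto simp: tau_def)
let ?S = "SUM l:{-(R0 + R)..R0 + R}. g (tau l y)"
have "norm (C y i j) <= B0 * ?S ^ p" if i: "abs i <= R" for i j
proof -
 have "norm (C y i j) = norm (C (tau i y) 0 (j - i))" by (simp add: shift)
 also have "... <= B0 * (SUM l:{-R0..R0}. g (tau l (tau i y))) ^ p" by (rule b[OF yt])
 also have "(SUM l:{-R0..R0}. g (tau l (tau i y))) = (SUM l:{i - R0..i + R0}. g (tau l y))"
  unfolding tau_tau by (rule sum.reindex_bij_witness[of _ "%l. l - i" "%l. l + i"]) auto
 also have "B0 * (SUM l:{i - R0..i + R0}. g (tau l y)) ^ p <= B0 * ?S ^ p"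
 proof (intro mlm power_mono B0 sum_mono2 sum_nonneg)
  show "0 <= g (tau l y)" for l using g[OF yt, of l] by simp
  show "0 <= g (tau l y)" for l using g[OF yt, of l] by simp
 qed (use i in auto)
 finally show ?thesis .
qed
moreover have "0 <= ?S" by (intro sum_nonneg) (use g[OF yt] in \<open>auto intro: order_trans[of 0 1]\<close>)
ultimately have "norm (qq d y) <= ((2 * real_of_int w + 1) * (B0 * ?S ^ p)) ^ d"
 unfolding qq_def by (intro cpow_bound[where R=R] band) (use B0 in \<open>auto simp: R_def\<close>)
also have "... = ((2 * real_of_int w + 1) * B0) ^ d * ?S ^ (p * d)" by (simp add: power_mult_distrib power_mult mult.assoc)
finally show "norm (qq d y) <= ((2 * real_of_int w + 1) * B0) ^ d * ?S ^ (p * d)" .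
qed

end

lemma eventually_large: "0 <= w ==> (!!N. 0 < N ==> w < int N ==> N : S ==> Q N) ==> eventually Q (large S)" unfolding eventually_inf_principal
using eventually_gt_at_top[of "nat w"] by (rule eventually_mono) (auto simp: nat_less_iff)

text \<open>\<open>et = 1\<close> is the symmetric, \<open>et = -1\<close> the antisymmetric case.\<close>

lemma moment_log_convex: fixes C :: "int => int => real" assumes b: "band w C" and sym: "!!i j. C j i = et * C i j" and et: "et * et = 1"
shows "et ^ D * cpow w C (2 * D) 0 0 >= (et * cpow w C 2 0 0) ^ D" "et * cpow w C 2 0 0 = (SUM l:{-w..w}. (C 0 l)^2)"
proof -
have w: "0 <= w" using b by (simp add: band_def)
define K where "K = {-(int (2 * D + 4) * w)..int (2 * D + 4) * w}"
define p where "p k = cpow w C k 0" for k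
have p0: "p k l = 0" if "k <= 2 * D + 3" "l \<notin> K" for k l
proof -
 have "int k * w < abs (0 - l)"
 proof -
  have "int k * w <= int (2 * D + 4) * w" using that(1) w by (intro mrm) auto
  moreover have "int (2 * D + 4) * w < abs (0 - l)" using that(2) by (auto simp: K_def)
  ultimately show ?thesis by linarith
 qed
 thus ?thesis using band_cpow[OF b, of k] by (simp add: p_def band_def)
qed
have pS: "p (Suc k) l = (SUM j:K. p k j * C j l)" if "k <= 2 * D + 3" for k l
proof -
 have "{0 - int k * w..0 + int k * w} <= K"
 proof -
  have "int k * w <= int (2 * D + 4) * w" using that w by (intro mrm) auto
  thus ?thesis by (auto simp: K_def)
 qed
 thus ?thesis unfolding p_def by (simp add: comp_eq_left[OF band_cpow[OF b] b, of K 0 k] K_def)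
qed
\<comment> \<open>The inner product of the rows at 0 of two powers. Symmetry moves a factor
  \<open>C\<close> from one side to the other at the price of \<open>et\<close>, so up to sign the
  value depends on \<open>a + b\<close> only.\<close>
define I where "I a b = (SUM l:K. p a l * p b l)" for a b
have Iswap: "I (Suc a) b = et * I a (Suc b)" if "a <= 2 * D + 3" "b <= 2 * D + 3" for a b
proof -
 have "I (Suc a) b = (SUM l:K. SUM j:K. p a j * C j l * p b l)" unfolding I_def pS[OF that(1)] by (simp add: sum_distrib_right)
 also have "... = (SUM j:K. SUM l:K. p a j * C j l * p b l)" by (rule sum.swap)
 also have "... = et * (SUM j:K. p a j * (SUM l:K. p b l * C l j))"
 proof -
  have "p a j * C j l * p b l = et * (p a j * (p b l * C l j))" for j l using sym[of j l] et sym[of l j] by (simp add: mult_ac)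
  hence "(SUM j:K. SUM l:K. p a j * C j l * p b l) = (SUM j:K. SUM l:K. et * (p a j * (p b l * C l j)))" by (intro sum.cong refl)
  thus ?thesis by (simp only: sum_distrib_left)
 qed
 also have "... = et * I a (Suc b)" unfolding I_def pS[OF that(2)] ..
 finally show ?thesis .
qed
have "0 : K" using w by (auto simp: K_def)
hence I0: "I a 0 = p a 0" for a by (simp add: I_def p_def K_def if_distrib[where f="%z. _ * z"] cong: if_cong)
have Ik: "I a b = et ^ b * p (a + b) 0" if "a + b <= 2 * D + 3" for a b using that
proof (induction b arbitrary: a)
 case (Suc b)
 have "et * I (Suc a) b = (et * et) * I a (Suc b)" using Suc.prems by (simp add: Iswap)
 hence "I a (Suc b) = et * I (Suc a) b" using et by simp
 thus ?case using Suc.IH[of "Suc a"] Suc.prems by simp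
qed (simp add: I0)
define v where "v k = I k k" for k
have v0: "v 0 = 1" using Ik[of 0 0] by (simp add: v_def p_def)
have vn: "0 <= v k" for k unfolding v_def I_def by (intro sum_nonneg) simp
have "I 1 1 = et ^ 1 * p (1 + 1) 0" by (rule Ik) simp
hence v1: "v 1 = et * p 2 0" by (simp only: v_def power_one_right one_add_one)
have cs: "(v (Suc k))^2 <= v k * v (Suc (Suc k))" if "Suc k <= D" for k
proof -
 have "v (Suc k) = et * I k (Suc (Suc k))" unfolding v_def using Iswap[of k "Suc k"] that by simp
 moreover have "et^2 = 1" using et by (simp add: power2_eq_square)
 ultimately have "(v (Suc k))^2 = (I k (Suc (Suc k)))^2" by (simp add: power_mult_distrib)
 also have "... <= (SUM l:K. (p k l)^2) * (SUM l:K. (p (Suc (Suc k)) l)^2)" unfolding I_def by (rule Cauchy_Schwarz_ineq_sum)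
 also have "... = v k * v (Suc (Suc k))" by (simp add: v_def I_def power2_eq_square)
 finally show ?thesis .
qed
\<comment> \<open>By Cauchy-Schwarz \<open>v\<close> is log-convex, so its consecutive ratios
  increase; starting from \<open>v 0 = 1\<close> they are at least \<open>v 1\<close>. A vanishing
  term makes the next one vanish.\<close>
have grow: "v 1 * v k <= v (Suc k)" if "k <= D" for k using that
proof (induction k)
 case (Suc k)
 note c = cs[OF Suc.prems]
 show ?case
 proof (cases "v k = 0")
  case True
  hence "v (Suc k) = 0" using c by simp
  thus ?thesis using vn by simp
 next
  case False
  hence vk: "0 < v k" using vn[of k] by simp
  have "v 1 * v k * v (Suc k) <= v (Suc k) * v (Suc k)" using Suc vn by (intro mrm) auto
  also have "... <= v k * v (Suc (Suc k))" using c by (simp add: power2_eq_square)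
  finally have "v k * (v 1 * v (Suc k)) <= v k * v (Suc (Suc k))" by (simp add: mult_ac)
  thus ?thesis using vk by simp
 qed
qed (simp add: v0)
have "v 1 ^ k <= v k" if "k <= D" for k using that
proof (induction k)
 case (Suc k)
 hence "v 1 * v 1 ^ k <= v 1 * v k" using vn by (intro mlm) auto
 thus ?case using grow[of k] Suc.prems by simp
qed (simp add: v0)
from this[OF order_refl] have vD1: "v 1 ^ D <= v D" .
have "I D D = et ^ D * p (D + D) 0" by (rule Ik) simp
hence "v D = et ^ D * p (2 * D) 0" by (simp only: v_def mult_2)
hence "(et * p 2 0) ^ D <= et ^ D * p (2 * D) 0" using vD1 by (simp only: v1)
thus "et ^ D * cpow w C (2 * D) 0 0 >= (et * cpow w C 2 0 0) ^ D" by (simp only: p_def)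
have one: "p 1 l = C 0 l" for l
proof -
 have "comp w (cpow w C 0) C 0 l = (SUM k:{0} \<union> {l - w..l + w}. cpow w C 0 0 k * C k l)" by (rule comp_eq[OF b]) auto
 also have "... = (SUM k:{0} \<union> {l - w..l + w}. if k = 0 then C k l else 0)" by (intro sum.cong) auto
 also have "... = C 0 l" by (subst sum.delta) auto
 finally show ?thesis by (simp add: p_def)
qed
have "et * p 2 0 = (SUM l:K. p 1 l * p 1 l)" using v1 unfolding v_def I_def by metis
also have "... = (SUM l:K. (C 0 l)^2)" by (simp only: one power2_eq_square)
also have "... = (SUM l:{-w..w}. (C 0 l)^2)"
proof (rule sum.mono_neutral_right)
 have "w <= int (2 * D + 4) * w" using mrm[of 1 "int (2 * D + 4)" w] w by simp
 thus "{-w..w} <= K" by (auto simp: K_def)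
 show "ALL l:K - {-w..w}. (C 0 l)^2 = 0" using b by (auto simp: band_def)
qed (simp add: K_def)
finally show "et * cpow w C 2 0 0 = (SUM l:{-w..w}. (C 0 l)^2)" by (simp only: p_def)
qed

lemma cpow_nonneg: "(!!i j. 0 <= (C i j :: real)) ==> 0 <= cpow w C d i j" by (induction d arbitrary: i j) (auto simp: comp_def intro!: sum_nonneg)

lemma cpow_diag_ge: assumes "!!i j. 0 <= (C i j :: real)" "0 <= w" shows "C i i ^ d <= cpow w C d i i"
proof (induction d)
case (Suc d)
have "C i i ^ Suc d <= cpow w C d i i * C i i" using Suc assms(1)[of i i] by (simp add: mlm mult.commute)
also have "... <= cpow w C (Suc d) i i" unfolding cpow.simps comp_def
 by (rule member_le_sum[of i _ "%k. cpow w C d i k * C k i"]) (use assms cpow_nonneg[OF assms(1)] in auto)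
finally show ?case .
qed simp

lemma (in band_model) conclude: fixes MM :: "'a matrix_model" and F :: "'a => real => real" and P :: "complex poly"
assumes "var_space MM : sets borel" "standing_hypotheses MM P F al" "0 < al" "sizes MM = UNIV" "!!N x. lax MM N x : carrier_mat N N"
 and lift: "!!N x. 0 < N ==> lifts N w (C (zper N x)) (lax MM N x)"
 and "g : bmeas zseq" "EX R. zloc R g" "!!y. range y <= var_space MM ==> 1 <= g y"
 and "!!j :: nat. EX B. ALL y. range y <= var_space MM & (ALL k. norm (y k) <= real j) --> g y <= B"
 and "!!d. EX B R. ALL y. range y <= var_space MM --> norm (qq d y) <= B * (SUM l:{-R..R}. g (tau l y)) ^ ka d"
 and "EX c>0. EX C'. ALL y. range y <= var_space MM --> c * g y ^ K - C' <= Re (coeff P (degree P) * qq (degree P) y)"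
 and "1 <= K" "!!d. d < degree P ==> ka d <= K - 1" shows "covariance_is_free_energy_derivative MM P F al m n"
proof -
have w: "0 <= w" using band by (auto simp: band_def)
have "\<forall>\<^sub>F N in large (sizes MM). ALL x:vectors (var_space MM) N. mat_trace (lax MM N x ^\<^sub>m d) = (SUM i<N. qq d (tau (int i) (zper N x)))" for d
 by (rule eventually_large[of "int d * w"]) (use w in \<open>auto intro!: qq_trace lift\<close>)
then interpret local_model MM F al P m n qq g K ka using assms by unfold_locales (auto intro: qq_meas qq_loc)
show ?thesis by (rule local_model_main)
qed

section \<open>Measurability and coercivity estimates for the individual models\<close>

lemma coord_measurable: "(%y. y k) : bmeas (zseq :: (int => 'a::topological_space) measure)" by (rule measurable_component_singleton) simp

lemma fst_borel: "fst : bmeas (borel :: (real \<times> real) measure)" and snd_borel: "snd : bmeas (borel :: (real \<times> real) measure)"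
by (auto intro!: borel_measurable_continuous_onI continuous_intros)

lemma fst_coord: "(%y. fst (y k)) : bmeas (zseq :: (int => real \<times> real) measure)" by (rule measurable_compose[OF coord_measurable fst_borel])

lemma snd_coord: "(%y. snd (y k)) : bmeas (zseq :: (int => real \<times> real) measure)" by (rule measurable_compose[OF coord_measurable snd_borel])

lemma power_one_plus: fixes z :: real assumes "0 <= z" shows "(1 + z) ^ D <= 2 ^ D * (1 + z ^ D)"
proof -
have "1 + z <= 2 * max 1 z" by simp
hence "(1 + z) ^ D <= (2 * max 1 z) ^ D" using assms by (intro power_mono) auto
also have "... = 2 ^ D * (max 1 z) ^ D" by (rule power_mult_distrib)
also have "(max 1 z) ^ D <= 1 + z ^ D" using assms by (cases "z <= 1") auto
finally show ?thesis by simp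
qed

text \<open>The base 6 is the 3 from squaring a sum of three terms times the 2 of
  \<open>power_one_plus\<close>.\<close>

lemma power_one_plus2: fixes u v :: real shows "(1 + abs u + abs v) ^ (2 * D) <= 6 ^ D * (1 + (u^2 + v^2) ^ D)"
proof -
have "0 <= (1 - abs u)^2 + (1 - abs v)^2 + (abs u - abs v)^2" by simp
hence "(1 + abs u + abs v)^2 <= 3 * (1 + (u^2 + v^2))" by (simp add: power2_eq_square alg)
hence "((1 + abs u + abs v)^2) ^ D <= (3 * (1 + (u^2 + v^2))) ^ D" by (intro power_mono) auto
also have "... = 3 ^ D * (1 + (u^2 + v^2)) ^ D" by (rule power_mult_distrib)
also have "... <= 3 ^ D * (2 ^ D * (1 + (u^2 + v^2) ^ D))" by (intro mlm power_one_plus) auto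
also have "... = 6 ^ D * (1 + (u^2 + v^2) ^ D)" using power_mult_distrib[of "3 :: real" 2 D] by simp
finally show ?thesis by (simp add: power_mult)
qed

lemma coercive_estimate: fixes a z :: real assumes "0 < a" "(u^2 + v^2) ^ D <= z" shows "a / 6 ^ D * (1 + abs u + abs v) ^ (2 * D) - a <= a * z"
proof -
have "a / 6 ^ D * (1 + abs u + abs v) ^ (2 * D) <= a / 6 ^ D * (6 ^ D * (1 + (u^2 + v^2) ^ D))" using assms(1) by (intro mlm power_one_plus2) auto
also have "... = a * (1 + (u^2 + v^2) ^ D)" by simp
also have "... <= a * (1 + z)" using assms by (intro mlm) auto
finally show ?thesis by (simp add: alg)
qed

lemma degree_complex_poly: "degree (complex_poly P) = degree P" "coeff (complex_poly P) d = of_real (coeff P d)" by (simp_all add: degree_map_poly coeff_map_poly)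

section \<open>Periodic Jacobi matrices\<close>

definition jacobi_op :: "(int => real \<times> real) => int => int => real" where
"jacobi_op y i j = (if j = i then fst (y i) else 0) + ((if j = i + 1 then snd (y i) else 0) + (if j = i - 1 then snd (y (i - 1)) else 0))"

lemma jacobi_lifts: assumes N: "0 < N" shows "lifts N 1 (%i j. cor (jacobi_op (zper N x) i j)) (jacobi_lax N x)"
proof (rule lifts_cong[OF lifts_add[OF lifts_stencil[OF N, of 0 0 1 "%j. of_real (fst (x j))"]
 lifts_add[OF lifts_stencil[OF N, of 1 0 1 "%j. of_real (snd (x j))"] lifts_stencil[OF N, of 0 1 1 "%j. of_real (snd (x j))"]]]])
qed (auto simp: jacobi_lax_def jacobi_op_def zper_def fun_eq_iff sum.distrib alg intro!: eq_matI)

definition one_site :: "('a => real) => (int => 'a) => real" where "one_site G y = G (y 0)"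

lemma one_site: fixes G :: "'a::euclidean_space => real" assumes "continuous_on UNIV G"
shows "one_site G : bmeas zseq" "EX R. zloc R (one_site G)" "EX B. ALL y. range y <= X & (ALL k. norm (y k) <= real j) --> one_site G y <= B"
 "one_site G (tau l y) = G (y l)"
proof -
show "one_site G : bmeas zseq" unfolding one_site_def[abs_def] by (rule measurable_compose[OF coord_measurable borel_measurable_continuous_onI[OF assms]])
show "EX R. zloc R (one_site G)" by (rule exI[of _ 0]) (auto simp: zloc_def one_site_def)
have "bounded (G ` cball 0 (real j))" using assms by (intro compact_imp_bounded compact_continuous_image continuous_on_subset[OF assms]) auto
then obtain B where B: "ALL x:cball 0 (real j). norm (G x) <= B" unfolding bounded_iff by blast
have "one_site G y <= B" if "ALL k. norm (y k) <= real j" for y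
proof -
 have "y 0 : cball 0 (real j)" using that by simp
 hence "norm (G (y 0)) <= B" using B by blast
 thus ?thesis by (simp add: one_site_def)
qed
thus "EX B. ALL y. range y <= X & (ALL k. norm (y k) <= real j) --> one_site G y <= B" by blast
qed (simp add: one_site_def tau_def)

lemma three_sum: "(SUM l:{-1..1::int}. f l) = f (-1) + f 0 + (f 1 :: real)"
proof -
have "{-1..1::int} = {-1, 0, 1}" by auto
thus ?thesis by simp
qed

text \<open>Log-convexity of the moments bounds the diagonal of the top power below by a power of
  the squared length of row 0, which contains both variables of the site. A power \<open>d\<close>
  has degree \<open>d\<close> in the variables, so the lower powers stay below
  \<open>2 * D\<close>.\<close>

theorem jacobi_case: fixes F :: "real \<times> real => real => real"
assumes P: "jacobi_potential P" and hyp: "standing_hypotheses jacobi_model (complex_poly P) F al" "0 < al"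
shows "covariance_is_free_energy_derivative jacobi_model (complex_poly P) F al m n"
proof -
define C where "C y i j = cor (jacobi_op y i j)" for y i j
have bd: "band 1 (jacobi_op y)" for y by (auto simp: band_def jacobi_op_def)
interpret band_model C 1
proof
 show "band 1 (C y)" for y using bd[of y] by (simp add: band_def C_def)
 show "C (tau l y) i j = C y (i + l) (j + l)" for y l i j by (simp add: C_def jacobi_op_def tau_def alg)
 note m = fst_coord snd_coord
 show "(%y. C y i j) : bmeas zseq" for i j unfolding C_def jacobi_op_def using m[of i] m[of "i - 1"] by measurable
 show "EX R. ALL y y' j. (ALL k. abs k <= R --> y k = y' k) --> C y 0 j = C y' 0 j" by (rule exI[of _ 1]) (simp add: C_def jacobi_op_def)
qed
have qr: "qq d y = of_real (cpow 1 (jacobi_op y) d 0 0)" for d y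
proof -
 have "C y = (%i j. cor (jacobi_op y i j))" by (simp add: C_def fun_eq_iff)
 thus ?thesis unfolding qq_def by (simp only: cpow_of_real)
qed
define G where "G x = 1 + abs (fst x) + abs (snd x)" for x :: "real \<times> real"
have cG: "continuous_on UNIV G" unfolding G_def by (intro continuous_intros)
note os = one_site[OF cG]
obtain D where D: "degree P = 2 * D" "1 <= D" using P by (auto simp: jacobi_potential_def elim!: evenE)
show ?thesis
proof (rule conclude[where g="one_site G" and K="2 * D" and ka="%d. 1 * d"])
 show "var_space jacobi_model : sets borel" by (simp add: jacobi_model_def borel_closed closed_Times)
 show "sizes jacobi_model = UNIV" by (simp add: jacobi_model_def)
 show "lax jacobi_model N x : carrier_mat N N" for N x by (simp add: jacobi_model_def jacobi_lax_def)
 show "lifts N 1 (C (zper N x)) (lax jacobi_model N x)" if "0 < N" for N x using jacobi_lifts[OF that, of x] by (simp add: jacobi_model_def C_def[abs_def])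
 show "1 <= one_site G y" for y by (simp add: one_site_def G_def)
 show "EX B R. ALL y. range y <= var_space jacobi_model --> norm (qq d y) <= B * (SUM l:{-R..R}. one_site G (tau l y)) ^ (1 * d)" for d
 proof (rule qq_bound[where ?B0.0=1 and ?R0.0=1])
  fix y j
  show "norm (C y 0 j) <= 1 * (SUM l:{-1..1}. one_site G (tau l y)) ^ 1" unfolding C_def norm_of_real three_sum os(4) by (auto simp: jacobi_op_def G_def)
 qed (auto simp: one_site_def G_def)
 show "EX c>0. EX C'. ALL y. range y <= var_space jacobi_model --> c * one_site G y ^ (2 * D) - C' <= Re (coeff (complex_poly P) (degree (complex_poly P)) * qq (degree (complex_poly P)) y)"
 proof (intro exI conjI allI impI)
  let ?a = "lead_coeff P"
  have a: "0 < ?a" using P by (simp add: jacobi_potential_def)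
  thus "0 < ?a / 6 ^ D" by simp
  fix y
  have s: "jacobi_op y j i = 1 * jacobi_op y i j" for i j by (auto simp: jacobi_op_def)
  have "(fst (y 0))^2 + (snd (y 0))^2 <= (SUM l:{-1..1}. (jacobi_op y 0 l)^2)" unfolding three_sum by (simp add: jacobi_op_def)
  hence "((fst (y 0))^2 + (snd (y 0))^2) ^ D <= (1 * cpow 1 (jacobi_op y) 2 0 0) ^ D" using moment_log_convex(2)[OF bd s] by (intro power_mono) auto
  also have "... <= 1 ^ D * cpow 1 (jacobi_op y) (2 * D) 0 0" using moment_log_convex(1)[OF bd s] by simp
  finally have "((fst (y 0))^2 + (snd (y 0))^2) ^ D <= cpow 1 (jacobi_op y) (2 * D) 0 0" by simp
  from coercive_estimate[OF a this]
  show "?a / 6 ^ D * one_site G y ^ (2 * D) - ?a <= Re (coeff (complex_poly P) (degree (complex_poly P)) * qq (degree (complex_poly P)) y)"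
   by (simp add: degree_complex_poly qr one_site_def G_def D)
 qed
 show "1 * d <= 2 * D - 1" if "d < degree (complex_poly P)" for d using that D by (simp add: degree_complex_poly)
qed (use hyp os D in auto)
qed

section \<open>Antisymmetric matrices\<close>

definition antisymmetric_op :: "(int => real) => int => int => real" where
"antisymmetric_op y i j = (if j = i + 1 then y i else 0) + (if j = i - 1 then - y (i - 1) else 0)"

lemma antisymmetric_lifts: assumes N: "0 < N" shows "lifts N 1 (%i j. cor (antisymmetric_op (zper N x) i j)) (antisymmetric_lax N x)"
proof (rule lifts_cong[OF lifts_add[OF lifts_stencil[OF N, of 1 0 1 "%j. of_real (x j)"] lifts_stencil[OF N, of 0 1 1 "%j. - of_real (x j)"]]])
qed (auto simp: antisymmetric_lax_def antisymmetric_op_def zper_def fun_eq_iff sum.distrib sum_negf sum_subtractf alg intro!: eq_matI)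

text \<open>The sign \<open>(- 1) ^ D\<close> of the leading coefficient is that of the diagonal of
  the \<open>2 * D\<close>-th power, so the moment inequality applies with
  \<open>et = -1\<close>.\<close>

theorem antisymmetric_case: fixes F :: "real => real => real"
assumes P: "antisymmetric_potential P" and hyp: "standing_hypotheses antisymmetric_model (complex_poly P) F al" "0 < al"
shows "covariance_is_free_energy_derivative antisymmetric_model (complex_poly P) F al m n"
proof -
define C where "C y i j = cor (antisymmetric_op y i j)" for y i j
have bd: "band 1 (antisymmetric_op y)" for y by (auto simp: band_def antisymmetric_op_def)
interpret band_model C 1
proof
 show "band 1 (C y)" for y using bd[of y] by (simp add: band_def C_def)
 show "C (tau l y) i j = C y (i + l) (j + l)" for y l i j by (simp add: C_def antisymmetric_op_def tau_def alg)
 have m: "(%y. y k) : bmeas (zseq :: (int => real) measure)" for k :: int by (rule coord_measurable)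
 show "(%y. C y i j) : bmeas zseq" for i j unfolding C_def antisymmetric_op_def using m[of i] m[of "i - 1"] by measurable
 show "EX R. ALL y y' j. (ALL k. abs k <= R --> y k = y' k) --> C y 0 j = C y' 0 j" by (rule exI[of _ 1]) (simp add: C_def antisymmetric_op_def)
qed
have qr: "qq d y = of_real (cpow 1 (antisymmetric_op y) d 0 0)" for d y
proof -
 have "C y = (%i j. cor (antisymmetric_op y i j))" by (simp add: C_def fun_eq_iff)
 thus ?thesis unfolding qq_def by (simp only: cpow_of_real)
qed
define G where "G x = 1 + abs x" for x :: real
have cG: "continuous_on UNIV G" unfolding G_def by (intro continuous_intros)
note os = one_site[OF cG]
obtain D a R where R: "0 < a" "degree R < 2 * D - 1" "P = monom ((- 1) ^ D * a) (2 * D) + R" using P by (auto simp: antisymmetric_potential_def)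
have D: "degree P = 2 * D" "1 <= D"
proof -
 have "degree (monom ((- 1) ^ D * a) (2 * D)) = 2 * D" using R(1) by (simp add: degree_monom_eq)
 thus "degree P = 2 * D" unfolding R(3) using R(2) by (subst degree_add_eq_left) auto
qed (use R(2) in auto)
have lc: "coeff P (2 * D) = (- 1) ^ D * a" using R(2) by (simp add: R(3) coeff_eq_0)
show ?thesis
proof (rule conclude[where g="one_site G" and K="2 * D" and ka="%d. 1 * d"])
 show "var_space antisymmetric_model : sets borel" by (simp add: antisymmetric_model_def)
 show "sizes antisymmetric_model = UNIV" by (simp add: antisymmetric_model_def)
 show "lax antisymmetric_model N x : carrier_mat N N" for N x by (simp add: antisymmetric_model_def antisymmetric_lax_def)
 show "lifts N 1 (C (zper N x)) (lax antisymmetric_model N x)" if "0 < N" for N x using antisymmetric_lifts[OF that, of x] by (simp add: antisymmetric_model_def C_def[abs_def])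
 show "1 <= one_site G y" for y by (simp add: one_site_def G_def)
 show "EX B R. ALL y. range y <= var_space antisymmetric_model --> norm (qq d y) <= B * (SUM l:{-R..R}. one_site G (tau l y)) ^ (1 * d)" for d
 proof (rule qq_bound[where ?B0.0=1 and ?R0.0=1])
  fix y j
  show "norm (C y 0 j) <= 1 * (SUM l:{-1..1}. one_site G (tau l y)) ^ 1" unfolding C_def norm_of_real three_sum os(4) by (auto simp: antisymmetric_op_def G_def)
 qed (auto simp: one_site_def G_def)
 show "EX c>0. EX C'. ALL y. range y <= var_space antisymmetric_model --> c * one_site G y ^ (2 * D) - C' <= Re (coeff (complex_poly P) (degree (complex_poly P)) * qq (degree (complex_poly P)) y)"
 proof (intro exI conjI allI impI)
  show "0 < a / 6 ^ D" using R(1) by simp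
  fix y
  have s: "antisymmetric_op y j i = - 1 * antisymmetric_op y i j" for i j by (auto simp: antisymmetric_op_def)
  have "(y 0)^2 + 0^2 <= (SUM l:{-1..1}. (antisymmetric_op y 0 l)^2)" unfolding three_sum by (simp add: antisymmetric_op_def)
  hence "((y 0)^2 + 0^2) ^ D <= (- 1 * cpow 1 (antisymmetric_op y) 2 0 0) ^ D" using moment_log_convex(2)[OF bd s] by (intro power_mono) auto
  also have "... <= (- 1) ^ D * cpow 1 (antisymmetric_op y) (2 * D) 0 0" using moment_log_convex(1)[OF bd s] by simp
  finally have "((y 0)^2 + 0^2) ^ D <= (- 1) ^ D * cpow 1 (antisymmetric_op y) (2 * D) 0 0" .
  note est = coercive_estimate[OF R(1) this]
  have "Re (coeff (complex_poly P) (degree (complex_poly P)) * qq (degree (complex_poly P)) y) = a * ((- 1) ^ D * cpow 1 (antisymmetric_op y) (2 * D) 0 0)"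
   by (simp only: degree_complex_poly D lc qr of_real_mult[symmetric] Re_complex_of_real) simp
  thus "a / 6 ^ D * one_site G y ^ (2 * D) - a <= Re (coeff (complex_poly P) (degree (complex_poly P)) * qq (degree (complex_poly P)) y)"
   using est by (simp add: one_site_def G_def)
 qed
 show "1 * d <= 2 * D - 1" if "d < degree (complex_poly P)" for d using that D by (simp add: degree_complex_poly)
qed (use hyp os D in auto)
qed

section \<open>Products of a bidiagonal matrix with its transpose\<close>

lemma three_sum': "(SUM k:{j - 1..j + 1::int}. f k) = f (j - 1) + f j + f (j + 1)" for f :: "int => 'b::comm_ring_1"
proof -
have "{j - 1..j + 1} = {j - 1, j, j + 1}" by auto
thus ?thesis by (simp add: add.assoc)
qed

definition laguerre_left :: "(int => real \<times> real) => int => int => real" where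
"laguerre_left y i j = (if j = i then fst (y i) else 0) + (if j = i + 1 then snd (y i) else 0)"
definition laguerre_right :: "(int => real \<times> real) => int => int => real" where
"laguerre_right y i j = (if j = i then fst (y i) else 0) + (if j = i - 1 then snd (y (i - 1)) else 0)"
definition laguerre_op :: "(int => real \<times> real) => int => int => real" where
"laguerre_op y i j = laguerre_left y i j * fst (y j) + laguerre_left y i (j + 1) * snd (y j)"

lemma laguerre_lifts: assumes N: "0 < N" shows "lifts N 2 (%i j. cor (laguerre_op (zper N x) i j)) (laguerre_factor N x * transpose_mat (laguerre_factor N x))"
proof -
have l: "lifts N 1 (%i j. cor (laguerre_left (zper N x) i j)) (laguerre_factor N x)"
 by (rule lifts_cong[OF lifts_add[OF lifts_stencil[OF N, of 0 0 1 "%j. of_real (fst (x j))"] lifts_stencil[OF N, of 1 0 1 "%j. of_real (snd (x j))"]]])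
  (auto simp: laguerre_factor_def laguerre_left_def zper_def fun_eq_iff sum.distrib alg intro!: eq_matI)
have r: "lifts N 1 (%i j. cor (laguerre_right (zper N x) i j)) (transpose_mat (laguerre_factor N x))"
 by (rule lifts_cong[OF lifts_add[OF lifts_stencil[OF N, of 0 0 1 "%j. of_real (fst (x j))"] lifts_stencil[OF N, of 0 1 1 "%j. of_real (snd (x j))"]]])
  (auto simp: laguerre_factor_def laguerre_right_def zper_def fun_eq_iff sum.distrib alg unit_entry_def conj_commute intro!: eq_matI)
have "comp 1 (%i j. cor (laguerre_left y i j)) (%i j. cor (laguerre_right y i j)) = (%i j. cor (laguerre_op y i j))" for y
 unfolding comp_def three_sum' by (auto simp: fun_eq_iff laguerre_op_def laguerre_right_def)
thus ?thesis using lifts_comp[OF l r] by simp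
qed

text \<open>The matrix is quadratic in the variables, hence the exponents \<open>2 * d\<close>. All
  entries are nonnegative, and the path that stays at site 0 already contributes
  \<open>(a^2 + b^2) ^ D\<close>.\<close>

theorem laguerre_case: fixes F :: "real \<times> real => real => real"
assumes P: "laguerre_potential P" and hyp: "standing_hypotheses laguerre_model (complex_poly P) F al" "0 < al"
shows "covariance_is_free_energy_derivative laguerre_model (complex_poly P) F al m n"
proof -
define C where "C y i j = cor (laguerre_op y i j)" for y i j
have bd: "band 2 (laguerre_op y)" for y by (auto simp: band_def laguerre_op_def laguerre_left_def)
interpret band_model C 2
proof
 show "band 2 (C y)" for y using bd[of y] by (simp add: band_def C_def)
 show "C (tau l y) i j = C y (i + l) (j + l)" for y l i j by (simp add: C_def laguerre_op_def laguerre_left_def tau_def alg)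
 note m = fst_coord snd_coord
 show "(%y. C y i j) : bmeas zseq" for i j unfolding C_def laguerre_op_def laguerre_left_def using m[of i] m[of j] by measurable
 have "laguerre_op y 0 j = laguerre_op y' 0 j" if e: "ALL k. abs k <= 2 --> y k = y' k" for y y' j
 proof (cases "abs j <= 2")
  case True
  thus ?thesis using e by (simp add: laguerre_op_def laguerre_left_def)
 next
  case False
  thus ?thesis by (auto simp: laguerre_op_def laguerre_left_def)
 qed
 thus "EX R. ALL y y' j. (ALL k. abs k <= R --> y k = y' k) --> C y 0 j = C y' 0 j" unfolding C_def by metis
qed
have qr: "qq d y = of_real (cpow 2 (laguerre_op y) d 0 0)" for d y
proof -
 have "C y = (%i j. cor (laguerre_op y i j))" by (simp add: C_def fun_eq_iff)
 thus ?thesis unfolding qq_def by (simp only: cpow_of_real)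
qed
define G where "G x = 1 + abs (fst x) + abs (snd x)" for x :: "real \<times> real"
have cG: "continuous_on UNIV G" unfolding G_def by (intro continuous_intros)
note os = one_site[OF cG]
define D where "D = degree P"
have D: "1 <= D" "0 < coeff P D" using P by (auto simp: laguerre_potential_def D_def)
show ?thesis
proof (rule conclude[where g="one_site G" and K="2 * D" and ka="%d. 2 * d"])
 show "var_space laguerre_model : sets borel" by (simp add: laguerre_model_def borel_closed closed_Times)
 show "sizes laguerre_model = UNIV" by (simp add: laguerre_model_def)
 show "lax laguerre_model N x : carrier_mat N N" for N x
 proof -
  have "laguerre_factor N x : carrier_mat N N" by (simp add: laguerre_factor_def)
  thus ?thesis by (auto simp: laguerre_model_def intro: mult_carrier_mat[of _ N N])
 qed
 show "lifts N 2 (C (zper N x)) (lax laguerre_model N x)" if "0 < N" for N x using laguerre_lifts[OF that, of x] by (simp add: laguerre_model_def C_def[abs_def])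
 show "1 <= one_site G y" for y by (simp add: one_site_def G_def)
 show "EX B R. ALL y. range y <= var_space laguerre_model --> norm (qq d y) <= B * (SUM l:{-R..R}. one_site G (tau l y)) ^ (2 * d)" for d
 proof (rule qq_bound[where ?B0.0=2 and ?R0.0=1])
  fix y j
  let ?S = "SUM l:{-1..1}. one_site G (tau l y)"
  have S: "?S = G (y (- 1)) + G (y 0) + G (y 1)" unfolding three_sum os(4) ..
  have B: "abs (laguerre_left y 0 j') <= ?S" for j' unfolding S laguerre_left_def G_def by auto
  have "abs (laguerre_op y 0 j) <= 2 * ?S ^ 2"
  proof (cases "j : {- 1, 0, 1}")
   case True
   hence "abs (fst (y j)) <= ?S" "abs (snd (y j)) <= ?S" unfolding S by (auto simp: G_def)
   hence "abs (laguerre_left y 0 j * fst (y j)) <= ?S * ?S" "abs (laguerre_left y 0 (j + 1) * snd (y j)) <= ?S * ?S"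
    unfolding abs_mult by (auto intro!: mult_mono B order_trans[OF abs_ge_zero B])
   thus ?thesis unfolding laguerre_op_def power2_eq_square by linarith
  next
   case False
   thus ?thesis by (simp add: laguerre_op_def laguerre_left_def)
  qed
  thus "norm (C y 0 j) <= 2 * ?S ^ 2" by (simp add: C_def)
 qed (auto simp: one_site_def G_def)
 show "EX c>0. EX C'. ALL y. range y <= var_space laguerre_model --> c * one_site G y ^ (2 * D) - C' <= Re (coeff (complex_poly P) (degree (complex_poly P)) * qq (degree (complex_poly P)) y)"
 proof (intro exI conjI allI impI)
  show "0 < coeff P D / 6 ^ D" using D by simp
  fix y :: "int => real \<times> real" assume y: "range y <= var_space laguerre_model"
  have "y k : {0..} \<times> {0..}" for k using y by (auto simp: laguerre_model_def)
  hence "0 <= fst (y k)" "0 <= snd (y k)" for k by (auto simp: mem_Times_iff)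
  hence nn: "0 <= laguerre_op y i j" for i j by (simp add: laguerre_op_def laguerre_left_def)
  have "laguerre_op y 0 0 ^ D <= cpow 2 (laguerre_op y) D 0 0" by (rule cpow_diag_ge[OF nn]) simp
  hence "((fst (y 0))^2 + (snd (y 0))^2) ^ D <= cpow 2 (laguerre_op y) D 0 0" by (simp add: laguerre_op_def laguerre_left_def power2_eq_square)
  from coercive_estimate[OF D(2) this]
  show "coeff P D / 6 ^ D * one_site G y ^ (2 * D) - coeff P D <= Re (coeff (complex_poly P) (degree (complex_poly P)) * qq (degree (complex_poly P)) y)"
   by (simp add: degree_complex_poly qr one_site_def G_def flip: D_def)
 qed
 show "2 * d <= 2 * D - 1" if "d < degree (complex_poly P)" for d using that by (simp add: degree_complex_poly D_def)
qed (use hyp os D in auto)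
qed

section \<open>Matrices with one upper diagonal and one lower diagonal at distance
  \<open>r\<close>\<close>

definition inb_op :: "nat => (int => real) => (int => real) => int => int => real" where
"inb_op r a b i j = (if j = i + 1 then a i else 0) + (if j = i - int r then b (i - int r) else 0)"

lemma inb_lifts: assumes N: "0 < N" and r: "1 <= r"
shows "lifts N (int r) (%i j. cor (inb_op r (%k. a (Suc (nat (k mod int N)))) (%k. b (Suc (nat (k mod int N)))) i j)) (inb_lax r N a b)"
by (rule lifts_cong[OF lifts_add[OF lifts_stencil[OF N, of 1 0 "int r" "%j. of_real (a j)"] lifts_stencil[OF N, of 0 r "int r" "%j. of_real (b j)"]]])
 (use r in \<open>auto simp: inb_lax_def inb_op_def fun_eq_iff sum.distrib alg intro!: eq_matI\<close>)

lemma band_inb: "1 <= r ==> band (int r) (inb_op r a b)" by (auto simp: band_def inb_op_def)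

lemma inb_rec: assumes r: "1 <= r"
shows "cpow (int r) (inb_op r a b) (Suc d) i j = cpow (int r) (inb_op r a b) d i (j - 1) * a (j - 1) + cpow (int r) (inb_op r a b) d i (j + int r) * b j"
proof -
let ?p = "cpow (int r) (inb_op r a b) d i"
have "(SUM k:{j - int r..j + int r}. ?p k * inb_op r a b k j) = (SUM k:{j - int r..j + int r}. (if k = j - 1 then ?p k * a k else 0) + (if k = j + int r then ?p k * b (k - int r) else 0))"
 by (intro sum.cong refl) (auto simp: inb_op_def alg)
also have "... = ?p (j - 1) * a (j - 1) + ?p (j + int r) * b j" unfolding sum.distrib using r by (subst sum.delta, simp, subst sum.delta, simp) auto
finally show ?thesis by (simp add: comp_def)
qed

lemma inb_nonneg: "(!!k. 0 <= a k) ==> (!!k. 0 <= b k) ==> 0 <= cpow (int r) (inb_op r a b) d i j" by (rule cpow_nonneg) (simp add: inb_op_def)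

text \<open>A sum over paths from 0: a step goes up by 1 with weight 1, or down by \<open>r\<close>
  with a weight from \<open>b\<close>. A path of length \<open>d\<close> to \<open>j\<close> with
  \<open>e\<close> jumps down satisfies \<open>d - j = (r + 1) * e\<close>, so the exponent of
  \<open>M\<close> is forced, and there are at most \<open>2 ^ d\<close> paths.\<close>

lemma inb_upper_aux: assumes r: "1 <= r" and b: "!!k. 0 <= b k" and M: "1 <= M" "!!k. abs k <= R ==> b k <= M" and d: "int d * int r <= R"
shows "(ALL e::nat. int d - j = int (r + 1) * int e --> cpow (int r) (inb_op r (%_. 1) b) d 0 j <= 2 ^ d * M ^ e) &
 ((ALL e::nat. int d - j ~= int (r + 1) * int e) --> cpow (int r) (inb_op r (%_. 1) b) d 0 j = 0)" using d
proof (induction d arbitrary: j)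
case 0
have "1 <= M ^ e" "0 <= M ^ e" for e using M(1) by simp_all
thus ?case using r by (auto dest: spec[of _ 0])
next
case (Suc d)
let ?p = "cpow (int r) (inb_op r (%_. 1) b)"
have d: "int d * int r <= R" using Suc.prems by (simp add: alg)
have nn: "0 <= ?p d 0 k" for k using b by (intro inb_nonneg) auto
note IH = Suc.IH[OF d]
have rec: "?p (Suc d) 0 j = ?p d 0 (j - 1) + ?p d 0 (j + int r) * b j" by (simp only: inb_rec[OF r] mult_1_right)
show ?case
proof (intro conjI allI impI)
 fix e assume e: "int (Suc d) - j = int (r + 1) * int e"
 show "?p (Suc d) 0 j <= 2 ^ Suc d * M ^ e"
 proof (cases "abs j <= R")
  case False
  hence "int (Suc d) * int r < abs (0 - j)" using Suc.prems by simp
  hence "?p (Suc d) 0 j = 0" using band_cpow[OF band_inb[OF r], of "Suc d" "%_. 1" b] unfolding band_def by blast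
  moreover have "0 <= 2 ^ Suc d * M ^ e" using M(1) by simp
  ultimately show ?thesis by simp
 next
  case True
  have 1: "?p d 0 (j - 1) <= 2 ^ d * M ^ e" using IH[of "j - 1"] e by auto
  have 2: "?p d 0 (j + int r) * b j <= 2 ^ d * M ^ e"
  proof (cases e)
   case 0
   have "int d - (j + int r) ~= int (r + 1) * int e'" for e' :: nat
   proof -
    have "int d - (j + int r) < 0" using e 0 r by simp
    moreover have "0 <= int (r + 1) * int e'" by simp
    ultimately show ?thesis by linarith
   qed
   hence "?p d 0 (j + int r) = 0" using IH[of "j + int r"] by blast
   thus ?thesis using M(1) by simp
  next
   case (Suc e')
   have "int d - (j + int r) = int (r + 1) * int e'" using e Suc by (simp add: alg)
   hence "?p d 0 (j + int r) <= 2 ^ d * M ^ e'" using IH[of "j + int r"] by blast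
   hence "?p d 0 (j + int r) * b j <= 2 ^ d * M ^ e' * M" using M(2)[OF True] b[of j] nn M(1) by (intro mult_mono) auto
   thus ?thesis using Suc by (simp add: mult_ac)
  qed
  show ?thesis unfolding rec using 1 2 by simp
 qed
next
 assume e: "ALL e::nat. int (Suc d) - j ~= int (r + 1) * int e"
 have "?p d 0 (j - 1) = 0"
 proof -
  have "int d - (j - 1) ~= int (r + 1) * int e'" for e' :: nat using e by (auto dest: spec[of _ e'])
  thus ?thesis using IH[of "j - 1"] by blast
 qed
 moreover have "?p d 0 (j + int r) = 0"
 proof -
  have "int d - (j + int r) ~= int (r + 1) * int e'" for e' :: nat
  proof
   assume "int d - (j + int r) = int (r + 1) * int e'"
   hence "int (Suc d) - j = int (r + 1) * int (Suc e')" by (simp add: alg)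
   thus False using e by blast
  qed
  thus ?thesis using IH[of "j + int r"] by blast
 qed
 ultimately show "?p (Suc d) 0 j = 0" unfolding rec by simp
qed
qed

lemma inb_upper: assumes r: "1 <= r" and b: "!!k. 0 <= b k" and M: "1 <= M" "!!k. abs k <= int d * int r ==> b k <= M"
shows "cpow (int r) (inb_op r (%_. 1) b) d 0 0 <= 2 ^ d * M ^ (d div (r + 1))"
proof -
have aux: "(ALL e::nat. int d - 0 = int (r + 1) * int e --> cpow (int r) (inb_op r (%_. 1) b) d 0 0 <= 2 ^ d * M ^ e) &
 ((ALL e::nat. int d - 0 ~= int (r + 1) * int e) --> cpow (int r) (inb_op r (%_. 1) b) d 0 0 = 0)"
 by (rule inb_upper_aux[where R="int d * int r"]) (use r b M in auto)
show ?thesis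
proof (cases "(r + 1) dvd d")
case True
hence "int d - 0 = int (r + 1) * int (d div (r + 1))" by (metis diff_zero dvd_mult_div_cancel of_nat_mult)
thus ?thesis using aux by blast
next
case False
have "int d - 0 ~= int (r + 1) * int e" for e :: nat
proof
 assume "int d - 0 = int (r + 1) * int e"
 hence "int d = int ((r + 1) * e)" by (simp add: distrib_right)
 hence "d = (r + 1) * e" by (simp only: of_nat_eq_iff)
 thus False using False by (metis dvd_triv_left)
qed
hence "cpow (int r) (inb_op r (%_. 1) b) d 0 0 = 0" using aux by blast
thus ?thesis using M(1) by simp
qed
qed

text \<open>One path suffices: \<open>k\<close> rounds of climbing \<open>r\<close> steps and
  jumping back to 0, each round with the weight \<open>b 0\<close>.\<close>

lemma inb_lower: assumes r: "1 <= r" and b: "!!k. 0 <= b k" shows "b 0 ^ k <= cpow (int r) (inb_op r (%_. 1) b) (k * (r + 1)) 0 0"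
proof (induction k)
case (Suc k)
let ?p = "cpow (int r) (inb_op r (%_. 1) b)"
have nn: "0 <= ?p d 0 j" for d j using b by (intro inb_nonneg) auto
have up: "?p d 0 0 <= ?p (d + s) 0 (int s)" for d s
proof (induction s)
 case (Suc s)
 have "?p (d + s) 0 (int s) <= ?p (Suc (d + s)) 0 (int (Suc s))"
  unfolding inb_rec[OF r] using mult_nonneg_nonneg[OF nn b, of "d + s" "int (Suc s) + int r" "int (Suc s)"] by simp
 thus ?case using Suc by simp
qed simp
let ?d = "k * (r + 1)"
have "b 0 ^ Suc k <= ?p ?d 0 0 * b 0" using mrm[OF Suc b[of 0]] by (simp add: mult.commute)
also have "... <= ?p (?d + r) 0 (int r) * b 0" using up b by (intro mrm) auto
also have "... <= ?p (Suc (?d + r)) 0 0" unfolding inb_rec[OF r] using nn[of "?d + r" "0 - 1"] by simp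
finally show ?case by (simp add: alg)
qed simp

text \<open>A closed path crosses each edge upwards as often as a jump passes over it downwards.\<close>

lemma inb_gauge: assumes r: "1 <= r" and a: "!!k. a k ~= 0"
shows "cpow (int r) (inb_op r a (%_. 1)) d i i = cpow (int r) (inb_op r (%_. 1) (%k. PROD l<r. a (k + int l))) d i i"
proof -
\<comment> \<open>The product of \<open>a\<close> over the edges from 0 to \<open>j\<close>,
  inverted for negative \<open>j\<close>. Conjugation with this diagonal turns the weights of the
  upward steps into 1.\<close>
define pw where "pw j = (if 0 <= j then PROD k:{0..<j}. a k else inverse (PROD k:{j..<0}. a k))" for j
have nz: "pw j ~= 0" for j using a by (simp add: pw_def)
have step: "pw (j + 1) = pw j * a j" for j
proof -
 consider "0 <= j" | "j = - 1" | "j < - 1" by linarith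
 thus ?thesis
 proof cases
  case 1
  hence "{0..<j + 1} = insert j {0..<j}" by auto
  thus ?thesis using 1 by (simp add: pw_def mult.commute)
 next
  case 2
  have "{- 1..<0} = {- 1 :: int}" by auto
  thus ?thesis using 2 a by (simp add: pw_def)
 next
  case 3
  hence "{j..<0} = insert j {j + 1..<0}" by auto
  thus ?thesis using 3 a by (simp add: pw_def)
 qed
qed
have jump: "pw (j + int s) = pw j * (PROD l<s. a (j + int l))" for j s
proof (induction s)
 case (Suc s)
 have "pw (j + int (Suc s)) = pw (j + int s) * a (j + int s)" using step[of "j + int s"] by (simp add: alg)
 thus ?case using Suc by simp
qed simp
let ?A = "%k. PROD l<r. a (k + int l)"
have "pw i * cpow (int r) (inb_op r a (%_. 1)) d i j = cpow (int r) (inb_op r (%_. 1) ?A) d i j * pw j" for j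
proof (induction d arbitrary: j)
 case (Suc d)
 have "pw i * cpow (int r) (inb_op r a (%_. 1)) (Suc d) i j = (pw i * cpow (int r) (inb_op r a (%_. 1)) d i (j - 1)) * a (j - 1) + pw i * cpow (int r) (inb_op r a (%_. 1)) d i (j + int r)"
  unfolding inb_rec[OF r] by (simp add: alg)
 also have "... = cpow (int r) (inb_op r (%_. 1) ?A) d i (j - 1) * (pw (j - 1) * a (j - 1)) + cpow (int r) (inb_op r (%_. 1) ?A) d i (j + int r) * pw (j + int r)"
  unfolding Suc.IH by (simp add: mult.assoc)
 also have "pw (j - 1) * a (j - 1) = pw j" using step[of "j - 1"] by simp
 also have "pw (j + int r) = pw j * ?A j" by (rule jump)
 also have "cpow (int r) (inb_op r (%_. 1) ?A) d i (j - 1) * pw j + cpow (int r) (inb_op r (%_. 1) ?A) d i (j + int r) * (pw j * ?A j) = cpow (int r) (inb_op r (%_. 1) ?A) (Suc d) i j * pw j"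
  unfolding inb_rec[OF r] by (simp add: alg)
 finally show ?case .
qed simp
from this[of i] show ?thesis using nz[of i] by simp
qed

lemma cpow_continuous: fixes C :: "real => int => int => real" assumes "!!i j. continuous_on UNIV (%e. C e i j)" shows "continuous_on UNIV (%e. cpow w (C e) d i j)"
by (induction d arbitrary: i j) (auto simp: comp_def intro!: continuous_intros assms)

text \<open>The gauge divides by the weights, while the variables may vanish. Both sides are
  continuous in the weights, so these are raised by \<open>1 / (n + 1)\<close> and the limit is
  taken.\<close>

lemma inb_gauge_nonneg: assumes r: "1 <= r" and a: "!!k. 0 <= a k"
shows "cpow (int r) (inb_op r a (%_. 1)) d i i = cpow (int r) (inb_op r (%_. 1) (%k. PROD l<r. a (k + int l))) d i i"
proof -
define f where "f e = cpow (int r) (inb_op r (%k. a k + e) (%_. 1)) d i i - cpow (int r) (inb_op r (%_. 1) (%k. PROD l<r. a (k + int l) + e)) d i i" for e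
have "continuous_on UNIV (%e. inb_op r (%k. a k + e) (%_. 1) i j)" "continuous_on UNIV (%e. inb_op r (%_. 1) (%k. PROD l<r. a (k + int l) + e) i j)" for i j
 unfolding inb_op_def by (cases "j = i + 1"; cases "j = i - int r"; auto intro!: continuous_intros)+
hence "continuous_on UNIV f" unfolding f_def by (intro continuous_intros cpow_continuous)
hence "isCont f 0" by (simp add: continuous_on_eq_continuous_at)
hence "(%n. f (inverse (real (Suc n)))) ----> f 0" by (rule isCont_tendsto_compose) (rule LIMSEQ_inverse_real_of_nat)
moreover have "f (inverse (real (Suc n))) = 0" for n
proof -
 have "a k + inverse (real (Suc n)) ~= 0" for k
 proof -
  have "0 < a k + inverse (real (Suc n))" using a[of k] by (intro add_nonneg_pos) auto
  thus ?thesis by simp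
 qed
 thus ?thesis unfolding f_def by (subst inb_gauge[OF r]) auto
qed
ultimately have "f 0 = 0" by (simp add: LIMSEQ_const_iff)
thus ?thesis by (simp add: f_def)
qed

text \<open>In both variants the trace densities are functions of the weights \<open>bt y\<close> of
  the downward jumps: the variable itself or, after the gauge, a product of \<open>r\<close>
  consecutive variables. The size function is built from \<open>bt\<close>, because in the second
  variant the energy does not control single variables.\<close>

lemma (in band_model) inb_conclude: fixes MM :: "'a matrix_model" and F :: "'a => real => real" and P :: "real poly"
assumes r: "1 <= r" and P: "inb_potential r P" and X: "var_space MM : sets borel"
 and hyp: "standing_hypotheses MM (complex_poly P) F al" "0 < al" "sizes MM = UNIV" "!!N x. lax MM N x : carrier_mat N N"
 and lift: "!!N x. 0 < N ==> lifts N w (C (zper N x)) (lax MM N x)"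
 and qb: "!!d y. range y <= var_space MM ==> qq d y = of_real (cpow (int r) (inb_op r (%_. 1) (bt y)) d 0 0)"
 and bt: "!!y k. range y <= var_space MM ==> 0 <= bt y k" "!!y l k. bt (tau l y) k = bt y (k + l)" "(%y. bt y 0) : bmeas zseq" "EX R. zloc R (%y. bt y 0)"
  "!!j :: nat. EX B. ALL y. range y <= var_space MM & (ALL k. norm (y k) <= real j) --> bt y 0 <= B"
shows "covariance_is_free_energy_derivative MM (complex_poly P) F al m n"
proof -
obtain k where k: "1 <= k" "degree P = k * (r + 1)" and a: "0 < lead_coeff P" using P by (auto simp: inb_potential_def)
define g where "g y = 1 + bt y 0" for y
have gt: "g (tau l y) = 1 + bt y l" for l y by (simp add: g_def bt)
show ?thesis
proof (rule conclude[where g=g and K=k and ka="%d. d div (r + 1)", OF X hyp(1,2,3,4) lift])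
 show "g : bmeas zseq" unfolding g_def[abs_def] using bt(3) by measurable
 show "EX R. zloc R g" using bt(4) unfolding g_def[abs_def] zloc_def by metis
 show "1 <= g y" if "range y <= var_space MM" for y using bt(1)[OF that] by (simp add: g_def)
 show "EX B. ALL y. range y <= var_space MM & (ALL k. norm (y k) <= real j) --> g y <= B" for j
 proof -
  obtain B where "ALL y. range y <= var_space MM & (ALL k. norm (y k) <= real j) --> bt y 0 <= B" using bt(5) by blast
  thus ?thesis by (intro exI[of _ "1 + B"]) (auto simp: g_def)
 qed
 show "EX B R. ALL y. range y <= var_space MM --> norm (qq d y) <= B * (SUM l:{-R..R}. g (tau l y)) ^ (d div (r + 1))" for d
 proof (intro exI allI impI)
  fix y :: "int => 'a" assume y: "range y <= var_space MM"
  let ?R = "int d * int r"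
  let ?M = "SUM l:{-?R..?R}. g (tau l y)"
  have nn: "0 <= g (tau l y)" for l unfolding gt using bt(1)[OF y, of l] by simp
  have M: "g (tau l y) <= ?M" if "abs l <= ?R" for l using that nn by (intro member_le_sum[of l _ "%l. g (tau l y)"]) auto
  have "1 <= ?M" using M[of 0] bt(1)[OF y, of 0] unfolding gt by simp
  moreover have "bt y l <= ?M" if "abs l <= ?R" for l using M[OF that] unfolding gt by simp
  ultimately have "cpow (int r) (inb_op r (%_. 1) (bt y)) d 0 0 <= 2 ^ d * ?M ^ (d div (r + 1))" by (intro inb_upper r bt(1)[OF y])
  moreover have "0 <= cpow (int r) (inb_op r (%_. 1) (bt y)) d 0 0" using bt(1)[OF y] by (intro inb_nonneg) auto
  ultimately show "norm (qq d y) <= 2 ^ d * ?M ^ (d div (r + 1))" unfolding qb[OF y] norm_of_real by simp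
 qed
 show "EX c>0. EX C'. ALL y. range y <= var_space MM --> c * g y ^ k - C' <= Re (coeff (complex_poly P) (degree (complex_poly P)) * qq (degree (complex_poly P)) y)"
 proof (intro exI conjI allI impI)
  show "0 < lead_coeff P / 2 ^ k" using a by simp
  fix y :: "int => 'a" assume y: "range y <= var_space MM"
  have "bt y 0 ^ k <= cpow (int r) (inb_op r (%_. 1) (bt y)) (degree P) 0 0" unfolding k(2) by (rule inb_lower[OF r bt(1)[OF y]])
  hence z: "lead_coeff P * bt y 0 ^ k <= lead_coeff P * cpow (int r) (inb_op r (%_. 1) (bt y)) (degree P) 0 0" using a by (intro mlm) auto
  have "lead_coeff P / 2 ^ k * g y ^ k <= lead_coeff P / 2 ^ k * (2 ^ k * (1 + bt y 0 ^ k))" unfolding g_def using a bt(1)[OF y] by (intro mlm power_one_plus) auto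
  also have "... = lead_coeff P + lead_coeff P * bt y 0 ^ k" by (simp add: alg)
  finally show "lead_coeff P / 2 ^ k * g y ^ k - lead_coeff P <= Re (coeff (complex_poly P) (degree (complex_poly P)) * qq (degree (complex_poly P)) y)"
   using z unfolding degree_complex_poly qb[OF y] by (simp flip: of_real_mult)
 qed
 show "1 <= k" by (rule k)
 show "d div (r + 1) <= k - 1" if "d < degree (complex_poly P)" for d
 proof -
  have "d < k * (r + 1)" using that k by (simp add: degree_complex_poly)
  hence "d div (r + 1) < k" by (simp add: less_mult_imp_div_less)
  thus ?thesis by simp
 qed
qed
qed

theorem inb_case: fixes F :: "real => real => real"
assumes r: "1 <= r" and P: "inb_potential r P" and MM: "MM : {inb_model_a r, inb_model_b r}" and hyp: "standing_hypotheses MM (complex_poly P) F al" "0 < al"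
shows "covariance_is_free_energy_derivative MM (complex_poly P) F al m n"
proof -
have bm: "band_model (%y i j. cor (inb_op r y (%_. 1) i j)) (int r)" "band_model (%y i j. cor (inb_op r (%_. 1) y i j)) (int r)"
proof -
 have m: "(%y. y k) : bmeas (zseq :: (int => real) measure)" for k :: int by (rule coord_measurable)
 show "band_model (%y i j. cor (inb_op r y (%_. 1) i j)) (int r)"
 proof
  show "band (int r) (%i j. cor (inb_op r y (%_. 1) i j))" for y using band_inb[OF r, of y "%_. 1"] by (simp add: band_def)
  show "cor (inb_op r (tau l y) (%_. 1) i j) = cor (inb_op r y (%_. 1) (i + l) (j + l))" for y l i j by (simp add: inb_op_def tau_def alg)
  show "(%y. cor (inb_op r y (%_. 1) i j)) : bmeas zseq" for i j unfolding inb_op_def using m[of i] by measurable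
  show "EX R. ALL y y' j. (ALL k. abs k <= R --> y k = y' k) --> cor (inb_op r y (%_. 1) 0 j) = cor (inb_op r y' (%_. 1) 0 j)"
   by (rule exI[of _ 0]) (simp add: inb_op_def)
 qed
 show "band_model (%y i j. cor (inb_op r (%_. 1) y i j)) (int r)"
 proof
  show "band (int r) (%i j. cor (inb_op r (%_. 1) y i j))" for y using band_inb[OF r, of "%_. 1" y] by (simp add: band_def)
  show "cor (inb_op r (%_. 1) (tau l y) i j) = cor (inb_op r (%_. 1) y (i + l) (j + l))" for y l i j by (simp add: inb_op_def tau_def alg)
  show "(%y. cor (inb_op r (%_. 1) y i j)) : bmeas zseq" for i j unfolding inb_op_def using m[of "i - int r"] by measurable
  show "EX R. ALL y y' j. (ALL k. abs k <= R --> y k = y' k) --> cor (inb_op r (%_. 1) y 0 j) = cor (inb_op r (%_. 1) y' 0 j)"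
   by (rule exI[of _ "int r"]) (simp add: inb_op_def)
 qed
qed
from MM consider "MM = inb_model_a r" | "MM = inb_model_b r" by blast
thus ?thesis
proof cases
 case 1
 have X: "var_space MM = {0..}" by (simp add: 1 inb_model_a_def)
 show ?thesis
 proof (rule band_model.inb_conclude[OF bm(1) r P _ hyp, where bt="%y k. PROD l<r. y (k + int l)"])
  show "lifts N (int r) (%i j. cor (inb_op r (zper N x) (%_. 1) i j)) (lax MM N x)" if "0 < N" for N x
   using inb_lifts[OF that r, of x "%_. 1"] by (simp add: 1 inb_model_a_def zper_def[abs_def])
  show "band_model.qq (%y i j. cor (inb_op r y (%_. 1) i j)) (int r) d y = cor (cpow (int r) (inb_op r (%_. 1) (%k. PROD l<r. y (k + int l))) d 0 0)"
   if "range y <= var_space MM" for d y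
  proof -
   have "0 <= y k" for k using that by (auto simp: X)
   thus ?thesis unfolding band_model.qq_def[OF bm(1)] cpow_of_real by (simp add: inb_gauge_nonneg[OF r])
  qed
  show "0 <= (PROD l<r. y (k + int l))" if "range y <= var_space MM" for y k using that by (intro prod_nonneg) (auto simp: X)
  show "(PROD l'<r. tau l y (k + int l')) = (PROD l'<r. y (k + l + int l'))" for y l k by (simp add: tau_def alg)
  show "(%y :: int => real. PROD l<r. y (0 + int l)) : bmeas zseq" by (intro borel_measurable_prod coord_measurable)
  show "EX R. zloc R (%y :: int => real. PROD l<r. y (0 + int l))" by (rule exI[of _ "int r"]) (auto simp: zloc_def intro!: prod.cong)
  show "EX B. ALL y. range y <= var_space MM & (ALL k. norm (y k) <= real j) --> (PROD l<r. y (0 + int l)) <= B" for j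
  proof (intro exI allI impI)
   fix y :: "int => real" assume y: "range y <= var_space MM & (ALL k. norm (y k) <= real j)"
   hence "0 <= y k & y k <= real j" for k by (auto simp: X abs_le_iff)
   hence "(PROD l<r. y (0 + int l)) <= (PROD l<r. real j)" by (intro prod_mono) auto
   thus "(PROD l<r. y (0 + int l)) <= (PROD l<r. real j)" .
  qed
 qed (auto simp: 1 inb_model_a_def inb_lax_def)
next
 case 2
 have X: "var_space MM = {0..}" by (simp add: 2 inb_model_b_def)
 show ?thesis
 proof (rule band_model.inb_conclude[OF bm(2) r P _ hyp, where bt="%y. y"])
  show "lifts N (int r) (%i j. cor (inb_op r (%_. 1) (zper N x) i j)) (lax MM N x)" if "0 < N" for N x
   using inb_lifts[OF that r, of "%_. 1" x] by (simp add: 2 inb_model_b_def zper_def[abs_def])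
  show "band_model.qq (%y i j. cor (inb_op r (%_. 1) y i j)) (int r) d y = cor (cpow (int r) (inb_op r (%_. 1) y) d 0 0)" for d y
   unfolding band_model.qq_def[OF bm(2)] cpow_of_real ..
  show "0 <= y k" if "range y <= var_space MM" for y k using that by (auto simp: X)
  show "EX R. zloc R (%y :: int => real. y 0)" by (rule exI[of _ 0]) (auto simp: zloc_def)
  show "EX B. ALL y. range y <= var_space MM & (ALL k. norm (y k) <= real j) --> y 0 <= B" for j by (rule exI[of _ "real j"]) (auto simp: abs_le_iff)
 qed (auto simp: 2 inb_model_b_def inb_lax_def tau_def coord_measurable)
qed
qed

section \<open>Periodic CMV matrices\<close>

lemma mat_trace_comm: assumes "A : carrier_mat N N" "B : carrier_mat N N" shows "mat_trace (A * B) = mat_trace (B * A)"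
proof -
have "mat_trace (A * B) = (SUM i<N. SUM k<N. A $$ (i, k) * B $$ (k, i))" using assms by (simp add: mat_trace_def scalar_prod_def atLeast0LessThan)
also have "... = (SUM k<N. SUM i<N. B $$ (k, i) * A $$ (i, k))" by (subst sum.swap) (simp add: mult.commute)
also have "... = mat_trace (B * A)" using assms by (simp add: mat_trace_def scalar_prod_def atLeast0LessThan)
finally show ?thesis .
qed

text \<open>Powers pass through a factor, \<open>(A * B)^k * A = A * (B * A)^k\<close>, and the
  trace is cyclic. This gives the trace of the CMV matrix with its two factors in the other
  order.\<close>

lemma mat_trace_power_comm: assumes A: "A : carrier_mat N N" and B: "B : carrier_mat N N" shows "mat_trace ((A * B) ^\<^sub>m d) = mat_trace ((B * A) ^\<^sub>m d)"
proof (cases d)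
case 0
thus ?thesis using assms by (simp add: mat_trace_def)
next
case (Suc d')
have AB: "A * B : carrier_mat N N" "B * A : carrier_mat N N" using assms by auto
have push: "(A * B) ^\<^sub>m k * A = A * (B * A) ^\<^sub>m k" for k
proof (induction k)
 case (Suc k)
 have p: "(A * B) ^\<^sub>m k : carrier_mat N N" "(B * A) ^\<^sub>m k : carrier_mat N N" using AB by auto
 have "(A * B) ^\<^sub>m Suc k * A = (A * B) ^\<^sub>m k * (A * B * A)" using p AB A by (simp add: assoc_mult_mat[of _ N N _ N _ N])
 also have "A * B * A = A * (B * A)" using A B by (simp add: assoc_mult_mat[of _ N N _ N _ N])
 also have "(A * B) ^\<^sub>m k * (A * (B * A)) = (A * B) ^\<^sub>m k * A * (B * A)" using p AB A by (simp add: assoc_mult_mat[of _ N N _ N _ N])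
 also have "... = A * (B * A) ^\<^sub>m k * (B * A)" by (simp only: Suc)
 also have "... = A * (B * A) ^\<^sub>m Suc k" using p AB A by (simp add: assoc_mult_mat[of _ N N _ N _ N])
 finally show ?case .
qed (use A B in auto)
have p: "(A * B) ^\<^sub>m d' : carrier_mat N N" "(B * A) ^\<^sub>m d' : carrier_mat N N" using AB by auto
have "mat_trace ((A * B) ^\<^sub>m d) = mat_trace ((A * B) ^\<^sub>m d' * A * B)" using Suc p A B by (simp add: assoc_mult_mat[of _ N N _ N _ N])
also have "... = mat_trace (A * (B * A) ^\<^sub>m d' * B)" by (simp only: push)
also have "... = mat_trace (B * (A * (B * A) ^\<^sub>m d'))" by (rule mat_trace_comm[of _ N]) (use p A B in auto)
also have "B * (A * (B * A) ^\<^sub>m d') = (B * A) * (B * A) ^\<^sub>m d'" using p A B by (simp add: assoc_mult_mat[of _ N N _ N _ N])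
also have "mat_trace ... = mat_trace ((B * A) ^\<^sub>m d' * (B * A))" by (rule mat_trace_comm[of _ N]) (use p AB in auto)
finally show ?thesis using Suc by simp
qed

definition cmv_rho :: "complex => complex" where "cmv_rho z = of_real (sqrt (1 - (cmod z)^2))"

text \<open>The blocks \<open>\<Xi>\<close> at the positions \<open>k\<close> with \<open>k + e\<close> even; positions are counted from 0.\<close>

definition cmv_op :: "int => (int => complex) => int => int => complex" where
"cmv_op e y i j = ((if j = i then (if even (i + e) then cnj (y i) else 0) else 0) + (if j = i + 1 then (if even (i + e) then cmv_rho (y i) else 0) else 0))
  + ((if j = i - 1 then (if even (i - 1 + e) then cmv_rho (y (i - 1)) else 0) else 0) + (if j = i then (if even (i - 1 + e) then - y (i - 1) else 0) else 0))"

definition cmv_half :: "int => nat => (nat => complex) => complex mat" where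
"cmv_half e N x = mat N N (%(p, q). SUM j:{j:{1..N}. even (int j - 1 + e)}. cmv_block_entry N x j p q)"

lemma cmv_half_lifts: assumes N: "0 < N" "even N" shows "lifts N 1 (cmv_op e (zper N x)) (cmv_half e N x)"
proof -
let ?f = "%c j. if even (int j - 1 + e) then c (x j) else (0 :: complex)"
\<comment> \<open>Evenness of \<open>N\<close> makes the parity of a site well defined on the
  cycle.\<close>
have par: "even (k mod int N + e) = even (k + e)" for k using N(2) by (simp add: dvd_mod_iff)
have idx: "?f c (Suc (nat (k mod int N))) = (if even (k + e) then c (zper N x k) else 0)" for c k
proof -
 have "int (Suc (nat (k mod int N))) - 1 = k mod int N" using N(1) by simp
 thus ?thesis using par[of k] by (simp only: zper_def)
qed
note l = lifts_add[OF lifts_add[OF lifts_stencil[OF N(1), of 0 0 1 "?f cnj"] lifts_stencil[OF N(1), of 1 0 1 "?f cmv_rho"]]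
 lifts_add[OF lifts_stencil[OF N(1), of 0 1 1 "?f cmv_rho"] lifts_stencil[OF N(1), of 1 1 1 "?f uminus"]]]
show ?thesis
proof (rule lifts_cong[OF l])
 show "(%i j. ((if j = i - int 0 + int 0 then ?f cnj (Suc (nat ((i - int 0) mod int N))) else 0) + (if j = i - int 0 + int 1 then ?f cmv_rho (Suc (nat ((i - int 0) mod int N))) else 0)) +
  ((if j = i - int 1 + int 0 then ?f cmv_rho (Suc (nat ((i - int 1) mod int N))) else 0) + (if j = i - int 1 + int 1 then ?f uminus (Suc (nat ((i - int 1) mod int N))) else 0))) = cmv_op e (zper N x)"
  unfolding idx by (simp add: cmv_op_def fun_eq_iff)
 have "(SUM j:{j:{1..N}. even (int j - 1 + e)}. cmv_block_entry N x j p q) =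
  (SUM j=1..N. ?f cnj j * unit_entry N (j + 0) (j + 0) p q) + (SUM j=1..N. ?f cmv_rho j * unit_entry N (j + 0) (j + 1) p q)
  + ((SUM j=1..N. ?f cmv_rho j * unit_entry N (j + 1) (j + 0) p q) + (SUM j=1..N. ?f uminus j * unit_entry N (j + 1) (j + 1) p q))" for p q
  unfolding sum.inter_filter[OF finite_atLeastAtMost] sum.distrib[symmetric] by (intro sum.cong refl) (simp add: cmv_block_entry_def cmv_rho_def Let_def)
 thus "mat N N (%z. ((case z of (p, q) => SUM j=1..N. ?f cnj j * unit_entry N (j + 0) (j + 0) p q) + (case z of (p, q) => SUM j=1..N. ?f cmv_rho j * unit_entry N (j + 0) (j + 1) p q))
  + ((case z of (p, q) => SUM j=1..N. ?f cmv_rho j * unit_entry N (j + 1) (j + 0) p q) + (case z of (p, q) => SUM j=1..N. ?f uminus j * unit_entry N (j + 1) (j + 1) p q))) = cmv_half e N x"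
  unfolding cmv_half_def by (intro arg_cong[where f="mat N N"]) (simp add: fun_eq_iff)
qed simp_all
qed

lemma cmv_lax_half: "cmv_lax N x = cmv_half 0 N x * cmv_half 1 N x"
proof -
have "{j:{1..N}. odd j} = {j:{1..N}. even (int j - 1 + 0)}" "{j:{1..N}. even j} = {j:{1..N}. even (int j - 1 + 1)}" by auto
thus ?thesis unfolding cmv_lax_def cmv_half_def by simp
qed

text \<open>A shift by an odd number exchanges the two factors; the parameter \<open>e\<close> keeps
  track of the parity.\<close>

lemma cmv_op_tau: "cmv_op e (tau l y) i j = cmv_op (e + l) y (i + l) (j + l)"
proof -
have "even (i + l + (e + l)) = even (i + e)" "even (i + l - 1 + (e + l)) = even (i - 1 + e)" by presburger+
thus ?thesis by (simp add: cmv_op_def tau_def diff_add_eq)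
qed

lemma cmv_op_parity: "even (e - e') ==> cmv_op e = cmv_op e'"
proof -
assume "even (e - e')"
hence "even (k + e) = even (k + e')" for k by presburger
hence "cmv_op e y i j = cmv_op e' y i j" for y i j by (simp only: cmv_op_def)
thus ?thesis by (simp add: fun_eq_iff)
qed

lemma band_cmv: "band 1 (cmv_op e y)" by (auto simp: band_def cmv_op_def)

definition cmv_full :: "int => (int => complex) => int => int => complex" where
"cmv_full e y = comp 1 (cmv_op e y) (cmv_op (e + 1) y)"

definition cmv_q :: "int => nat => (int => complex) => complex" where
"cmv_q e d y = cpow 2 (cmv_full e y) d 0 0"

lemma band_full: "band 2 (cmv_full e y)" using band_comp[OF band_cmv[of e y] band_cmv[of "e + 1" y]] by (simp add: cmv_full_def)

lemma cmv_full_tau: "cmv_full e (tau l y) i j = cmv_full (e + l) y (i + l) (j + l)"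
proof -
have "cmv_full e (tau l y) i j = (SUM k:{j - 1..j + 1}. cmv_op (e + l) y (i + l) (k + l) * cmv_op (e + 1 + l) y (k + l) (j + l))"
 by (simp add: cmv_full_def comp_def cmv_op_tau)
also have "... = (SUM k:{j + l - 1..j + l + 1}. cmv_op (e + l) y (i + l) k * cmv_op (e + 1 + l) y k (j + l))"
 by (rule sum.reindex_bij_witness[of _ "%k. k - l" "%k. k + l"]) auto
finally show ?thesis by (simp add: cmv_full_def comp_def ac_simps)
qed

lemma cmv_q_tau: "cpow 2 (cmv_full e y) d l l = cmv_q (e - l) d (tau l y)"
unfolding cmv_q_def using cpow_shift[of "cmv_full (e - l) (tau l y)" "cmv_full e y" l 2 d 0 0] cmv_full_tau[of "e - l" l y] by simp

lemma cmv_q_parity: "even (e - e') ==> cmv_q e = cmv_q e'"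
unfolding cmv_q_def[abs_def] cmv_full_def[abs_def] using cmv_op_parity[of e e'] cmv_op_parity[of "e + 1" "e' + 1"] by simp

definition cmv_mean :: "nat => (int => complex) => complex" where
"cmv_mean d y = (cmv_q 0 d y + cmv_q 1 d y) / 2"

text \<open>
The CMV operator commutes with even shifts only. Averaging over the two orders of its factors,
which does not change the trace, makes the local function independent of the parity.
\<close>

lemma cmv_trace: assumes N: "0 < N" "even N" "int d * 2 < int N" shows "mat_trace (cmv_lax N x ^\<^sub>m d) = (SUM i<N. cmv_mean d (tau (int i) (zper N x)))"
proof -
let ?y = "zper N x"
have A: "lifts N 2 (cmv_full 0 ?y) (cmv_half 0 N x * cmv_half 1 N x)" "lifts N 2 (cmv_full 1 ?y) (cmv_half 1 N x * cmv_half 0 N x)"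
 using lifts_comp[OF cmv_half_lifts[OF N(1,2), of 0 x] cmv_half_lifts[OF N(1,2), of 1 x]] lifts_comp[OF cmv_half_lifts[OF N(1,2), of 1 x] cmv_half_lifts[OF N(1,2), of 0 x]]
  cmv_op_parity[of 2 0] by (simp_all add: cmv_full_def)
have c: "cmv_half e N x : carrier_mat N N" for e by (simp add: cmv_half_def)
have t0: "mat_trace (cmv_lax N x ^\<^sub>m d) = (SUM i<N. cmv_q (0 - int i) d (tau (int i) ?y))"
 unfolding cmv_lax_half using lifts_trace[OF lifts_pow[OF A(1)] N(3)] by (simp add: cmv_q_tau)
have t1: "mat_trace (cmv_lax N x ^\<^sub>m d) = (SUM i<N. cmv_q (1 - int i) d (tau (int i) ?y))"
 unfolding cmv_lax_half mat_trace_power_comm[OF c c] using lifts_trace[OF lifts_pow[OF A(2)] N(3)] by (simp add: cmv_q_tau)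
have "cmv_q (0 - int i) d z + cmv_q (1 - int i) d z = 2 * cmv_mean d z" for i z
proof (cases "even i")
 case True
 hence "cmv_q (0 - int i) = cmv_q 0" "cmv_q (1 - int i) = cmv_q 1" by (auto intro!: cmv_q_parity)
 thus ?thesis by (simp add: cmv_mean_def)
next
 case False
 hence "cmv_q (0 - int i) = cmv_q 1" "cmv_q (1 - int i) = cmv_q 0" by (auto intro!: cmv_q_parity)
 thus ?thesis by (simp add: cmv_mean_def)
qed
note mean = this
have "mat_trace (cmv_lax N x ^\<^sub>m d) + mat_trace (cmv_lax N x ^\<^sub>m d) = (SUM i<N. cmv_q (0 - int i) d (tau (int i) ?y) + cmv_q (1 - int i) d (tau (int i) ?y))"
 unfolding sum.distrib t0[symmetric] t1[symmetric] ..
also have "... = 2 * (SUM i<N. cmv_mean d (tau (int i) ?y))" by (simp only: mean sum_distrib_left)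
finally show ?thesis by simp
qed

lemma cmv_mean_measurable: "cmv_mean d : bmeas zseq"
proof -
have y: "(%y. y k) : bmeas (zseq :: (int => complex) measure)" for k :: int by (rule coord_measurable)
have rho: "cmv_rho : bmeas borel" unfolding cmv_rho_def[abs_def] by (intro borel_measurable_continuous_onI continuous_intros)
have cn: "cnj : bmeas borel" by (intro borel_measurable_continuous_onI continuous_intros)
note [measurable] = y measurable_compose[OF y rho] measurable_compose[OF y cn]
have op: "(%y. cmv_op e y i j) : bmeas zseq" for e i j unfolding cmv_op_def by measurable
have full: "(%y. cmv_full e y i j) : bmeas zseq" for e i j unfolding cmv_full_def comp_def by (intro borel_measurable_sum borel_measurable_times op)
have "(%y. cpow 2 (cmv_full e y) d i j) : bmeas zseq" for e i j
proof (induction d arbitrary: i j)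
 case (Suc d)
 thus ?case unfolding cpow.simps comp_def by (intro borel_measurable_sum borel_measurable_times full)
qed simp
thus ?thesis unfolding cmv_mean_def[abs_def] cmv_q_def[abs_def] by measurable
qed

lemma cmv_mean_local: "EX R. zloc R (cmv_mean d)"
proof -
let ?R = "int d * 2"
have q: "cmv_q e d y = cmv_q e d y'" if "ALL k. abs k <= ?R + 5 --> y k = y' k" for e and y y' :: "int => complex"
proof -
 have op: "cmv_op e y i j = cmv_op e y' i j" if "abs i <= ?R + 3" for e i j
  using that \<open>ALL k. abs k <= ?R + 5 --> y k = y' k\<close> by (simp add: cmv_op_def)
 have "cmv_full e y i j = cmv_full e y' i j" if "abs i <= ?R" "abs j <= ?R" for i j
  unfolding cmv_full_def comp_def using that by (intro sum.cong refl arg_cong2[where f="(*)"] op) auto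
 thus ?thesis unfolding cmv_q_def by (intro cpow_loc[where R="?R"] band_full) auto
qed
show ?thesis
proof (rule exI[of _ "?R + 5"], unfold zloc_def, intro allI impI)
 fix y y' :: "int => complex" assume "ALL k. abs k <= ?R + 5 --> y k = y' k"
 thus "cmv_mean d y = cmv_mean d y'" unfolding cmv_mean_def using q by metis
qed
qed

text \<open>In the unit disc all entries are bounded: by 4 for the four summands of a factor, by
  \<open>3 * 4 ^ 2 = 48\<close> for the product, and each power of this operator of width 2 costs
  \<open>5 * 48 = 240\<close>.\<close>

lemma cmv_mean_bound: "EX B. ALL y. range y <= ball 0 1 --> norm (cmv_mean d y) <= B"
proof (intro exI allI impI)
fix y :: "int => complex" assume y: "range y <= ball 0 1"
have y1: "norm (y k) <= 1" for k using y by (auto simp: image_subset_iff less_imp_le)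
have rho: "norm (cmv_rho (y k)) <= 1" for k
proof -
 have "(norm (y k))^2 <= 1" using y1[of k] by (simp add: power_le_one)
 hence "0 <= 1 - (norm (y k))^2" "1 - (norm (y k))^2 <= 1" by simp_all
 thus ?thesis by (simp add: cmv_rho_def)
qed
have op: "norm (cmv_op e y i j) <= 4" for e i j
proof -
 have "norm (cmv_op e y i j) <= (1 + 1) + (1 + 1)" unfolding cmv_op_def by (intro order_trans[OF norm_triangle_ineq] add_mono) (auto simp: y1 rho)
 thus ?thesis by simp
qed
have full: "norm (cmv_full e y i j) <= 48" for e i j
proof -
 have "norm (cmv_full e y i j) <= (SUM k:{j - 1..j + 1}. 16)" unfolding cmv_full_def comp_def
 proof (rule sum_norm_le)
  fix k show "norm (cmv_op e y i k * cmv_op (e + 1) y k j) <= 16" using mult_mono[OF op[of e i k] op[of "e + 1" k j]] by (simp add: norm_mult)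
 qed
 thus ?thesis by simp
qed
have q: "norm (cmv_q e d y) <= 240 ^ d" for e
 unfolding cmv_q_def using cpow_bound[where R="int d * 2" and w=2 and b=48 and C="cmv_full e y" and d=d and j=0, OF full band_full] by simp
have "norm (cmv_mean d y) <= (norm (cmv_q 0 d y) + norm (cmv_q 1 d y)) / 2" by (simp add: cmv_mean_def norm_divide norm_triangle_ineq)
thus "norm (cmv_mean d y) <= 240 ^ d" using q[of 0] q[of 1] by simp
qed

text \<open>With bounded entries the constant 1 serves as size function, all exponents are 0, and
  coercivity reduces to the boundedness of the leading term.\<close>

theorem cmv_case: fixes F :: "complex => real => real" assumes hyp: "standing_hypotheses cmv_model P F al" "0 < al"
shows "covariance_is_free_energy_derivative cmv_model P F al m n"
proof -
have X: "var_space cmv_model = ball 0 1" "sizes cmv_model = {N. even N}" "lax cmv_model = cmv_lax" by (simp_all add: cmv_model_def)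
interpret local_model cmv_model F al P m n cmv_mean "%_. 1" 1 "%_. 0"
proof
 show "standing_hypotheses cmv_model P F al" "0 < al" by (fact hyp)+
 show "large (sizes cmv_model) ~= bot"
 proof
  assume "large (sizes cmv_model) = bot"
  hence "\<forall>\<^sub>F N in large (sizes cmv_model). False" by simp
  hence "\<forall>\<^sub>F N in sequentially. odd N" by (simp add: X eventually_inf_principal)
  then obtain N0 :: nat where "ALL N>=N0. odd N" unfolding eventually_sequentially ..
  thus False by (elim allE[of _ "2 * N0"]) simp
 qed
 show "lax cmv_model N x : carrier_mat N N" for N x unfolding X(3) cmv_lax_def by (rule mult_carrier_mat[of _ N N]) auto
 show "\<forall>\<^sub>F N in large (sizes cmv_model). ALL x:vectors (var_space cmv_model) N. mat_trace (lax cmv_model N x ^\<^sub>m d) = (SUM i<N. cmv_mean d (tau (int i) (zper N x)))" for d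
  unfolding X(3) by (rule eventually_large[of "int d * 2"]) (auto intro!: cmv_trace simp: X(2))
 show "cmv_mean d : bmeas zseq" for d by (rule cmv_mean_measurable)
 show "EX R. zloc R (cmv_mean d)" for d by (rule cmv_mean_local)
 show "EX R. zloc R (%_ :: int => complex. 1 :: real)" by (simp add: zloc_def)
 show "EX B. ALL y :: int => complex. range y <= var_space cmv_model & (ALL k. norm (y k) <= real j) --> (1 :: real) <= B" for j by (rule exI[of _ 1]) simp
 show "EX B R. ALL y. range y <= var_space cmv_model --> norm (cmv_mean d y) <= B * (SUM l:{-R..R}. 1) ^ 0" for d using cmv_mean_bound[of d] by (simp add: X)
 obtain B where B: "!!y. range y <= ball 0 1 ==> norm (cmv_mean (degree P) y) <= B" using cmv_mean_bound by blast
 show "EX c>0. EX C'. ALL y. range y <= var_space cmv_model --> c * 1 ^ 1 - C' <= Re (coeff P (degree P) * cmv_mean (degree P) y)"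
 proof (rule exI[of _ "1 :: real"], rule conjI, simp, rule exI[of _ "1 + norm (coeff P (degree P)) * B"], intro allI impI)
  fix y :: "int => complex" assume "range y <= var_space cmv_model"
  hence "norm (coeff P (degree P) * cmv_mean (degree P) y) <= norm (coeff P (degree P)) * B" unfolding norm_mult by (intro mlm B) (auto simp: X)
  thus "1 * 1 ^ 1 - (1 + norm (coeff P (degree P)) * B) <= Re (coeff P (degree P) * cmv_mean (degree P) y)"
   using abs_Re_le_cmod[of "coeff P (degree P) * cmv_mean (degree P) y"] by simp
 qed
qed (simp_all add: X)
show ?thesis by (rule local_model_main)
qed

theorem theorem1p9:
  fixes \<alpha> :: real and m n r :: nat
  assumes "0 < \<alpha>" and "1 \<le> m" and "1 \<le> n" and "1 \<le> r"
  shows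
    "(\<forall>(P :: real poly) (F :: real \<times> real \<Rightarrow> real \<Rightarrow> real).
        jacobi_potential P \<and>
        standing_hypotheses jacobi_model (complex_poly P) F \<alpha> \<and>
        (\<forall>s\<in>{m, n}. seed_moment_bound jacobi_model (complex_poly P) s) \<longrightarrow>
        covariance_is_free_energy_derivative jacobi_model (complex_poly P) F \<alpha> m n) \<and>
     (\<forall>(P :: real poly) (F :: real \<times> real \<Rightarrow> real \<Rightarrow> real).
        laguerre_potential P \<and>
        standing_hypotheses laguerre_model (complex_poly P) F \<alpha> \<and>
        (\<forall>s\<in>{m, n}. seed_moment_bound laguerre_model (complex_poly P) s) \<longrightarrow>
        covariance_is_free_energy_derivative laguerre_model (complex_poly P) F \<alpha> m n) \<and>
     (\<forall>(P :: real poly) (F :: real \<Rightarrow> real \<Rightarrow> real).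
        antisymmetric_potential P \<and>
        standing_hypotheses antisymmetric_model (complex_poly P) F \<alpha> \<and>
        (\<forall>s\<in>{m, n}. seed_moment_bound antisymmetric_model (complex_poly P) s) \<longrightarrow>
        covariance_is_free_energy_derivative antisymmetric_model (complex_poly P) F \<alpha> m n) \<and>
     (\<forall>(P :: complex poly) (F :: complex \<Rightarrow> real \<Rightarrow> real).
        standing_hypotheses cmv_model P F \<alpha> \<and>
        (\<forall>s\<in>{m, n}. seed_moment_bound cmv_model P s) \<longrightarrow>
        covariance_is_free_energy_derivative cmv_model P F \<alpha> m n) \<and>
     (\<forall>(P :: real poly) (F :: real \<Rightarrow> real \<Rightarrow> real).
        \<forall>\<M> \<in> {inb_model_a r, inb_model_b r}.
        inb_potential r P \<and>
        standing_hypotheses \<M> (complex_poly P) F \<alpha> \<and>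
        (\<forall>s\<in>{m, n}. seed_moment_bound \<M> (complex_poly P) s) \<longrightarrow>
        covariance_is_free_energy_derivative \<M> (complex_poly P) F \<alpha> m n)"
proof (intro conjI allI ballI impI; elim conjE)
qed (use assms in \<open>blast intro: jacobi_case laguerre_case antisymmetric_case cmv_case inb_case\<close>)+

end
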